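(* Let $\alpha\in(0,1)$ be an irrational number of bounded type and $Tx=x+\alpha$ on $\mathbb T$. Let $\beta_1,\dots,\beta_d\in[0,1)$ be such that there is no non-trivial rational relation between $1,\alpha,\beta_1,\dots,\beta_d$ (i.e. these numbers are linearly independent over $\mathbb Q$). Then the cocycle $\Phi=(1_{[0,\beta_j)}-\beta_j)_{j=1,\dots,d}:\mathbb T\to\mathbb R^d$ is regular over $T$. Moreover, every step cocycle $\varphi:\mathbb T\to\mathbb R^{d'}$ of dimension $d'\le d$, with zero mean and discontinuities at $\{0,\beta_1,\dots,\beta_d\}$, is regular over $T$.
   Context: $\mathbb T=[0,1)$ is the additive circle (addition mod $1$) with Lebesgue measure $\mu$. An irrational $\alpha=[0;a_1,a_2,\dots]$ is of bounded type if its sequence of partial quotients $(a_n)$ is bounded. A step cocycle is a function constant on each interval of a finite partition of $\mathbb T$ into intervals; zero mean means that each coordinate has integral $0$ with respect to $\mu$. A measurable function $\Phi:\mathbb T\to\mathbb R^m$ is called a cocycle over $T$. Two cocycles $\Phi,\Psi:\mathbb T\to\mathbb R^m$ are cohomologous if $\Phi-\Psi=f-f\circ T$ a.e. for some measurable $f:\mathbb T\to\mathbb R^m$. A cocycle $\Phi:\mathbb T\to\mathbb R^m$ is regular if it is cohomologous to a cocycle $\Psi$ taking values in a closed subgroup $H\subset\mathbb R^m$ such that $T_\Psi(x,h)=(Tx,h+\Psi(x))$ is ergodic on $\mathbb T\times H$ for the product of $\mu$ and Haar measure on $H$. *)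

theory Defs
  imports "HOL-Analysis.Analysis"
begin

section \<open>Bounded type\<close>

definition gauss_map :: "real \<Rightarrow> real" where
  "gauss_map x = frac (1 / x)"

text \<open>For irrational \<open>\<alpha> = [0; a\<^sub>1, a\<^sub>2, \<dots>]\<close> in \<open>(0,1)\<close>, the value at \<open>n\<close> is \<open>a\<close> with index \<open>n + 1\<close>.\<close>

definition partial_quotient :: "real \<Rightarrow> nat \<Rightarrow> int" where
  "partial_quotient \<alpha> n = \<lfloor>1 / (gauss_map ^^ n) \<alpha>\<rfloor>"

definition bounded_type :: "real \<Rightarrow> bool" where
  "bounded_type \<alpha> \<longleftrightarrow> (\<exists>C. \<forall>n. partial_quotient \<alpha> n \<le> C)"


section \<open>The circle and its rotations\<close>

definition circle :: "real measure" where
  "circle = restrict_space lborel {0..<1}"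

definition rotation :: "real \<Rightarrow> real \<Rightarrow> real" where
  "rotation \<alpha> x = frac (x + \<alpha>)"


section \<open>Ergodicity and Haar measure\<close>

text \<open>The measure may be infinite, hence the formulation with null and co-null sets.\<close>

definition ergodic :: "'a measure \<Rightarrow> ('a \<Rightarrow> 'a) \<Rightarrow> bool" where
  "ergodic M S \<longleftrightarrow>
     S \<in> measurable M M \<and> distr M M S = M \<and>
     (\<forall>A \<in> sets M. S -` A \<inter> space M = A \<longrightarrow> emeasure M A = 0 \<or> emeasure M (space M - A) = 0)"

definition closed_subgroup :: "'v::euclidean_space set \<Rightarrow> bool" where
  "closed_subgroup H \<longleftrightarrow>
     closed H \<and> 0 \<in> H \<and> (\<forall>x\<in>H. \<forall>y\<in>H. x + y \<in> H) \<and> (\<forall>x\<in>H. - x \<in> H)"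

text \<open>
  A closed subgroup of a Euclidean space is locally compact and second countable, so a Borel
  measure that is finite on compact sets is automatically regular; Haar measure is unique only up
  to a positive factor, which affects neither null sets nor invariance.
\<close>

definition haar_measure :: "'v::euclidean_space set \<Rightarrow> 'v measure \<Rightarrow> bool" where
  "haar_measure H \<nu> \<longleftrightarrow>
     sets \<nu> = sets (restrict_space borel H) \<and>
     (\<forall>h\<in>H. \<forall>A\<in>sets \<nu>. emeasure \<nu> ((+) h ` A) = emeasure \<nu> A) \<and>
     (\<forall>K. compact K \<and> K \<subseteq> H \<longrightarrow> emeasure \<nu> K < \<infinity>) \<and>
     emeasure \<nu> H \<noteq> 0"


section \<open>Cocycles\<close>

text \<open>Functions on the circle are represented by functions on the reals; only their values on
  \<open>[0,1)\<close> matter.\<close>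

definition cocycle :: "(real \<Rightarrow> 'v::euclidean_space) \<Rightarrow> bool" where
  "cocycle \<Phi> \<longleftrightarrow> \<Phi> \<in> borel_measurable circle"

definition cohomologous ::
  "(real \<Rightarrow> real) \<Rightarrow> (real \<Rightarrow> 'v::euclidean_space) \<Rightarrow> (real \<Rightarrow> 'v) \<Rightarrow> bool" where
  "cohomologous T \<Phi> \<Psi> \<longleftrightarrow>
     (\<exists>f \<in> borel_measurable circle. AE x in circle. \<Phi> x - \<Psi> x = f x - f (T x))"

definition skew_product ::
  "(real \<Rightarrow> real) \<Rightarrow> (real \<Rightarrow> 'v::euclidean_space) \<Rightarrow> real \<times> 'v \<Rightarrow> real \<times> 'v" where
  "skew_product T \<Psi> = (\<lambda>(x, h). (T x, h + \<Psi> x))"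

definition regular_cocycle ::
  "(real \<Rightarrow> real) \<Rightarrow> (real \<Rightarrow> 'v::euclidean_space) \<Rightarrow> bool" where
  "regular_cocycle T \<Phi> \<longleftrightarrow>
     cocycle \<Phi> \<and>
     (\<exists>\<Psi> H \<nu>. cocycle \<Psi> \<and> cohomologous T \<Phi> \<Psi> \<and>
        closed_subgroup H \<and> (\<forall>x\<in>{0..<1}. \<Psi> x \<in> H) \<and>
        haar_measure H \<nu> \<and> ergodic (circle \<Otimes>\<^sub>M \<nu>) (skew_product T \<Psi>))"

definition step_cocycle :: "(real \<Rightarrow> 'v::euclidean_space) \<Rightarrow> bool" where
  "step_cocycle \<phi> \<longleftrightarrow>
     (\<exists>P. finite P \<and> partition_on {0..<1} P \<and> (\<forall>I\<in>P. is_interval I \<and> \<phi> constant_on I))"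

definition zero_mean :: "(real \<Rightarrow> real ^ 'n) \<Rightarrow> bool" where
  "zero_mean \<phi> \<longleftrightarrow> (\<forall>i. (LINT x|circle. \<phi> x $ i) = 0)"

text \<open>Continuity is meant in the topology of the circle, hence the periodic extension.\<close>

definition discontinuities :: "(real \<Rightarrow> 'v::euclidean_space) \<Rightarrow> real set" where
  "discontinuities \<phi> = {x \<in> {0..<1}. \<not> isCont (\<lambda>y. \<phi> (frac y)) x}"

end

theory Submission
  imports Defs
begin

text \<open>
  On \<open>[0,1)\<close> the indicator of \<open>[0,\<beta>)\<close> minus \<open>\<beta>\<close> is the sawtooth difference
  \<open>frac (x - \<beta>) - frac x\<close>, and a step cocycle of zero mean is a linear image of such a vector \<open>\<Phi>\<close>. Call \<open>e\<close> a
  period of a cocycle if every invariant set of its skew product is invariant under translation by \<open>e\<close> in the fibre.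

  Let \<open>E\<close> be the group of integral periods of \<open>\<Phi>\<close>, and let \<open>\<phi> = P \<Phi>\<close>, with \<open>P\<close> an integral matrix with kernel
  spanned by \<open>E\<close>. If the Birkhoff sums of \<open>\<phi>\<close> along times \<open>N\<close> with \<open>N \<alpha>\<close> close to an integer took two different
  bounded values with probabilities bounded away from 0, a limiting argument would give a new integral period. So this does
  not happen, and at denominators \<open>q k\<close> of dyadic size the sums equal one value \<open>w k\<close> outside a set of small
  measure \<open>\<delta> k\<close>. As \<open>\<alpha>\<close> is badly approximable, the discontinuities then cluster along the orbit of the
  rotation with jumps cancelling in each cluster, so \<open>\<phi>\<close> is, up to an error controlled by \<open>\<delta> k\<close>, the
  coboundary of an explicit function \<open>f k\<close>. If the \<open>f k\<close> did not converge modulo constants, the sum of the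
  \<open>\<delta> k\<close> along a separated set of scales would be bounded below; the exceptional events at these scales are
  nearly independent, so exactly one of them would happen with probability bounded away from 0, again producing two
  values. Hence \<open>\<phi>\<close> is a coboundary, and \<open>\<Phi>\<close> is cohomologous to a cocycle with values in the span of \<open>E\<close>.

  In coordinates given by a basis of periods, invariant sets live on the circle times a torus, and Fourier
  analysis there shows that the only obstructions to further periods are integral characters which become
  multiplicative coboundaries along the cocycle. They form a lattice; subtracting logarithms of the corresponding transfer functions
  moves the cocycle into the closed subgroup \<open>H\<close> they annihilate, all of whose elements are periods. That is
  ergodicity over \<open>H\<close>.
\<close>

section \<open>Badly approximable rotations\<close>

text \<open>Integral periods are the ones a limit can produce: two values of a Birkhoff sum at the
  same time differ by an integral vector, so the difference of two limiting values is attained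
  exactly at a finite stage. The obstacle to convergence is that the \<delta> k need not be summable
  over all scales: one pattern of nearly cancelling discontinuities may persist through a long run
  of k. Persistence costs nothing, however: approximations of X b by X a + m \<alpha> at two scales
  with the same a force the same m, as long as the scales differ by less than half of
  log2(1/\<delta>), so the transfer function does not move. A path through the scales is therefore
  charged only to scales separated by four times log2(1/\<delta>), a bounded number of times each.
  The same separation makes the correlation errors, of order 2^(-|k-l|/2), at most of the order of
  \<delta>^2, negligible against the sum of the \<delta>. Comparing logarithms of probabilities with
  distances of scales is the reason for dyadic scales and for rounding probabilities to powers of
  1/2.\<close>

definition badly_approximable :: "real \<Rightarrow> real \<Rightarrow> bool" where
  "badly_approximable c \<alpha> \<longleftrightarrow> 0 < c \<and> (\<forall>n p :: int. n \<noteq> 0 \<longrightarrow> c \<le> \<bar>of_int n\<bar> * \<bar>of_int n * \<alpha> - of_int p\<bar>)"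

lemma irrational_gauss_map:
  assumes "0 < x" "x < 1" "x \<notin> \<rat>"
  shows "0 < gauss_map x" "gauss_map x < 1" "gauss_map x \<notin> \<rat>"
proof -
  have *: "1 / x \<notin> \<rat>"
    using assms(3) by (metis Rats_divide Rats_1 divide_divide_eq_right div_by_1 mult_1)
  have "frac (1/x) \<notin> \<rat>"
  proof
    assume "frac (1/x) \<in> \<rat>"
    then have "frac (1/x) + of_int \<lfloor>1/x\<rfloor> \<in> \<rat>" by (intro Rats_add) auto
    then show False using * by (simp add: frac_def)
  qed
  then show "gauss_map x \<notin> \<rat>" by (simp add: gauss_map_def)
  then have "gauss_map x \<noteq> 0" by (metis Rats_0)
  then show "0 < gauss_map x" "gauss_map x < 1"
    using frac_ge_0[of "1/x"] frac_lt_1[of "1/x"] by (auto simp: gauss_map_def less_le)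
qed

lemma partial_quotient_gauss_map: "partial_quotient (gauss_map x) n = partial_quotient x (Suc n)"
  by (simp add: partial_quotient_def funpow_swap1)

text \<open>The second conjunct carries the induction along the continued fraction algorithm
  \<open>(n, p, x) \<mapsto> (p, n - a p, 1/x - a)\<close>.\<close>

lemma approximation_descent:
  fixes C :: int and n :: nat
  assumes "0 < x" "x < 1" "x \<notin> \<rat>" "\<And>k. partial_quotient x k \<le> C" "n \<ge> 1"
  shows "1 \<le> (of_int C + 1)\<^sup>2 * real n * \<bar>real n * x - of_int p\<bar> \<and>
    (p \<ge> 1 \<longrightarrow> x \<le> (of_int C + 1)\<^sup>2 * of_int p * \<bar>real n * x - of_int p\<bar>)"
  using assms
proof (induction n arbitrary: x p rule: less_induct)
  case (less n x p)
  define a where "a = \<lfloor>1/x\<rfloor>"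
  define x' where "x' = gauss_map x"
  define p' where "p' = int n - a * p"
  \<comment> \<open>Both x and x' are at least 1/(C+1); the case p' = 0 needs the two bounds at
    once, hence the square.\<close>
  define K where "K = (of_int C + 1 :: real)\<^sup>2"
  have x': "0 < x'" "x' < 1" "x' \<notin> \<rat>"
    using irrational_gauss_map less.prems by (auto simp: x'_def)
  have pq': "\<And>k. partial_quotient x' k \<le> C"
    using less.prems(4) by (simp add: x'_def partial_quotient_gauss_map)
  have inv: "1/x = of_int a + x'" by (simp add: x'_def a_def gauss_map_def frac_def)
  have a: "a \<le> C" using less.prems(4)[of 0] by (simp add: partial_quotient_def a_def)
  have a1: "a \<ge> 1" using less.prems(1,2) by (simp add: a_def le_floor_iff)
  have C1: "C \<ge> 1" using a a1 by simp
  have xlow: "1 \<le> (of_int C + 1) * y" if y: "0 < y" "y < 1" "\<And>k. partial_quotient y k \<le> C" for y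
  proof -
    have "1 / y \<le> of_int \<lfloor>1/y\<rfloor> + 1" by linarith
    also have "\<dots> \<le> of_int C + 1" using y(3)[of 0] by (simp add: partial_quotient_def)
    finally show ?thesis using y(1) by (simp add: field_simps)
  qed
  have xl: "1 \<le> (of_int C + 1) * x" and xl': "1 \<le> (of_int C + 1) * x'"
    using xlow less.prems x' pq' by blast+
  have Kx: "1 \<le> K * x" 
  proof -
    have "1 * 1 \<le> (of_int C + 1) * ((of_int C + 1) * x)"
      using xl C1 by (intro mult_mono) auto
    then show ?thesis by (simp add: K_def power2_eq_square mult.assoc)
  qed
  have Kx': "1 \<le> K * x'" 
  proof -
    have "1 * 1 \<le> (of_int C + 1) * ((of_int C + 1) * x')"
      using xl' C1 by (intro mult_mono) auto
    then show ?thesis by (simp add: K_def power2_eq_square mult.assoc)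
  qed
  have K0: "K > 0" using C1 by (simp add: K_def)
  have Kxx': "1 \<le> K * (x * x')"
  proof -
    have "1 * 1 \<le> ((of_int C + 1) * x) * ((of_int C + 1) * x')"
      using xl xl' C1 by (intro mult_mono) auto
    then show ?thesis by (simp add: K_def power2_eq_square mult_ac)
  qed
  define e where "e = \<bar>of_int p * x' - of_int p'\<bar>"
  have np: "real n = of_int a * of_int p + of_int p'" by (simp add: p'_def)
  \<comment> \<open>One step of the algorithm multiplies the error by -x, because x (a + x') =
    1.\<close>
  have "real n * x - of_int p = - (x * (of_int p * x' - of_int p'))"
  proof -
    have "x * (of_int a + x') = 1" using inv less.prems(1) by (simp add: field_simps)
    then have x1: "x * x' = 1 - of_int a * x" by (simp add: algebra_simps)
    have "x * (of_int p * x' - of_int p') = of_int p * (x * x') - x * of_int p'" by (simp add: algebra_simps)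
    also have "\<dots> = of_int p - (of_int a * of_int p + of_int p') * x" unfolding x1 by (simp add: algebra_simps)
    finally show ?thesis using np by simp
  qed
  then have xe: "\<bar>real n * x - of_int p\<bar> = x * e"
    using less.prems(1) by (simp add: e_def abs_mult)
  have n1: "real n \<ge> 1" using less.prems(5) by simp
  show ?case unfolding K_def[symmetric] xe
  proof (cases "p \<ge> 1")
    case False
    then have "real n * x \<le> x * e" using xe less.prems(1) by (smt (verit) of_int_le_0_iff mult_nonneg_nonneg of_nat_0_le_iff)
    then have "x \<le> x * e" using n1 less.prems(1)
      by (smt (verit) mult_le_cancel_right1)
    then have "K * real n * x \<le> K * real n * (x * e)" using K0 n1 by (intro mult_left_mono) auto
    moreover have "K * x * 1 \<le> K * x * real n" using n1 K0 less.prems(1) by (intro mult_left_mono) auto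
    ultimately have "1 \<le> K * real n * (x * e)" using Kx by (simp add: mult_ac)
    then show "1 \<le> K * real n * (x * e) \<and> (1 \<le> p \<longrightarrow> x \<le> K * real_of_int p * (x * e))"
      using False by simp
  next
    case True
    then have p1: "real_of_int p \<ge> 1" by simp
    have "1 \<le> K * real n * (x * e) \<and> 1 \<le> K * real_of_int p * e"
    proof -
      consider "p' \<ge> 1" | "p' = 0" | "p' \<le> -1" by linarith
      then show ?thesis
      proof cases
        \<comment> \<open>The induction hypothesis is used here: a \<ge> 1 and p' \<ge> 1 give p <
          n. Adding a times its first conclusion to its second bounds 1/x by
          \<open>K * n * e\<close>, since n = a p + p'.\<close>
        case 1
        have "p * 1 \<le> a * p" using a1 True by (simp add: mult.commute)
        then have "p < int n" using 1 by (simp add: p'_def)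
        then have pn: "nat p < n" using True by simp
        have "1 \<le> K * real (nat p) * \<bar>real (nat p) * x' - of_int p'\<bar> \<and>
          (p' \<ge> 1 \<longrightarrow> x' \<le> K * of_int p' * \<bar>real (nat p) * x' - of_int p'\<bar>)"
          unfolding K_def using less.IH[OF pn x' pq', of p'] True by simp
        then have h: "1 \<le> K * of_int p * e" "x' \<le> K * of_int p' * e"
          using 1 True by (auto simp: e_def)
        have "1 / x \<le> of_int a * (K * of_int p * e) + K * of_int p' * e"
          unfolding inv using h a1 by (intro add_mono) auto
        also have "\<dots> = K * real n * e" by (simp add: np algebra_simps)
        finally show ?thesis using h less.prems(1) by (simp add: field_simps)
      next
        case 2
        have e: "e = of_int p * x'" using 2 p1 x' by (simp add: e_def)
        have pp: "real_of_int p * real_of_int p \<ge> 1" "real n * of_int p \<ge> 1" using p1 n1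
          by (metis mult_mono mult_1 zero_le_one order_trans)+
        have "1 * 1 \<le> (K * x') * (of_int p * of_int p)" using Kx' pp K0 x' by (intro mult_mono) auto
        moreover have "1 * 1 \<le> (K * (x * x')) * (real n * of_int p)" 
          using Kxx' pp K0 x' less.prems(1) by (intro mult_mono) auto
        ultimately show ?thesis unfolding e by (simp add: mult_ac)
      next
        case 3
        then have "real_of_int p' \<le> -1" by linarith
        then have e: "e \<ge> 1" unfolding e_def using p1 x' mult_nonneg_nonneg[of "of_int p" x'] by linarith
        have "1 * 1 \<le> (K * x) * (real n * e)" using Kx e n1 mult_mono[of 1 "real n" 1 e] by (intro mult_mono) auto
        moreover have "1 * 1 \<le> K * (of_int p * e)" 
          using Kx K0 less.prems(1,2) e p1 mult_mono[of 1 "real_of_int p" 1 e]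
          by (intro mult_mono) (auto intro: order_trans[of 1 "K*x" K] simp: mult_le_cancel_left1)
        ultimately show ?thesis by (simp add: mult_ac)
      qed
    qed
    moreover from this have "x * 1 \<le> x * (K * real_of_int p * e)" 
      using less.prems(1) by (intro mult_left_mono) auto
    ultimately show "1 \<le> K * real n * (x * e) \<and> (1 \<le> p \<longrightarrow> x \<le> K * real_of_int p * (x * e))"
      by (simp add: mult_ac)
  qed
qed

lemma bounded_type_badly_approximable:
  assumes "0 < \<alpha>" "\<alpha> < 1" "\<alpha> \<notin> \<rat>" "bounded_type \<alpha>"
  obtains c where "badly_approximable c \<alpha>"
proof -
  obtain C where C: "\<And>n. partial_quotient \<alpha> n \<le> C"
    using assms(4) by (auto simp: bounded_type_def)
  have "\<lfloor>1/\<alpha>\<rfloor> \<ge> 1" using assms by (simp add: le_floor_iff)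
  moreover have "\<lfloor>1/\<alpha>\<rfloor> \<le> C" using C[of 0] by (simp add: partial_quotient_def)
  ultimately have C1: "C \<ge> 1" by (rule order_trans)
  define K where "K = (of_int C + 1 :: real)\<^sup>2"
  have K: "K > 0" using C1 by (simp add: K_def)
  have "1 / K \<le> \<bar>of_int n\<bar> * \<bar>of_int n * \<alpha> - of_int p\<bar>" if "n \<noteq> 0" for n p :: int
  proof -
    have "1 \<le> K * real (nat \<bar>n\<bar>) * \<bar>real (nat \<bar>n\<bar>) * \<alpha> - of_int (sgn n * p)\<bar>"
      using approximation_descent[OF assms(1-3) C, of "nat \<bar>n\<bar>" "sgn n * p"] that by (auto simp: K_def)
    moreover have "\<bar>\<bar>real_of_int n\<bar> * \<alpha> - of_int (sgn n) * of_int p\<bar> = \<bar>of_int n * \<alpha> - of_int p\<bar>"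
      using that by (cases "n > 0") (auto simp: sgn_if)
    ultimately show ?thesis using K by (simp add: field_simps)
  qed
  then have "badly_approximable (1/K) \<alpha>" using K by (simp add: badly_approximable_def)
  then show ?thesis using that by blast
qed

section \<open>Orbits along approximate denominators and the Denjoy-Koksma inequality\<close>

lemma coprime_mult_mod_inj:
  fixes p :: int and J :: nat
  assumes "coprime p (int J)"
  shows "inj_on (\<lambda>j. (p * int j) mod int J) {..<J}"
proof (rule inj_onI)
  fix i j assume ij: "i \<in> {..<J}" "j \<in> {..<J}" and e: "(p * int i) mod int J = (p * int j) mod int J"
  have "int J dvd p * (int i - int j)" using e by (simp add: mod_eq_dvd_iff right_diff_distrib)
  then have "int J dvd int i - int j" using assms by (simp add: coprime_dvd_mult_right_iff coprime_commute)
  then show "i = j" using ij by (metis lessThan_iff mod_eq_dvd_iff mod_less of_nat_eq_iff zmod_int)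
qed

text \<open>As J \<alpha> is within 1/J of p, the points j \<alpha> lie within 1/J of the fractions
  p j / J. A hit therefore confines p j modulo J to six consecutive residues, and j is determined by
  p j modulo J.\<close>

lemma card_orbit_near:
  fixes p :: int and J :: nat
  assumes J: "J > 0" and cop: "coprime p (int J)" and ap: "\<bar>real J * \<alpha> - of_int p\<bar> < 1 / J"
  shows "card {j\<in>{..<J}. \<exists>n::int. \<bar>x + real j * \<alpha> - z - of_int n\<bar> \<le> 2 / J} \<le> 6"
proof -
  define S where "S = {j\<in>{..<J}. \<exists>n::int. \<bar>x + real j * \<alpha> - z - of_int n\<bar> \<le> 2 / J}"
  define fl where "fl = \<lfloor>real J * (z - x)\<rfloor>"
  have sub: "(\<lambda>j. (p * int j) mod int J) ` S \<subseteq> (\<lambda>m. (fl + m) mod int J) ` {-2..3}"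
  proof
    fix y assume "y \<in> (\<lambda>j. (p * int j) mod int J) ` S"
    then obtain j n where j: "j < J" "y = (p * int j) mod int J" "\<bar>x + real j * \<alpha> - z - of_int n\<bar> \<le> 2 / J"
      by (auto simp: S_def)
    define \<eta> where "\<eta> = real J * \<alpha> - of_int p"
    have "\<bar>real j * \<eta>\<bar> < 1"
    proof -
      have "\<bar>real j * \<eta>\<bar> \<le> real J * \<bar>\<eta>\<bar>" using j(1) by (simp add: abs_mult mult_right_mono)
      also have "\<dots> < 1" using ap J by (simp add: \<eta>_def field_simps)
      finally show ?thesis .
    qed
    moreover have "\<bar>real J * (x + real j * \<alpha> - z - of_int n)\<bar> \<le> 2"
      using j(3) J by (simp only: abs_mult abs_of_nat) (simp add: pos_le_divide_eq mult.commute)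
    moreover have "real J * (x + real j * \<alpha> - z - of_int n) = 
        of_int p * real j - real J * of_int n - real J * (z - x) + real j * \<eta>"
      by (simp add: \<eta>_def algebra_simps)
    ultimately have "\<bar>of_int (p * int j - int J * n) - real J * (z - x)\<bar> < 3" by simp
    then have "p * int j - int J * n - fl \<in> {-2..3}" unfolding fl_def by (simp; linarith)
    moreover have "(fl + (p * int j - int J * n - fl)) mod int J = (p * int j) mod int J"
      by (simp add: mod_diff_eq[symmetric, of "p * int j" "int J * n"] )
    ultimately show "y \<in> (\<lambda>m. (fl + m) mod int J) ` {-2..3}"
      using j(2) by (intro image_eqI[where x="p * int j - int J * n - fl"]) auto
  qed
  have "card S = card ((\<lambda>j. (p * int j) mod int J) ` S)"
    by (rule card_image[symmetric], rule inj_on_subset[OF coprime_mult_mod_inj[OF cop]]) (auto simp: S_def)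
  also have "\<dots> \<le> card ((\<lambda>m. (fl + m) mod int J) ` {-2..3})" using sub by (intro card_mono) auto
  also have "\<dots> \<le> 6" by (rule order_trans[OF card_image_le]) auto
  finally show ?thesis by (simp add: S_def)
qed

lemma periodic_add_int:
  fixes f :: "real \<Rightarrow> 'a"
  assumes "\<And>x. f (x + 1) = f x"
  shows "f (x + of_int n) = f x"
proof -
  have *: "f (x + real k) = f x" for x k
  proof (induction k)
    case (Suc k)
    have "f (x + real (Suc k)) = f ((x + real k) + 1)" by (simp add: algebra_simps)
    then show ?case using assms Suc by simp
  qed auto
  show ?thesis
  proof (cases "n \<ge> 0")
    case True then show ?thesis using *[of x "nat n"] by simp
  next
    case False then show ?thesis using *[of "x + of_int n" "nat (-n)"] by simp
  qed
qed

lemma periodic_frac: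
  fixes f :: "real \<Rightarrow> 'a"
  assumes "\<And>x. f (x + 1) = f x"
  shows "f (frac x) = f x"
  using periodic_add_int[of f x "-\<lfloor>x\<rfloor>", OF assms] by (simp add: frac_def)

text \<open>Dirichlet's theorem with bound 2^k gives \<open>q k\<close> at most 2^k; bad
  approximability of the same fraction forces \<open>q k\<close> to be at least c 2^k. So every
  dyadic scale has a denominator of its own size.\<close>

lemma dyadic_denominators:
  assumes "badly_approximable c \<alpha>"
  obtains q :: "nat \<Rightarrow> nat" and p :: "nat \<Rightarrow> int" where
    "\<And>k. q k > 0" "\<And>k. real (q k) \<le> 2 ^ k" "\<And>k. c * 2 ^ k \<le> real (q k)"
    "\<And>k. coprime (p k) (int (q k))" "\<And>k. \<bar>real (q k) * \<alpha> - of_int (p k)\<bar> < 1 / 2 ^ k"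
proof -
  have "\<exists>qp. fst qp > 0 \<and> real (fst qp) \<le> 2 ^ k \<and> c * 2 ^ k \<le> real (fst qp) \<and>
      coprime (snd qp) (int (fst qp)) \<and> \<bar>real (fst qp) * \<alpha> - of_int (snd qp)\<bar> < 1 / 2 ^ k" for k
  proof -
    obtain h m where m: "coprime h m" "0 < m" "m \<le> int (2 ^ k)" "\<bar>of_int m * \<alpha> - of_int h\<bar> < 1 / real (2 ^ k)"
      using Dirichlet_approx_coprime[of "2 ^ k" \<alpha>] by (metis zero_less_power zero_less_numeral)
    have "c \<le> of_int m * \<bar>of_int m * \<alpha> - of_int h\<bar>"
      using assms m(2) unfolding badly_approximable_def by (metis abs_of_pos less_irrefl of_int_0_less_iff)
    also have "\<dots> \<le> of_int m * (1 / 2 ^ k)" using m by (intro mult_left_mono) auto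
    finally have "c * 2 ^ k \<le> of_int m" by (simp add: field_simps)
    moreover have "real_of_int m \<le> 2 ^ k" using m(3) by (metis of_int_le_iff of_int_of_nat_eq of_nat_numeral of_nat_power)
    ultimately show ?thesis using m by (intro exI[of _ "(nat m, h)"]) auto
  qed
  then obtain qp where "\<And>k. fst (qp k) > 0 \<and> real (fst (qp k)) \<le> 2 ^ k \<and> c * 2 ^ k \<le> real (fst (qp k)) \<and>
      coprime (snd (qp k)) (int (fst (qp k))) \<and> \<bar>real (fst (qp k)) * \<alpha> - of_int (snd (qp k))\<bar> < 1 / 2 ^ k"
    by metis
  then show ?thesis using that[of "\<lambda>k. fst (qp k)" "\<lambda>k. snd (qp k)"] by simp
qed

text \<open>Two orbit segments of length \<open>J\<close> are matched by a bijection moving points by at most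
  \<open>2/J\<close> modulo 1; only matched pairs separated by a point of \<open>F\<close> contribute more than \<open>2 L/J\<close>.\<close>

lemma denjoy_koksma:
  fixes f :: "real \<Rightarrow> real" and L :: real and p :: int and J :: nat
  assumes J: "J > 0" and cop: "coprime p (int J)" and ap: "\<bar>real J * \<alpha> - of_int p\<bar> < 1 / J"
    and per: "\<And>x. f (x + 1) = f x" and osc: "\<And>x y. \<bar>f x - f y\<bar> \<le> 1"
    and F: "finite F" and L: "L \<ge> 0"
    and lip: "\<And>x y. (\<And>z n. z \<in> F \<Longrightarrow> \<not> (min x y \<le> z + of_int n \<and> z + of_int n \<le> max x y)) \<Longrightarrow>
       \<bar>f x - f y\<bar> \<le> L * \<bar>x - y\<bar>"
  shows "\<bar>(\<Sum>j<J. f (x + real j * \<alpha>)) - (\<Sum>j<J. f (y + real j * \<alpha>))\<bar> \<le> 2 * L + 6 * card F"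
proof -
  \<comment> \<open>\<open>r\<close> inverts p modulo J and \<open>l\<close> counts the steps of
    length 1/J from x to y. Thus p (j - \<pi> j) is congruent to \<open>l\<close>, and y + \<pi> j
    \<alpha> lands next to x + j \<alpha> modulo 1.\<close>
  obtain r s where rs: "r * p + s * int J = 1" using bezout_int[of p "int J"] cop by auto
  define l where "l = \<lfloor>real J * (y - x)\<rfloor>"
  define \<pi> where "\<pi> j = nat ((int j - l * r) mod int J)" for j
  define \<eta> where "\<eta> = real J * \<alpha> - of_int p"
  define Bad where "Bad = {j\<in>{..<J}. \<exists>z\<in>F. \<exists>n::int. \<bar>x + real j * \<alpha> - z - of_int n\<bar> \<le> 2 / J}"
  have pi_int: "int (\<pi> j) = (int j - l * r) mod int J" for j using J by (simp add: \<pi>_def)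
  have pi_lt: "\<pi> j < J" for j using J by (simp add: \<pi>_def nat_less_iff)
  have inj: "inj_on \<pi> {..<J}"
  proof (rule inj_onI)
    fix i j assume ij: "i \<in> {..<J}" "j \<in> {..<J}" and e: "\<pi> i = \<pi> j"
    have "(int i - l * r) mod int J = (int j - l * r) mod int J" using e pi_int by metis
    then have "int J dvd int i - int j" by (simp add: mod_eq_dvd_iff)
    then show "i = j" using ij by (metis lessThan_iff mod_eq_dvd_iff mod_less of_nat_eq_iff zmod_int)
  qed
  have "\<pi> ` {..<J} = {..<J}" using pi_lt by (intro card_subset_eq) (auto simp: card_image[OF inj])
  then have reidx: "(\<Sum>j<J. f (y + real j * \<alpha>)) = (\<Sum>j<J. f (y + real (\<pi> j) * \<alpha>))"
    using sum.reindex[OF inj, of "\<lambda>j. f (y + real j * \<alpha>)"] by simp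
  have near: "\<exists>n::int. \<bar>(x + real j * \<alpha>) - (y + real (\<pi> j) * \<alpha>) - of_int n\<bar> \<le> 2 / J" if j: "j < J" for j
  proof -
    have "int J dvd p * int j - p * int (\<pi> j) - l"
    proof -
      have "int J dvd (int j - l * r) - int (\<pi> j)" unfolding pi_int by (simp add: dvd_minus_mod)
      then have "int J dvd p * ((int j - l * r) - int (\<pi> j)) - l * (s * int J)" by simp
      also have "p * ((int j - l * r) - int (\<pi> j)) - l * (s * int J) = p * int j - p * int (\<pi> j) - l * (r * p + s * int J)"
        by (simp add: algebra_simps)
      finally show ?thesis by (simp add: rs)
    qed
    then obtain n where n: "p * int j - p * int (\<pi> j) - l = int J * n" by (auto elim: dvdE)
    have "real J * ((x + real j * \<alpha>) - (y + real (\<pi> j) * \<alpha>) - of_int n)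
       = (of_int (p * int j - p * int (\<pi> j) - l) - real J * of_int n) + (of_int l - real J * (y - x)) + (real j - real (\<pi> j)) * \<eta>"
      by (simp add: \<eta>_def algebra_simps)
    also have "\<dots> = (of_int l - real J * (y - x)) + (real j - real (\<pi> j)) * \<eta>" unfolding n by simp
    \<comment> \<open>One unit for rounding J (y - x), one for drifting by \<eta> at most J
      times.\<close>
    also have "\<bar>\<dots>\<bar> \<le> 1 + 1"
    proof (rule order_trans[OF abs_triangle_ineq add_mono])
      show "\<bar>of_int l - real J * (y - x)\<bar> \<le> 1" unfolding l_def by linarith
      have "\<bar>(real j - real (\<pi> j)) * \<eta>\<bar> \<le> real J * \<bar>\<eta>\<bar>"
        using j pi_lt[of j] by (simp add: abs_mult mult_right_mono)
      also have "\<dots> \<le> 1" using ap J by (simp add: \<eta>_def field_simps)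
      finally show "\<bar>(real j - real (\<pi> j)) * \<eta>\<bar> \<le> 1" .
    qed
    finally have "real J * \<bar>(x + real j * \<alpha>) - (y + real (\<pi> j) * \<alpha>) - of_int n\<bar> \<le> 2"
      by (metis abs_mult abs_of_nat one_add_one)
    then show ?thesis using J by (intro exI[of _ n]) (simp add: pos_le_divide_eq mult.commute)
  qed
  have trm: "\<bar>f (x + real j * \<alpha>) - f (y + real (\<pi> j) * \<alpha>)\<bar> \<le> 2 * L / J + of_bool (j \<in> Bad)" if j: "j < J" for j
  proof (cases "j \<in> Bad")
    case True
    have "0 \<le> 2 * L / J" using L by simp
    then show ?thesis using True osc[of "x + real j * \<alpha>" "y + real (\<pi> j) * \<alpha>"] by simp
  next
    case False
    obtain n :: int where n: "\<bar>(x + real j * \<alpha>) - (y + real (\<pi> j) * \<alpha>) - of_int n\<bar> \<le> 2 / J" using near[OF j] by auto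
    define u v where "u = x + real j * \<alpha>" and "v = y + real (\<pi> j) * \<alpha> + of_int n"
    have uv: "\<bar>u - v\<bar> \<le> 2 / J" using n by (simp add: u_def v_def algebra_simps)
    have "\<not> (min u v \<le> z + of_int m \<and> z + of_int m \<le> max u v)" if "z \<in> F" for z m
    proof
      assume "min u v \<le> z + of_int m \<and> z + of_int m \<le> max u v"
      then have "u \<le> z + of_int m \<and> z + of_int m \<le> v \<or> v \<le> z + of_int m \<and> z + of_int m \<le> u"
        by (auto simp: min_def max_def split: if_splits)
      then have "\<bar>u - z - of_int m\<bar> \<le> 2 / J" using uv unfolding abs_le_iff by linarith
      then show False using False that j by (auto simp: Bad_def u_def)
    qed
    then have "\<bar>f u - f v\<bar> \<le> L * \<bar>u - v\<bar>" by (rule lip)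
    also have "\<dots> \<le> L * (2 / J)" using uv L by (rule mult_left_mono)
    finally have "\<bar>f u - f v\<bar> \<le> 2 * L / J" by (simp add: mult.commute)
    moreover have "f v = f (y + real (\<pi> j) * \<alpha>)" unfolding v_def by (rule periodic_add_int[of f, OF per])
    ultimately show ?thesis using False by (simp add: u_def)
  qed
  have cardBad: "card Bad \<le> 6 * card F"
  proof -
    have "Bad = (\<Union>z\<in>F. {j\<in>{..<J}. \<exists>n::int. \<bar>x + real j * \<alpha> - z - of_int n\<bar> \<le> 2 / J})"
      by (auto simp: Bad_def)
    then have "card Bad \<le> (\<Sum>z\<in>F. card {j\<in>{..<J}. \<exists>n::int. \<bar>x + real j * \<alpha> - z - of_int n\<bar> \<le> 2 / J})"
      by (simp only: card_UN_le[OF F])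
    also have "\<dots> \<le> (\<Sum>z\<in>F. 6)" by (intro sum_mono card_orbit_near[OF J cop ap])
    finally show ?thesis by simp
  qed
  have "\<bar>(\<Sum>j<J. f (x + real j * \<alpha>)) - (\<Sum>j<J. f (y + real j * \<alpha>))\<bar> \<le>
     (\<Sum>j<J. \<bar>f (x + real j * \<alpha>) - f (y + real (\<pi> j) * \<alpha>)\<bar>)"
    unfolding reidx sum_subtractf[symmetric] by (rule sum_abs)
  also have "\<dots> \<le> (\<Sum>j<J. 2 * L / J + of_bool (j \<in> Bad))" using trm by (intro sum_mono) auto
  also have "\<dots> = 2 * L + card Bad"
  proof -
    have "(\<Sum>j<J. of_bool (j \<in> Bad) :: real) = card ({..<J} \<inter> Bad)"
      by (subst sum_of_bool_eq) auto
    moreover have "{..<J} \<inter> Bad = Bad" by (auto simp: Bad_def)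
    ultimately show ?thesis using J by (simp add: sum.distrib)
  qed
  finally show ?thesis using cardBad by linarith
qed

section \<open>Combinatorial lemmas and integer lattices\<close>

text \<open>Read \<open>R i j a\<close> as: passing from i to j costs at most a. Jump for nothing to
  the last index with the current label, pay one step, and that label never returns; so each label
  is paid for at most twice, on arrival and on departure.\<close>

lemma loop_erasure:
  fixes R :: "nat \<Rightarrow> nat \<Rightarrow> real \<Rightarrow> bool" and lab :: "nat \<Rightarrow> 'l" and w :: "'l \<Rightarrow> real"
  assumes tr: "\<And>i j k a b. R i j a \<Longrightarrow> R j k b \<Longrightarrow> R i k (a + b)"
    and mono: "\<And>i j a b. R i j a \<Longrightarrow> a \<le> b \<Longrightarrow> R i j b"
    and w: "\<And>x. 0 \<le> w x"
    and same: "\<And>k k'. k \<in> {i..j} \<Longrightarrow> k' \<in> {i..j} \<Longrightarrow> lab k = lab k' \<Longrightarrow> R k k' 0"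
    and step: "\<And>k. i \<le> k \<Longrightarrow> k < j \<Longrightarrow> R k (Suc k) (w (lab k) + w (lab (Suc k)))"
    and "i \<le> j"
  shows "R i j (2 * sum w (lab ` {i..j}))"
proof -
  \<comment> \<open>The initial label is paid only on departure; this saving absorbs the cost of the
    connecting step in the induction.\<close>
  have "R i j (2 * sum w (lab ` {i..j}) - w (lab i))"
    using same step \<open>i \<le> j\<close>
  proof (induction "j - i" arbitrary: i rule: less_induct)
    case less
    define M where "M = {k \<in> {i..j}. lab k = lab i}"
    define i' where "i' = Max M"
    have M: "finite M" "i \<in> M" using less.prems(3) by (auto simp: M_def)
    have i': "i' \<in> M" unfolding i'_def using M by (intro Max_in) auto
    have i'max: "\<And>k. k \<in> M \<Longrightarrow> k \<le> i'" unfolding i'_def using M by (intro Max_ge)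
    have r0: "R i i' 0" using i' less.prems by (auto simp: M_def)
    have wi: "w (lab i) \<le> sum w (lab ` {i..j})"
      using less.prems(3) w by (intro member_le_sum) auto
    show ?case
    proof (cases "i' = j")
      case True
      then show ?thesis using mono[OF r0, of "2 * sum w (lab ` {i..j}) - w (lab i)"] wi w[of "lab i"] by simp
    next
      case False
      then have ij: "i' < j" "i \<le> i'" using i' by (auto simp: M_def)
      have IH: "R (Suc i') j (2 * sum w (lab ` {Suc i'..j}) - w (lab (Suc i')))"
        by (rule less.hyps) (use ij less.prems in auto)
      have "lab ` {Suc i'..j} \<subseteq> lab ` {i..j} - {lab i}"
        using i'max ij by (fastforce simp: M_def)
      then have "sum w (lab ` {Suc i'..j}) \<le> sum w (lab ` {i..j} - {lab i})"
        using w by (intro sum_mono2) auto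
      also have "\<dots> = sum w (lab ` {i..j}) - w (lab i)"
        using less.prems(3) by (subst sum_diff1) auto
      finally have le: "sum w (lab ` {Suc i'..j}) \<le> sum w (lab ` {i..j}) - w (lab i)" .
      have "R i' (Suc i') (w (lab i) + w (lab (Suc i')))"
        using less.prems(2)[of i'] ij i' by (simp add: M_def)
      from tr[OF r0 tr[OF this IH]] show ?thesis
        by (rule mono) (use le in simp)
    qed
  qed
  then show ?thesis by (rule mono) (use w in simp)
qed

text \<open>Scales are kept in order of increasing exponent when they are far from those kept
  before; the induction removes a scale of largest exponent. Required distance and covering radius
  are both governed by the smaller exponent, that is, by the more probable event. The factor 4 is
  the one needed in \<open>sum_distant_scales\<close>.\<close>

lemma greedy_separated:
  fixes e :: "nat \<Rightarrow> nat"
  assumes "finite I"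
  shows "\<exists>S\<subseteq>I. (\<forall>k\<in>S. \<forall>l\<in>S. k \<noteq> l \<longrightarrow> e k \<le> e l \<longrightarrow> 4 * int (e k) \<le> \<bar>int k - int l\<bar>) \<and>
     (\<forall>k\<in>I. \<exists>l\<in>S. e l \<le> e k \<and> (k = l \<or> \<bar>int k - int l\<bar> < 4 * int (e l)))"
  using assms
proof (induction "card I" arbitrary: I)
  case 0
  then show ?case by auto
next
  case (Suc n)
  then have ne: "I \<noteq> {}" by auto
  define m where "m = Max (e ` I)"
  have "m \<in> e ` I" unfolding m_def using ne Suc by (intro Max_in) auto
  then obtain k where k: "k \<in> I" "e k = m" by auto
  have kmax: "e l \<le> e k" if "l \<in> I" for l using that Suc k by (simp add: m_def)
  have "n = card (I - {k})" using Suc k by simp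
  from Suc.hyps(1)[OF this] Suc.prems obtain S where
    S: "S \<subseteq> I - {k}" "\<forall>k\<in>S. \<forall>l\<in>S. k \<noteq> l \<longrightarrow> e k \<le> e l \<longrightarrow> 4 * int (e k) \<le> \<bar>int k - int l\<bar>"
      "\<forall>k\<in>I - {k}. \<exists>l\<in>S. e l \<le> e k \<and> (k = l \<or> \<bar>int k - int l\<bar> < 4 * int (e l))" by auto
  show ?case
  proof (cases "\<exists>l\<in>S. \<bar>int k - int l\<bar> < 4 * int (e l)")
    case True
    then show ?thesis using S kmax by (intro exI[of _ S]) blast
  next
    case False
    have "4 * int (e a) \<le> \<bar>int a - int b\<bar>" if "a \<in> insert k S" "b \<in> insert k S" "a \<noteq> b" "e a \<le> e b" for a b
    proof -
      have fl: "4 * int (e l) \<le> \<bar>int k - int l\<bar>" if "l \<in> S" for l using False that by force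
      consider "a = k" "b \<in> S" | "b = k" "a \<in> S" | "a \<in> S" "b \<in> S" using \<open>a \<in> insert k S\<close> \<open>b \<in> insert k S\<close> \<open>a \<noteq> b\<close> by blast
      then show ?thesis
      proof cases
        case 1
        then have "e b = e a" using that(4) kmax[of b] S(1) by auto
        then show ?thesis using fl[OF 1(2)] 1 by simp
      next
        case 2
        then show ?thesis using fl[OF 2(2)] by (simp add: abs_minus_commute)
      next
        case 3
        then show ?thesis using S(2) that by blast
      qed
    qed
    then show ?thesis using S k by (intro exI[of _ "insert k S"]) blast
  qed
qed

text \<open>Elements are dropped while the rest still reaches \<eta>; the last drop loses at most
  \<eta> / 2.\<close>

lemma subset_sum_between:
  fixes D :: "'a \<Rightarrow> real"
  assumes "finite S" "\<And>x. x \<in> S \<Longrightarrow> 0 \<le> D x" "\<And>x. x \<in> S \<Longrightarrow> D x \<le> \<eta> / 2" "\<eta> \<le> sum D S" "0 \<le> \<eta>"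
  shows "\<exists>S'\<subseteq>S. \<eta> / 2 \<le> sum D S' \<and> sum D S' \<le> \<eta>"
  using assms
proof (induction S)
  case empty
  then show ?case by auto
next
  case (insert x F)
  show ?case
  proof (cases "\<eta> \<le> sum D F")
    case True
    then obtain S' where "S' \<subseteq> F" "\<eta> / 2 \<le> sum D S' \<and> sum D S' \<le> \<eta>"
      using insert by auto
    then show ?thesis by blast
  next
    case False
    have "\<eta> \<le> D x + sum D F" using insert by simp
    then have "\<eta> / 2 \<le> sum D F" using insert.prems(2)[of x] by simp
    then show ?thesis using False by (intro exI[of _ F]) auto
  qed
qed

lemma geometric_pairs:
  assumes "a \<le> b"
  shows "(\<Sum>t\<in>{2*a..<2*b}. (1/2::real) ^ (t div 2)) = 4 * (1/2)^a - 4 * (1/2)^b"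
  using assms
proof (induction b rule: dec_induct)
  case (step b)
  have "{2*a..<2 * Suc b} = insert (2*b) (insert (2*b+1) {2*a..<2*b})" using step by auto
  then show ?case using step by simp
qed simp

text \<open>On either side of k the distance determines l, and \<open>div 2\<close> takes each value
  twice; each side is thus part of a doubled geometric series starting at exponent 2 e. The halved
  distance is the one in the error of \<open>quasi_independent\<close>.\<close>

lemma sum_distant_scales:
  fixes k e :: nat
  assumes "finite S"
  shows "(\<Sum>l\<in>{l\<in>S. 4 * int e \<le> \<bar>int k - int l\<bar>}. (1/2::real) ^ (nat \<bar>int k - int l\<bar> div 2)) \<le> 8 * ((1/2)^e)^2"
proof -
  obtain N where N: "\<And>l. l \<in> S \<Longrightarrow> l < N" using assms by (meson finite_nat_bounded lessThan_iff subsetD)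
  define b where "b = 2 * e + N + k"
  have bnd: "(\<Sum>t\<in>{4*e..<2*b}. (1/2::real) ^ (t div 2)) \<le> 4 * (1/2)^(2*e)"
    using geometric_pairs[of "2*e" b] by (simp add: b_def)
  have half: "(\<Sum>l\<in>X. (1/2::real) ^ (nat \<bar>int k - int l\<bar> div 2)) \<le> 4 * (1/2)^(2*e)"
    if X: "X \<subseteq> {l\<in>S. 4 * int e \<le> \<bar>int k - int l\<bar>}" and inj: "inj_on (\<lambda>l. nat \<bar>int k - int l\<bar>) X" for X
  proof -
    have "(\<Sum>l\<in>X. (1/2::real) ^ (nat \<bar>int k - int l\<bar> div 2)) = (\<Sum>t\<in>(\<lambda>l. nat \<bar>int k - int l\<bar>) ` X. (1/2) ^ (t div 2))"
      by (simp add: sum.reindex[OF inj])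
    also have "\<dots> \<le> (\<Sum>t\<in>{4*e..<2*b}. (1/2::real) ^ (t div 2))"
      using X N by (intro sum_mono2) (auto simp: b_def dest!: subsetD[OF X] N)
    finally show ?thesis using bnd by simp
  qed
  define Y where "Y = {l\<in>S. 4 * int e \<le> \<bar>int k - int l\<bar>}"
  define h where "h l = (1/2::real) ^ (nat \<bar>int k - int l\<bar> div 2)" for l
  define A B where "A = {l\<in>Y. l \<le> k}" and "B = {l\<in>Y. \<not> l \<le> k}"
  have "Y = A \<union> B" "A \<inter> B = {}" "finite A" "finite B" using assms by (auto simp: A_def B_def Y_def)
  then have "sum h Y = sum h A + sum h B" by (simp only: sum.union_disjoint)
  also have "\<dots> \<le> 4 * (1/2)^(2*e) + 4 * (1/2)^(2*e)"
    unfolding h_def by (intro add_mono half) (auto simp: A_def B_def Y_def inj_on_def)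
  finally show ?thesis by (simp add: h_def Y_def power_mult[symmetric] mult.commute)
qed

section \<open>Subgroups of the integer lattice\<close>

definition int_vecs :: "(real ^ 'n) set" where
  "int_vecs = {v. \<forall>i. v $ i \<in> \<int>}"

lemma int_vecs_diff: "x \<in> int_vecs \<Longrightarrow> y \<in> int_vecs \<Longrightarrow> x - y \<in> int_vecs"
  by (auto simp: int_vecs_def)

lemma int_vecs_add: "x \<in> int_vecs \<Longrightarrow> y \<in> int_vecs \<Longrightarrow> x + y \<in> int_vecs"
  by (auto simp: int_vecs_def)

lemma int_vecs_minus: "x \<in> int_vecs \<Longrightarrow> - x \<in> int_vecs"
  by (auto simp: int_vecs_def)

lemma int_vecs_0 [simp]: "0 \<in> int_vecs"
  by (auto simp: int_vecs_def)

lemma int_vecs_sum: "(\<And>x. x \<in> A \<Longrightarrow> f x \<in> int_vecs) \<Longrightarrow> sum f A \<in> int_vecs"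
  by (induction A rule: infinite_finite_induct) (auto intro: int_vecs_add)

lemma int_vecs_scale: "x \<in> int_vecs \<Longrightarrow> c \<in> \<int> \<Longrightarrow> c *\<^sub>R x \<in> int_vecs"
  by (auto simp: int_vecs_def)

lemma subgroup_scale_int:
  fixes G :: "'v::real_vector set"
  assumes diff: "\<And>x y. x \<in> G \<Longrightarrow> y \<in> G \<Longrightarrow> x - y \<in> G" and x: "x \<in> G"
  shows "of_int k *\<^sub>R x \<in> G"
proof -
  have 0: "0 \<in> G" using diff[OF x x] by simp
  have m: "- y \<in> G" if "y \<in> G" for y using diff[OF 0 that] by simp
  have *: "of_nat n *\<^sub>R x \<in> G" for n
  proof (induction n)
    case (Suc n)
    have "of_nat n *\<^sub>R x - (- x) \<in> G" by (intro diff Suc m x)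
    then show ?case by (simp add: algebra_simps)
  qed (use 0 in simp)
  show ?thesis
  proof (cases "k \<ge> 0")
    case True
    then show ?thesis using *[of "nat k"] by simp
  next
    case False
    then show ?thesis using m[OF *[of "nat (-k)"]] by simp
  qed
qed

lemma subgroup_sum:
  fixes G :: "'v::real_vector set"
  assumes diff: "\<And>x y. x \<in> G \<Longrightarrow> y \<in> G \<Longrightarrow> x - y \<in> G" and 0: "0 \<in> G"
    and "\<And>x. x \<in> A \<Longrightarrow> f x \<in> G"
  shows "sum f A \<in> G"
  using assms(3)
proof (induction A rule: infinite_finite_induct)
  case (insert x F)
  have "f x - (0 - sum f F) \<in> G" using insert by (intro diff 0) auto
  then show ?case using insert by simp
qed (use 0 in auto)

lemma integer_subgroup_basis:
  fixes G :: "(real ^ 'n) set" and I :: "'n set"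
  assumes G: "G \<subseteq> int_vecs" and diff': "\<forall>x\<in>G. \<forall>y\<in>G. x - y \<in> G"
  shows "\<exists>B dual. finite B \<and> B \<subseteq> {n\<in>G. \<forall>i. i \<notin> I \<longrightarrow> n $ i = 0} \<and>
    (\<forall>b\<in>B. \<forall>b'\<in>B. b \<bullet> dual b' = (if b = b' then 1 else 0)) \<and>
    (\<forall>n\<in>G. (\<forall>i. i \<notin> I \<longrightarrow> n $ i = 0) \<longrightarrow> n = (\<Sum>b\<in>B. (n \<bullet> dual b) *\<^sub>R b) \<and> (\<forall>b\<in>B. n \<bullet> dual b \<in> \<int>)) \<and>
    (\<forall>b\<in>B. \<forall>i. dual b $ i \<in> \<rat> \<and> (i \<notin> I \<longrightarrow> dual b $ i = 0))"
proof -
  have diff: "\<And>x y. x \<in> G \<Longrightarrow> y \<in> G \<Longrightarrow> x - y \<in> G" using diff' by blast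
  have "finite I" by simp
  then show ?thesis
  proof (induction I)
    case empty
    show ?case by (rule exI[of _ "{}"]) (auto simp: vec_eq_iff)
  next
    case (insert i I)
    let ?G = "\<lambda>I. {n\<in>G. \<forall>i. i \<notin> I \<longrightarrow> n $ i = 0}"
    from insert.IH obtain B dual where B0: "finite B" "B \<subseteq> ?G I"
      "\<forall>b\<in>B. \<forall>b'\<in>B. b \<bullet> dual b' = (if b = b' then 1 else 0)"
      "\<forall>n\<in>G. (\<forall>i. i \<notin> I \<longrightarrow> n $ i = 0) \<longrightarrow> n = (\<Sum>b\<in>B. (n \<bullet> dual b) *\<^sub>R b) \<and> (\<forall>b\<in>B. n \<bullet> dual b \<in> \<int>)"
      "\<forall>b\<in>B. \<forall>i. dual b $ i \<in> \<rat> \<and> (i \<notin> I \<longrightarrow> dual b $ i = 0)" by (elim exE conjE)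
    have B: "finite B" "B \<subseteq> ?G I"
      "\<And>b b'. b \<in> B \<Longrightarrow> b' \<in> B \<Longrightarrow> b \<bullet> dual b' = (if b = b' then 1 else 0)"
      "\<And>n. n \<in> ?G I \<Longrightarrow> n = (\<Sum>b\<in>B. (n \<bullet> dual b) *\<^sub>R b)"
      "\<And>n b. n \<in> ?G I \<Longrightarrow> b \<in> B \<Longrightarrow> n \<bullet> dual b \<in> \<int>"
      "\<And>b i. b \<in> B \<Longrightarrow> dual b $ i \<in> \<rat>"
      "\<And>b i. b \<in> B \<Longrightarrow> i \<notin> I \<Longrightarrow> dual b $ i = 0"
      by (fact B0(1), fact B0(2), use B0(3) in blast, use B0(4) in blast, use B0(4) in blast, use B0(5) in blast, use B0(5) in blast)
    show ?case
    proof (cases "\<forall>n\<in>?G (insert i I). n $ i = 0")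
      case True
      then have eq: "?G (insert i I) = ?G I" by auto
      show ?thesis
      proof (rule exI[of _ B], rule exI[of _ dual], intro conjI ballI impI allI)
        show "B \<subseteq> ?G (insert i I)" using B(2) eq by simp
        fix n assume "n \<in> G" "\<forall>j. j \<notin> insert i I \<longrightarrow> n $ j = 0"
        then have n: "n \<in> ?G I" using eq by blast
        show "n = (\<Sum>b\<in>B. (n \<bullet> dual b) *\<^sub>R b)" by (rule B(4)[OF n])
        fix b assume "b \<in> B"
        then show "n \<bullet> dual b \<in> \<int>" by (rule B(5)[OF n])
      qed (use B in auto)
    next
      case False
      define P where "P m \<longleftrightarrow> 0 < m \<and> (\<exists>n\<in>?G (insert i I). n $ i = real m)" for m :: nat
      from False obtain n where n: "n \<in> ?G (insert i I)" "n $ i \<noteq> 0" by auto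
      have Gdiff: "x - y \<in> ?G J" if "x \<in> ?G J" "y \<in> ?G J" for x y J using that diff by auto
      have neg: "- x \<in> ?G J" if "x \<in> ?G J" for x J
        using Gdiff[OF Gdiff[OF that that] that] by simp
      have "n $ i \<in> \<int>" using n G by (auto simp: int_vecs_def)
      then obtain z where z: "n $ i = of_int z" by (rule Ints_cases)
      have "P (nat \<bar>z\<bar>)"
      proof (cases "z > 0")
        case True
        then show ?thesis using n z by (auto simp: P_def)
      next
        case False
        then have "(- n) $ i = real (nat \<bar>z\<bar>)" using z by simp
        moreover have "0 < nat \<bar>z\<bar>" using n(2) z by simp
        ultimately show ?thesis using neg[OF n(1)] unfolding P_def by blast
      qed
      define m where "m = (LEAST m. P m)"
      have "P m" unfolding m_def by (rule LeastI[of P, OF \<open>P (nat \<bar>z\<bar>)\<close>])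
      then obtain s where s: "s \<in> ?G (insert i I)" "s $ i = real m" "m > 0" by (auto simp: P_def)
      have least: "\<not> P k" if "k < m" for k using not_less_Least[of k P] that by (simp add: m_def)
      have quot: "\<exists>k::int. n $ i = of_int k * real m \<and> n - of_int k *\<^sub>R s \<in> ?G I" if n: "n \<in> ?G (insert i I)" for n
      proof -
        have "n $ i \<in> \<int>" using n G by (auto simp: int_vecs_def)
        then obtain z where z: "n $ i = of_int z" by (rule Ints_cases)
        define k where "k = z div int m"
        have mem: "n - of_int k *\<^sub>R s \<in> ?G (insert i I)"
          using Gdiff[OF n subgroup_scale_int[of "?G (insert i I)" s k]] Gdiff s(1) by blast
        have "(n - of_int k *\<^sub>R s) $ i = of_int (z - k * int m)" using z s(2) by simp
        also have "z - k * int m = z mod int m" by (simp add: k_def minus_div_mult_eq_mod)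
        finally have c: "(n - of_int k *\<^sub>R s) $ i = of_int (z mod int m)" .
        have "z mod int m = 0"
        proof (rule ccontr)
          assume nz: "z mod int m \<noteq> 0"
          have "0 \<le> z mod int m" "z mod int m < int m" using s(3) by simp_all
          with nz have r: "0 < z mod int m" "z mod int m < int m" by linarith+
          then have "P (nat (z mod int m))" unfolding P_def using mem c by (intro conjI bexI[of _ "n - of_int k *\<^sub>R s"]) auto
          then show False using least r by (auto simp: nat_less_iff)
        qed
        then have "(n - of_int k *\<^sub>R s) $ i = 0" using c by simp
        moreover from this have "n $ i = of_int k * real m" using s(2) by simp
        ultimately show ?thesis using mem by (intro exI[of _ k]) auto
      qed
      \<comment> \<open>\<open>w\<close> vanishes on the old basis and takes the value 1 on
        \<open>s\<close>, so it is dual to \<open>s\<close>; multiples of it make the old dual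
        vectors vanish on \<open>s\<close>.\<close>
      define w where "w = axis i (1 / real m)"
      define dual' where "dual' b = (if b = s then w else dual b - (s \<bullet> dual b) *\<^sub>R w)" for b
      have iw: "x \<bullet> w = x $ i / real m" for x by (simp add: w_def inner_axis)
      have sB: "s \<notin> B" using B(2) s insert.hyps by auto
      have sw: "s \<bullet> w = 1" using s iw by simp
      have Bw: "b \<bullet> w = 0" if "b \<in> B" for b using that B(2) insert.hyps by (auto simp: iw)
      have srat: "s \<bullet> dual b \<in> \<rat>" if "b \<in> B" for b
        unfolding inner_vec_def inner_real_def using s G B(6)[OF that]
        by (intro Rats_sum Rats_mult) (auto simp: int_vecs_def dest: subsetD[OF Ints_subset_Rats])
      show ?thesis
      proof (rule exI[of _ "insert s B"], rule exI[of _ dual'], intro conjI ballI impI allI)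
        show "finite (insert s B)" using B by simp
        show "insert s B \<subseteq> ?G (insert i I)" using s B(2) by auto
        fix b b' assume b: "b \<in> insert s B" "b' \<in> insert s B"
        show "b \<bullet> dual' b' = (if b = b' then 1 else 0)"
          using b sB sw Bw B(3) by (auto simp: dual'_def inner_diff_right)
      next
        fix n assume "n \<in> G" "\<forall>j. j \<notin> insert i I \<longrightarrow> n $ j = 0"
        then have n: "n \<in> ?G (insert i I)" by blast
        obtain k where k: "n $ i = of_int k * real m" "n - of_int k *\<^sub>R s \<in> ?G I" using quot[OF n] by blast
        have nw: "n \<bullet> w = of_int k" using k(1) s(3) by (simp add: iw)
        have nd: "n \<bullet> dual' b = (n - of_int k *\<^sub>R s) \<bullet> dual b" if "b \<in> B" for b
          using that sB nw by (auto simp: dual'_def inner_diff_right inner_diff_left)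
        have "n - of_int k *\<^sub>R s = (\<Sum>b\<in>B. ((n - of_int k *\<^sub>R s) \<bullet> dual b) *\<^sub>R b)" by (rule B(4)[OF k(2)])
        also have "\<dots> = (\<Sum>b\<in>B. (n \<bullet> dual' b) *\<^sub>R b)" by (intro sum.cong refl) (simp add: nd)
        finally show "n = (\<Sum>b\<in>insert s B. (n \<bullet> dual' b) *\<^sub>R b)"
          using sB B(1) nw by (simp add: dual'_def algebra_simps)
        fix b assume "b \<in> insert s B"
        show "n \<bullet> dual' b \<in> \<int>"
        proof (cases "b = s")
          case True
          then show ?thesis using nw by (simp add: dual'_def)
        next
          case False
          then have "b \<in> B" using \<open>b \<in> insert s B\<close> by simp
          then show ?thesis using nd B(5)[OF k(2)] by metis
        qed
      next
        fix b j assume b: "b \<in> insert s B"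
        have "w $ j \<in> \<rat>" by (simp add: w_def axis_def)
        then show "dual' b $ j \<in> \<rat>" using b B(6) srat by (auto simp: dual'_def)
        assume "j \<notin> insert i I"
        then show "dual' b $ j = 0" using b B(7) by (auto simp: dual'_def w_def axis_def)
      qed
    qed
  qed
qed

lemma common_denominator:
  fixes A :: "real set"
  assumes "finite A" "A \<subseteq> \<rat>"
  shows "\<exists>D::nat. D > 0 \<and> (\<forall>a\<in>A. real D * a \<in> \<int>)"
  using assms
proof (induction A)
  case (insert x A)
  then obtain D where D: "D > 0" "\<forall>a\<in>A. real D * a \<in> \<int>" by auto
  from insert.prems have "x \<in> \<rat>" by simp
  then obtain p q where pq: "q > 0" "x = of_int p / of_int q" by (metis Rats_cases')
  then have "real (nat q) * x \<in> \<int>" by simp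
  then have "real (D * nat q) * x \<in> \<int>" by (simp add: mult.assoc)
  moreover have "real (D * nat q) * a \<in> \<int>" if "a \<in> A" for a
  proof -
    have "real (D * nat q) * a = real (nat q) * (real D * a)" by simp
    then show ?thesis using D(2) that by (metis Ints_mult Ints_of_nat)
  qed
  ultimately show ?case using D pq by (intro exI[of _ "D * nat q"]) auto
qed auto

text \<open>P is D times the projection along the span of G given by the dual basis, with D a common
  denominator of the dual vectors and \<kappa> = 1/D. Rounding the coefficients of t down gives an
  element of G, and what remains is bounded apart from the part seen by P.\<close>

lemma integer_quotient:
  fixes G :: "(real ^ 'n) set"
  assumes G: "G \<subseteq> int_vecs" and diff: "\<And>x y. x \<in> G \<Longrightarrow> y \<in> G \<Longrightarrow> x - y \<in> G" and 0: "0 \<in> G"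
  obtains P :: "real ^ 'n \<Rightarrow> real ^ 'n" and \<kappa> K where
    "linear P" "\<And>v. v \<in> int_vecs \<Longrightarrow> P v \<in> int_vecs" "\<And>v. v \<in> G \<Longrightarrow> P v = 0"
    "\<And>t. \<exists>v\<in>G. norm (t - v) \<le> K * (1 + norm (P t))" "\<And>t. t - \<kappa> *\<^sub>R P t \<in> span G"
proof -
  have diff': "\<forall>x\<in>G. \<forall>y\<in>G. x - y \<in> G" using diff by blast
  obtain B dual where B0: "finite B" "B \<subseteq> {n\<in>G. \<forall>i. i \<notin> UNIV \<longrightarrow> n $ i = 0}"
      "\<forall>n\<in>G. (\<forall>i. i \<notin> UNIV \<longrightarrow> n $ i = 0) \<longrightarrow> n = (\<Sum>b\<in>B. (n \<bullet> dual b) *\<^sub>R b) \<and> (\<forall>b\<in>B. n \<bullet> dual b \<in> \<int>)"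
      "\<forall>b\<in>B. \<forall>i. dual b $ i \<in> \<rat> \<and> (i \<notin> UNIV \<longrightarrow> dual b $ i = 0)"
    using integer_subgroup_basis[OF G diff', of UNIV] by (elim exE conjE)
  have B: "finite B" "B \<subseteq> G"
      "\<And>n. n \<in> G \<Longrightarrow> n = (\<Sum>b\<in>B. (n \<bullet> dual b) *\<^sub>R b)"
      "\<And>b i. b \<in> B \<Longrightarrow> dual b $ i \<in> \<rat>"
    using B0 by auto
  obtain D :: nat where D: "D > 0" "\<And>b i. b \<in> B \<Longrightarrow> real D * dual b $ i \<in> \<int>"
  proof -
    have "(\<lambda>(b, i). dual b $ i) ` (B \<times> UNIV) \<subseteq> \<rat>" using B(4) by auto
    from common_denominator[OF _ this] B(1) show ?thesis using that by auto
  qed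
  define Q where "Q t = t - (\<Sum>b\<in>B. (t \<bullet> dual b) *\<^sub>R b)" for t
  have linQ: "linear Q" unfolding Q_def
    by (intro linearI) (simp_all add: inner_add_left algebra_simps sum.distrib scaleR_sum_right)
  show ?thesis
  proof (rule that[of "\<lambda>t. real D *\<^sub>R Q t" "1 + (\<Sum>b\<in>B. norm b)" "1 / real D"])
    show "linear (\<lambda>t. real D *\<^sub>R Q t)" by (intro linear_compose_scale_right linQ)
    show "real D *\<^sub>R Q v = 0" if "v \<in> G" for v using B(3)[OF that] by (simp add: Q_def)
    show "real D *\<^sub>R Q v \<in> int_vecs" if v: "v \<in> int_vecs" for v
    proof -
      have "real D * (v \<bullet> dual b) \<in> \<int>" if "b \<in> B" for b
      proof -
        have "real D * (v \<bullet> dual b) = (\<Sum>i\<in>UNIV. v $ i * (real D * dual b $ i))"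
          by (simp add: inner_vec_def sum_distrib_left mult_ac)
        also have "\<dots> \<in> \<int>"
        proof (rule Ints_sum)
          fix i
          have "v $ i \<in> \<int>" using v by (simp add: int_vecs_def)
          then show "v $ i * (real D * dual b $ i) \<in> \<int>" using D(2)[OF that] by (rule Ints_mult)
        qed
        finally show ?thesis .
      qed
      then have "real D *\<^sub>R v - (\<Sum>b\<in>B. (real D * (v \<bullet> dual b)) *\<^sub>R b) \<in> int_vecs"
        using v B(2) G by (intro int_vecs_diff int_vecs_sum int_vecs_scale) auto
      then show ?thesis by (simp add: Q_def scaleR_diff_right scaleR_sum_right)
    qed
    show "t - (1 / real D) *\<^sub>R (real D *\<^sub>R Q t) \<in> span G" for t
    proof -
      have "(\<Sum>b\<in>B. (t \<bullet> dual b) *\<^sub>R b) \<in> span G"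
        using B(2) by (intro span_sum span_scale span_base) auto
      then show ?thesis using D(1) by (simp add: Q_def)
    qed
    show "\<exists>v\<in>G. norm (t - v) \<le> (1 + (\<Sum>b\<in>B. norm b)) * (1 + norm (real D *\<^sub>R Q t))" for t
    proof
      define v where "v = (\<Sum>b\<in>B. of_int \<lfloor>t \<bullet> dual b\<rfloor> *\<^sub>R b)"
      show "v \<in> G" unfolding v_def using B(2)
        by (intro subgroup_sum diff 0 subgroup_scale_int) auto
      have "t - v = Q t + (\<Sum>b\<in>B. frac (t \<bullet> dual b) *\<^sub>R b)"
        by (simp add: Q_def v_def frac_def algebra_simps sum_subtractf[symmetric] sum.distrib[symmetric])
      then have "norm (t - v) \<le> norm (Q t) + norm (\<Sum>b\<in>B. frac (t \<bullet> dual b) *\<^sub>R b)"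
        by (simp add: norm_triangle_ineq)
      also have "norm (\<Sum>b\<in>B. frac (t \<bullet> dual b) *\<^sub>R b) \<le> (\<Sum>b\<in>B. norm b)"
      proof (rule sum_norm_le)
        fix b :: "real ^ 'n"
        have "\<bar>frac (t \<bullet> dual b)\<bar> \<le> 1" using frac_ge_0[of "t \<bullet> dual b"] frac_lt_1[of "t \<bullet> dual b"] by linarith
        then show "norm (frac (t \<bullet> dual b) *\<^sub>R b) \<le> norm b" by (simp add: mult_left_le_one_le)
      qed
      also have "norm (Q t) \<le> norm (real D *\<^sub>R Q t)" using D(1) by (simp add: mult_le_cancel_right1)
      also have "norm (real D *\<^sub>R Q t) + (\<Sum>b\<in>B. norm b) \<le> (1 + (\<Sum>b\<in>B. norm b)) * (1 + norm (real D *\<^sub>R Q t))"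
      proof -
        have "0 \<le> (\<Sum>b\<in>B. norm b)" "0 \<le> norm (real D *\<^sub>R Q t)" by (simp_all add: sum_nonneg)
        then have "0 \<le> (\<Sum>b\<in>B. norm b) * norm (real D *\<^sub>R Q t)" by (rule mult_nonneg_nonneg)
        then show ?thesis by (simp add: distrib_left distrib_right)
      qed
      finally show "norm (t - v) \<le> (1 + (\<Sum>b\<in>B. norm b)) * (1 + norm (real D *\<^sub>R Q t))" by simp
    qed
  qed
qed

section \<open>Lebesgue measure on the circle\<close>

lemma space_circle [simp]: "space circle = {0..<1}"
  by (simp add: circle_def space_restrict_space)

lemma sets_circle: "sets circle = {A \<in> sets borel. A \<subseteq> {0..<1}}"
  by (auto simp: circle_def sets_restrict_space_iff subset_eq)

lemma emeasure_circle: "A \<in> sets borel \<Longrightarrow> A \<subseteq> {0..<1} \<Longrightarrow> emeasure circle A = emeasure lborel A"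
  by (simp add: circle_def emeasure_restrict_space)

lemma emeasure_space_circle: "emeasure circle {0..<1} = 1"
  by (simp add: emeasure_circle)

lemma finite_measure_circle: "finite_measure circle"
  by (intro finite_measureI) (simp add: emeasure_space_circle)

interpretation circle: finite_measure circle
  by (rule finite_measure_circle)

lemma measure_space_circle [simp]: "measure circle {0..<1} = 1"
  by (simp add: measure_def emeasure_space_circle)

lemma measurable_circleI: "f \<in> borel_measurable borel \<Longrightarrow> f \<in> borel_measurable circle"
  by (simp add: circle_def measurable_restrict_space1)

lemma AE_circle_iff: "(AE x in circle. P x) \<longleftrightarrow> (AE x in lborel. 0 \<le> x \<and> x < 1 \<longrightarrow> P x)"
  unfolding circle_def by (subst AE_restrict_space_iff) auto

lemma Collect_circle_sets: "Measurable.pred borel P \<Longrightarrow> {x \<in> {0..<1}. P x} \<in> sets circle"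
  by (auto simp: sets_circle)

lemma frac_borel [measurable]: "frac \<in> borel_measurable (borel :: real measure)"
  unfolding frac_def by measurable

lemma rotation_measurable: "(\<lambda>x. frac (x + c)) \<in> measurable circle circle"
  unfolding circle_def
  by (intro measurable_restrict_space2 measurable_restrict_space1) (auto simp: frac_lt_1)

lemma distr_rotation: "distr circle circle (\<lambda>x. frac (x + c)) = circle"
proof (rule measure_eqI)
  fix A assume "A \<in> sets (distr circle circle (\<lambda>x. frac (x + c)))"
  then have A: "A \<in> sets circle" "A \<in> sets borel" "A \<subseteq> {0..<1}" by (auto simp: sets_circle)
  define d where "d = frac c"
  have d: "0 \<le> d" "d < 1" by (auto simp: d_def frac_lt_1)
  have fr: "frac (x + c) = (if x + d < 1 then x + d else x + d - 1)" if "0 \<le> x" "x < 1" for x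
  proof -
    have "frac (x + c) = frac (x + d)" unfolding d_def by (metis frac_def periodic_add_int[of frac] frac_1_eq add.commute add_diff_eq diff_add_cancel)
    then show ?thesis using that d by (auto simp: frac_eq intro!: frac_unique_iff[THEN iffD2])
  qed
  \<comment> \<open>The preimage of A consists of two translates: the part of A in [d,1) moved by
    -d, and the part in [0,d) moved by 1 - d.\<close>
  define A1 A2 where "A1 = (\<lambda>x. d + x) -` (A \<inter> {d..<1})" and "A2 = (\<lambda>x. (d - 1) + x) -` (A \<inter> {0..<d})"
  have eq: "(\<lambda>x. frac (x + c)) -` A \<inter> {0..<1} = A1 \<union> A2"
  proof (intro set_eqI iffI)
    fix x assume "x \<in> (\<lambda>x. frac (x + c)) -` A \<inter> {0..<1}"
    then show "x \<in> A1 \<union> A2" using fr[of x] A(3) d by (auto simp: A1_def A2_def add.commute add_diff_eq split: if_splits)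
  next
    fix x assume "x \<in> A1 \<union> A2"
    then have x: "0 \<le> x" "x < 1" using d by (auto simp: A1_def A2_def)
    show "x \<in> (\<lambda>x. frac (x + c)) -` A \<inter> {0..<1}"
      using \<open>x \<in> A1 \<union> A2\<close> x fr[OF x] d by (auto simp: A1_def A2_def add.commute add_diff_eq)
  qed
  have tr: "emeasure lborel ((\<lambda>x. a + x) -` B) = emeasure lborel B" if "B \<in> sets borel" for a :: real and B
    using that by (subst (2) lborel_distr_plus[of a, symmetric]) (simp add: emeasure_distr)
  have m: "A1 \<in> sets borel" "A2 \<in> sets borel" using A(2) unfolding A1_def A2_def
    by (auto intro!: measurable_sets_borel[of "\<lambda>x. _ + x"])
  have "emeasure (distr circle circle (\<lambda>x. frac (x + c))) A = emeasure circle (A1 \<union> A2)"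
    using A rotation_measurable by (simp add: emeasure_distr eq)
  also have "\<dots> = emeasure lborel (A1 \<union> A2)"
    by (rule emeasure_circle) (use m eq in auto)
  also have "\<dots> = emeasure lborel A1 + emeasure lborel A2"
    using m d by (intro plus_emeasure[symmetric]) (auto simp: A1_def A2_def)
  also have "\<dots> = emeasure lborel (A \<inter> {d..<1}) + emeasure lborel (A \<inter> {0..<d})"
    unfolding A1_def A2_def using A by (subst (1 2) tr) auto
  also have "\<dots> = emeasure lborel ((A \<inter> {d..<1}) \<union> (A \<inter> {0..<d}))"
    using A by (intro plus_emeasure) auto
  also have "(A \<inter> {d..<1}) \<union> (A \<inter> {0..<d}) = A" using A(3) d by auto
  also have "emeasure lborel A = emeasure circle A" using A by (simp add: emeasure_circle)
  finally show "emeasure (distr circle circle (\<lambda>x. frac (x + c))) A = emeasure circle A" .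
qed simp

lemma AE_circle_shift:
  assumes "AE x in circle. P x" "\<And>x. P (x + 1) \<longleftrightarrow> P x"
  shows "AE x in circle. P (x + c)"
proof -
  have "AE x in distr circle circle (\<lambda>x. frac (x + c)). P x" using assms(1) by (subst distr_rotation)
  then have "AE x in circle. P (frac (x + c))" by (rule AE_distrD[OF rotation_measurable])
  moreover have "P (frac y) = P y" for y by (rule periodic_frac[of P, OF assms(2)])
  ultimately show ?thesis by simp
qed

lemma measure_circle_shift:
  assumes "Measurable.pred borel P" "\<And>x. P (x + 1) \<longleftrightarrow> P x"
  shows "measure circle {x \<in> {0..<1}. P (x + c)} = measure circle {x \<in> {0..<1}. P x}"
proof -
  have "measure circle {x \<in> {0..<1}. P x} = measure (distr circle circle (\<lambda>x. frac (x + c))) {x \<in> {0..<1}. P x}"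
    by (simp add: distr_rotation)
  also have "\<dots> = measure circle ((\<lambda>x. frac (x + c)) -` {x \<in> {0..<1}. P x} \<inter> space circle)"
    using assms(1) by (intro measure_distr rotation_measurable) (auto simp: sets_circle)
  also have "(\<lambda>x. frac (x + c)) -` {x \<in> {0..<1}. P x} \<inter> space circle = {x \<in> {0..<1}. P (x + c)}"
    using periodic_frac[of P, OF assms(2)] by (auto simp: frac_lt_1)
  finally show ?thesis by simp
qed

lemma integral_circle_shift:
  fixes f :: "real \<Rightarrow> 'b::{banach, second_countable_topology}"
  assumes "f \<in> borel_measurable borel" "\<And>x. f (x + 1) = f x"
  shows "(LINT x|circle. f (x + c)) = (LINT x|circle. f x)"
proof -
  have "(LINT x|circle. f x) = (LINT x|distr circle circle (\<lambda>x. frac (x + c)). f x)"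
    by (simp add: distr_rotation)
  also have "\<dots> = (LINT x|circle. f (frac (x + c)))"
    by (rule integral_distr[OF rotation_measurable]) (use assms in \<open>simp add: measurable_circleI\<close>)
  finally show ?thesis using periodic_frac[of f, OF assms(2)] by simp
qed

text \<open>Countably many integer translates of the exceptional set in [0,1) cover the one on the
  line. This allows rotations to be treated as plain translations of periodic objects.\<close>

lemma AE_circle_lborel:
  fixes P :: "real \<Rightarrow> bool"
  assumes "\<And>x. P (x + 1) \<longleftrightarrow> P x"
  shows "(AE x in circle. P x) \<longleftrightarrow> (AE x in lborel. P x)"
proof
  assume "AE x in circle. P x"
  then have a: "AE x in lborel. 0 \<le> x \<and> x < 1 \<longrightarrow> P x" by (simp add: AE_circle_iff)
  have "AE x in lborel. \<forall>n::int. 0 \<le> x + of_int n \<and> x + of_int n < 1 \<longrightarrow> P (x + of_int n)"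
    unfolding AE_all_countable
  proof
    fix n :: int
    have "AE x in distr lborel borel ((+) (real_of_int n)). 0 \<le> x \<and> x < 1 \<longrightarrow> P x" using a by (subst lborel_distr_plus)
    then have "AE x in lborel. 0 \<le> of_int n + x \<and> of_int n + x < 1 \<longrightarrow> P (of_int n + x)"
      by (rule AE_distrD[rotated]) simp
    then show "AE x in lborel. 0 \<le> x + of_int n \<and> x + of_int n < 1 \<longrightarrow> P (x + of_int n)"
      by (simp only: add.commute[of "real_of_int n"])
  qed
  then show "AE x in lborel. P x"
  proof eventually_elim
    fix x assume *: "\<forall>n::int. 0 \<le> x + of_int n \<and> x + of_int n < 1 \<longrightarrow> P (x + of_int n)"
    have "0 \<le> x + of_int (-\<lfloor>x\<rfloor>) \<and> x + of_int (-\<lfloor>x\<rfloor>) < 1" by (simp; linarith)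
    then have "P (x + of_int (-\<lfloor>x\<rfloor>))" using * by blast
    then show "P x" using periodic_add_int[of P x "-\<lfloor>x\<rfloor>", OF assms] by simp
  qed
qed (auto simp: AE_circle_iff)

section \<open>Periods of measurable sets\<close>

lemma AE_lborel_shift:
  fixes c :: "'a::euclidean_space"
  assumes "AE x in lborel. P x"
  shows "AE x in lborel. P (x + c)"
proof -
  have "AE x in distr lborel borel ((+) c). P x" using assms by (subst lborel_distr_plus)
  then have "AE x in lborel. P (c + x)" by (rule AE_distrD[rotated]) simp
  then show ?thesis by (simp add: add.commute)
qed

lemma emeasure_lborel_shift:
  fixes c :: "'a::euclidean_space"
  assumes "A \<in> sets borel"
  shows "emeasure lborel {x. x + c \<in> A} = emeasure lborel A"
proof -
  have "emeasure lborel A = emeasure (distr lborel borel ((+) c)) A" by (simp add: lborel_distr_plus)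
  also have "\<dots> = emeasure lborel {x. x + c \<in> A}"
    using assms by (subst emeasure_distr) (auto simp: vimage_def add.commute)
  finally show ?thesis by simp
qed

lemma shift_sets_borel:
  fixes c :: "'a::euclidean_space"
  assumes "A \<in> sets borel"
  shows "{x. x + c \<in> A} \<in> sets borel"
  using measurable_sets_borel[of "\<lambda>y. y + c" borel A] assms by (simp add: vimage_def)

text \<open>Squeeze A between a compact K and an open U, each with error e/2. A small translation
  keeps K inside U, so only A - K and the translate of U - A can be lost.\<close>

lemma translation_continuity1:
  fixes A :: "'a::euclidean_space set"
  assumes A: "A \<in> sets borel" "bounded A" and e: "e > 0"
  shows "\<exists>d>0. \<forall>v. norm v < d \<longrightarrow> emeasure lborel {y\<in>A. y + v \<notin> A} \<le> ennreal e"
proof -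
  have Al: "A \<in> sets lebesgue" using A(1) by simp
  have e2: "e / 2 > 0" using e by simp
  obtain U where U: "open U" "A \<subseteq> U" "emeasure lebesgue (U - A) < ennreal (e/2)"
    by (rule sets_lebesgue_outer_open[OF Al e2])
  obtain K where K: "closed K" "K \<subseteq> A" "emeasure lebesgue (A - K) < ennreal (e/2)"
    by (rule sets_lebesgue_inner_closed[OF Al e2])
  have cK: "compact K" using K A bounded_subset compact_eq_bounded_closed by blast
  obtain d where d: "d > 0" "(\<Union>x\<in>K. ball x d) \<subseteq> U"
    using compact_subset_open_imp_ball_epsilon_subset[OF cK U(1)] K U by blast
  have mU: "U - A \<in> sets borel" "A - K \<in> sets borel" using A U K by auto
  have "emeasure lborel {y\<in>A. y + v \<notin> A} \<le> ennreal e" if v: "norm v < d" for v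
  proof -
    have "{y\<in>A. y + v \<notin> A} \<subseteq> (A - K) \<union> {y. y + v \<in> U - A}"
    proof
      fix y assume y: "y \<in> {y\<in>A. y + v \<notin> A}"
      show "y \<in> (A - K) \<union> {y. y + v \<in> U - A}"
      proof (cases "y \<in> K")
        case True
        then have "y + v \<in> U" using d(2) v by (force simp: dist_norm)
        then show ?thesis using y by auto
      qed (use y in auto)
    qed
    then have "emeasure lborel {y\<in>A. y + v \<notin> A} \<le> emeasure lborel ((A - K) \<union> {y. y + v \<in> U - A})"
      using mU(2) shift_sets_borel[OF mU(1), of v] by (intro emeasure_mono) (simp_all only: sets_lborel sets.Un)
    also have "\<dots> \<le> emeasure lborel (A - K) + emeasure lborel {y. y + v \<in> U - A}"
      using mU(2) shift_sets_borel[OF mU(1), of v] by (intro emeasure_subadditive) (simp_all only: sets_lborel)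
    also have "\<dots> = emeasure lborel (A - K) + emeasure lborel (U - A)"
      by (simp only: emeasure_lborel_shift[OF mU(1)])
    also have "\<dots> \<le> ennreal (e/2) + ennreal (e/2)"
      using U(3) K(3) mU by (intro add_mono) auto
    also have "\<dots> = ennreal e" using e by (simp add: ennreal_plus[symmetric] del: ennreal_plus)
    finally show ?thesis .
  qed
  then show ?thesis using d(1) by blast
qed

text \<open>Cutting A with the ball of radius R + 1 reduces to bounded sets: both y and y + v stay
  in it when v is short, so the cut does not affect their membership.\<close>

lemma translation_continuity:
  fixes A :: "'a::euclidean_space set"
  assumes A: "A \<in> sets borel" and e: "e > 0"
  shows "\<exists>d>0. \<forall>v. norm v < d \<longrightarrow> emeasure lborel {y\<in>cball 0 R. (y + v \<in> A) \<noteq> (y \<in> A)} \<le> ennreal e"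
proof -
  define C where "C = A \<inter> cball 0 (R + 1)"
  have C: "C \<in> sets borel" "bounded C" using A by (auto simp: C_def)
  obtain d where d: "d > 0" "\<And>v. norm v < d \<Longrightarrow> emeasure lborel {y\<in>C. y + v \<notin> C} \<le> ennreal (e/2)"
    using translation_continuity1[OF C, of "e/2"] e by auto
  have "emeasure lborel {y\<in>cball 0 R. (y + v \<in> A) \<noteq> (y \<in> A)} \<le> ennreal e" if v: "norm v < min d 1" for v
  proof -
    have m: "{y\<in>C. y + w \<notin> C} \<in> sets borel" for w
    proof -
      have "{y\<in>C. y + w \<notin> C} = C - {y. y + w \<in> C}" by auto
      then show ?thesis using C(1) shift_sets_borel[OF C(1), of w] by simp
    qed
    have "{y\<in>cball 0 R. (y + v \<in> A) \<noteq> (y \<in> A)} \<subseteq> {y\<in>C. y + v \<notin> C} \<union> {y. y + v \<in> {z\<in>C. z + (-v) \<notin> C}}"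
    proof
      fix y assume y: "y \<in> {y\<in>cball 0 R. (y + v \<in> A) \<noteq> (y \<in> A)}"
      have "norm (y + v) \<le> R + 1" using y v norm_triangle_ineq[of y v] by auto
      then have "y \<in> C \<longleftrightarrow> y \<in> A" "y + v \<in> C \<longleftrightarrow> y + v \<in> A" using y by (auto simp: C_def)
      then show "y \<in> {y\<in>C. y + v \<notin> C} \<union> {y. y + v \<in> {z\<in>C. z + (-v) \<notin> C}}" using y by auto
    qed
    then have "emeasure lborel {y\<in>cball 0 R. (y + v \<in> A) \<noteq> (y \<in> A)} \<le>
        emeasure lborel ({y\<in>C. y + v \<notin> C} \<union> {y. y + v \<in> {z\<in>C. z + (-v) \<notin> C}})"
      using m[of v] shift_sets_borel[OF m[of "-v"], of v]
      by (intro emeasure_mono) (simp_all only: sets_lborel sets.Un)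
    also have "\<dots> \<le> emeasure lborel {y\<in>C. y + v \<notin> C} + emeasure lborel {y. y + v \<in> {z\<in>C. z + (-v) \<notin> C}}"
      using m[of v] shift_sets_borel[OF m[of "-v"], of v]
      by (intro emeasure_subadditive) (simp_all only: sets_lborel)
    also have "\<dots> = emeasure lborel {y\<in>C. y + v \<notin> C} + emeasure lborel {z\<in>C. z + (-v) \<notin> C}"
      by (simp only: emeasure_lborel_shift[OF m])
    also have "\<dots> \<le> ennreal (e/2) + ennreal (e/2)" using d(2)[of v] d(2)[of "-v"] v by (intro add_mono) auto
    also have "\<dots> = ennreal e" using e by (simp add: ennreal_plus[symmetric] del: ennreal_plus)
    finally show ?thesis .
  qed
  then show ?thesis using d(1) by (intro exI[of _ "min d 1"]) auto
qed

definition period :: "'a::euclidean_space set \<Rightarrow> 'a \<Rightarrow> bool" where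
  "period A v \<longleftrightarrow> (AE y in lborel. y + v \<in> A \<longleftrightarrow> y \<in> A)"

lemma period_0 [simp]: "period A 0"
  by (simp add: period_def)

lemma period_diff:
  assumes "period A u" "period A v"
  shows "period A (u - v)"
proof -
  have "AE y in lborel. (y + (u - v) + v \<in> A \<longleftrightarrow> y + (u - v) \<in> A)"
    using AE_lborel_shift[OF assms(2)[unfolded period_def], of "u - v"] by simp
  with assms(1)[unfolded period_def] show ?thesis unfolding period_def
    by eventually_elim (simp add: algebra_simps)
qed

lemma period_of_int: "period A (u::'a::euclidean_space) \<Longrightarrow> period A (of_int n *\<^sub>R u)"
  using subgroup_scale_int[of "Collect (period A)" u n] period_diff by auto

text \<open>The periods form a closed group. If w is a period close to v, then failure of v at y is
  failure of the short translation w - v at y + v, which has small measure on balls.\<close>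

lemma period_limit:
  assumes A: "A \<in> sets borel" and lim: "\<And>d. d > 0 \<Longrightarrow> \<exists>w. norm (w - v) < d \<and> period A w"
  shows "period A v"
proof -
  have pm: "{y. y + u \<in> A} \<in> sets borel" for u by (rule shift_sets_borel[OF A])
  have m: "{y. (y + v \<in> A) \<noteq> (y \<in> A)} \<in> sets borel"
  proof -
    have "{y. (y + v \<in> A) \<noteq> (y \<in> A)} = ({y. y + v \<in> A} - A) \<union> (A - {y. y + v \<in> A})" by auto
    then show ?thesis using pm[of v] A by simp
  qed
  have "{y. (y + v \<in> A) \<noteq> (y \<in> A)} \<in> null_sets lborel"
  proof -
    have z: "{y\<in>cball 0 (real n). (y + v \<in> A) \<noteq> (y \<in> A)} \<in> null_sets lborel" for n
    proof -
      define X where "X = {y\<in>cball 0 (real n). (y + v \<in> A) \<noteq> (y \<in> A)}"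
      have X: "X \<in> sets borel" using m by (auto simp: X_def Collect_conj_eq)
      have le: "emeasure lborel X \<le> ennreal e" if e: "e > 0" for e
      proof -
        obtain d where d: "d > 0" "\<And>u. norm u < d \<Longrightarrow> emeasure lborel {y\<in>cball 0 (real n + norm v). (y + u \<in> A) \<noteq> (y \<in> A)} \<le> ennreal e"
          using translation_continuity[OF A e, of "real n + norm v"] by auto
        obtain w where w: "norm (w - v) < d" "period A w" using lim d(1) by blast
        define Y where "Y = {y\<in>cball 0 (real n + norm v). (y + (w - v) \<in> A) \<noteq> (y \<in> A)}"
        have Y: "Y \<in> sets borel"
        proof -
          have "Y = cball 0 (real n + norm v) \<inter> (({y. y + (w - v) \<in> A} - A) \<union> (A - {y. y + (w - v) \<in> A}))" by (auto simp: Y_def)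
          then show ?thesis using pm[of "w - v"] A by simp
        qed
        have "emeasure lborel X \<le> emeasure lborel {y. y + v \<in> Y}"
        proof (rule emeasure_mono_AE)
          show "AE y in lborel. y \<in> X \<longrightarrow> y \<in> {y. y + v \<in> Y}"
            using w(2)[unfolded period_def]
          proof eventually_elim
            case (elim y)
            have "norm (y + v) \<le> real n + norm v" if "norm y \<le> real n" using that norm_triangle_ineq[of y v] by linarith
            then show ?case using elim by (auto simp: X_def Y_def algebra_simps)
          qed
          show "{y. y + v \<in> Y} \<in> sets lborel" using shift_sets_borel[OF Y, of v] by simp
        qed
        also have "\<dots> = emeasure lborel Y" by (rule emeasure_lborel_shift[OF Y])
        also have "\<dots> \<le> ennreal e" unfolding Y_def by (rule d(2)[OF w(1)])
        finally show ?thesis .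
      qed
      have "emeasure lborel X \<le> 0"
      proof (rule ennreal_le_epsilon)
        fix e :: real assume "0 < e"
        then show "emeasure lborel X \<le> 0 + ennreal e" using le[of e] by simp
      qed
      then show ?thesis using X unfolding X_def[symmetric] by (intro null_setsI) auto
    qed
    have "{y. (y + v \<in> A) \<noteq> (y \<in> A)} = (\<Union>n. {y\<in>cball 0 (real n). (y + v \<in> A) \<noteq> (y \<in> A)})"
      using real_arch_simple by auto
    then show ?thesis using null_sets_UN'[of UNIV "\<lambda>n. {y\<in>cball 0 (real n). (y + v \<in> A) \<noteq> (y \<in> A)}"] z by simp
  qed
  then show ?thesis unfolding period_def by (intro AE_I'[of "{y. (y + v \<in> A) \<noteq> (y \<in> A)}"]) auto
qed

lemma AE_lborel_ex:
  assumes "AE y in (lborel :: 'a::euclidean_space measure). P y"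
  shows "\<exists>y. P y"
proof (rule ccontr)
  assume "\<nexists>y. P y"
  then have "AE y in (lborel :: 'a measure). False" using assms by simp
  then have "ae_filter (lborel :: 'a measure) = bot" by (simp add: trivial_limit_def)
  then show False by (simp add: ae_filter_eq_bot_iff)
qed

text \<open>Exchanging the quantifiers by Fubini yields one y that decides membership for almost
  every y + v.\<close>

lemma all_periods_trivial:
  fixes A :: "'a::euclidean_space set"
  assumes A: "A \<in> sets borel" and "\<And>v. period A v"
  shows "(AE y in lborel. y \<in> A) \<or> (AE y in lborel. y \<notin> A)"
proof -
  have "AE v in lborel. AE y in lborel. y + v \<in> A \<longleftrightarrow> y \<in> A" using assms(2) by (simp add: period_def)
  moreover have "{z \<in> space (lborel \<Otimes>\<^sub>M lborel). (snd z + fst z \<in> A) = (snd z \<in> A)} \<in> sets (lborel \<Otimes>\<^sub>M lborel)"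
    using A by measurable
  ultimately have "AE y in lborel. AE v in lborel. y + v \<in> A \<longleftrightarrow> y \<in> A"
    using lborel_pair.AE_commute[of "\<lambda>v y. (y + v \<in> A) = (y \<in> A)"] by simp
  from AE_lborel_ex[OF this] obtain y where y: "AE v in lborel. y + v \<in> A \<longleftrightarrow> y \<in> A" ..
  have "AE v in lborel. v \<in> A \<longleftrightarrow> y \<in> A" using AE_lborel_shift[OF y, of "- y"] by simp
  then show ?thesis by (cases "y \<in> A") auto
qed

section \<open>Periods of skew products\<close>

text \<open>1 and \<alpha> are periods and generate a dense group; the group of periods is closed,
  so every real number is a period.\<close>

lemma rotation_ergodic:
  fixes \<alpha> :: real
  assumes "\<alpha> \<notin> \<rat>" "Z \<in> sets borel" "\<And>x. x + 1 \<in> Z \<longleftrightarrow> x \<in> Z" "AE x in lborel. x + \<alpha> \<in> Z \<longleftrightarrow> x \<in> Z"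
  shows "(AE x in lborel. x \<in> Z) \<or> (AE x in lborel. x \<notin> Z)"
proof (rule all_periods_trivial[OF assms(2)])
  fix v
  have "period Z 1" using assms(3) by (simp add: period_def)
  moreover have "period Z \<alpha>" using assms(4) by (simp add: period_def)
  ultimately have *: "period Z (real_of_int k * \<alpha> - real_of_int h)" for k h
    using period_diff[OF period_of_int[of Z \<alpha> k] period_of_int[of Z 1 h]] by simp
  show "period Z v"
  proof (rule period_limit[OF assms(2)])
    fix d :: real assume "d > 0"
    then obtain k h where "\<bar>of_int k * \<alpha> - of_int h - v\<bar> < d"
      using sequence_of_fractional_parts_is_dense[OF assms(1)] by metis
    then show "\<exists>w. norm (w - v) < d \<and> period Z w" using * by (intro exI[of _ "of_int k * \<alpha> - of_int h"]) simp
  qed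
qed

section \<open>Null sets in the product of the line with the fibre\<close>

lemma fst_borel [measurable]: "fst \<in> borel_measurable (borel :: ('a::second_countable_topology \<times> 'b::second_countable_topology) measure)"
  and snd_borel [measurable]: "snd \<in> borel_measurable (borel :: ('a::second_countable_topology \<times> 'b::second_countable_topology) measure)"
  by (simp_all add: borel_measurable_continuous_onI continuous_on_fst continuous_on_snd)

lemma sets_lborel_pair: "sets (lborel \<Otimes>\<^sub>M lborel :: ('a::euclidean_space \<times> 'b::euclidean_space) measure) = sets borel"
  by (simp only: lborel_prod sets_lborel)

lemma AE_lborel_pair_iff:
  fixes P :: "'a::euclidean_space \<times> 'b::euclidean_space \<Rightarrow> bool"
  assumes "{z. P z} \<in> sets borel"
  shows "(AE z in lborel. P z) \<longleftrightarrow> (AE x in lborel. AE t in lborel. P (x, t))"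
proof -
  note s = sets_lborel_pair[where 'a='a and 'b='b]
  show ?thesis
  proof -
    have "{z \<in> space (lborel \<Otimes>\<^sub>M lborel). P (fst z, snd z)} \<in> sets (lborel \<Otimes>\<^sub>M lborel)"
      unfolding s using assms by (simp add: space_pair_measure)
    from lborel_pair.AE_pair_iff[OF this] show ?thesis by (simp only: lborel_prod prod.collapse)
  qed
qed

lemma AE_lborel_pairD:
  fixes P :: "'a::euclidean_space \<times> 'b::euclidean_space \<Rightarrow> bool"
  assumes "AE z in lborel. P z"
  shows "AE x in lborel. AE t in lborel. P (x, t)"
proof -
  have "AE z in lborel \<Otimes>\<^sub>M lborel. P z" using assms by (simp only: lborel_prod)
  then show ?thesis by (rule lborel_pair.AE_pair)
qed

lemma AE_lborel_commute:
  fixes P :: "'a::euclidean_space \<Rightarrow> 'b::euclidean_space \<Rightarrow> bool"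
  assumes "{z. P (fst z) (snd z)} \<in> sets borel"
  shows "(AE x in lborel. AE t in lborel. P x t) \<longleftrightarrow> (AE t in lborel. AE x in lborel. P x t)"
proof -
  note s = sets_lborel_pair[where 'a='a and 'b='b]
  have "{z \<in> space (lborel \<Otimes>\<^sub>M lborel). P (fst z) (snd z)} \<in> sets (lborel \<Otimes>\<^sub>M lborel)"
    unfolding s using assms by (simp add: space_pair_measure)
  then show ?thesis by (rule lborel_pair.AE_commute)
qed

lemma AE_lborel_fst:
  assumes "AE x in lborel. P x"
  shows "AE z in (lborel :: ('a::euclidean_space \<times> 'b::euclidean_space) measure). P (fst z)"
proof -
  obtain N where N: "N \<in> null_sets lborel" "{x. \<not> P x} \<subseteq> N"
    using assms by (auto simp: eventually_ae_filter)
  have [measurable]: "N \<in> sets borel" using N by auto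
  have "AE x in lborel. AE t in (lborel :: 'b measure). x \<notin> N"
    using AE_not_in[OF N(1)] by eventually_elim simp
  then have "AE z in (lborel :: ('a \<times> 'b) measure). fst z \<notin> N"
    by (subst AE_lborel_pair_iff) (auto)
  then show ?thesis by eventually_elim (use N(2) in auto)
qed

lemma skew_borel:
  fixes g :: "'a::euclidean_space \<Rightarrow> 'v::euclidean_space"
  assumes [measurable]: "g \<in> borel_measurable borel"
  shows "(\<lambda>z. (fst z + a, snd z + g (fst z))) \<in> borel_measurable borel"
  by (intro borel_measurable_Pair) auto

text \<open>The map translates the base and then every fibre, so Fubini keeps null sets
  null.\<close>

lemma AE_skew:
  fixes g :: "'a::euclidean_space \<Rightarrow> 'v::euclidean_space"
  assumes g: "g \<in> borel_measurable borel" and ae: "AE z in lborel. P z"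
  shows "AE z in lborel. P (fst z + a, snd z + g (fst z))"
proof -
  obtain N where N: "N \<in> null_sets lborel" "{x. \<not> P x} \<subseteq> N"
    using ae by (auto simp: eventually_ae_filter)
  have "AE z in lborel. z \<notin> N" using N by (rule_tac AE_not_in)
  then have "AE x in lborel. AE t in lborel. (x, t) \<notin> N" by (rule AE_lborel_pairD)
  then have "AE x in lborel. AE t in lborel. (x + a, t) \<notin> N" by (rule AE_lborel_shift)
  then have "AE x in lborel. AE t in lborel. (x + a, t + g x) \<notin> N"
    by eventually_elim (rule AE_lborel_shift)
  moreover have "{z. (fst z + a, snd z + g (fst z)) \<notin> N} \<in> sets borel"
    using measurable_sets_borel[OF skew_borel[OF g], of "- N" a] N(1) by (auto simp: vimage_def)
  ultimately have "AE z in lborel. (fst z + a, snd z + g (fst z)) \<notin> N"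
    by (subst AE_lborel_pair_iff) auto
  then show ?thesis by eventually_elim (use N(2) in auto)
qed

text \<open>Functions on the circle are lifted to periodic functions on the line, so that
  composition with the rotation involves no \<open>frac\<close>.\<close>

definition circle_fun :: "(real \<Rightarrow> 'v::euclidean_space) \<Rightarrow> bool" where
  "circle_fun g \<longleftrightarrow> g \<in> borel_measurable borel \<and> (\<forall>x. g (x + 1) = g x)"

text \<open>Invariance holds only almost everywhere, so that slices of invariant sets, which are
  invariant up to null sets, belong to the same class.\<close>

definition skew_inv :: "real \<Rightarrow> (real \<Rightarrow> 'v::euclidean_space) \<Rightarrow> (real \<times> 'v) set \<Rightarrow> bool" where
  "skew_inv \<alpha> g A \<longleftrightarrow> A \<in> sets borel \<and> (\<forall>x t. (x + 1, t) \<in> A \<longleftrightarrow> (x, t) \<in> A) \<and>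
     (AE z in lborel. (fst z + \<alpha>, snd z + g (fst z)) \<in> A \<longleftrightarrow> z \<in> A)"

text \<open>These are the finite essential values of the cocycle, described through invariant
  sets.\<close>

definition PER :: "real \<Rightarrow> (real \<Rightarrow> 'v::euclidean_space) \<Rightarrow> 'v set" where
  "PER \<alpha> g = {e. \<forall>A. skew_inv \<alpha> g A \<longrightarrow> period A (0, e)}"

text \<open>The Birkhoff sum along the lifted orbit, which is not reduced modulo 1.\<close>

definition bs :: "real \<Rightarrow> (real \<Rightarrow> 'v::real_vector) \<Rightarrow> nat \<Rightarrow> real \<Rightarrow> 'v" where
  "bs \<alpha> g N x = (\<Sum>k<N. g (x + real k * \<alpha>))"

lemma PER_0 [simp]: "0 \<in> PER \<alpha> g"
  using period_0 by (simp add: PER_def zero_prod_def[symmetric])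

lemma PER_diff: "u \<in> PER \<alpha> g \<Longrightarrow> v \<in> PER \<alpha> g \<Longrightarrow> u - v \<in> PER \<alpha> g"
  using period_diff[of _ "(0, u)" "(0, v)"] by (auto simp: PER_def)

lemma bs_add: "bs \<alpha> g (M + N) x = bs \<alpha> g M x + bs \<alpha> g N (x + real M * \<alpha>)"
  by (induction N) (simp_all add: bs_def algebra_simps)

lemma bs_Suc: "bs \<alpha> g (Suc N) x = bs \<alpha> g N x + g (x + real N * \<alpha>)"
  by (simp add: bs_def)

lemma bs_borel [measurable (raw)]:
  fixes g :: "real \<Rightarrow> 'v::euclidean_space"
  assumes [measurable]: "g \<in> borel_measurable borel"
  shows "bs \<alpha> g N \<in> borel_measurable borel"
  unfolding bs_def by measurable

lemma bs_periodic: "(\<And>x. g (x + 1) = g x) \<Longrightarrow> bs \<alpha> g N (x + 1) = bs \<alpha> g N x"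
  unfolding bs_def by (metis (no_types, lifting) add.assoc add.commute)

lemma skew_inv_iterate:
  fixes g :: "real \<Rightarrow> 'v::euclidean_space"
  assumes A: "skew_inv \<alpha> g A" and g: "g \<in> borel_measurable borel"
  shows "AE z in lborel. (fst z + real N * \<alpha>, snd z + bs \<alpha> g N (fst z)) \<in> A \<longleftrightarrow> z \<in> A"
proof (induction N)
  case 0
  then show ?case by (simp add: bs_def)
next
  case (Suc N)
  have "AE z in lborel. (fst z + \<alpha>, snd z + g (fst z)) \<in> A \<longleftrightarrow> z \<in> A"
    using A by (simp add: skew_inv_def)
  from AE_skew[OF bs_borel[OF g] this, of "real N * \<alpha>" \<alpha> N] Suc
  show ?case by eventually_elim (simp add: bs_Suc algebra_simps)
qed

lemma measurable_section_measure:
  fixes D :: "('a::euclidean_space \<times> 'v::euclidean_space) set"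
  assumes "D \<in> sets borel"
  shows "(\<lambda>x. emeasure lborel {t. (x, t) \<in> D}) \<in> borel_measurable borel"
proof -
  have "D \<in> sets (lborel \<Otimes>\<^sub>M lborel)" using assms by (simp only: sets_lborel_pair)
  from lborel.measurable_emeasure_Pair[OF this] show ?thesis by (simp add: vimage_def)
qed

lemma emeasure_lborel_pair:
  fixes D :: "('a::euclidean_space \<times> 'v::euclidean_space) set"
  assumes "D \<in> sets borel"
  shows "emeasure lborel D = (\<integral>\<^sup>+x. emeasure lborel {t. (x, t) \<in> D} \<partial>lborel)"
proof -
  have "D \<in> sets (lborel \<Otimes>\<^sub>M lborel)" using assms by (simp only: sets_lborel_pair)
  from lborel.emeasure_pair_measure_alt[OF this] show ?thesis by (simp add: vimage_def lborel_prod)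
qed

lemma AE_section_iff:
  fixes D :: "('a::euclidean_space \<times> 'v::euclidean_space) set"
  assumes "D \<in> sets borel"
  shows "(AE t in lborel. (x, t) \<notin> D) \<longleftrightarrow> emeasure lborel {t. (x, t) \<in> D} = 0"
proof -
  have "Pair x -` D \<in> sets borel"
    using assms measurable_sets_borel[of "Pair x" borel D] by (auto intro!: borel_measurable_Pair)
  then show ?thesis by (subst AE_iff_measurable[OF _ refl]) (auto simp: vimage_def)
qed

text \<open>If the period \<open>q0\<close> failed, it would fail on the fibre over almost every \<open>x\<close>, by ergodicity of the
  rotation, hence on fibres over most of every \<open>X n\<close>; there, however, the invariance under the
  \<open>N n\<close>-th iterate and continuity of translations make the failure negligible.\<close>

lemma PER_limit:
  fixes g :: "real \<Rightarrow> 'v::euclidean_space" and p :: "nat \<Rightarrow> int"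
  assumes irr: "\<alpha> \<notin> \<rat>" and g: "circle_fun g" and E0: "countable E0" "E0 \<subseteq> PER \<alpha> g"
    and X: "\<And>n. X n \<in> sets circle" "\<And>n. measure circle (X n) \<ge> \<epsilon>" "\<epsilon> > 0"
    and b: "\<And>n x. x \<in> X n \<Longrightarrow> bs \<alpha> g (N n) x - q n \<in> E0"
    and \<theta>: "(\<lambda>n. real (N n) * \<alpha> - of_int (p n)) \<longlonglongrightarrow> 0" and q: "q \<longlonglongrightarrow> q0"
  shows "q0 \<in> PER \<alpha> g"
  unfolding PER_def
proof (intro CollectI allI impI)
  fix A assume A: "skew_inv \<alpha> g A"
  then have [measurable]: "A \<in> sets borel" and per: "\<And>x t. (x + 1, t) \<in> A \<longleftrightarrow> (x, t) \<in> A"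
    and inv: "AE z in lborel. (fst z + \<alpha>, snd z + g (fst z)) \<in> A \<longleftrightarrow> z \<in> A"
    by (auto simp: skew_inv_def)
  have gm [measurable]: "g \<in> borel_measurable borel" and gper: "\<And>x. g (x + 1) = g x" using g by (auto simp: circle_fun_def)
  define D where "D = {z. (z + (0, q0) \<in> A) \<noteq> (z \<in> A)}"
  have D [measurable]: "D \<in> sets borel" unfolding D_def by measurable
  \<comment> \<open>Base points over which \<open>q0\<close> fails on positive fibre measure. This
    set is invariant under the rotation, hence null or conull.\<close>
  define Z where "Z = {x. emeasure lborel {t. (x, t) \<in> D} \<noteq> 0}"
  have Z [measurable]: "Z \<in> sets borel" unfolding Z_def using measurable_section_measure[OF D] by measurable
  have Zper: "x + 1 \<in> Z \<longleftrightarrow> x \<in> Z" for x by (simp add: Z_def D_def per)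
  have Ziff: "x \<notin> Z \<longleftrightarrow> (AE t in lborel. (x, t + q0) \<in> A \<longleftrightarrow> (x, t) \<in> A)" for x
    using AE_section_iff[OF D, of x] by (simp add: Z_def D_def)
  have "AE x in lborel. x + \<alpha> \<in> Z \<longleftrightarrow> x \<in> Z"
    using AE_lborel_pairD[OF inv]
  proof eventually_elim
    fix x assume h: "AE t in lborel. (fst (x, t) + \<alpha>, snd (x, t) + g (fst (x, t))) \<in> A \<longleftrightarrow> (x, t) \<in> A"
    then have h1: "AE t in lborel. (x + \<alpha>, t + g x) \<in> A \<longleftrightarrow> (x, t) \<in> A" by simp
    from AE_lborel_shift[OF h1, of q0] have h2: "AE t in lborel. (x + \<alpha>, t + q0 + g x) \<in> A \<longleftrightarrow> (x, t + q0) \<in> A" .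
    have "(AE t in lborel. (x, t + q0) \<in> A \<longleftrightarrow> (x, t) \<in> A) \<longleftrightarrow>
       (AE t in lborel. (x + \<alpha>, t + g x + q0) \<in> A \<longleftrightarrow> (x + \<alpha>, t + g x) \<in> A)"
    proof
      assume "AE t in lborel. (x, t + q0) \<in> A \<longleftrightarrow> (x, t) \<in> A"
      with h1 h2 show "AE t in lborel. (x + \<alpha>, t + g x + q0) \<in> A \<longleftrightarrow> (x + \<alpha>, t + g x) \<in> A"
        by eventually_elim (simp add: add_ac)
    next
      assume "AE t in lborel. (x + \<alpha>, t + g x + q0) \<in> A \<longleftrightarrow> (x + \<alpha>, t + g x) \<in> A"
      with h1 h2 show "AE t in lborel. (x, t + q0) \<in> A \<longleftrightarrow> (x, t) \<in> A"
        by eventually_elim (simp add: add_ac)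
    qed
    also have "\<dots> \<longleftrightarrow> (AE t in lborel. (x + \<alpha>, t + q0) \<in> A \<longleftrightarrow> (x + \<alpha>, t) \<in> A)"
    proof
      assume "AE t in lborel. (x + \<alpha>, t + g x + q0) \<in> A \<longleftrightarrow> (x + \<alpha>, t + g x) \<in> A"
      from AE_lborel_shift[OF this, of "- g x"] show "AE t in lborel. (x + \<alpha>, t + q0) \<in> A \<longleftrightarrow> (x + \<alpha>, t) \<in> A" by simp
    next
      assume "AE t in lborel. (x + \<alpha>, t + q0) \<in> A \<longleftrightarrow> (x + \<alpha>, t) \<in> A"
      from AE_lborel_shift[OF this, of "g x"] show "AE t in lborel. (x + \<alpha>, t + g x + q0) \<in> A \<longleftrightarrow> (x + \<alpha>, t + g x) \<in> A" by simp
    qed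
    finally show "x + \<alpha> \<in> Z \<longleftrightarrow> x \<in> Z" using Ziff by blast
  qed
  from rotation_ergodic[OF irr Z Zper this] show "period A (0, q0)"
  proof
    assume "AE x in lborel. x \<notin> Z"
    then have "AE x in lborel. AE t in lborel. (x, t) \<notin> D"
      by eventually_elim (use AE_section_iff[OF D] in \<open>simp add: Z_def\<close>)
    then have "AE z in lborel. z \<notin> D" by (subst AE_lborel_pair_iff) auto
    then show ?thesis by (simp add: period_def D_def)
  next
    assume AEZ: "AE x in lborel. x \<in> Z"
    define h where "h m x = emeasure lborel {t. (x, t) \<in> D \<inter> UNIV \<times> cball 0 (real m)}" for m x
    have Dm: "D \<inter> UNIV \<times> cball 0 (real m) \<in> sets borel" for m
      using borel_closed[OF closed_Times[OF closed_UNIV closed_cball]] by (intro sets.Int D)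
    have hm [measurable]: "h m \<in> borel_measurable borel" for m
      unfolding h_def by (rule measurable_section_measure[OF Dm])
    \<comment> \<open>A single index is both radius and threshold, so \<open>Y m\<close> increases
      to \<open>Z\<close>; one m makes the failure quantitative on all but \<epsilon>/2 of the
      circle, hence on a part of measure \<epsilon>/2 of every \<open>X n\<close>.\<close>
    define Y where "Y m = {x \<in> {0..<1}. ennreal (1 / Suc m) < h m x}" for m
    have Ym: "Y m \<in> sets circle" for m unfolding Y_def by (intro Collect_circle_sets) measurable
    have hmono: "h m x \<le> h n x" if "m \<le> n" for m n x
    proof -
      have "{t. (x, t) \<in> D \<inter> UNIV \<times> cball 0 (real n)} \<in> sets borel"
        using measurable_sets_borel[of "Pair x" borel, OF _ Dm[of n]] by (simp add: vimage_def borel_measurable_Pair)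
      then show ?thesis unfolding h_def using that by (intro emeasure_mono) auto
    qed
    have Yinc: "incseq Y"
    proof (rule incseq_SucI, rule subsetI)
      fix m x assume "x \<in> Y m"
      then have "x \<in> {0..<1}" "ennreal (1 / Suc m) < h m x" by (simp_all add: Y_def)
      have "ennreal (1 / Suc (Suc m)) \<le> ennreal (1 / Suc m)" by (intro ennreal_leI) (simp add: field_simps)
      also have "\<dots> < h m x" by fact
      also have "\<dots> \<le> h (Suc m) x" by (rule hmono) simp
      finally show "x \<in> Y (Suc m)" using \<open>x \<in> {0..<1}\<close> by (simp add: Y_def)
    qed
    have YU: "(\<Union>m. Y m) = Z \<inter> {0..<1}"
    proof (intro set_eqI iffI)
      fix x assume "x \<in> Z \<inter> {0..<1}"
      then have x: "emeasure lborel {t. (x, t) \<in> D} > 0" "x \<in> {0..<1}" by (auto simp: Z_def zero_less_iff_neq_zero)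
      have "(SUP m. h m x) = emeasure lborel (\<Union>m. {t. (x, t) \<in> D \<inter> UNIV \<times> cball 0 (real m)})"
        unfolding h_def
      proof (rule SUP_emeasure_incseq)
        show "range (\<lambda>m. {t. (x, t) \<in> D \<inter> UNIV \<times> cball 0 (real m)}) \<subseteq> sets lborel"
          using measurable_sets_borel[of "Pair x" borel, OF _ Dm] by (auto simp: vimage_def borel_measurable_Pair)
        show "incseq (\<lambda>m. {t. (x, t) \<in> D \<inter> UNIV \<times> cball 0 (real m)})" by (auto simp: incseq_def)
      qed
      also have "(\<Union>m. {t. (x, t) \<in> D \<inter> UNIV \<times> cball 0 (real m)}) = {t. (x, t) \<in> D}"
        using real_arch_simple by auto
      finally obtain m where m: "h m x > 0" using x(1) by (metis less_SUP_iff)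
      obtain k where k: "ennreal (1 / Suc k) < h m x"
      proof (cases "h m x = \<infinity>")
        case True
        then show ?thesis using that[of 0] by (simp add: ennreal_less_top)
      next
        case False
        then have pos: "enn2real (h m x) > 0" using m by (simp add: enn2real_positive_iff less_top)
        then obtain k where "inverse (real (Suc k)) < enn2real (h m x)" using reals_Archimedean by blast
        then have "ennreal (1 / Suc k) < ennreal (enn2real (h m x))" using pos by (intro ennreal_lessI) (auto simp: inverse_eq_divide)
        then show ?thesis using that False by (simp add: less_top)
      qed
      have "ennreal (1 / Suc (max m k)) \<le> ennreal (1 / Suc k)" by (intro ennreal_leI) (simp add: field_simps)
      also note k
      also have "h m x \<le> h (max m k) x" by (rule hmono) simp
      finally show "x \<in> (\<Union>m. Y m)" using x(2) by (auto simp: Y_def)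
    next
      fix x assume "x \<in> (\<Union>m. Y m)"
      then obtain m where m: "x \<in> {0..<1}" "ennreal (1 / Suc m) < h m x" by (auto simp: Y_def)
      have "Pair x -` D \<in> sets borel" using measurable_sets_borel[of "Pair x" borel D] D by (simp add: borel_measurable_Pair)
      then have "h m x \<le> emeasure lborel {t. (x, t) \<in> D}" unfolding h_def by (intro emeasure_mono) (auto simp: vimage_def)
      then show "x \<in> Z \<inter> {0..<1}" using m by (auto simp: Z_def)
    qed
    have "AE x in circle. x \<in> Z" using AEZ by (subst AE_circle_lborel) (simp_all add: Zper)
    then have "measure circle (Z \<inter> {0..<1}) = measure circle {0..<1}"
      by (intro measure_eq_AE) (auto simp: sets_circle)
    then have one: "measure circle (Z \<inter> {0..<1}) = 1" by simp
    have "(\<lambda>m. measure circle (Y m)) \<longlonglongrightarrow> measure circle (\<Union>m. Y m)"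
      using Ym by (intro circle.finite_Lim_measure_incseq Yinc) auto
    then have "(\<lambda>m. measure circle (Y m)) \<longlonglongrightarrow> 1" by (simp add: YU one)
    then have "eventually (\<lambda>m. measure circle (Y m) > 1 - \<epsilon> / 2) sequentially"
      using X(3) by (intro order_tendstoD) auto
    then obtain m where m: "measure circle (Y m) > 1 - \<epsilon> / 2" by (auto simp: eventually_sequentially)
    define c0 where "c0 = (1 / Suc m) * (\<epsilon> / 2)"
    have c0: "c0 > 0" using X(3) by (simp add: c0_def)
    define R where "R = real m + norm q0 + 3"
    obtain d where d: "d > 0" "\<And>v. norm v < d \<Longrightarrow> emeasure lborel {y\<in>cball 0 R. (y + v \<in> A) \<noteq> (y \<in> A)} \<le> ennreal (c0/3)"
      using translation_continuity[of A "c0/3" R] c0 by auto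
    have "eventually (\<lambda>n. norm (real (N n) * \<alpha> - of_int (p n)) < d) sequentially"
      using tendstoD[OF \<theta> d(1)] by (simp add: dist_norm)
    moreover have "eventually (\<lambda>n. norm (q n - q0) < min d 1) sequentially"
      using tendstoD[OF q, of "min d 1"] d(1) by (simp add: dist_norm)
    ultimately have "eventually (\<lambda>n. norm (real (N n) * \<alpha> - of_int (p n)) < d \<and> norm (q n - q0) < min d 1) sequentially"
      by (rule eventually_conj)
    then obtain n where n: "norm (real (N n) * \<alpha> - of_int (p n)) < d" "norm (q n - q0) < d" "norm (q n - q0) < 1"
      by (auto simp: eventually_sequentially)
    define \<theta>n where "\<theta>n = real (N n) * \<alpha> - of_int (p n)"
    define W where "W v = {y\<in>cball 0 R. (y + v \<in> A) \<noteq> (y \<in> A)}" for v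
    have W [measurable]: "W v \<in> sets borel" for v unfolding W_def by measurable
    define Dn where "Dn = {z. fst z \<in> X n \<and> z \<in> D \<inter> UNIV \<times> cball 0 (real m)}"
    have Xb [measurable]: "X n \<in> sets borel" and X01: "X n \<subseteq> {0..<1}" using X(1)[of n] by (auto simp: sets_circle)
    have Dn: "Dn \<in> sets borel"
    proof -
      have "Dn = (fst -` X n) \<inter> (D \<inter> UNIV \<times> cball 0 (real m))" by (auto simp: Dn_def)
      moreover have "(fst -` X n :: (real \<times> 'v) set) \<in> sets borel" by (rule measurable_sets_borel[OF fst_borel Xb])
      ultimately show ?thesis using Dm by auto
    qed
    have "ennreal c0 \<le> emeasure lborel Dn"
    proof -
      have XY: "measure circle (X n \<inter> Y m) \<ge> \<epsilon> / 2"
      proof -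
        have "measure circle (X n) + measure circle (Y m) = measure circle (X n \<union> Y m) + measure circle (X n \<inter> Y m)"
          using X(1) Ym by (subst measure_Un3) (auto simp: circle.fmeasurable_eq_sets)
        moreover have "measure circle (X n \<union> Y m) \<le> measure circle {0..<1}"
          using X01 by (intro circle.finite_measure_mono) (auto simp: Y_def sets_circle)
        ultimately show ?thesis using m X(2)[of n] by simp
      qed
      have XYb: "X n \<inter> Y m \<in> sets borel" "X n \<inter> Y m \<subseteq> {0..<1}" using Ym[of m] by (auto simp: sets_circle)
      have "ennreal c0 \<le> ennreal (1 / Suc m) * ennreal (measure circle (X n \<inter> Y m))"
      proof -
        have "c0 \<le> (1 / Suc m) * measure circle (X n \<inter> Y m)"
          unfolding c0_def using XY by (intro mult_left_mono) auto
        then have "ennreal c0 \<le> ennreal ((1 / Suc m) * measure circle (X n \<inter> Y m))" by (rule ennreal_leI)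
        also have "\<dots> = ennreal (1 / Suc m) * ennreal (measure circle (X n \<inter> Y m))" by (rule ennreal_mult) auto
        finally show ?thesis .
      qed
      also have "ennreal (measure circle (X n \<inter> Y m)) = emeasure lborel (X n \<inter> Y m)"
        using XYb by (simp add: circle.emeasure_eq_measure[symmetric] emeasure_circle)
      also have "ennreal (1 / Suc m) * emeasure lborel (X n \<inter> Y m) = (\<integral>\<^sup>+x. ennreal (1 / Suc m) * indicator (X n \<inter> Y m) x \<partial>lborel)"
        using XYb by (simp add: nn_integral_cmult_indicator)
      also have "\<dots> \<le> (\<integral>\<^sup>+x. emeasure lborel {t. (x, t) \<in> Dn} \<partial>lborel)"
      proof (rule nn_integral_mono)
        fix x show "ennreal (1 / Suc m) * indicator (X n \<inter> Y m) x \<le> emeasure lborel {t. (x, t) \<in> Dn}"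
        proof (cases "x \<in> X n \<inter> Y m")
          case True
          then have "emeasure lborel {t. (x, t) \<in> Dn} = h m x" by (simp add: Dn_def h_def)
          then show ?thesis using True by (simp add: Y_def less_imp_le)
        qed simp
      qed
      also have "\<dots> = emeasure lborel Dn" by (rule emeasure_lborel_pair[OF Dn, symmetric])
      finally show ?thesis .
    qed
    also have "emeasure lborel Dn \<le> emeasure lborel ({z. z + (0, q0) \<in> W (0, q n - q0)} \<union> {z. z + (0, q n) \<in> W (\<theta>n, 0)})"
    proof (rule emeasure_mono_AE)
      show "{z. z + (0, q0) \<in> W (0, q n - q0)} \<union> {z. z + (0, q n) \<in> W (\<theta>n, 0)} \<in> sets lborel"
        using shift_sets_borel[OF W] by simp
      have "AE z in lborel. (fst z + real (N n) * \<alpha>, snd z + bs \<alpha> g (N n) (fst z)) \<in> A \<longleftrightarrow> z \<in> A"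
        by (rule skew_inv_iterate[OF A gm])
      \<comment> \<open>The element of \<open>E0\<close> to be used varies with the point, so all of
        them must be good off one null set. This is where countability enters.\<close>
      moreover have "AE z in lborel. \<forall>e\<in>E0. z + (\<theta>n, q n) + (0, e) \<in> A \<longleftrightarrow> z + (\<theta>n, q n) \<in> A"
      proof -
        have "AE z in lborel. \<forall>e\<in>E0. z + (0, e) \<in> A \<longleftrightarrow> z \<in> A"
          using E0 A by (subst AE_ball_countable) (auto simp: PER_def period_def)
        from AE_lborel_shift[OF this, of "(\<theta>n, q n)"] show ?thesis .
      qed
      ultimately show "AE z in lborel. z \<in> Dn \<longrightarrow> z \<in> {z. z + (0, q0) \<in> W (0, q n - q0)} \<union> {z. z + (0, q n) \<in> W (\<theta>n, 0)}"
      proof eventually_elim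
        case (elim z)
        obtain x t where z: "z = (x, t)" by (cases z)
        show ?case
        proof
          assume "z \<in> Dn"
          then have xt: "x \<in> X n" "((x, t + q0) \<in> A) \<noteq> ((x, t) \<in> A)" "norm t \<le> real m"
            by (auto simp: Dn_def D_def z)
          have x01: "\<bar>x\<bar> \<le> 1" using xt(1) X01 by auto
          have e: "bs \<alpha> g (N n) x - q n \<in> E0" using b xt(1) by blast
          have "(x, t) \<in> A \<longleftrightarrow> (x + real (N n) * \<alpha>, t + bs \<alpha> g (N n) x) \<in> A" using elim(1) by (simp add: z)
          also have "\<dots> \<longleftrightarrow> (x + \<theta>n, t + q n + (bs \<alpha> g (N n) x - q n)) \<in> A"
            using periodic_add_int[of "\<lambda>x. (x, t + bs \<alpha> g (N n) x') \<in> A" "x + \<theta>n" "p n" for x'] per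
              periodic_add_int[of "\<lambda>y. (y, t + bs \<alpha> g (N n) x) \<in> A" "x + \<theta>n" "p n"] by (simp add: \<theta>n_def algebra_simps)
          also have "\<dots> \<longleftrightarrow> (x + \<theta>n, t + q n) \<in> A" using elim(2) e by (force simp: z)
          \<comment> \<open>Replacing \<open>q0\<close> by \<open>q n\<close> and then moving the
            base by \<open>\<theta>n\<close> are two small translations, one of which must change
            membership. Each does so on measure at most c0/3, and 2 c0/3 is less than c0.\<close>
          finally have "((x, t + q0) \<in> A) \<noteq> ((x, t + q n) \<in> A) \<or> ((x, t + q n) \<in> A) \<noteq> ((x + \<theta>n, t + q n) \<in> A)"
            using xt(2) by blast
          moreover have "norm (x, t + q0) \<le> R"
            using norm_Pair_le[of x "t + q0"] norm_triangle_ineq[of t q0] x01 xt(3) by (simp add: R_def)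
          moreover have "norm (q n) \<le> norm q0 + 1" using n(3) norm_triangle_ineq[of "q n - q0" q0] by simp
          then have "norm (x, t + q n) \<le> R"
            using norm_Pair_le[of x "t + q n"] norm_triangle_ineq[of t "q n"] x01 xt(3) by (simp add: R_def)
          ultimately show "z \<in> {z. z + (0, q0) \<in> W (0, q n - q0)} \<union> {z. z + (0, q n) \<in> W (\<theta>n, 0)}"
            by (auto simp: W_def z)
        qed
      qed
    qed
    also have "\<dots> \<le> emeasure lborel {z. z + (0, q0) \<in> W (0, q n - q0)} + emeasure lborel {z. z + (0, q n) \<in> W (\<theta>n, 0)}"
      using shift_sets_borel[OF W] by (intro emeasure_subadditive) auto
    also have "\<dots> = emeasure lborel (W (0, q n - q0)) + emeasure lborel (W (\<theta>n, 0))"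
      by (simp only: emeasure_lborel_shift[OF W])
    also have "\<dots> \<le> ennreal (c0/3) + ennreal (c0/3)"
      unfolding W_def using n by (intro add_mono d(2)) (auto simp: \<theta>n_def norm_Pair)
    also have "\<dots> = ennreal (2 * c0 / 3)" using c0 by (simp add: ennreal_plus[symmetric] del: ennreal_plus)
    finally show ?thesis using c0 by (simp add: ennreal_le_iff)
  qed
qed

text \<open>The shear by f conjugates the two skew products and commutes with translations of the
  fibre.\<close>

lemma PER_cohomologous:
  fixes g :: "real \<Rightarrow> 'v::euclidean_space"
  assumes f: "circle_fun f" and ae: "AE x in lborel. g' x = g x - f x + f (x + \<alpha>)"
  shows "PER \<alpha> g \<subseteq> PER \<alpha> g'"
proof
  fix e assume e: "e \<in> PER \<alpha> g"
  have fm [measurable]: "f \<in> borel_measurable borel" and fper: "\<And>x. f (x + 1) = f x" using f by (auto simp: circle_fun_def)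
  show "e \<in> PER \<alpha> g'" unfolding PER_def
  proof (intro CollectI allI impI)
    fix A assume A: "skew_inv \<alpha> g' A"
    define A' where "A' = {z. (fst z + 0, snd z + f (fst z)) \<in> A}"
    have Am: "A \<in> sets borel" and inv: "AE z in lborel. (fst z + \<alpha>, snd z + g' (fst z)) \<in> A \<longleftrightarrow> z \<in> A"
      using A by (auto simp: skew_inv_def)
    have "skew_inv \<alpha> g A'"
      unfolding skew_inv_def
    proof (intro conjI allI)
      show "A' \<in> sets borel" using measurable_sets_borel[OF skew_borel[OF fm], OF Am, of 0] by (simp add: A'_def vimage_def)
      show "((x + 1, t) \<in> A') = ((x, t) \<in> A')" for x t using A by (simp add: A'_def fper skew_inv_def)
      show "AE z in lborel. (fst z + \<alpha>, snd z + g (fst z)) \<in> A' \<longleftrightarrow> z \<in> A'"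
        using AE_skew[OF fm inv, of 0] AE_lborel_fst[OF ae]
        by eventually_elim (simp add: A'_def algebra_simps)
    qed
    then have "AE z in lborel. z + (0, e) \<in> A' \<longleftrightarrow> z \<in> A'" using e by (auto simp: PER_def period_def)
    have "(\<lambda>x. - f x) \<in> borel_measurable borel" by measurable
    from AE_skew[OF this \<open>AE z in lborel. z + (0, e) \<in> A' \<longleftrightarrow> z \<in> A'\<close>, of 0] show "period A (0, e)"
      unfolding period_def by eventually_elim (simp add: A'_def case_prod_beta' plus_prod_def)
  qed
qed

text \<open>If L is not surjective, preimages of null sets under L need not be null. The set is
  therefore pulled back along t \<mapsto> L t + c for almost every c, and Fubini in c recovers the
  statement.\<close>

lemma PER_linear:
  fixes g :: "real \<Rightarrow> 'v::euclidean_space" and L :: "'v \<Rightarrow> 'w::euclidean_space"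
  assumes L: "linear L" and e: "e \<in> PER \<alpha> g" and gm [measurable]: "g \<in> borel_measurable borel"
  shows "L e \<in> PER \<alpha> (\<lambda>x. L (g x))"
  unfolding PER_def
proof (intro CollectI allI impI)
  fix A assume A: "skew_inv \<alpha> (\<lambda>x. L (g x)) A"
  have Lm [measurable]: "L \<in> borel_measurable borel"
    using L by (intro borel_measurable_continuous_onI linear_continuous_on linear_conv_bounded_linear[THEN iffD1])
  have Am [measurable]: "A \<in> sets borel" and inv: "AE z in lborel. (fst z + \<alpha>, snd z + L (g (fst z))) \<in> A \<longleftrightarrow> z \<in> A"
    and per: "\<And>x t. (x + 1, t) \<in> A \<longleftrightarrow> (x, t) \<in> A"
    using A by (auto simp: skew_inv_def)
  define B where "B c = {z. (fst z, L (snd z) + c) \<in> A}" for c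
  have Bm: "B c \<in> sets borel" for c unfolding B_def by measurable
  have "AE x in lborel. AE t in lborel. AE c in lborel. (x + \<alpha>, L t + c + L (g x)) \<in> A \<longleftrightarrow> (x, L t + c) \<in> A"
    using AE_lborel_pairD[OF inv]
  proof eventually_elim
    case (elim x)
    have "AE c in lborel. (x + \<alpha>, L t + c + L (g x)) \<in> A \<longleftrightarrow> (x, L t + c) \<in> A" for t
      using AE_lborel_shift[OF elim, of "L t"] by (simp add: add.commute)
    then show ?case by simp
  qed
  then have a: "AE z in lborel. AE c in lborel. (fst z + \<alpha>, L (snd z) + c + L (g (fst z))) \<in> A \<longleftrightarrow> (fst z, L (snd z) + c) \<in> A"
  proof -
    define E where "E = {w. ((fst (fst w) + \<alpha>, L (snd (fst w)) + snd w + L (g (fst (fst w)))) \<in> A) \<noteq> ((fst (fst w), L (snd (fst w)) + snd w) \<in> A)}"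
    have E: "E \<in> sets borel" unfolding E_def by measurable
    have eq: "(AE c in lborel. (fst z + \<alpha>, L (snd z) + c + L (g (fst z))) \<in> A \<longleftrightarrow> (fst z, L (snd z) + c) \<in> A) \<longleftrightarrow>
        emeasure lborel {c. (z, c) \<in> E} = 0" for z
      using AE_section_iff[OF E, of z] by (simp add: E_def)
    assume "AE x in lborel. AE t in lborel. AE c in lborel. (x + \<alpha>, L t + c + L (g x)) \<in> A \<longleftrightarrow> (x, L t + c) \<in> A"
    then show ?thesis unfolding eq using measurable_section_measure[OF E] eq
      by (subst AE_lborel_pair_iff) auto
  qed
  have "AE c in lborel. AE z in lborel. (fst z + \<alpha>, L (snd z) + c + L (g (fst z))) \<in> A \<longleftrightarrow> (fst z, L (snd z) + c) \<in> A"
    by (rule AE_lborel_commute[THEN iffD1, OF _ a]) measurable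
  then have "AE c in lborel. period (B c) (0, e)"
  proof eventually_elim
    case (elim c)
    then have "skew_inv \<alpha> g (B c)" using Bm[of c] per L
      by (simp add: skew_inv_def B_def linear_add add_ac)
    then show ?case using e by (simp add: PER_def)
  qed
  then have b: "AE c in lborel. AE z in lborel. (fst z, L (snd z) + L e + c) \<in> A \<longleftrightarrow> (fst z, L (snd z) + c) \<in> A"
    using L by (simp add: period_def B_def linear_add)
  have "AE z in lborel. AE c in lborel. (fst z, L (snd z) + L e + c) \<in> A \<longleftrightarrow> (fst z, L (snd z) + c) \<in> A"
    by (rule AE_lborel_commute[THEN iffD1, OF _ b]) measurable
  from AE_lborel_pairD[OF this]
  have "AE x in lborel. AE t in lborel. AE c in lborel. (x, L t + L e + c) \<in> A \<longleftrightarrow> (x, L t + c) \<in> A" by simp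
  then have "AE x in lborel. AE c in lborel. (x, c + L e) \<in> A \<longleftrightarrow> (x, c) \<in> A"
  proof eventually_elim
    case (elim x)
    from AE_lborel_ex[OF elim] obtain t where t: "AE c in lborel. (x, L t + L e + c) \<in> A \<longleftrightarrow> (x, L t + c) \<in> A" ..
    from AE_lborel_shift[OF this, of "- L t"] show ?case by (simp add: algebra_simps)
  qed
  then have "AE z in lborel. (fst z, snd z + L e) \<in> A \<longleftrightarrow> z \<in> A"
    by (subst AE_lborel_pair_iff) simp_all
  then show "period A (0, L e)" by (simp add: period_def plus_prod_def)
qed

section \<open>Sawtooth cocycles\<close>

definition cm :: "(real \<Rightarrow> bool) \<Rightarrow> real" where
  "cm P = measure circle {x \<in> {0..<1}. P x}"

lemma cm_nonneg: "0 \<le> cm P"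
  by (simp add: cm_def)

lemma cm_le_1: "Measurable.pred borel P \<Longrightarrow> cm P \<le> 1"
  unfolding cm_def by (rule order_trans[OF circle.bounded_measure]) simp

lemma cm_mono:
  assumes "\<And>x. 0 \<le> x \<Longrightarrow> x < 1 \<Longrightarrow> P x \<Longrightarrow> Q x" "Measurable.pred borel Q"
  shows "cm P \<le> cm Q"
  unfolding cm_def by (intro circle.finite_measure_mono Collect_circle_sets assms(2)) (use assms(1) in auto)

lemma cm_or:
  assumes "Measurable.pred borel P" "Measurable.pred borel Q"
  shows "cm (\<lambda>x. P x \<or> Q x) \<le> cm P + cm Q"
proof -
  have "{x \<in> {0..<1}. P x \<or> Q x} = {x \<in> {0..<1}. P x} \<union> {x \<in> {0..<1}. Q x}" by auto
  then show ?thesis unfolding cm_def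
    using measure_Un_le[OF Collect_circle_sets[OF assms(1)] Collect_circle_sets[OF assms(2)]] by simp
qed

lemma cm_Bex:
  assumes "finite I" "\<And>i. i \<in> I \<Longrightarrow> Measurable.pred borel (P i)"
  shows "cm (\<lambda>x. \<exists>i\<in>I. P i x) \<le> (\<Sum>i\<in>I. cm (P i))"
proof -
  have "{x \<in> {0..<1}. \<exists>i\<in>I. P i x} = (\<Union>i\<in>I. {x \<in> {0..<1}. P i x})" by auto
  moreover have "measure circle (\<Union>i\<in>I. {x \<in> {0..<1}. P i x}) \<le> (\<Sum>i\<in>I. measure circle {x \<in> {0..<1}. P i x})"
    using Collect_circle_sets[OF assms(2)] by (intro circle.finite_measure_subadditive_finite assms(1)) blast
  ultimately show ?thesis unfolding cm_def by simp
qed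

lemma cm_not:
  assumes "Measurable.pred borel P"
  shows "cm (\<lambda>x. \<not> P x) = 1 - cm P"
proof -
  have "{x \<in> {0..<1}. \<not> P x} = space circle - {x \<in> {0..<1}. P x}" by auto
  then show ?thesis unfolding cm_def using circle.finite_measure_compl[OF Collect_circle_sets[OF assms]] by simp
qed

lemma cm_shift:
  assumes "Measurable.pred borel P" "\<And>x. P (x + 1) \<longleftrightarrow> P x"
  shows "cm (\<lambda>x. P (x + a)) = cm P"
  using measure_circle_shift[OF assms] by (simp add: cm_def)

lemma integrable_circle_bounded:
  fixes f :: "real \<Rightarrow> 'b::{banach, second_countable_topology}"
  assumes "f \<in> borel_measurable borel" "\<And>x. norm (f x) \<le> B"
  shows "integrable circle f"
  by (rule circle.integrable_const_bound[of _ B]) (use assms in \<open>auto intro: measurable_circleI\<close>)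

lemma integral_of_bool_cm:
  assumes "Measurable.pred borel P"
  shows "(LINT x|circle. of_bool (P x)) = cm P"
proof -
  have "(LINT x|circle. of_bool (P x)) = (LINT x|circle. indicator {x \<in> {0..<1}. P x} x :: real)"
    by (intro Bochner_Integration.integral_cong) (auto simp: indicator_def)
  also have "\<dots> = measure circle ({x \<in> {0..<1}. P x} \<inter> space circle)" by (rule Bochner_Integration.integral_indicator)
  also have "{x \<in> {0..<1}. P x} \<inter> space circle = {x \<in> {0..<1}. P x}" by auto
  finally show ?thesis by (simp only: cm_def)
qed

lemma ex_cm_pos: "cm P > 0 \<Longrightarrow> \<exists>x. 0 \<le> x \<and> x < 1 \<and> P x"
proof (rule ccontr)
  assume "cm P > 0" "\<nexists>x. 0 \<le> x \<and> x < 1 \<and> P x"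
  then have e: "{x \<in> {0..<1}. P x} = {}" by auto
  show False using \<open>cm P > 0\<close> unfolding cm_def e by simp
qed

lemma frac_int_shift: "frac (x + of_int n) = frac x"
  by (simp add: frac_def)

lemma frac_periodic: "frac (x + 1) = frac (x::real)"
  using frac_int_shift[of x 1] by simp

lemma frac_shift_eq:
  fixes y r :: real
  assumes "0 \<le> r" "r < 1"
  shows "frac (y + r) - frac y = r - of_bool (frac y \<ge> 1 - r)"
proof -
  have "frac (y + r) = frac (frac y + r)"
    using frac_int_shift[of "frac y + r" "\<lfloor>y\<rfloor>"] by (simp add: frac_def algebra_simps)
  also have "\<dots> = frac y + r - of_bool (frac y \<ge> 1 - r)"
  proof (cases "frac y \<ge> 1 - r")
    case True
    have "frac (frac y + r) = frac (frac y + r - 1)" using frac_int_shift[of "frac y + r" "-1"] by simp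
    also have "\<dots> = frac y + r - 1" using True assms frac_lt_1[of y] by (simp add: frac_eq)
    finally show ?thesis using True by simp
  next
    case False
    then have "0 \<le> frac y + r \<and> frac y + r < 1" using assms frac_ge_0[of y] by linarith
    then have "frac (frac y + r) = frac y + r" by (rule frac_eq[THEN iffD2])
    then show ?thesis using False by (simp only: of_bool_eq)
  qed
  finally show ?thesis by simp
qed

text \<open>The increment is \<epsilon> unless an integer is crossed, which happens on an arc of
  length |\<epsilon>|.\<close>

lemma frac_shift_measure: "cm (\<lambda>x. frac (x + a + \<epsilon>) - frac (x + a) \<noteq> \<epsilon>) \<le> \<bar>\<epsilon>\<bar>"
proof -
  have m: "Measurable.pred borel (\<lambda>x. frac (x + \<epsilon>) - frac x \<noteq> \<epsilon>)" by measurable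
  have "cm (\<lambda>x. frac (x + a + \<epsilon>) - frac (x + a) \<noteq> \<epsilon>) = cm (\<lambda>x. frac (x + \<epsilon>) - frac x \<noteq> \<epsilon>)"
  proof (rule cm_shift[OF m, of a])
    show "(frac (x + 1 + \<epsilon>) - frac (x + 1) \<noteq> \<epsilon>) = (frac (x + \<epsilon>) - frac x \<noteq> \<epsilon>)" for x
      using frac_periodic[of x] frac_periodic[of "x + \<epsilon>"] by (simp add: add.assoc add.commute[of 1])
  qed
  also have "\<dots> \<le> \<bar>\<epsilon>\<bar>"
  proof (cases "\<bar>\<epsilon>\<bar> < 1")
    case False
    then show ?thesis using cm_le_1[OF m] by simp
  next
    case True
    define I where "I = (if \<epsilon> \<ge> 0 then {1 - \<epsilon>..<1} else {0..<-\<epsilon>})"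
    have I: "I \<in> sets circle" "I \<in> sets borel" "I \<subseteq> {0..<1}" using True by (auto simp: I_def sets_circle)
    have "{x \<in> {0..<1}. frac (x + \<epsilon>) - frac x \<noteq> \<epsilon>} \<subseteq> I"
    proof
      fix x assume x: "x \<in> {x \<in> {0..<1}. frac (x + \<epsilon>) - frac x \<noteq> \<epsilon>}"
      then have "frac x = x" by (simp add: frac_eq)
      then have "frac (x + \<epsilon>) \<noteq> x + \<epsilon>" using x by auto
      then have "\<not> (0 \<le> x + \<epsilon> \<and> x + \<epsilon> < 1)" by (simp add: frac_eq)
      then show "x \<in> I" using x by (auto simp: I_def)
    qed
    then have "cm (\<lambda>x. frac (x + \<epsilon>) - frac x \<noteq> \<epsilon>) \<le> measure circle I"
      unfolding cm_def using I by (intro circle.finite_measure_mono) auto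
    also have "\<dots> = measure lborel I" using I by (simp add: measure_def emeasure_circle)
    also have "\<dots> = \<bar>\<epsilon>\<bar>" by (simp add: I_def)
    finally show ?thesis .
  qed
  finally show ?thesis .
qed

lemma int_vecs_small:
  assumes "v \<in> int_vecs" "norm v < 1"
  shows "v = 0"
proof -
  have "v $ i = 0" for i
  proof -
    have "\<bar>v $ i\<bar> < 1" using component_le_norm_cart[of v i] assms(2) by simp
    moreover have "v $ i \<in> \<int>" using assms(1) by (simp add: int_vecs_def)
    ultimately show ?thesis by (metis Ints_nonzero_abs_less1)
  qed
  then show ?thesis by (simp add: vec_eq_iff)
qed

lemma finite_int_vecs_bounded: "finite {v \<in> int_vecs. norm (v :: real ^ 'n) \<le> R}"
proof -
  define A where "A = of_int ` {-\<lceil>R\<rceil>..\<lceil>R\<rceil>} \<union> {0::real}"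
  have "{v \<in> int_vecs. norm (v :: real ^ 'n) \<le> R} \<subseteq> (\<lambda>f. \<chi> i. f i) ` (UNIV \<rightarrow>\<^sub>E A)"
  proof
    fix v :: "real ^ 'n" assume v: "v \<in> {v \<in> int_vecs. norm v \<le> R}"
    have "v $ i \<in> A" for i
    proof -
      have "v $ i \<in> \<int>" using v by (simp add: int_vecs_def)
      then obtain z where z: "v $ i = of_int z" by (rule Ints_cases)
      have "\<bar>v $ i\<bar> \<le> R" using component_le_norm_cart[of v i] v by simp
      then have "\<bar>real_of_int z\<bar> \<le> of_int \<lceil>R\<rceil>" using z by linarith
      then have "\<bar>z\<bar> \<le> \<lceil>R\<rceil>" by (simp only: of_int_abs[symmetric] of_int_le_iff)
      then have "z \<in> {-\<lceil>R\<rceil>..\<lceil>R\<rceil>}" by (simp add: abs_le_iff)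
      then show ?thesis by (simp add: A_def z)
    qed
    then show "v \<in> (\<lambda>f. \<chi> i. f i) ` (UNIV \<rightarrow>\<^sub>E A)"
      by (intro image_eqI[of _ _ "\<lambda>i. v $ i"]) (auto simp: PiE_def)
  qed
  moreover have "finite ((\<lambda>f. \<chi> i. f i) ` ((UNIV :: 'n set) \<rightarrow>\<^sub>E A))"
    by (intro finite_imageI finite_PiE) (auto simp: A_def)
  ultimately show ?thesis by (rule finite_subset)
qed

text \<open>Integral weights of total 0 at arbitrary points: the slopes of the sawtooths cancel, so
  \<phi> is a step function with integral jumps and mean 0. The projection of \<open>Phi\<close>
  modulo its integral periods has this form.\<close>

locale sawtooth =
  fixes \<alpha> c :: real and q :: "nat \<Rightarrow> nat" and p :: "nat \<Rightarrow> int"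
    and X :: "'b::finite \<Rightarrow> real" and \<tau> :: "'b \<Rightarrow> real ^ 'n"
  assumes bad: "badly_approximable c \<alpha>"
    and q_pos: "\<And>k. q k > 0" and q_le: "\<And>k. real (q k) \<le> 2 ^ k" and q_ge: "\<And>k. c * 2 ^ k \<le> real (q k)"
    and q_cop: "\<And>k. coprime (p k) (int (q k))" and q_app: "\<And>k. \<bar>real (q k) * \<alpha> - of_int (p k)\<bar> < 1 / 2 ^ k"
    and \<tau>_int: "\<And>b. \<tau> b \<in> int_vecs" and \<tau>_sum: "(\<Sum>b\<in>UNIV. \<tau> b) = 0"
begin

definition \<phi> :: "real \<Rightarrow> real ^ 'n" where
  "\<phi> x = (\<Sum>b\<in>UNIV. frac (x - X b) *\<^sub>R \<tau> b)"

definition T :: real where "T = (\<Sum>b\<in>UNIV. norm (\<tau> b))"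

definition nb :: real where "nb = real CARD('b)"

lemma T_nonneg: "0 \<le> T" by (simp add: T_def sum_nonneg)

lemma nb_ge_1: "1 \<le> nb" by (simp add: nb_def Suc_le_eq)

lemma c_pos: "c > 0" using bad by (simp add: badly_approximable_def)

lemma badD: "n \<noteq> 0 \<Longrightarrow> c \<le> \<bar>of_int n\<bar> * \<bar>of_int n * \<alpha> - of_int m\<bar>"
  using bad by (simp add: badly_approximable_def)

lemma q_app': "\<bar>real (q k) * \<alpha> - of_int (p k)\<bar> < 1 / real (q k)"
proof -
  have "1 / 2 ^ k \<le> 1 / real (q k)" using q_le[of k] q_pos[of k] by (intro divide_left_mono) auto
  then show ?thesis using q_app[of k] by linarith
qed

lemma phi_borel [measurable]: "\<phi> \<in> borel_measurable borel"
  unfolding \<phi>_def by measurable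

lemma phi_periodic: "\<phi> (x + 1) = \<phi> x"
proof -
  have "frac (x + 1 - X b) = frac (x - X b)" for b using frac_periodic[of "x - X b"] by (simp add: algebra_simps)
  then show ?thesis by (simp add: \<phi>_def)
qed

lemma bs_phi_periodic: "bs \<alpha> \<phi> N (x + 1) = bs \<alpha> \<phi> N x"
  by (rule bs_periodic) (rule phi_periodic)

lemma bs_phi_borel [measurable]: "bs \<alpha> \<phi> N \<in> borel_measurable borel"
  by (rule bs_borel) measurable

lemma bs_phi: "bs \<alpha> \<phi> N x = (\<Sum>b\<in>UNIV. (\<Sum>j<N. frac (x - X b + real j * \<alpha>)) *\<^sub>R \<tau> b)"
proof -
  have "bs \<alpha> \<phi> N x = (\<Sum>j<N. \<Sum>b\<in>UNIV. frac (x - X b + real j * \<alpha>) *\<^sub>R \<tau> b)"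
    unfolding bs_def \<phi>_def by (simp add: algebra_simps)
  also have "\<dots> = (\<Sum>b\<in>UNIV. \<Sum>j<N. frac (x - X b + real j * \<alpha>) *\<^sub>R \<tau> b)" by (rule sum.swap)
  finally show ?thesis by (simp add: scaleR_sum_left)
qed

lemma sum_const_tau: "(\<Sum>b\<in>UNIV. a *\<^sub>R \<tau> b) = 0"
  by (simp add: scaleR_sum_right[symmetric] \<tau>_sum)

text \<open>The linear parts cancel because the weights add up to 0; only floors remain.\<close>

lemma phi_diff_int: "\<phi> x - \<phi> y \<in> int_vecs"
proof -
  have "\<phi> x - \<phi> y = (\<Sum>b\<in>UNIV. (x - y) *\<^sub>R \<tau> b) - (\<Sum>b\<in>UNIV. of_int (\<lfloor>x - X b\<rfloor> - \<lfloor>y - X b\<rfloor>) *\<^sub>R \<tau> b)"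
    unfolding \<phi>_def sum_subtractf[symmetric] by (intro sum.cong refl) (simp add: frac_def algebra_simps)
  also have "\<dots> = - (\<Sum>b\<in>UNIV. of_int (\<lfloor>x - X b\<rfloor> - \<lfloor>y - X b\<rfloor>) *\<^sub>R \<tau> b)" by (simp only: sum_const_tau) simp
  also have "\<dots> \<in> int_vecs" by (intro int_vecs_minus int_vecs_sum int_vecs_scale \<tau>_int) auto
  finally show ?thesis .
qed

lemma bs_diff_int: "bs \<alpha> \<phi> N x - bs \<alpha> \<phi> N y \<in> int_vecs"
  unfolding bs_def sum_subtractf[symmetric] by (intro int_vecs_sum phi_diff_int)

text \<open>The constant 8 is 2 L + 6 card F in \<open>denjoy_koksma\<close> for the sawtooth, with
  L = 1 and F = {0}. As the weights add up to 0, only differences of sawtooth sums matter.\<close>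

lemma bs_bounded: "norm (bs \<alpha> \<phi> (q k) x) \<le> 8 * T"
proof -
  define S where "S y = (\<Sum>j<q k. frac (y + real j * \<alpha>))" for y
  have DK: "\<bar>S y - S z\<bar> \<le> 8" for y z
  proof -
    have "\<bar>S y - S z\<bar> \<le> 2 * 1 + real (6 * card {0::real})" unfolding S_def
    proof (rule denjoy_koksma[where f=frac and F="{0}" and L=1 and p="p k", OF q_pos q_cop q_app'])
      show "frac (x + 1) = frac x" for x :: real by (rule frac_periodic)
    next
      fix x y :: real
      show "\<bar>frac x - frac y\<bar> \<le> 1"
        using frac_ge_0[of x] frac_ge_0[of y] frac_lt_1[of x] frac_lt_1[of y] by linarith
      assume *: "\<And>z n. z \<in> {0} \<Longrightarrow> \<not> (min x y \<le> z + of_int n \<and> z + of_int n \<le> max x y)"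
      have fl: "\<lfloor>x\<rfloor> = \<lfloor>y\<rfloor>" if "x \<le> y" "\<And>n. \<not> (x \<le> of_int n \<and> of_int n \<le> y)" for x y :: real
        using that(1) that(2)[of "\<lfloor>y\<rfloor>"] by (simp add: not_le) linarith
      have "\<lfloor>x\<rfloor> = \<lfloor>y\<rfloor>"
      proof (cases "x \<le> y")
        case True
        then show ?thesis using *[of 0] by (intro fl) (auto simp: min_def max_def)
      next
        case False
        then show ?thesis using *[of 0] by (intro fl[symmetric]) (auto simp: min_def max_def)
      qed
      then show "\<bar>frac x - frac y\<bar> \<le> 1 * \<bar>x - y\<bar>" by (simp add: frac_def)
    qed auto
    then show ?thesis by simp
  qed
  have "bs \<alpha> \<phi> (q k) x = (\<Sum>b\<in>UNIV. (S (x - X b) - S x) *\<^sub>R \<tau> b) + (\<Sum>b\<in>UNIV. S x *\<^sub>R \<tau> b)"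
    by (simp add: bs_phi S_def sum.distrib[symmetric] scaleR_add_left[symmetric])
  also have "\<dots> = (\<Sum>b\<in>UNIV. (S (x - X b) - S x) *\<^sub>R \<tau> b)" by (simp only: sum_const_tau) simp
  also have "norm \<dots> \<le> (\<Sum>b\<in>UNIV. 8 * norm (\<tau> b))"
    using DK by (intro sum_norm_le) (simp add: mult_right_mono)
  finally show ?thesis by (simp add: T_def sum_distrib_left)
qed

text \<open>If no term wraps around, all terms grow by the same \<theta> and the weights cancel the
  growth; each of the nb * N terms wraps on measure at most |\<theta>|.\<close>

lemma bs_shift_measure: "cm (\<lambda>x. bs \<alpha> \<phi> N (x + \<theta>) \<noteq> bs \<alpha> \<phi> N x) \<le> nb * real N * \<bar>\<theta>\<bar>"
proof -
  define P where "P = (\<lambda>(b, j) x. frac (x + (real j * \<alpha> - X b) + \<theta>) - frac (x + (real j * \<alpha> - X b)) \<noteq> \<theta>)"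
  have Pm: "Measurable.pred borel (P i)" for i unfolding P_def by (cases i) simp
  have "cm (\<lambda>x. bs \<alpha> \<phi> N (x + \<theta>) \<noteq> bs \<alpha> \<phi> N x) \<le> cm (\<lambda>x. \<exists>i\<in>UNIV \<times> {..<N}. P i x)"
  proof (rule cm_mono)
    fix x assume "bs \<alpha> \<phi> N (x + \<theta>) \<noteq> bs \<alpha> \<phi> N x"
    show "\<exists>i\<in>UNIV \<times> {..<N}. P i x"
    proof (rule ccontr)
      assume "\<not> (\<exists>i\<in>UNIV \<times> {..<N}. P i x)"
      then have *: "frac (x + (real j * \<alpha> - X b) + \<theta>) - frac (x + (real j * \<alpha> - X b)) = \<theta>" if "j < N" for b j
        using that by (auto simp: P_def)
      have "bs \<alpha> \<phi> N (x + \<theta>) - bs \<alpha> \<phi> N x =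
         (\<Sum>b\<in>UNIV. (\<Sum>j<N. frac (x + (real j * \<alpha> - X b) + \<theta>) - frac (x + (real j * \<alpha> - X b))) *\<^sub>R \<tau> b)"
        unfolding bs_phi by (simp add: sum_subtractf scaleR_diff_left algebra_simps)
      also have "\<dots> = (\<Sum>b\<in>UNIV. (real N * \<theta>) *\<^sub>R \<tau> b)" using * by (intro sum.cong refl) simp
      also have "\<dots> = 0" by (rule sum_const_tau)
      finally show False using \<open>bs \<alpha> \<phi> N (x + \<theta>) \<noteq> bs \<alpha> \<phi> N x\<close> by simp
    qed
  next
    have "finite (UNIV \<times> {..<N} :: ('b \<times> nat) set)" by simp
    then show "Measurable.pred borel (\<lambda>x. \<exists>i\<in>UNIV \<times> {..<N}. P i x)" using Pm by (intro pred_intros_finite) auto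
  qed
  also have "\<dots> \<le> (\<Sum>i\<in>UNIV \<times> {..<N}. cm (P i))" by (intro cm_Bex Pm) auto
  also have "\<dots> \<le> (\<Sum>i\<in>(UNIV \<times> {..<N} :: ('b \<times> nat) set). \<bar>\<theta>\<bar>)"
  proof (rule sum_mono)
    fix i show "cm (P i) \<le> \<bar>\<theta>\<bar>" unfolding P_def by (cases i) (simp add: frac_shift_measure)
  qed
  finally show ?thesis by (simp add: nb_def)
qed

end

section \<open>Telescoping sums of sawtooths\<close>

lemma frac_diff_no_int:
  fixes x y :: real
  assumes "\<And>n::int. \<not> (min x y \<le> of_int n \<and> of_int n \<le> max x y)"
  shows "frac x - frac y = x - y"
proof -
  have fl: "\<lfloor>x\<rfloor> = \<lfloor>y\<rfloor>" if "x \<le> y" "\<And>n. \<not> (x \<le> of_int n \<and> of_int n \<le> y)" for x y :: real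
    using that(1) that(2)[of "\<lfloor>y\<rfloor>"] by (simp add: not_le) linarith
  have "\<lfloor>x\<rfloor> = \<lfloor>y\<rfloor>"
  proof (cases "x \<le> y")
    case True
    then show ?thesis using assms by (intro fl) (auto simp: min_def max_def)
  next
    case False
    then show ?thesis using assms by (intro fl[symmetric]) (auto simp: min_def max_def)
  qed
  then show ?thesis by (simp add: frac_def)
qed

lemma cm_frac_ge:
  assumes "0 \<le> r" "r \<le> 1"
  shows "cm (\<lambda>x. 1 - r \<le> frac (x + a)) = r"
proof -
  have "cm (\<lambda>x. 1 - r \<le> frac (x + a)) = cm (\<lambda>x. 1 - r \<le> frac x)"
  proof (rule cm_shift)
    show "(1 - r \<le> frac (x + 1)) = (1 - r \<le> frac x)" for x by (simp add: frac_periodic)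
  qed measurable
  also have "{x \<in> {0..<1}. 1 - r \<le> frac x} = {1 - r..<1}" using assms by (auto simp: frac_eq)
  then have "cm (\<lambda>x. 1 - r \<le> frac x) = measure circle {1 - r..<1}" by (simp only: cm_def)
  also have "\<dots> = r" using assms by (simp add: measure_def emeasure_circle)
  finally show ?thesis .
qed

lemma frac_near:
  fixes u v r :: real
  assumes "1 - r \<le> frac u" "1 - r \<le> frac v"
  shows "\<exists>n::int. \<bar>v - u - of_int n\<bar> < r"
proof
  have "frac v - frac u = v - u - of_int (\<lfloor>v\<rfloor> - \<lfloor>u\<rfloor>)" by (simp add: frac_def)
  then show "\<bar>v - u - of_int (\<lfloor>v\<rfloor> - \<lfloor>u\<rfloor>)\<bar> < r"
    using assms frac_lt_1[of u] frac_lt_1[of v] by linarith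
qed

text \<open>Telescoping sums of the sawtooth: \<open>G m y - G m (y + \<alpha>) = frac (y - m \<alpha>) - frac y\<close>, for all integers \<open>m\<close>.\<close>

definition G :: "real \<Rightarrow> int \<Rightarrow> real \<Rightarrow> real" where
  "G \<alpha> m y = (\<Sum>i\<in>{1..m}. frac (y - of_int i * \<alpha>)) - (\<Sum>i\<in>{m+1..0}. frac (y - of_int i * \<alpha>))"

lemma G_borel [measurable]: "G \<alpha> m \<in> borel_measurable borel"
  unfolding G_def by measurable

lemma G_periodic: "G \<alpha> m (y + 1) = G \<alpha> m y"
proof -
  have "frac (y + 1 - of_int i * \<alpha>) = frac (y - of_int i * \<alpha>)" for i
    using frac_periodic[of "y - of_int i * \<alpha>"] by (simp add: algebra_simps)
  then show ?thesis by (simp add: G_def)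
qed

lemma G_Suc: "G \<alpha> (m + 1) y = G \<alpha> m y + frac (y - of_int (m + 1) * \<alpha>)"
proof (cases "m \<ge> 0")
  case True
  have "{1..m+1} = insert (m+1) {1..m}" "{m+1+1..0} = {}" "{m+1..0} = {}" using True by auto
  then show ?thesis by (simp add: G_def)
next
  case False
  have "{m+1..0} = insert (m+1) {m+1+1..0}" "{1..m} = {}" "{1..m+1} = {}" using False by auto
  then show ?thesis by (simp add: G_def)
qed

lemma G_telescope: "G \<alpha> m y - G \<alpha> m (y + \<alpha>) = frac (y - of_int m * \<alpha>) - frac y"
proof (induction m rule: int_induct[where k=0])
  case base
  then show ?case by (simp add: G_def)
next
  case (step1 m)
  have e: "y + \<alpha> - of_int (m + 1) * \<alpha> = y - of_int m * \<alpha>" by (simp add: algebra_simps)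
  show ?case using step1 unfolding G_Suc e by linarith
next
  case (step2 m)
  have g: "G \<alpha> m z = G \<alpha> (m - 1) z + frac (z - of_int m * \<alpha>)" for z using G_Suc[of \<alpha> "m - 1" z] by simp
  have e: "y + \<alpha> - of_int m * \<alpha> = y - of_int (m - 1) * \<alpha>" by (simp add: algebra_simps)
  show ?case using step2 g[of y] g[of "y + \<alpha>"] unfolding e by linarith
qed

text \<open>Each of the |m| terms has slope 1 between its jumps, and for negative m the second sum
  carries the sign.\<close>

lemma G_local:
  assumes "\<And>i n::int. \<bar>i\<bar> \<le> \<bar>m\<bar> \<Longrightarrow> \<not> (min x y \<le> of_int i * \<alpha> + of_int n \<and> of_int i * \<alpha> + of_int n \<le> max x y)"
  shows "G \<alpha> m x - G \<alpha> m y = of_int m * (x - y)"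
proof -
  have fr: "frac (x - of_int i * \<alpha>) - frac (y - of_int i * \<alpha>) = x - y" if "\<bar>i\<bar> \<le> \<bar>m\<bar>" for i
  proof -
    have "frac (x - of_int i * \<alpha>) - frac (y - of_int i * \<alpha>) = (x - of_int i * \<alpha>) - (y - of_int i * \<alpha>)"
    proof (rule frac_diff_no_int)
      fix n show "\<not> (min (x - of_int i * \<alpha>) (y - of_int i * \<alpha>) \<le> of_int n \<and> of_int n \<le> max (x - of_int i * \<alpha>) (y - of_int i * \<alpha>))"
        using assms[OF that, of n] by (auto simp: min_def max_def split: if_splits)
    qed
    then show ?thesis by simp
  qed
  have "G \<alpha> m x - G \<alpha> m y = (\<Sum>i\<in>{1..m}. frac (x - of_int i * \<alpha>) - frac (y - of_int i * \<alpha>))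
     - (\<Sum>i\<in>{m+1..0}. frac (x - of_int i * \<alpha>) - frac (y - of_int i * \<alpha>))"
    by (simp add: G_def sum_subtractf)
  also have "\<dots> = (\<Sum>i\<in>{1..m}. x - y) - (\<Sum>i\<in>{m+1..0}. x - y)"
    by (intro arg_cong2[where f="(-)"] sum.cong refl fr) auto
  also have "\<dots> = of_int m * (x - y)" by (cases "m \<ge> 0") (auto simp: algebra_simps)
  finally show ?thesis .
qed

context sawtooth begin

text \<open>Off a set of measure \<open>q s * \<eta>\<close>, u is constant along q s consecutive
  orbit points. If two such constants differed, an indicator would have orbit sums 0 and q s,
  whereas Denjoy-Koksma allows them to differ by 6 card F only.\<close>

lemma almost_constant:
  fixes u :: "real \<Rightarrow> real ^ 'n"
  assumes [measurable]: "u \<in> borel_measurable borel" and per: "\<And>x. u (x + 1) = u x" and F: "finite F"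
    and loc: "\<And>x y. (\<And>z n. z \<in> F \<Longrightarrow> \<not> (min x y \<le> z + of_int n \<and> z + of_int n \<le> max x y)) \<Longrightarrow> u x = u y"
    and inv: "cm (\<lambda>x. u (x + \<alpha>) \<noteq> u x) \<le> \<eta>" and J: "6 * card F < q s" "real (q s) * \<eta> < 1"
  shows "\<exists>v. cm (\<lambda>x. u x \<noteq> v) \<le> real (q s) * \<eta>"
proof -
  define P where "P j x \<longleftrightarrow> u (x + real j * \<alpha> + \<alpha>) \<noteq> u (x + real j * \<alpha>)" for j x
  have Pm: "Measurable.pred borel (P j)" for j unfolding P_def by measurable
  define Bad where "Bad x \<longleftrightarrow> (\<exists>j\<in>{..<q s}. P j x)" for x
  have Badm [measurable]: "Measurable.pred borel Bad" unfolding Bad_def using Pm by (intro pred_intros_finite) auto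
  have "cm Bad \<le> (\<Sum>j\<in>{..<q s}. cm (P j))" unfolding Bad_def by (intro cm_Bex Pm) auto
  also have "\<dots> \<le> (\<Sum>j\<in>{..<q s}. \<eta>)"
  proof (rule sum_mono)
    fix j
    have "cm (P j) = cm (\<lambda>x. u (x + \<alpha>) \<noteq> u x)" unfolding P_def
    proof (rule cm_shift)
      show "(u (x + 1 + \<alpha>) \<noteq> u (x + 1)) = (u (x + \<alpha>) \<noteq> u x)" for x
        using per[of x] per[of "x + \<alpha>"] by (simp add: algebra_simps)
    qed measurable
    then show "cm (P j) \<le> \<eta>" using inv by simp
  qed
  finally have bad_le: "cm Bad \<le> real (q s) * \<eta>" by simp
  have "cm (\<lambda>x. \<not> Bad x) = 1 - cm Bad" by (rule cm_not) measurable
  then have "0 < cm (\<lambda>x. \<not> Bad x)" using bad_le J(2) by linarith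
  then obtain x0 where x0: "\<not> Bad x0" using ex_cm_pos by blast
  have orb: "u (x + real j * \<alpha>) = u x" if "\<not> Bad x" "j < q s" for x j
    using that(2)
  proof (induction j)
    case (Suc j)
    then have "\<not> P j x" using that(1) by (auto simp: Bad_def)
    then have "u (x + real j * \<alpha> + \<alpha>) = u (x + real j * \<alpha>)" by (simp add: P_def)
    then show ?case using Suc by (simp add: algebra_simps)
  qed simp
  have "u x = u x0" if x: "\<not> Bad x" for x
  proof (rule ccontr)
    assume ne: "u x \<noteq> u x0"
    define g where "g y = (of_bool (u y \<noteq> u x0) :: real)" for y
    have "\<bar>(\<Sum>j<q s. g (x + real j * \<alpha>)) - (\<Sum>j<q s. g (x0 + real j * \<alpha>))\<bar> \<le> 2 * 0 + real (6 * card F)"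
    proof (rule denjoy_koksma[where f=g and F=F and L=0 and p="p s", OF q_pos q_cop q_app'])
      show "g (x + 1) = g x" for x by (simp add: g_def per)
      show "\<bar>g x - g y\<bar> \<le> 1" for x y by (simp add: g_def)
      fix x y assume "\<And>z n. z \<in> F \<Longrightarrow> \<not> (min x y \<le> z + of_int n \<and> z + of_int n \<le> max x y)"
      from loc[OF this] show "\<bar>g x - g y\<bar> \<le> 0 * \<bar>x - y\<bar>" by (simp add: g_def)
    qed (use F in auto)
    moreover have "(\<Sum>j<q s. g (x + real j * \<alpha>)) = real (q s)" using orb[OF x] ne by (simp add: g_def)
    moreover have "(\<Sum>j<q s. g (x0 + real j * \<alpha>)) = 0" using orb[OF x0] by (simp add: g_def)
    ultimately show False using J(1) by simp
  qed
  then have "cm (\<lambda>x. u x \<noteq> u x0) \<le> cm Bad" by (intro cm_mono) auto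
  then show ?thesis using bad_le by (intro exI[of _ "u x0"]) simp
qed

text \<open>The coboundary of this function replaces the sawtooth at the root
  \<open>X (ro b)\<close> by the one \<open>m b\<close> rotations further, a point meant to
  approximate \<open>X b\<close>.\<close>

definition F :: "('b \<Rightarrow> 'b) \<Rightarrow> ('b \<Rightarrow> int) \<Rightarrow> real \<Rightarrow> real ^ 'n" where
  "F ro m x = (\<Sum>b\<in>UNIV. G \<alpha> (m b) (x - X (ro b)) *\<^sub>R \<tau> b)"

lemma F_borel [measurable]: "F ro m \<in> borel_measurable borel"
  unfolding F_def by measurable

lemma F_periodic: "F ro m (x + 1) = F ro m x"
proof -
  have "G \<alpha> (m b) (x + 1 - X (ro b)) = G \<alpha> (m b) (x - X (ro b))" for b
    using G_periodic[of \<alpha> "m b" "x - X (ro b)"] by (simp add: algebra_simps)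
  then show ?thesis by (simp add: F_def)
qed

lemma sum_over_roots:
  fixes ro :: "'b \<Rightarrow> 'b"
  assumes "\<And>a. (\<Sum>b | ro b = a. \<tau> b) = 0"
  shows "(\<Sum>b\<in>UNIV. h (ro b) *\<^sub>R \<tau> b) = 0"
proof -
  have "(\<Sum>b\<in>UNIV. h (ro b) *\<^sub>R \<tau> b) = (\<Sum>a\<in>UNIV. \<Sum>b | b \<in> UNIV \<and> ro b = a. h (ro b) *\<^sub>R \<tau> b)"
    by (rule sum.group[of "UNIV::'b set" "UNIV::'b set" ro "\<lambda>b. h (ro b) *\<^sub>R \<tau> b", symmetric]) simp_all
  also have "\<dots> = (\<Sum>a\<in>UNIV. h a *\<^sub>R (\<Sum>b | ro b = a. \<tau> b))"
    by (simp add: scaleR_sum_right)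
  finally show ?thesis using assms by simp
qed

end

section \<open>Clusters of discontinuities at a dyadic scale\<close>

locale heights = sawtooth \<alpha> c q p X \<tau>
  for \<alpha> c q p and X :: "'b::finite \<Rightarrow> real" and \<tau> :: "'b \<Rightarrow> real ^ 'n" +
  fixes w :: "nat \<Rightarrow> real ^ 'n" and e :: "nat \<Rightarrow> nat"
  assumes height: "\<And>k. cm (\<lambda>x. bs \<alpha> \<phi> (q k) x \<noteq> w k) \<le> (1/2) ^ e k"
begin

text \<open>A power of 1/2 bounding the exceptional probability, so that its exponent can be
  compared with distances between scales.\<close>

definition D :: "nat \<Rightarrow> real" where "D k = (1/2) ^ e k"
definition C :: real where "C = 2 * T + 1"

lemma D_pos: "0 < D k" by (simp add: D_def)
lemma D_le_1: "D k \<le> 1" by (simp add: D_def power_le_one)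
lemma C_pos: "0 < C" using T_nonneg by (simp add: C_def)

text \<open>The jumps of \<open>bs \<alpha> \<phi> (q k)\<close> in a window \<open>(x, x + r]\<close> come from a single linked cluster, and the function
  rarely differs from \<open>w k\<close>; integrating over \<open>x\<close>, the total jump of the cluster is an integer vector of norm less than 1.\<close>

lemma closed_sum_zero:
  fixes Z :: "'b set"
  assumes small: "C * D k < c" "C * D k < 1"
    and closed: "\<And>a b m n. a \<in> Z \<Longrightarrow> \<bar>m\<bar> < int (q k) \<Longrightarrow> \<bar>X a - X b - of_int m * \<alpha> - of_int n\<bar> \<le> C * D k / q k \<Longrightarrow> b \<in> Z"
  shows "sum \<tau> Z = 0"
proof -
  \<comment> \<open>The window is short: an orbit of q k points hits a given discontinuity in it
    with mean \<open>q k * r = C * D k\<close>.\<close>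
  define r where "r = C * D k / real (q k)"
  have qk: "real (q k) \<ge> 1" using q_pos[of k] by linarith
  have qr: "real (q k) * r = C * D k" using q_pos[of k] by (simp add: r_def)
  have r0: "0 < r" using C_pos D_pos q_pos by (simp add: r_def)
  have r1: "r < 1"
  proof -
    have "1 * r \<le> real (q k) * r" using qk r0 by (intro mult_right_mono) auto
    then show ?thesis using small qr by simp
  qed
  define I where "I a x = {j \<in> {..<q k}. 1 - r \<le> frac (x + (real j * \<alpha> - X a))}" for a x
  define ca where "ca a x = (\<Sum>j<q k. of_bool (1 - r \<le> frac (x + (real j * \<alpha> - X a))) :: real)" for a x
  have ca_card: "ca a x = real (card (I a x))" for a x
    unfolding ca_def I_def by (subst sum_of_bool_eq) (auto simp: Int_def)
  \<comment> \<open>Two hits of one discontinuity would bring (j' - j) \<alpha> within r of an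
    integer, while q k * r < c.\<close>
  have ca_le1: "ca a x \<le> 1" for a x
  proof -
    have "j = j'" if j: "j \<in> I a x" and j': "j' \<in> I a x" for j j'
    proof (rule ccontr)
      assume "j \<noteq> j'"
      obtain n where "\<bar>(x + (real j' * \<alpha> - X a)) - (x + (real j * \<alpha> - X a)) - of_int n\<bar> < r"
        using frac_near j j' unfolding I_def by blast
      then have n: "\<bar>of_int (int j' - int j) * \<alpha> - of_int n\<bar> < r" by (simp add: algebra_simps)
      have "c \<le> \<bar>of_int (int j' - int j)\<bar> * \<bar>of_int (int j' - int j) * \<alpha> - of_int n\<bar>"
        by (rule badD) (use \<open>j \<noteq> j'\<close> in simp)
      also have "\<dots> \<le> real (q k) * r"
        using j j' n by (intro mult_mono) (auto simp: I_def)
      finally show False using small qr by simp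
    qed
    then have "card (I a x) \<le> Suc 0"
      by (subst card_le_Suc0_iff_eq) (auto simp: I_def)
    then show ?thesis by (simp add: ca_card)
  qed
  define \<zeta> where "\<zeta> x = (\<Sum>a\<in>Z. ca a x *\<^sub>R \<tau> a)" for x
  have [measurable]: "ca a \<in> borel_measurable borel" for a unfolding ca_def by measurable
  have zm [measurable]: "\<zeta> \<in> borel_measurable borel" unfolding \<zeta>_def by measurable
  have ca0: "0 \<le> ca a x" for a x by (simp add: ca_card)
  have znorm: "norm (\<zeta> x) \<le> T" for x
  proof -
    have "norm (\<zeta> x) \<le> (\<Sum>a\<in>Z. 1 * norm (\<tau> a))" unfolding \<zeta>_def
      using ca_le1 ca0 by (intro sum_norm_le) (simp add: mult_right_mono mult_left_le_one_le)
    also have "\<dots> \<le> T" unfolding T_def by (simp, intro sum_mono2) auto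
    finally show ?thesis .
  qed
  \<comment> \<open>A hit from Z excludes hits from outside, as Z is closed under links; the
    increment over the window is then - \<zeta> x.\<close>
  have zjump: "bs \<alpha> \<phi> (q k) (x + r) \<noteq> bs \<alpha> \<phi> (q k) x" if z: "\<zeta> x \<noteq> 0" for x
  proof -
    have "\<exists>a\<in>Z. ca a x \<noteq> 0" using z unfolding \<zeta>_def by (metis (no_types, lifting) scale_zero_left sum.neutral)
    then obtain a j where a: "a \<in> Z" "j \<in> I a x" unfolding ca_card by (metis card.empty all_not_in_conv of_nat_0)
    have out: "ca b x = 0" if "b \<notin> Z" for b
    proof (rule ccontr)
      assume "ca b x \<noteq> 0"
      then obtain j' where j': "j' \<in> I b x" unfolding ca_card by (metis card.empty all_not_in_conv of_nat_0)
      obtain n where "\<bar>(x + (real j' * \<alpha> - X b)) - (x + (real j * \<alpha> - X a)) - of_int n\<bar> < r"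
        using frac_near a(2) j' unfolding I_def by blast
      then have "\<bar>X a - X b - of_int (int j - int j') * \<alpha> - of_int n\<bar> \<le> C * D k / q k"
        by (simp add: algebra_simps r_def)
      moreover have "\<bar>int j - int j'\<bar> < int (q k)" using a(2) j' by (auto simp: I_def)
      ultimately show False using closed[OF a(1)] that by blast
    qed
    have "bs \<alpha> \<phi> (q k) (x + r) - bs \<alpha> \<phi> (q k) x =
       (\<Sum>b\<in>UNIV. (\<Sum>j<q k. frac (x + (real j * \<alpha> - X b) + r) - frac (x + (real j * \<alpha> - X b))) *\<^sub>R \<tau> b)"
      unfolding bs_phi by (simp add: sum_subtractf scaleR_diff_left algebra_simps)
    also have "\<dots> = (\<Sum>b\<in>UNIV. (real (q k) * r - ca b x) *\<^sub>R \<tau> b)"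
      using r0 r1 by (simp add: frac_shift_eq sum_subtractf ca_def)
    also have "\<dots> = (\<Sum>b\<in>UNIV. (real (q k) * r) *\<^sub>R \<tau> b) - (\<Sum>b\<in>UNIV. ca b x *\<^sub>R \<tau> b)"
      by (simp add: scaleR_diff_left sum_subtractf)
    also have "(\<Sum>b\<in>UNIV. (real (q k) * r) *\<^sub>R \<tau> b) = 0" by (rule sum_const_tau)
    also have "(\<Sum>b\<in>UNIV. ca b x *\<^sub>R \<tau> b) = \<zeta> x"
      unfolding \<zeta>_def by (rule sum.mono_neutral_right) (auto simp: out)
    finally show ?thesis using z by auto
  qed
  have zc: "cm (\<lambda>x. \<zeta> x \<noteq> 0) \<le> 2 * D k"
  proof -
    have "cm (\<lambda>x. \<zeta> x \<noteq> 0) \<le> cm (\<lambda>x. bs \<alpha> \<phi> (q k) (x + r) \<noteq> w k \<or> bs \<alpha> \<phi> (q k) x \<noteq> w k)"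
      using zjump by (intro cm_mono) (metis, measurable)
    also have "\<dots> \<le> cm (\<lambda>x. bs \<alpha> \<phi> (q k) (x + r) \<noteq> w k) + cm (\<lambda>x. bs \<alpha> \<phi> (q k) x \<noteq> w k)"
      by (rule cm_or) measurable
    also have "cm (\<lambda>x. bs \<alpha> \<phi> (q k) (x + r) \<noteq> w k) = cm (\<lambda>x. bs \<alpha> \<phi> (q k) x \<noteq> w k)"
      by (rule cm_shift) (measurable, simp add: bs_phi_periodic)
    finally show ?thesis using height[of k] by (simp add: D_def)
  qed
  have int_ca: "integrable circle (ca a)" for a
    by (rule integrable_circle_bounded[where B=1]) (use ca_le1 ca0 in auto)
  have "(LINT x|circle. ca a x) = real (q k) * r" for a
  proof -
    have "(LINT x|circle. ca a x) = (\<Sum>j<q k. LINT x|circle. of_bool (1 - r \<le> frac (x + (real j * \<alpha> - X a))))"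
      unfolding ca_def by (intro Bochner_Integration.integral_sum integrable_circle_bounded[where B=1]) auto
    also have "\<dots> = (\<Sum>j<q k. r)"
    proof (rule sum.cong[OF refl])
      fix j
      have "(LINT x|circle. of_bool (1 - r \<le> frac (x + (real j * \<alpha> - X a)))) = cm (\<lambda>x. 1 - r \<le> frac (x + (real j * \<alpha> - X a)))"
        by (rule integral_of_bool_cm) measurable
      then show "(LINT x|circle. of_bool (1 - r \<le> frac (x + (real j * \<alpha> - X a)))) = r"
        using cm_frac_ge[of r "real j * \<alpha> - X a"] r0 r1 by simp
    qed
    finally show ?thesis by simp
  qed
  then have "(LINT x|circle. \<zeta> x) = (real (q k) * r) *\<^sub>R sum \<tau> Z"
    unfolding \<zeta>_def using int_ca by (subst Bochner_Integration.integral_sum) (auto simp: scaleR_sum_right)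
  then have "(real (q k) * r) * norm (sum \<tau> Z) = norm (LINT x|circle. \<zeta> x)" using r0 by simp
  also have "\<dots> \<le> (LINT x|circle. norm (\<zeta> x))" by (rule integral_norm_bound)
  also have "\<dots> \<le> (LINT x|circle. T * of_bool (\<zeta> x \<noteq> 0))"
  proof (rule integral_mono)
    show "integrable circle (\<lambda>x. norm (\<zeta> x))" by (rule integrable_circle_bounded[where B=T]) (use znorm in auto)
    show "integrable circle (\<lambda>x. T * of_bool (\<zeta> x \<noteq> 0))" by (rule integrable_circle_bounded[where B=T]) (use T_nonneg in auto)
    show "norm (\<zeta> x) \<le> T * of_bool (\<zeta> x \<noteq> 0)" for x using znorm[of x] by simp
  qed
  also have "\<dots> = T * (LINT x|circle. of_bool (\<zeta> x \<noteq> 0))" by simp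
  also have "(LINT x|circle. of_bool (\<zeta> x \<noteq> 0)) = cm (\<lambda>x. \<zeta> x \<noteq> 0)" by (rule integral_of_bool_cm) measurable
  also have "T * \<dots> \<le> T * (2 * D k)" using zc T_nonneg by (rule mult_left_mono)
  \<comment> \<open>The left side is the mean of \<zeta>; the right side uses that \<zeta> has norm
    at most T and differs from 0 only if the sum is exceptional at one end of the window. The choice
    of C as 2 T + 1 brings the quotient below 1.\<close>
  finally have "C * D k * norm (sum \<tau> Z) \<le> T * (2 * D k)" by (simp only: qr)
  then have "(C * norm (sum \<tau> Z)) * D k \<le> (2 * T) * D k" by (simp add: mult_ac)
  then have "C * norm (sum \<tau> Z) \<le> 2 * T" using D_pos[of k] by (rule mult_right_le_imp_le)
  then have "C * norm (sum \<tau> Z) < C * 1" by (simp add: C_def)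
  then have "norm (sum \<tau> Z) < 1" using C_pos by simp
  then show ?thesis by (intro int_vecs_small int_vecs_sum \<tau>_int)
qed

text \<open>A chain inside a cluster needs at most as many links as there are pairs of points,
  \<open>nb\<^sup>2\<close>. Each link costs fewer than q k rotations, at most 2^k, and a
  displacement \<open>C * D k / q k\<close>, at most \<open>C * D k / (c * 2 ^ k)\<close>; the
  second bound gives \<open>K1\<close>.\<close>

definition K0 :: real where "K0 = nb\<^sup>2"
definition K1 :: real where "K1 = K0 * C / c"

lemma K_pos: "K0 \<ge> 1" "K1 > 0"
proof -
  have "1 * 1 \<le> nb * nb" using nb_ge_1 by (intro mult_mono) auto
  then show "K0 \<ge> 1" by (simp add: K0_def power2_eq_square)
  then show "K1 > 0" using C_pos c_pos by (simp add: K1_def)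
qed

text \<open>\<open>ro\<close> picks a representative of each cluster, and \<open>m b\<close> counts
  the rotations that lead from it to the neighbourhood of \<open>X b\<close>.\<close>

definition good_data :: "nat \<Rightarrow> ('b \<Rightarrow> 'b) \<Rightarrow> ('b \<Rightarrow> int) \<Rightarrow> bool" where
  "good_data k ro m \<longleftrightarrow> (\<forall>a. (\<Sum>b | ro b = a. \<tau> b) = 0) \<and>
     (\<forall>b. \<bar>of_int (m b)\<bar> \<le> K0 * 2 ^ k \<and> (\<exists>n::int. \<bar>X b - X (ro b) - of_int (m b) * \<alpha> - of_int n\<bar> \<le> K1 * D k / 2 ^ k))"

lemma ex_good_data:
  assumes small: "C * D k < c" "C * D k < 1"
  shows "\<exists>ro m. good_data k ro m"
proof -
  define r where "r = C * D k / real (q k)"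
  define E where "E = {(a, b). \<exists>m n :: int. \<bar>m\<bar> < int (q k) \<and> \<bar>X a - X b - of_int m * \<alpha> - of_int n\<bar> \<le> r}"
  have r0: "0 \<le> r" using C_pos D_pos[of k] by (simp add: r_def)
  have "sym E"
  proof (rule symI)
    fix a b assume "(a, b) \<in> E"
    then obtain m n :: int where "\<bar>m\<bar> < int (q k)" "\<bar>X a - X b - of_int m * \<alpha> - of_int n\<bar> \<le> r" by (auto simp: E_def)
    then have "\<bar>- m\<bar> < int (q k)" "\<bar>X b - X a - of_int (- m) * \<alpha> - of_int (- n)\<bar> \<le> r" by (auto simp: abs_le_iff)
    then show "(b, a) \<in> E" unfolding E_def by blast
  qed
  then have symr: "sym (E\<^sup>*)" by (rule sym_rtrancl)
  \<comment> \<open>Links are symmetric, so all points of a cluster reach the same set and the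
    choice is the same for all of them.\<close>
  define ro where "ro b = (SOME a. (b, a) \<in> E\<^sup>*)" for b
  have ro1: "(b, ro b) \<in> E\<^sup>*" for b unfolding ro_def by (rule someI[of _ b]) simp
  have ro_eq: "ro b = ro b'" if "(b, b') \<in> E\<^sup>*" for b b'
  proof -
    have "(b, a) \<in> E\<^sup>* \<longleftrightarrow> (b', a) \<in> E\<^sup>*" for a
      using that symD[OF symr that] by (meson rtrancl_trans)
    then show ?thesis by (simp add: ro_def)
  qed
  have steps: "\<exists>m n::int. \<bar>real_of_int m\<bar> \<le> real i * real (q k) \<and> \<bar>X a - X b - of_int m * \<alpha> - of_int n\<bar> \<le> real i * r"
    if "(a, b) \<in> E ^^ i" for a b i
    using that
  proof (induction i arbitrary: b)
    case 0
    then show ?case by (intro exI[of _ 0]) auto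
  next
    case (Suc i)
    then obtain b' where b': "(a, b') \<in> E ^^ i" "(b', b) \<in> E" by auto
    obtain m n :: int where mn: "\<bar>real_of_int m\<bar> \<le> real i * real (q k)" "\<bar>X a - X b' - of_int m * \<alpha> - of_int n\<bar> \<le> real i * r"
      using Suc.IH[OF b'(1)] by auto
    obtain m' n' :: int where mn': "\<bar>m'\<bar> < int (q k)" "\<bar>X b' - X b - of_int m' * \<alpha> - of_int n'\<bar> \<le> r"
      using b'(2) by (auto simp: E_def)
    have "\<bar>real_of_int m'\<bar> \<le> real (q k)" using mn'(1) by linarith
    then have "\<bar>real_of_int (m + m')\<bar> \<le> real (Suc i) * real (q k)" using mn(1) by (simp add: algebra_simps)
    moreover have "\<bar>X a - X b - of_int (m + m') * \<alpha> - of_int (n + n')\<bar> \<le> real (Suc i) * r"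
      using mn(2) mn'(2) by (simp add: algebra_simps)
    ultimately show ?case by (intro exI[of _ "m + m'"] exI[of _ "n + n'"] conjI)
  qed
  have off: "\<exists>m n::int. \<bar>real_of_int m\<bar> \<le> K0 * 2 ^ k \<and> \<bar>X b - X (ro b) - of_int m * \<alpha> - of_int n\<bar> \<le> K1 * D k / 2 ^ k" for b
  proof -
    have cE: "card E \<le> CARD('b) * CARD('b)" 
    proof -
      have "card E \<le> card (UNIV \<times> UNIV :: ('b \<times> 'b) set)" by (rule card_mono) auto
      then show ?thesis by (simp only: card_cartesian_product)
    qed
    have "(b, ro b) \<in> (\<Union>i\<in>{i. i \<le> card E}. E ^^ i)" using ro1 rtrancl_finite_eq_relpow[of E] by simp
    then obtain i where i: "i \<le> card E" "(b, ro b) \<in> E ^^ i" by auto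
    obtain m n :: int where mn: "\<bar>real_of_int m\<bar> \<le> real i * real (q k)" "\<bar>X b - X (ro b) - of_int m * \<alpha> - of_int n\<bar> \<le> real i * r"
      using steps[OF i(2)] by auto
    have "i \<le> CARD('b) * CARD('b)" using i(1) cE by simp
    then have iK: "real i \<le> K0" unfolding K0_def nb_def power2_eq_square of_nat_mult[symmetric] of_nat_le_iff .
    have "real i * real (q k) \<le> K0 * 2 ^ k" using iK q_le[of k] K_pos by (intro mult_mono) auto
    moreover have "real i * r \<le> K1 * D k / 2 ^ k"
    proof -
      have "r \<le> C * D k / (c * 2 ^ k)" unfolding r_def using q_ge[of k] q_pos[of k] c_pos C_pos D_pos[of k]
        by (intro divide_left_mono) auto
      then have "real i * r \<le> K0 * (C * D k / (c * 2 ^ k))" using iK r0 K_pos by (intro mult_mono) auto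
      then show ?thesis by (simp add: K1_def)
    qed
    ultimately show ?thesis using mn by (meson order_trans)
  qed
  then obtain m where m: "\<And>b. \<exists>n::int. \<bar>real_of_int (m b)\<bar> \<le> K0 * 2 ^ k \<and> \<bar>X b - X (ro b) - of_int (m b) * \<alpha> - of_int n\<bar> \<le> K1 * D k / 2 ^ k"
    by metis
  have "(\<Sum>b | ro b = a. \<tau> b) = 0" for a
  proof (rule closed_sum_zero[OF small])
    fix b b' and m n :: int
    assume "b \<in> {b. ro b = a}" "\<bar>m\<bar> < int (q k)" "\<bar>X b - X b' - of_int m * \<alpha> - of_int n\<bar> \<le> C * D k / q k"
    then have "(b, b') \<in> E" "ro b = a" unfolding E_def r_def by auto
    then show "b' \<in> {b. ro b = a}" using ro_eq[OF r_into_rtrancl] by simp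
  qed
  then have "good_data k ro m" unfolding good_data_def using m by blast
  then show ?thesis by blast
qed

text \<open>Two offsets of b to the same root would differ by a non-zero integer whose multiple of
  \<alpha> is too close to an integer. Hence the transfer function stays the same while the roots do
  and the gap of scales is small against the exponents.\<close>

lemma good_data_unique:
  assumes g: "good_data k ro m" "good_data l ro m'" and kl: "k \<le> l" and d: "D k \<le> d" "D l \<le> d"
    and small: "4 * K0 * K1 * 2 ^ (l - k) * d < c"
  shows "m = m'"
proof
  fix b
  obtain n n' :: int where n: "\<bar>X b - X (ro b) - of_int (m b) * \<alpha> - of_int n\<bar> \<le> K1 * D k / 2 ^ k"
      "\<bar>X b - X (ro b) - of_int (m' b) * \<alpha> - of_int n'\<bar> \<le> K1 * D l / 2 ^ l"
      "\<bar>real_of_int (m b)\<bar> \<le> K0 * 2 ^ k" "\<bar>real_of_int (m' b)\<bar> \<le> K0 * 2 ^ l"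
    using g unfolding good_data_def by meson
  have p: "(2::real) ^ k \<le> 2 ^ l" using kl by (intro power_increasing) auto
  have "\<bar>of_int (m b - m' b) * \<alpha> - of_int (n' - n)\<bar> \<le> K1 * D k / 2 ^ k + K1 * D l / 2 ^ l"
    using n(1,2) by (simp add: algebra_simps abs_le_iff)
  also have "\<dots> \<le> K1 * d / 2 ^ k + K1 * d / 2 ^ k"
  proof (rule add_mono)
    show "K1 * D k / 2 ^ k \<le> K1 * d / 2 ^ k" using d K_pos by (intro divide_right_mono mult_left_mono) auto
    show "K1 * D l / 2 ^ l \<le> K1 * d / 2 ^ k" using d K_pos p D_pos[of l] by (intro frac_le mult_left_mono mult_nonneg_nonneg) auto
  qed
  finally have near: "\<bar>of_int (m b - m' b) * \<alpha> - of_int (n' - n)\<bar> \<le> 2 * (K1 * d / 2 ^ k)" by (simp only: mult_2)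
  have "K0 * 2 ^ k \<le> K0 * 2 ^ l" using p K_pos by (intro mult_left_mono) auto
  then have mm: "\<bar>real_of_int (m b - m' b)\<bar> \<le> 2 * (K0 * 2 ^ l)" using n(3,4) by simp
  show "m b = m' b"
  proof (rule ccontr)
    assume "m b \<noteq> m' b"
    then have "c \<le> \<bar>of_int (m b - m' b)\<bar> * \<bar>of_int (m b - m' b) * \<alpha> - of_int (n' - n)\<bar>" by (intro badD) simp
    also have "\<dots> \<le> (2 * (K0 * 2 ^ l)) * (2 * (K1 * d / 2 ^ k))" using mm near by (intro mult_mono) auto
    also have "\<dots> = 4 * K0 * K1 * 2 ^ (l - k) * d" using kl by (simp add: power_diff)
    finally show False using small by simp
  qed
qed

text \<open>The sawtooth at \<open>X b\<close> and the one \<open>m b\<close> rotations beyond its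
  root differ by a constant \<open>\<epsilon> b\<close> off an arc of that length. The total
  constant is written without the roots, which cancel, so that the constants of two data differ by
  an integral combination of \<alpha> and 1.\<close>

lemma transfer_eq:
  assumes g: "good_data k ro m"
  obtains \<nu> :: "'b \<Rightarrow> int" where
    "\<And>b. \<bar>X b - X (ro b) - of_int (m b) * \<alpha> - of_int (\<nu> b)\<bar> \<le> K1 * D k / 2 ^ k"
    "cm (\<lambda>x. \<phi> x - (F ro m x - F ro m (x + \<alpha>)) \<noteq> - (\<Sum>b\<in>UNIV. (X b - of_int (m b) * \<alpha> - of_int (\<nu> b)) *\<^sub>R \<tau> b)) \<le> nb * (K1 * D k / 2 ^ k)"
proof -
  obtain \<nu> :: "'b \<Rightarrow> int" where nu: "\<And>b. \<bar>X b - X (ro b) - of_int (m b) * \<alpha> - of_int (\<nu> b)\<bar> \<le> K1 * D k / 2 ^ k"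
    using g unfolding good_data_def by metis
  define \<epsilon> where "\<epsilon> b = X b - X (ro b) - of_int (m b) * \<alpha> - of_int (\<nu> b)" for b
  have zero: "\<And>a. (\<Sum>b | ro b = a. \<tau> b) = 0" using g by (simp add: good_data_def)
  have drift: "(\<Sum>b\<in>UNIV. (X b - of_int (m b) * \<alpha> - of_int (\<nu> b)) *\<^sub>R \<tau> b) = (\<Sum>b\<in>UNIV. \<epsilon> b *\<^sub>R \<tau> b)"
  proof -
    have "(\<Sum>b\<in>UNIV. \<epsilon> b *\<^sub>R \<tau> b) = (\<Sum>b\<in>UNIV. (X b - of_int (m b) * \<alpha> - of_int (\<nu> b)) *\<^sub>R \<tau> b) - (\<Sum>b\<in>UNIV. X (ro b) *\<^sub>R \<tau> b)"
      unfolding \<epsilon>_def sum_subtractf[symmetric] by (intro sum.cong refl) (simp add: algebra_simps)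
    then show ?thesis using sum_over_roots[of ro X, OF zero] by simp
  qed
  define P where "P b x \<longleftrightarrow> frac (x + (- X b) + \<epsilon> b) - frac (x + (- X b)) \<noteq> \<epsilon> b" for b x
  have Pm: "Measurable.pred borel (P b)" for b unfolding P_def by measurable
  have "cm (\<lambda>x. \<phi> x - (F ro m x - F ro m (x + \<alpha>)) \<noteq> - (\<Sum>b\<in>UNIV. \<epsilon> b *\<^sub>R \<tau> b)) \<le> cm (\<lambda>x. \<exists>b\<in>UNIV. P b x)"
  proof (rule cm_mono)
    show "Measurable.pred borel (\<lambda>x. \<exists>b\<in>UNIV. P b x)" using Pm by (intro pred_intros_finite) auto
    fix x assume ne: "\<phi> x - (F ro m x - F ro m (x + \<alpha>)) \<noteq> - (\<Sum>b\<in>UNIV. \<epsilon> b *\<^sub>R \<tau> b)"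
    show "\<exists>b\<in>UNIV. P b x"
    proof (rule ccontr)
      assume "\<not> (\<exists>b\<in>UNIV. P b x)"
      then have fr: "frac (x - X b + \<epsilon> b) - frac (x - X b) = \<epsilon> b" for b by (auto simp: P_def)
      have fr2: "frac (x - X (ro b) - of_int (m b) * \<alpha>) = frac (x - X b + \<epsilon> b)" for b
      proof -
        have "x - X (ro b) - of_int (m b) * \<alpha> = x - X b + \<epsilon> b + of_int (\<nu> b)" by (simp add: \<epsilon>_def)
        then show ?thesis by (simp only: frac_int_shift)
      qed
      have "F ro m x - F ro m (x + \<alpha>) = (\<Sum>b\<in>UNIV. (G \<alpha> (m b) (x - X (ro b)) - G \<alpha> (m b) (x - X (ro b) + \<alpha>)) *\<^sub>R \<tau> b)"
        unfolding F_def sum_subtractf[symmetric] by (simp add: algebra_simps)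
      also have "\<dots> = (\<Sum>b\<in>UNIV. frac (x - X b + \<epsilon> b) *\<^sub>R \<tau> b) - (\<Sum>b\<in>UNIV. frac (x - X (ro b)) *\<^sub>R \<tau> b)"
        unfolding G_telescope fr2 by (simp add: scaleR_diff_left sum_subtractf)
      also have "(\<Sum>b\<in>UNIV. frac (x - X (ro b)) *\<^sub>R \<tau> b) = 0"
        using sum_over_roots[of ro "\<lambda>a. frac (x - X a)", OF zero] .
      finally have "\<phi> x - (F ro m x - F ro m (x + \<alpha>)) = - (\<Sum>b\<in>UNIV. (frac (x - X b + \<epsilon> b) - frac (x - X b)) *\<^sub>R \<tau> b)"
        unfolding \<phi>_def by (simp add: scaleR_diff_left sum_subtractf)
      then show False using ne fr by simp
    qed
  qed
  also have "\<dots> \<le> (\<Sum>b\<in>UNIV. cm (P b))" by (intro cm_Bex Pm) auto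
  also have "\<dots> \<le> (\<Sum>b\<in>(UNIV::'b set). K1 * D k / 2 ^ k)"
  proof (rule sum_mono)
    fix b
    have "cm (P b) \<le> \<bar>\<epsilon> b\<bar>" unfolding P_def by (rule frac_shift_measure)
    then show "cm (P b) \<le> K1 * D k / 2 ^ k" using nu[of b] by (simp add: \<epsilon>_def)
  qed
  finally have "cm (\<lambda>x. \<phi> x - (F ro m x - F ro m (x + \<alpha>)) \<noteq> - (\<Sum>b\<in>UNIV. \<epsilon> b *\<^sub>R \<tau> b)) \<le> nb * (K1 * D k / 2 ^ k)"
    by (simp add: nb_def)
  then show ?thesis using that[of \<nu>] nu drift by simp
qed

end

context heights begin

lemma drift_small:
  assumes g: "good_data k ro m"
    and nu: "\<And>b. \<bar>X b - X (ro b) - of_int (m b) * \<alpha> - of_int (\<nu> b)\<bar> \<le> K1 * D k / 2 ^ k"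
  shows "norm (\<Sum>b\<in>UNIV. (X b - of_int (m b) * \<alpha> - of_int (\<nu> b)) *\<^sub>R \<tau> b) \<le> T * (K1 * D k / 2 ^ k)"
proof -
  have zero: "\<And>a. (\<Sum>b | ro b = a. \<tau> b) = 0" using g by (simp add: good_data_def)
  have "(\<Sum>b\<in>UNIV. (X b - of_int (m b) * \<alpha> - of_int (\<nu> b)) *\<^sub>R \<tau> b)
      = (\<Sum>b\<in>UNIV. (X b - X (ro b) - of_int (m b) * \<alpha> - of_int (\<nu> b)) *\<^sub>R \<tau> b) + (\<Sum>b\<in>UNIV. X (ro b) *\<^sub>R \<tau> b)"
    unfolding sum.distrib[symmetric] by (intro sum.cong refl) (simp add: algebra_simps)
  also have "(\<Sum>b\<in>UNIV. X (ro b) *\<^sub>R \<tau> b) = 0" by (rule sum_over_roots[OF zero])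
  finally have eq: "(\<Sum>b\<in>UNIV. (X b - of_int (m b) * \<alpha> - of_int (\<nu> b)) *\<^sub>R \<tau> b)
      = (\<Sum>b\<in>UNIV. (X b - X (ro b) - of_int (m b) * \<alpha> - of_int (\<nu> b)) *\<^sub>R \<tau> b)" by simp
  have "norm (\<Sum>b\<in>UNIV. (X b - X (ro b) - of_int (m b) * \<alpha> - of_int (\<nu> b)) *\<^sub>R \<tau> b) \<le>
     (\<Sum>b\<in>UNIV. (K1 * D k / 2 ^ k) * norm (\<tau> b))"
  proof (rule sum_norm_le)
    fix b show "norm ((X b - X (ro b) - of_int (m b) * \<alpha> - of_int (\<nu> b)) *\<^sub>R \<tau> b) \<le> (K1 * D k / 2 ^ k) * norm (\<tau> b)"
      using mult_right_mono[OF nu[of b], of "norm (\<tau> b)"] by simp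
  qed
  then show ?thesis unfolding eq sum_distrib_left[symmetric] T_def[symmetric] by (simp only: mult.commute)
qed

text \<open>At most nb (2 K0 2^k + 1) jumps at scale k and nb (4 K0 2^k + 1) at scale k + 1;
  together at most \<open>K5 * 2 ^ k\<close>.\<close>

definition K5 :: real where "K5 = nb * (6 * K0 + 2)"

lemma card_discontinuities:
  assumes g: "good_data k ro m" "good_data (Suc k) ro' m'"
  defines "S \<equiv> (\<Union>b. (\<lambda>i. X (ro b) + of_int i * \<alpha>) ` {-\<bar>m b\<bar>..\<bar>m b\<bar>}) \<union> (\<Union>b. (\<lambda>i. X (ro' b) + of_int i * \<alpha>) ` {-\<bar>m' b\<bar>..\<bar>m' b\<bar>})"
  shows "finite S" "real (card S) \<le> K5 * 2 ^ k"
proof -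
  have one: "real (card (\<Union>b. (\<lambda>i. X (ro b) + of_int i * \<alpha>) ` {-\<bar>m b\<bar>..\<bar>m b\<bar>})) \<le> nb * (2 * (K0 * 2 ^ l) + 1)"
    if m: "\<And>b. \<bar>real_of_int (m b)\<bar> \<le> K0 * 2 ^ l" for ro :: "'b \<Rightarrow> 'b" and m l
  proof -
    have "card (\<Union>b. (\<lambda>i. X (ro b) + of_int i * \<alpha>) ` {-\<bar>m b\<bar>..\<bar>m b\<bar>}) \<le>
        (\<Sum>b\<in>UNIV. card ((\<lambda>i. X (ro b) + of_int i * \<alpha>) ` {-\<bar>m b\<bar>..\<bar>m b\<bar>}))"
      by (rule card_UN_le) simp
    also have "\<dots> \<le> (\<Sum>b\<in>UNIV. card {-\<bar>m b\<bar>..\<bar>m b\<bar>})" by (intro sum_mono card_image_le) simp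
    finally have "real (card (\<Union>b. (\<lambda>i. X (ro b) + of_int i * \<alpha>) ` {-\<bar>m b\<bar>..\<bar>m b\<bar>})) \<le> (\<Sum>b\<in>UNIV. real (card {-\<bar>m b\<bar>..\<bar>m b\<bar>}))"
      unfolding of_nat_sum[symmetric] of_nat_le_iff .
    also have "\<dots> \<le> (\<Sum>b\<in>(UNIV::'b set). 2 * (K0 * 2 ^ l) + 1)"
    proof (rule sum_mono)
      fix b
      have "real (card {-\<bar>m b\<bar>..\<bar>m b\<bar>}) = 2 * \<bar>real_of_int (m b)\<bar> + 1" by simp
      then show "real (card {-\<bar>m b\<bar>..\<bar>m b\<bar>}) \<le> 2 * (K0 * 2 ^ l) + 1" using m[of b] by simp
    qed
    finally show ?thesis by (simp add: nb_def)
  qed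
  show "finite S" unfolding S_def by auto
  have "real (card S) \<le> nb * (2 * (K0 * 2 ^ k) + 1) + nb * (2 * (K0 * 2 ^ Suc k) + 1)"
    unfolding S_def using g
    by (intro order_trans[OF of_nat_mono[OF card_Un_le]], unfold of_nat_add, intro add_mono one) (auto simp: good_data_def)
  also have "\<dots> = nb * (6 * K0 * 2 ^ k + 2 * 1)" by (simp add: algebra_simps)
  also have "\<dots> \<le> nb * (6 * K0 * 2 ^ k + 2 * 2 ^ k)" using nb_ge_1 by (intro mult_left_mono add_left_mono) auto
  finally show "real (card S) \<le> K5 * 2 ^ k" by (simp add: K5_def algebra_simps)
qed

text \<open>Both transfer functions solve the cohomological equation up to constants whose difference has the form
  \<open>l \<alpha> + r\<close> with integer vectors \<open>l\<close>, \<open>r\<close>; being tiny, it vanishes together with the slope \<open>l\<close> of the difference.\<close>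

lemma consecutive:
  obtains \<eta>0 K6 where "\<eta>0 > 0" "K6 \<ge> 0"
    "\<And>k ro m ro' m'. good_data k ro m \<Longrightarrow> good_data (Suc k) ro' m' \<Longrightarrow> D k + D (Suc k) < \<eta>0 \<Longrightarrow>
       \<exists>v. cm (\<lambda>x. F ro' m' x - F ro m x \<noteq> v) \<le> K6 * (D k + D (Suc k))"
proof -
  \<comment> \<open>With s extra scales the denominator q (k + s) exceeds six times the number of
    jumps, as \<open>almost_constant\<close> requires.\<close>
  obtain s :: nat where s: "6 * K5 / c < 2 ^ s" using real_arch_pow[of 2 "6 * K5 / c"] by auto
  have s': "6 * K5 < c * 2 ^ s" using s c_pos by (simp add: field_simps)
  define K6 where "K6 = 2 ^ s * nb * K1"
  have K6: "K6 \<ge> 0" using nb_ge_1 K_pos by (simp add: K6_def)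
  \<comment> \<open>Three smallness conditions in one: the first term makes the slope
    \<open>l\<close> vanish, the second the integral vector \<open>r\<close>, and \<open>K6\<close>
    keeps \<open>q (k + s) * \<eta>\<close> below 1.\<close>
  define L where "L = 3 * K0 * T * T * K1 / c + T * K1 + K6 + 1"
  have Lparts: "0 \<le> 3 * K0 * T * T * K1 / c" "0 \<le> T * K1" using T_nonneg K_pos c_pos by simp_all
  have L: "L > 0" unfolding L_def using Lparts K6 by linarith
  show ?thesis
  proof (rule that[of "1 / L" K6])
    show "1 / L > 0" using L by simp
    show "K6 \<ge> 0" by (rule K6)
    fix k ro m ro' m'
    assume g: "good_data k ro m" "good_data (Suc k) ro' m'" and dd: "D k + D (Suc k) < 1 / L"
    define d where "d = D k + D (Suc k)"
    have d0: "d > 0" using D_pos by (simp add: d_def add_pos_pos)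
    have dL: "L * d < 1" using dd L by (simp add: d_def field_simps)
    have parts: "(3 * K0 * T * T * K1 / c) * d + (T * K1) * d + K6 * d + d < 1" using dL by (simp add: L_def algebra_simps)
    have nn: "0 \<le> (3 * K0 * T * T * K1 / c) * d" "0 \<le> (T * K1) * d" "0 \<le> K6 * d"
      by (fact mult_nonneg_nonneg[OF Lparts(1) less_imp_le[OF d0]], fact mult_nonneg_nonneg[OF Lparts(2) less_imp_le[OF d0]],
        fact mult_nonneg_nonneg[OF K6 less_imp_le[OF d0]])
    have s1: "(3 * K0 * T * T * K1 / c) * d < 1" and s2: "(T * K1) * d < 1" and s3: "K6 * d < 1"
      using parts nn d0 by linarith+
    obtain \<nu> where nu: "\<And>b. \<bar>X b - X (ro b) - of_int (m b) * \<alpha> - of_int (\<nu> b)\<bar> \<le> K1 * D k / 2 ^ k"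
      "cm (\<lambda>x. \<phi> x - (F ro m x - F ro m (x + \<alpha>)) \<noteq> - (\<Sum>b\<in>UNIV. (X b - of_int (m b) * \<alpha> - of_int (\<nu> b)) *\<^sub>R \<tau> b)) \<le> nb * (K1 * D k / 2 ^ k)"
      using transfer_eq[OF g(1)] by blast
    obtain \<nu>' where nu': "\<And>b. \<bar>X b - X (ro' b) - of_int (m' b) * \<alpha> - of_int (\<nu>' b)\<bar> \<le> K1 * D (Suc k) / 2 ^ Suc k"
      "cm (\<lambda>x. \<phi> x - (F ro' m' x - F ro' m' (x + \<alpha>)) \<noteq> - (\<Sum>b\<in>UNIV. (X b - of_int (m' b) * \<alpha> - of_int (\<nu>' b)) *\<^sub>R \<tau> b)) \<le> nb * (K1 * D (Suc k) / 2 ^ Suc k)"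
      using transfer_eq[OF g(2)] by blast
    define d1 where "d1 = (\<Sum>b\<in>UNIV. (X b - of_int (m b) * \<alpha> - of_int (\<nu> b)) *\<^sub>R \<tau> b)"
    define d2 where "d2 = (\<Sum>b\<in>UNIV. (X b - of_int (m' b) * \<alpha> - of_int (\<nu>' b)) *\<^sub>R \<tau> b)"
    define l where "l = (\<Sum>b\<in>UNIV. of_int (m b - m' b) *\<^sub>R \<tau> b)"
    define r where "r = (\<Sum>b\<in>UNIV. of_int (\<nu> b - \<nu>' b) *\<^sub>R \<tau> b)"
    have lint: "l \<in> int_vecs" and rint: "r \<in> int_vecs"
      unfolding l_def r_def by (intro int_vecs_sum int_vecs_scale \<tau>_int Ints_of_int)+
    have d21: "d2 - d1 = \<alpha> *\<^sub>R l + r"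
      unfolding d1_def d2_def l_def r_def scaleR_sum_right sum_subtractf[symmetric] sum.distrib[symmetric]
      by (intro sum.cong refl) (simp add: algebra_simps)
    have half: "K1 * D (Suc k) / 2 ^ Suc k \<le> K1 * D (Suc k) / 2 ^ k"
      using K_pos D_pos[of "Suc k"] by (intro divide_left_mono) auto
    have tot: "K1 * D k / 2 ^ k + K1 * D (Suc k) / 2 ^ Suc k \<le> K1 * d / 2 ^ k"
      using half by (simp add: d_def distrib_left add_divide_distrib)
    have "norm (d2 - d1) \<le> norm d2 + norm d1" by (rule norm_triangle_ineq4)
    also have "\<dots> \<le> T * (K1 * D (Suc k) / 2 ^ Suc k) + T * (K1 * D k / 2 ^ k)"
      unfolding d1_def d2_def by (intro add_mono drift_small[OF g(1) nu(1)] drift_small[OF g(2) nu'(1)])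
    also have "\<dots> = T * (K1 * D k / 2 ^ k + K1 * D (Suc k) / 2 ^ Suc k)" by (simp add: distrib_left)
    also have "\<dots> \<le> T * (K1 * d / 2 ^ k)" using tot T_nonneg by (rule mult_left_mono)
    finally have dn: "norm (d2 - d1) \<le> T * K1 * d / 2 ^ k" by (simp add: mult.assoc)
    have ln: "norm l \<le> 3 * K0 * T * 2 ^ k"
    proof -
      have "norm l \<le> (\<Sum>b\<in>UNIV. (3 * K0 * 2 ^ k) * norm (\<tau> b))" unfolding l_def
      proof (rule sum_norm_le)
        fix b
        have "\<bar>real_of_int (m b)\<bar> \<le> K0 * 2 ^ k" "\<bar>real_of_int (m' b)\<bar> \<le> K0 * 2 ^ Suc k" using g by (auto simp: good_data_def)
        then have "\<bar>real_of_int (m b - m' b)\<bar> \<le> 3 * K0 * 2 ^ k" by simp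
        then show "norm (of_int (m b - m' b) *\<^sub>R \<tau> b) \<le> (3 * K0 * 2 ^ k) * norm (\<tau> b)"
          by (simp only: norm_scaleR) (rule mult_right_mono, auto)
      qed
      then show ?thesis unfolding sum_distrib_left[symmetric] T_def[symmetric] by (simp add: mult_ac)
    qed
    have l0: "l = 0"
    proof (rule ccontr)
      assume "l \<noteq> 0"
      then obtain i where i: "l $ i \<noteq> 0" by (auto simp: vec_eq_iff)
      obtain a b :: int where ab: "l $ i = of_int a" "r $ i = of_int b"
        using lint rint unfolding int_vecs_def by (metis Ints_cases mem_Collect_eq)
      have "a \<noteq> 0" using i ab by simp
      then have "c \<le> \<bar>of_int a\<bar> * \<bar>of_int a * \<alpha> - of_int (- b)\<bar>" by (rule badD)
      also have "\<bar>of_int a * \<alpha> - of_int (- b)\<bar> = \<bar>(d2 - d1) $ i\<bar>" by (simp add: d21 ab mult.commute)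
      also have "\<bar>of_int a\<bar> * \<bar>(d2 - d1) $ i\<bar> \<le> (3 * K0 * T * 2 ^ k) * (T * K1 * d / 2 ^ k)"
        using component_le_norm_cart[of l i] component_le_norm_cart[of "d2 - d1" i] ln dn ab(1) T_nonneg K_pos
        by (intro mult_mono) auto
      also have "\<dots> = (3 * K0 * T * T * K1 / c) * d * c" using c_pos by simp
      also have "\<dots> < 1 * c" using s1 c_pos by (rule mult_strict_right_mono)
      finally show False by simp
    qed
    have "r = 0"
    proof (rule int_vecs_small[OF rint])
      have "norm r \<le> T * K1 * d / 2 ^ k" using dn d21 l0 by simp
      also have "\<dots> \<le> T * K1 * d / 1" using nn(2) by (intro divide_left_mono) auto
      finally show "norm r < 1" using s2 by simp
    qed
    with l0 d21 have deq: "d2 = d1" by simp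
    define u where "u x = F ro' m' x - F ro m x" for x
    define \<eta> where "\<eta> = nb * (K1 * d / 2 ^ k)"
    have "\<exists>v. cm (\<lambda>x. u x \<noteq> v) \<le> real (q (k + s)) * \<eta>"
    proof (rule almost_constant)
      show "u \<in> borel_measurable borel" unfolding u_def by measurable
      show "u (x + 1) = u x" for x by (simp add: u_def F_periodic)
      show "finite ((\<Union>b. (\<lambda>i. X (ro b) + of_int i * \<alpha>) ` {-\<bar>m b\<bar>..\<bar>m b\<bar>}) \<union> (\<Union>b. (\<lambda>i. X (ro' b) + of_int i * \<alpha>) ` {-\<bar>m' b\<bar>..\<bar>m' b\<bar>}))"
        by (rule card_discontinuities(1)[OF g])
      fix x y assume no: "\<And>z n. z \<in> (\<Union>b. (\<lambda>i. X (ro b) + of_int i * \<alpha>) ` {-\<bar>m b\<bar>..\<bar>m b\<bar>}) \<union> (\<Union>b. (\<lambda>i. X (ro' b) + of_int i * \<alpha>) ` {-\<bar>m' b\<bar>..\<bar>m' b\<bar>}) \<Longrightarrow>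
         \<not> (min x y \<le> z + of_int n \<and> z + of_int n \<le> max x y)"
      have Floc: "F ro m x - F ro m y = (x - y) *\<^sub>R (\<Sum>b\<in>UNIV. of_int (m b) *\<^sub>R \<tau> b)"
        if no: "\<And>b i n. \<bar>i\<bar> \<le> \<bar>m b\<bar> \<Longrightarrow> \<not> (min x y \<le> X (ro b) + of_int i * \<alpha> + of_int n \<and> X (ro b) + of_int i * \<alpha> + of_int n \<le> max x y)"
        for ro :: "'b \<Rightarrow> 'b" and m
      proof -
        have "G \<alpha> (m b) (x - X (ro b)) - G \<alpha> (m b) (y - X (ro b)) = of_int (m b) * (x - y)" for b
        proof -
          have "G \<alpha> (m b) (x - X (ro b)) - G \<alpha> (m b) (y - X (ro b)) = of_int (m b) * ((x - X (ro b)) - (y - X (ro b)))"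
          proof (rule G_local)
            fix i n :: int assume "\<bar>i\<bar> \<le> \<bar>m b\<bar>"
            from no[OF this, of n]
            show "\<not> (min (x - X (ro b)) (y - X (ro b)) \<le> of_int i * \<alpha> + of_int n \<and> of_int i * \<alpha> + of_int n \<le> max (x - X (ro b)) (y - X (ro b)))"
              by (auto simp: min_def max_def split: if_splits)
          qed
          then show ?thesis by simp
        qed
        then show ?thesis unfolding F_def sum_subtractf[symmetric] scaleR_diff_left[symmetric]
          by (simp add: scaleR_sum_right mult.commute)
      qed
      have F1: "F ro m x - F ro m y = (x - y) *\<^sub>R (\<Sum>b\<in>UNIV. of_int (m b) *\<^sub>R \<tau> b)"
      proof (rule Floc)
        fix b and i n :: int assume "\<bar>i\<bar> \<le> \<bar>m b\<bar>"
        then have "i \<in> {-\<bar>m b\<bar>..\<bar>m b\<bar>}" by auto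
        then show "\<not> (min x y \<le> X (ro b) + of_int i * \<alpha> + of_int n \<and> X (ro b) + of_int i * \<alpha> + of_int n \<le> max x y)"
          by (intro no) blast
      qed
      have F2: "F ro' m' x - F ro' m' y = (x - y) *\<^sub>R (\<Sum>b\<in>UNIV. of_int (m' b) *\<^sub>R \<tau> b)"
      proof (rule Floc)
        fix b and i n :: int assume "\<bar>i\<bar> \<le> \<bar>m' b\<bar>"
        then have "i \<in> {-\<bar>m' b\<bar>..\<bar>m' b\<bar>}" by auto
        then show "\<not> (min x y \<le> X (ro' b) + of_int i * \<alpha> + of_int n \<and> X (ro' b) + of_int i * \<alpha> + of_int n \<le> max x y)"
          by (intro no) blast
      qed
      have "u x - u y = (F ro' m' x - F ro' m' y) - (F ro m x - F ro m y)" by (simp add: u_def)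
      also have "\<dots> = - ((x - y) *\<^sub>R l)"
        unfolding F1 F2 l_def by (simp add: scaleR_diff_left scaleR_diff_right sum_subtractf)
      finally show "u x = u y" using l0 by simp
    next
      have "cm (\<lambda>x. u (x + \<alpha>) \<noteq> u x) \<le> cm (\<lambda>x. \<phi> x - (F ro m x - F ro m (x + \<alpha>)) \<noteq> - d1 \<or> \<phi> x - (F ro' m' x - F ro' m' (x + \<alpha>)) \<noteq> - d2)"
      proof (rule cm_mono)
        fix x assume ne: "u (x + \<alpha>) \<noteq> u x"
        show "\<phi> x - (F ro m x - F ro m (x + \<alpha>)) \<noteq> - d1 \<or> \<phi> x - (F ro' m' x - F ro' m' (x + \<alpha>)) \<noteq> - d2"
        proof (rule ccontr)
          assume "\<not> ?thesis"
          then have h: "\<phi> x - (F ro m x - F ro m (x + \<alpha>)) = \<phi> x - (F ro' m' x - F ro' m' (x + \<alpha>))"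
            using deq by simp
          have "F ro m x - F ro m (x + \<alpha>) = F ro' m' x - F ro' m' (x + \<alpha>)"
            using h by (rule diff_left_imp_eq)
          then show False using ne by (simp add: u_def algebra_simps)
        qed
      qed measurable
      also have "\<dots> \<le> cm (\<lambda>x. \<phi> x - (F ro m x - F ro m (x + \<alpha>)) \<noteq> - d1) + cm (\<lambda>x. \<phi> x - (F ro' m' x - F ro' m' (x + \<alpha>)) \<noteq> - d2)"
        by (rule cm_or) measurable
      also have "\<dots> \<le> nb * (K1 * D k / 2 ^ k) + nb * (K1 * D (Suc k) / 2 ^ Suc k)"
        unfolding d1_def d2_def by (intro add_mono nu(2) nu'(2))
      also have "\<dots> = nb * (K1 * D k / 2 ^ k + K1 * D (Suc k) / 2 ^ Suc k)" by (simp add: distrib_left)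
      also have "\<dots> \<le> \<eta>" unfolding \<eta>_def using tot nb_ge_1 by (intro mult_left_mono) auto
      finally show "cm (\<lambda>x. u (x + \<alpha>) \<noteq> u x) \<le> \<eta>" .
    next
      have "6 * (K5 * 2 ^ k) < (c * 2 ^ s) * 2 ^ k" using s' by simp
      also have "\<dots> = c * 2 ^ (k + s)" by (simp add: power_add)
      also have "\<dots> \<le> real (q (k + s))" by (rule q_ge)
      finally have "6 * real (card ((\<Union>b. (\<lambda>i. X (ro b) + of_int i * \<alpha>) ` {-\<bar>m b\<bar>..\<bar>m b\<bar>}) \<union> (\<Union>b. (\<lambda>i. X (ro' b) + of_int i * \<alpha>) ` {-\<bar>m' b\<bar>..\<bar>m' b\<bar>}))) < real (q (k + s))"
        using card_discontinuities(2)[OF g] by linarith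
      then show "6 * card ((\<Union>b. (\<lambda>i. X (ro b) + of_int i * \<alpha>) ` {-\<bar>m b\<bar>..\<bar>m b\<bar>}) \<union> (\<Union>b. (\<lambda>i. X (ro' b) + of_int i * \<alpha>) ` {-\<bar>m' b\<bar>..\<bar>m' b\<bar>})) < q (k + s)"
        by linarith
    next
      have "real (q (k + s)) * \<eta> \<le> K6 * d"
      proof -
        have "real (q (k + s)) * \<eta> \<le> 2 ^ (k + s) * \<eta>" unfolding \<eta>_def
          using q_le[of "k + s"] nb_ge_1 K_pos d0 by (intro mult_right_mono) auto
        also have "\<dots> = K6 * d" by (simp add: \<eta>_def K6_def power_add)
        finally show ?thesis .
      qed
      then show "real (q (k + s)) * \<eta> < 1" using s3 by simp
    qed
    then obtain v where v: "cm (\<lambda>x. u x \<noteq> v) \<le> real (q (k + s)) * \<eta>" ..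
    also have "real (q (k + s)) * \<eta> \<le> 2 ^ (k + s) * \<eta>" unfolding \<eta>_def
      using q_le[of "k + s"] nb_ge_1 K_pos d0 by (intro mult_right_mono) auto
    also have "\<dots> = K6 * d" by (simp add: \<eta>_def K6_def power_add)
    finally show "\<exists>v. cm (\<lambda>x. F ro' m' x - F ro m x \<noteq> v) \<le> K6 * (D k + D (Suc k))"
      unfolding u_def d_def by blast
  qed
qed

end

section \<open>Quasi-independence of exceptional events\<close>

context sawtooth begin

lemma bs_local:
  assumes no: "\<And>z n. z \<in> (\<lambda>(b, j). X b - real j * \<alpha>) ` (UNIV \<times> {..<N}) \<Longrightarrow> \<not> (min x y \<le> z + of_int n \<and> z + of_int n \<le> max x y)"
  shows "bs \<alpha> \<phi> N x = bs \<alpha> \<phi> N y"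
proof -
  have fr: "frac (x - X b + real j * \<alpha>) - frac (y - X b + real j * \<alpha>) = x - y" if "j < N" for b j
  proof -
    have "frac (x - X b + real j * \<alpha>) - frac (y - X b + real j * \<alpha>) = (x - X b + real j * \<alpha>) - (y - X b + real j * \<alpha>)"
    proof (rule frac_diff_no_int)
      fix n :: int
      have "X b - real j * \<alpha> \<in> (\<lambda>(b, j). X b - real j * \<alpha>) ` (UNIV \<times> {..<N})" using that by force
      from no[OF this, of n]
      show "\<not> (min (x - X b + real j * \<alpha>) (y - X b + real j * \<alpha>) \<le> of_int n \<and> of_int n \<le> max (x - X b + real j * \<alpha>) (y - X b + real j * \<alpha>))"
        by (auto simp: min_def max_def algebra_simps split: if_splits)
    qed
    then show ?thesis by simp
  qed
  have "bs \<alpha> \<phi> N x - bs \<alpha> \<phi> N y = (\<Sum>b\<in>UNIV. (\<Sum>j<N. frac (x - X b + real j * \<alpha>) - frac (y - X b + real j * \<alpha>)) *\<^sub>R \<tau> b)"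
    unfolding bs_phi by (simp add: sum_subtractf scaleR_diff_left)
  also have "\<dots> = (\<Sum>b\<in>UNIV. (real N * (x - y)) *\<^sub>R \<tau> b)" using fr by (intro sum.cong refl) simp
  also have "\<dots> = 0" by (rule sum_const_tau)
  finally show ?thesis by simp
qed

text \<open>The indicator of the exceptional set has at most nb * q k jumps, so Denjoy-Koksma
  compares the orbit sum at y with the one at any z; averaging over z turns the latter into its
  mean.\<close>

lemma orbit_count:
  "(\<Sum>j<q m. of_bool (bs \<alpha> \<phi> (q k) (y + real j * \<alpha>) \<noteq> v)) \<le> real (q m) * cm (\<lambda>x. bs \<alpha> \<phi> (q k) x \<noteq> v) + 6 * (nb * real (q k))"
proof -
  define g where "g x = (of_bool (bs \<alpha> \<phi> (q k) x \<noteq> v) :: real)" for x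
  define S where "S x = (\<Sum>j<q m. g (x + real j * \<alpha>))" for x
  define Fs where "Fs = (\<lambda>(b, j). X b - real j * \<alpha>) ` ((UNIV :: 'b set) \<times> {..<q k})"
  have gm [measurable]: "g \<in> borel_measurable borel" unfolding g_def by measurable
  have gper: "g (x + 1) = g x" for x by (simp add: g_def bs_phi_periodic)
  have "card Fs \<le> card ((UNIV :: 'b set) \<times> {..<q k})" unfolding Fs_def by (rule card_image_le) simp
  then have cF: "real (card Fs) \<le> nb * real (q k)" unfolding nb_def by (simp only: card_cartesian_product card_lessThan of_nat_mult[symmetric] of_nat_le_iff)
  have DK: "S y \<le> S z + 6 * (nb * real (q k))" for z
  proof -
    have "\<bar>S y - S z\<bar> \<le> 2 * 0 + real (6 * card Fs)" unfolding S_def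
    proof (rule denjoy_koksma[where f=g and F=Fs and L=0 and p="p m", OF q_pos q_cop q_app'])
      show "g (x + 1) = g x" for x by (rule gper)
      show "\<bar>g x - g y\<bar> \<le> 1" for x y by (simp add: g_def)
      show "finite Fs" unfolding Fs_def by simp
      fix x y assume "\<And>z n. z \<in> Fs \<Longrightarrow> \<not> (min x y \<le> z + of_int n \<and> z + of_int n \<le> max x y)"
      from bs_local[OF this[unfolded Fs_def]] show "\<bar>g x - g y\<bar> \<le> 0 * \<bar>x - y\<bar>" by (simp add: g_def)
    qed simp
    then show ?thesis using cF by simp
  qed
  have Sm [measurable]: "S \<in> borel_measurable borel" unfolding S_def by measurable
  have g1: "\<bar>g x\<bar> \<le> 1" for x by (simp add: g_def)
  have int_g: "integrable circle (\<lambda>x. g (x + a))" for a by (rule integrable_circle_bounded[where B=1]) (use g1 in auto)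
  have int_S: "integrable circle S" unfolding S_def by (intro Bochner_Integration.integrable_sum int_g)
  have "(LINT x|circle. S x) = (\<Sum>j<q m. LINT x|circle. g (x + real j * \<alpha>))"
    unfolding S_def by (intro Bochner_Integration.integral_sum int_g)
  also have "\<dots> = (\<Sum>j<q m. LINT x|circle. g x)"
    by (intro sum.cong refl integral_circle_shift gm) (rule gper)
  also have "(LINT x|circle. g x) = cm (\<lambda>x. bs \<alpha> \<phi> (q k) x \<noteq> v)"
    unfolding g_def by (rule integral_of_bool_cm) measurable
  finally have IS: "(LINT x|circle. S x) = real (q m) * cm (\<lambda>x. bs \<alpha> \<phi> (q k) x \<noteq> v)" by simp
  have "(LINT z|circle. S y - 6 * (nb * real (q k))) \<le> (LINT z|circle. S z)"
    by (intro integral_mono int_S) (use DK in \<open>auto simp: algebra_simps\<close>)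
  then have "S y - 6 * (nb * real (q k)) \<le> real (q m) * cm (\<lambda>x. bs \<alpha> \<phi> (q k) x \<noteq> v)"
    by (simp add: IS)
  then show ?thesis by (simp add: S_def g_def)
qed

text \<open>The first term is the error of \<open>orbit_count\<close> relative to the orbit length q
  m, the second the change of the event at scale l along that orbit.\<close>

definition K7 :: real where "K7 = 6 * nb / c + nb"

lemma K7_nonneg: "0 \<le> K7" using nb_ge_1 c_pos by (simp add: K7_def)

text \<open>Exchanging the two times turns a long sum moved by j \<alpha> into a sum of length j
  moved by q l * \<alpha>, which is within 2^-l of an integer.\<close>

lemma bs_almost_invariant: "cm (\<lambda>x. bs \<alpha> \<phi> (q l) (x + b + real j * \<alpha>) \<noteq> bs \<alpha> \<phi> (q l) (x + b)) \<le> nb * real j * (1 / 2 ^ l)"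
proof -
  define \<theta> where "\<theta> = real (q l) * \<alpha> - of_int (p l)"
  have eq: "bs \<alpha> \<phi> (q l) (y + real j * \<alpha>) - bs \<alpha> \<phi> (q l) y = bs \<alpha> \<phi> j (y + \<theta>) - bs \<alpha> \<phi> j y" for y
  proof -
    have "bs \<alpha> \<phi> j (y + real (q l) * \<alpha>) = bs \<alpha> \<phi> j (y + \<theta>)"
      using periodic_add_int[of "bs \<alpha> \<phi> j" "y + \<theta>" "p l", OF bs_phi_periodic] by (simp add: \<theta>_def)
    then show ?thesis using bs_add[of \<alpha> \<phi> "q l" j y] bs_add[of \<alpha> \<phi> j "q l" y] by (simp add: add.commute algebra_simps)
  qed
  then have iff: "bs \<alpha> \<phi> (q l) (y + real j * \<alpha>) \<noteq> bs \<alpha> \<phi> (q l) y \<longleftrightarrow> bs \<alpha> \<phi> j (y + \<theta>) \<noteq> bs \<alpha> \<phi> j y" for y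
    by (metis eq_iff_diff_eq_0)
  have "cm (\<lambda>x. bs \<alpha> \<phi> j (x + b + \<theta>) \<noteq> bs \<alpha> \<phi> j (x + b)) = cm (\<lambda>x. bs \<alpha> \<phi> j (x + \<theta>) \<noteq> bs \<alpha> \<phi> j x)"
  proof (rule cm_shift)
    show "(bs \<alpha> \<phi> j (x + 1 + \<theta>) \<noteq> bs \<alpha> \<phi> j (x + 1)) = (bs \<alpha> \<phi> j (x + \<theta>) \<noteq> bs \<alpha> \<phi> j x)" for x
      using bs_phi_periodic[of j x] bs_phi_periodic[of j "x + \<theta>"] by (simp add: algebra_simps)
  qed measurable
  also have "\<dots> \<le> nb * real j * \<bar>\<theta>\<bar>" by (rule bs_shift_measure)
  also have "\<dots> \<le> nb * real j * (1 / 2 ^ l)" using q_app[of l] nb_ge_1 by (intro mult_left_mono) (auto simp: \<theta>_def)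
  finally show ?thesis unfolding iff .
qed

text \<open>Events at scale \<open>l\<close> are nearly invariant along orbit segments that already equidistribute at scale \<open>k\<close>.\<close>

lemma quasi_independent:
  assumes kl: "k < l"
  shows "cm (\<lambda>x. bs \<alpha> \<phi> (q k) (x + a) \<noteq> v \<and> bs \<alpha> \<phi> (q l) (x + b) \<noteq> v') \<le>
    cm (\<lambda>x. bs \<alpha> \<phi> (q k) x \<noteq> v) * cm (\<lambda>x. bs \<alpha> \<phi> (q l) x \<noteq> v') + K7 * (1/2) ^ ((l - k) div 2)"
proof -
  \<comment> \<open>The intermediate scale m = k + h balances the errors: q k / q m and q m / 2^l
    are both of order 2^-h.\<close>
  define h where "h = (l - k) div 2"
  define m where "m = k + h"
  define J where "J = real (q m)"
  have J: "J > 0" "J \<le> 2 ^ m" "c * 2 ^ m \<le> J" using q_pos q_le q_ge by (simp_all add: J_def)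
  define P where "P x \<longleftrightarrow> bs \<alpha> \<phi> (q k) (x + a) \<noteq> v" for x
  define Q where "Q x \<longleftrightarrow> bs \<alpha> \<phi> (q l) (x + b) \<noteq> v'" for x
  define R where "R j x \<longleftrightarrow> bs \<alpha> \<phi> (q l) (x + b + real j * \<alpha>) \<noteq> bs \<alpha> \<phi> (q l) (x + b)" for j x
  have [measurable]: "Measurable.pred borel P" "Measurable.pred borel Q" unfolding P_def Q_def by measurable
  have Rm [measurable]: "Measurable.pred borel (R j)" for j unfolding R_def by measurable
  have per: "bs \<alpha> \<phi> N (x + 1 + a) = bs \<alpha> \<phi> N (x + a)" for N x a
    using bs_phi_periodic[of N "x + a"] by (simp add: algebra_simps)
  have cP: "cm P = cm (\<lambda>x. bs \<alpha> \<phi> (q k) x \<noteq> v)" unfolding P_def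
    by (rule cm_shift) (measurable, simp add: bs_phi_periodic)
  have cQ: "cm Q = cm (\<lambda>x. bs \<alpha> \<phi> (q l) x \<noteq> v')" unfolding Q_def
    by (rule cm_shift) (measurable, simp add: bs_phi_periodic)
  have one: "cm (\<lambda>x. P x \<and> Q x) \<le> cm (\<lambda>x. P (x + real j * \<alpha>) \<and> Q x) + nb * J * (1 / 2 ^ l)" if j: "j < q m" for j
  proof -
    have "cm (\<lambda>x. P x \<and> Q x) = cm (\<lambda>x. P (x + real j * \<alpha>) \<and> Q (x + real j * \<alpha>))"
      by (rule cm_shift[symmetric]) (measurable, simp add: P_def Q_def per)
    also have "\<dots> \<le> cm (\<lambda>x. (P (x + real j * \<alpha>) \<and> Q x) \<or> R j x)"
      by (rule cm_mono) (auto simp: Q_def R_def algebra_simps)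
    also have "\<dots> \<le> cm (\<lambda>x. P (x + real j * \<alpha>) \<and> Q x) + cm (R j)" by (rule cm_or) measurable
    also have "cm (R j) \<le> nb * real j * (1 / 2 ^ l)" unfolding R_def by (rule bs_almost_invariant)
    also have "\<dots> \<le> nb * J * (1 / 2 ^ l)" using j nb_ge_1 by (intro mult_right_mono mult_left_mono) (auto simp: J_def)
    finally show ?thesis by simp
  qed
  have "J * cm (\<lambda>x. P x \<and> Q x) = (\<Sum>j<q m. cm (\<lambda>x. P x \<and> Q x))" by (simp add: J_def)
  also have "\<dots> \<le> (\<Sum>j<q m. cm (\<lambda>x. P (x + real j * \<alpha>) \<and> Q x) + nb * J * (1 / 2 ^ l))"
    using one by (intro sum_mono) auto
  also have "\<dots> = (\<Sum>j<q m. cm (\<lambda>x. P (x + real j * \<alpha>) \<and> Q x)) + J * (nb * J * (1 / 2 ^ l))" by (simp add: sum.distrib J_def)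
  also have "(\<Sum>j<q m. cm (\<lambda>x. P (x + real j * \<alpha>) \<and> Q x)) \<le> (J * cm P + 6 * (nb * real (q k))) * cm Q"
  proof -
    have ib: "integrable circle (\<lambda>x. of_bool (P (x + real j * \<alpha>) \<and> Q x) :: real)" for j
      by (rule integrable_circle_bounded[where B=1]) auto
    have "(\<Sum>j<q m. cm (\<lambda>x. P (x + real j * \<alpha>) \<and> Q x)) = (\<Sum>j<q m. LINT x|circle. of_bool (P (x + real j * \<alpha>) \<and> Q x))"
      by (intro sum.cong refl integral_of_bool_cm[symmetric]) measurable
    also have "\<dots> = (LINT x|circle. (\<Sum>j<q m. of_bool (P (x + real j * \<alpha>) \<and> Q x)))"
      by (rule Bochner_Integration.integral_sum[symmetric]) (rule ib)
    also have "\<dots> \<le> (LINT x|circle. (J * cm P + 6 * (nb * real (q k))) * of_bool (Q x))"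
    proof (rule integral_mono)
      show "integrable circle (\<lambda>x. \<Sum>j<q m. of_bool (P (x + real j * \<alpha>) \<and> Q x) :: real)" by (intro Bochner_Integration.integrable_sum ib)
      show "integrable circle (\<lambda>x. (J * cm P + 6 * (nb * real (q k))) * of_bool (Q x))"
        by (rule integrable_circle_bounded[where B="\<bar>J * cm P + 6 * (nb * real (q k))\<bar>"]) auto
      fix x
      have "(\<Sum>j<q m. of_bool (P (x + real j * \<alpha>)) :: real) \<le> J * cm P + 6 * (nb * real (q k))"
        using orbit_count[of k "x + a" v m] unfolding P_def J_def cP[unfolded P_def] by (simp add: algebra_simps)
      then show "(\<Sum>j<q m. of_bool (P (x + real j * \<alpha>) \<and> Q x)) \<le> (J * cm P + 6 * (nb * real (q k))) * of_bool (Q x)"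
        by (cases "Q x") simp_all
    qed
    also have "\<dots> = (J * cm P + 6 * (nb * real (q k))) * cm Q"
      by (simp add: integral_of_bool_cm)
    finally show ?thesis .
  qed
  finally have "J * cm (\<lambda>x. P x \<and> Q x) \<le> (J * cm P + 6 * (nb * real (q k))) * cm Q + J * (nb * J * (1 / 2 ^ l))" by simp
  also have "\<dots> = J * (cm P * cm Q + 6 * (nb * real (q k)) / J * cm Q + nb * J * (1 / 2 ^ l))" using J by (simp add: field_simps)
  finally have "cm (\<lambda>x. P x \<and> Q x) \<le> cm P * cm Q + 6 * (nb * real (q k)) / J * cm Q + nb * J * (1 / 2 ^ l)"
    using J(1) by (rule mult_left_le_imp_le)
  also have "\<dots> \<le> cm P * cm Q + 6 * nb / c * (1/2) ^ h + nb * (1/2) ^ h"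
  proof -
    have "6 * (nb * real (q k)) / J * cm Q \<le> 6 * (nb * 2 ^ k) / (c * 2 ^ m) * 1"
      using J q_le[of k] nb_ge_1 c_pos cm_le_1[of Q] cm_nonneg[of Q]
      by (intro mult_mono frac_le) auto
    also have "\<dots> = 6 * nb / c * (1/2) ^ h" using c_pos by (simp add: m_def power_add power_divide field_simps)
    finally have 1: "6 * (nb * real (q k)) / J * cm Q \<le> 6 * nb / c * (1/2) ^ h" .
    have "m + h \<le> l" using kl by (simp add: m_def h_def)
    then have "(2::real) ^ m * 2 ^ h \<le> 2 ^ l" unfolding power_add[symmetric] by (intro power_increasing) auto
    then have "(2::real) ^ m / 2 ^ l \<le> (1/2) ^ h" by (simp add: power_divide field_simps)
    moreover have "J * (1 / 2 ^ l) \<le> 2 ^ m * (1 / 2 ^ l)" using J(2) by (rule mult_right_mono) simp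
    ultimately have "nb * (J * (1 / 2 ^ l)) \<le> nb * (1/2) ^ h" using nb_ge_1 by (intro mult_left_mono) auto
    then show ?thesis using 1 by (simp add: mult.assoc)
  qed
  finally show ?thesis unfolding P_def[symmetric] Q_def[symmetric] cP[symmetric] cQ[symmetric]
    by (simp add: K7_def h_def distrib_right)
qed

lemma integral_bs: "(LINT x|circle. bs \<alpha> \<phi> N x) = 0"
proof -
  define I where "I = (LINT x|circle. frac x)"
  have fr1: "norm (frac y :: real) \<le> 1" for y :: real using frac_ge_0[of y] frac_lt_1[of y] by simp
  have ib: "integrable circle (\<lambda>x. frac (x - a))" for a by (rule integrable_circle_bounded[where B=1]) (use fr1 in auto)
  have "(LINT x|circle. \<phi> x) = (\<Sum>b\<in>UNIV. LINT x|circle. frac (x - X b) *\<^sub>R \<tau> b)"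
    unfolding \<phi>_def by (intro Bochner_Integration.integral_sum integrable_scaleR_left ib)
  also have "\<dots> = (\<Sum>b\<in>UNIV. I *\<^sub>R \<tau> b)"
  proof (rule sum.cong[OF refl])
    fix b
    have "(LINT x|circle. frac (x - X b)) = I" unfolding I_def
      using integral_circle_shift[of frac "- X b"] frac_periodic by simp
    then show "(LINT x|circle. frac (x - X b) *\<^sub>R \<tau> b) = I *\<^sub>R \<tau> b" using ib by simp
  qed
  also have "\<dots> = 0" by (rule sum_const_tau)
  finally have phi0: "(LINT x|circle. \<phi> x) = 0" .
  have ip: "integrable circle (\<lambda>x. \<phi> (x + a))" for a
  proof (rule integrable_circle_bounded[where B=T])
    have "norm (\<phi> y) \<le> (\<Sum>b\<in>UNIV. norm (\<tau> b))" for y unfolding \<phi>_def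
      using fr1 by (intro sum_norm_le) (simp add: mult_left_le_one_le)
    then show "norm (\<phi> (x + a)) \<le> T" for x by (simp add: T_def)
  qed measurable
  have "(LINT x|circle. bs \<alpha> \<phi> N x) = (\<Sum>k<N. LINT x|circle. \<phi> (x + real k * \<alpha>))"
    unfolding bs_def by (intro Bochner_Integration.integral_sum ip)
  also have "\<dots> = (\<Sum>k<N. LINT x|circle. \<phi> x)"
    by (intro sum.cong refl integral_circle_shift phi_borel phi_periodic)
  finally show ?thesis by (simp add: phi0)
qed

text \<open>Each block of the cocycle identity is shifted by the lengths of the blocks before it;
  hence the arbitrary shifts in \<open>quasi_independent\<close> and
  \<open>rare_events\<close>.\<close>

lemma bs_sum_scales:
  assumes "finite S"
  shows "\<exists>a. \<forall>x. bs \<alpha> \<phi> (\<Sum>k\<in>S. q k) x = (\<Sum>k\<in>S. bs \<alpha> \<phi> (q k) (x + a k))"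
  using assms
proof (induction S)
  case empty
  then show ?case by (simp add: bs_def)
next
  case (insert s S)
  then obtain a where a: "\<And>x. bs \<alpha> \<phi> (\<Sum>k\<in>S. q k) x = (\<Sum>k\<in>S. bs \<alpha> \<phi> (q k) (x + a k))" by auto
  define a' where "a' = a(s := real (\<Sum>k\<in>S. q k) * \<alpha>)"
  have "bs \<alpha> \<phi> (\<Sum>k\<in>insert s S. q k) x = (\<Sum>k\<in>insert s S. bs \<alpha> \<phi> (q k) (x + a' k))" for x
  proof -
    have "bs \<alpha> \<phi> (\<Sum>k\<in>insert s S. q k) x = bs \<alpha> \<phi> ((\<Sum>k\<in>S. q k) + q s) x" using insert by (simp add: add.commute)
    also have "\<dots> = (\<Sum>k\<in>S. bs \<alpha> \<phi> (q k) (x + a k)) + bs \<alpha> \<phi> (q s) (x + a' s)" by (simp add: bs_add a a'_def)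
    also have "(\<Sum>k\<in>S. bs \<alpha> \<phi> (q k) (x + a k)) = (\<Sum>k\<in>S. bs \<alpha> \<phi> (q k) (x + a' k))"
      using insert by (intro sum.cong refl) (auto simp: a'_def)
    finally show ?thesis using insert by (simp add: add.commute)
  qed
  then show ?case by blast
qed

text \<open>The first claim is a union bound. For the second, when exactly one event happens the sum
  misses W by a single non-zero deviation, of norm at most 8 T + 8 T. The third holds because the
  sums have mean 0, so that -W is the mean deviation.\<close>

lemma rare_events:
  assumes S: "finite S" and w: "\<And>k. norm (w k) \<le> 8 * T"
    and pairs: "\<And>k l a b. k \<in> S \<Longrightarrow> l \<in> S \<Longrightarrow> k \<noteq> l \<Longrightarrow>
      cm (\<lambda>x. bs \<alpha> \<phi> (q k) (x + a) \<noteq> w k \<and> bs \<alpha> \<phi> (q l) (x + b) \<noteq> w l) \<le> B k l"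
  defines "\<delta> \<equiv> \<lambda>k. cm (\<lambda>x. bs \<alpha> \<phi> (q k) x \<noteq> w k)" and "N \<equiv> (\<Sum>k\<in>S. q k)" and "W \<equiv> (\<Sum>k\<in>S. w k)"
  shows "cm (\<lambda>x. bs \<alpha> \<phi> N x = W) \<ge> 1 - sum \<delta> S"
    and "cm (\<lambda>x. bs \<alpha> \<phi> N x \<noteq> W \<and> norm (bs \<alpha> \<phi> N x - W) \<le> 16 * T) \<ge> sum \<delta> S - (\<Sum>k\<in>S. \<Sum>l\<in>S - {k}. B k l)"
    and "norm W \<le> 16 * T * sum \<delta> S"
proof -
  obtain a where a: "\<And>x. bs \<alpha> \<phi> N x = (\<Sum>k\<in>S. bs \<alpha> \<phi> (q k) (x + a k))"
    using bs_sum_scales[OF S] unfolding N_def by blast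
  define A where "A k x \<longleftrightarrow> bs \<alpha> \<phi> (q k) (x + a k) \<noteq> w k" for k x
  have Am [measurable]: "Measurable.pred borel (A k)" for k unfolding A_def by measurable
  have cA: "cm (A k) = \<delta> k" for k unfolding A_def \<delta>_def
    by (rule cm_shift) (measurable, simp add: bs_phi_periodic)
  have diff: "bs \<alpha> \<phi> N x - W = (\<Sum>k\<in>S. bs \<alpha> \<phi> (q k) (x + a k) - w k)" for x by (simp add: a W_def sum_subtractf)
  have n16: "norm (bs \<alpha> \<phi> (q k) y - w k) \<le> 16 * T" for k y
    using norm_triangle_ineq4[of "bs \<alpha> \<phi> (q k) y" "w k"] bs_bounded[of k y] w[of k] by linarith
  have none: "bs \<alpha> \<phi> N x = W" if "\<not> (\<exists>k\<in>S. A k x)" for x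
  proof -
    have "(\<Sum>k\<in>S. bs \<alpha> \<phi> (q k) (x + a k) - w k) = 0" using that by (intro sum.neutral) (auto simp: A_def)
    then show ?thesis using diff[of x] by simp
  qed
  have Exm [measurable]: "Measurable.pred borel (\<lambda>x. \<exists>k\<in>S. A k x)" using S by (intro pred_intros_finite) auto
  have "1 - sum \<delta> S \<le> 1 - cm (\<lambda>x. \<exists>k\<in>S. A k x)" using cm_Bex[OF S, of A] Am by (simp add: cA)
  also have "\<dots> = cm (\<lambda>x. \<not> (\<exists>k\<in>S. A k x))" by (rule cm_not[symmetric]) measurable
  also have "\<dots> \<le> cm (\<lambda>x. bs \<alpha> \<phi> N x = W)" by (rule cm_mono) (use none in \<open>auto intro: Exm\<close>)
  finally show "cm (\<lambda>x. bs \<alpha> \<phi> N x = W) \<ge> 1 - sum \<delta> S" .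
  define E where "E x \<longleftrightarrow> bs \<alpha> \<phi> N x \<noteq> W \<and> norm (bs \<alpha> \<phi> N x - W) \<le> 16 * T" for x
  have Em [measurable]: "Measurable.pred borel E" unfolding E_def by measurable
  have iA: "integrable circle (\<lambda>x. of_bool (A k x) :: real)" for k by (rule integrable_circle_bounded[where B=1]) auto
  have iAA: "integrable circle (\<lambda>x. of_bool (A k x \<and> A l x) :: real)" for k l by (rule integrable_circle_bounded[where B=1]) auto
  \<comment> \<open>With n events happening the left side is n - n (n - 1): it equals 1 for n = 1
    and is at most 0 otherwise, a Bonferroni bound for exactly one event.\<close>
  have pt: "(\<Sum>k\<in>S. of_bool (A k x)) - (\<Sum>k\<in>S. \<Sum>l\<in>S - {k}. of_bool (A k x \<and> A l x)) \<le> (of_bool (E x) :: real)" for x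
  proof -
    define M where "M = {k\<in>S. A k x}"
    have M: "finite M" using S by (simp add: M_def)
    have s1: "(\<Sum>k\<in>S. of_bool (A k x) :: real) = card M" unfolding M_def using S by (simp add: sum_of_bool_eq Int_def)
    have s2: "(\<Sum>k\<in>S. \<Sum>l\<in>S - {k}. of_bool (A k x \<and> A l x) :: real) = real (card M) * (real (card M) - 1)"
    proof -
      have "(\<Sum>k\<in>S. \<Sum>l\<in>S - {k}. of_bool (A k x \<and> A l x) :: real) = (\<Sum>k\<in>S. if A k x then real (card M) - 1 else 0)"
      proof (rule sum.cong[OF refl])
        fix k assume k: "k \<in> S"
        show "(\<Sum>l\<in>S - {k}. of_bool (A k x \<and> A l x) :: real) = (if A k x then real (card M) - 1 else 0)"
        proof (cases "A k x")
          case True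
          have "(\<Sum>l\<in>S - {k}. of_bool (A k x \<and> A l x) :: real) = (\<Sum>l\<in>S - {k}. of_bool (A l x))" using True by simp
          also have "\<dots> = (\<Sum>l\<in>S. of_bool (A l x)) - of_bool (A k x)" using S k by (subst sum_diff1) auto
          finally show ?thesis using True s1 by simp
        qed simp
      qed
      also have "\<dots> = (\<Sum>k\<in>M. real (card M) - 1)" unfolding M_def by (rule sum.mono_neutral_cong_right) (use S in auto)
      finally show ?thesis by simp
    qed
    consider "card M = 0" | "card M = 1" | "card M \<ge> 2" by linarith
    then show ?thesis
    proof cases
      case 1
      then show ?thesis unfolding s1 s2 by simp
    next
      case 2
      then obtain k where k: "M = {k}" by (auto simp: card_1_singleton_iff)
      then have kS: "k \<in> S" "A k x" "\<And>l. l \<in> S \<Longrightarrow> l \<noteq> k \<Longrightarrow> \<not> A l x" by (auto simp: M_def)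
      have "bs \<alpha> \<phi> N x - W = bs \<alpha> \<phi> (q k) (x + a k) - w k"
      proof -
        have "(\<Sum>l\<in>S. bs \<alpha> \<phi> (q l) (x + a l) - w l) = (\<Sum>l\<in>{k}. bs \<alpha> \<phi> (q l) (x + a l) - w l)"
          using kS S by (intro sum.mono_neutral_right) (auto simp: A_def)
        then show ?thesis by (simp add: diff)
      qed
      moreover have "bs \<alpha> \<phi> (q k) (x + a k) \<noteq> w k" using kS(2) by (simp add: A_def)
      ultimately have "E x" unfolding E_def using n16[of k "x + a k"] by (metis eq_iff_diff_eq_0)
      then show ?thesis unfolding s1 s2 using 2 by simp
    next
      case 3
      then have "real (card M) * 1 \<le> real (card M) * (real (card M) - 1)" by (intro mult_left_mono) auto
      then show ?thesis unfolding s1 s2 by (cases "E x") simp_all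
    qed
  qed
  have "(LINT x|circle. (\<Sum>k\<in>S. of_bool (A k x)) - (\<Sum>k\<in>S. \<Sum>l\<in>S - {k}. of_bool (A k x \<and> A l x))) \<le> (LINT x|circle. (of_bool (E x) :: real))"
    using pt by (intro integral_mono Bochner_Integration.integrable_diff Bochner_Integration.integrable_sum iA iAA)
      (auto intro: integrable_circle_bounded[where B=1])
  also have "(LINT x|circle. of_bool (E x)) = cm E" by (rule integral_of_bool_cm) measurable
  also have "(LINT x|circle. (\<Sum>k\<in>S. of_bool (A k x)) - (\<Sum>k\<in>S. \<Sum>l\<in>S - {k}. of_bool (A k x \<and> A l x))) =
      (\<Sum>k\<in>S. LINT x|circle. (of_bool (A k x) :: real)) - (\<Sum>k\<in>S. \<Sum>l\<in>S - {k}. LINT x|circle. of_bool (A k x \<and> A l x))"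
    by (simp add: Bochner_Integration.integral_diff Bochner_Integration.integral_sum Bochner_Integration.integrable_sum iA iAA)
  also have "\<dots> = sum \<delta> S - (\<Sum>k\<in>S. \<Sum>l\<in>S - {k}. cm (\<lambda>x. A k x \<and> A l x))"
    by (simp add: integral_of_bool_cm cA)
  finally have "sum \<delta> S - (\<Sum>k\<in>S. \<Sum>l\<in>S - {k}. cm (\<lambda>x. A k x \<and> A l x)) \<le> cm E" .
  moreover have "(\<Sum>k\<in>S. \<Sum>l\<in>S - {k}. cm (\<lambda>x. A k x \<and> A l x)) \<le> (\<Sum>k\<in>S. \<Sum>l\<in>S - {k}. B k l)"
    unfolding A_def using pairs by (intro sum_mono) auto
  ultimately show "cm (\<lambda>x. bs \<alpha> \<phi> N x \<noteq> W \<and> norm (bs \<alpha> \<phi> N x - W) \<le> 16 * T) \<ge> sum \<delta> S - (\<Sum>k\<in>S. \<Sum>l\<in>S - {k}. B k l)"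
    unfolding E_def by linarith
  have ibs: "integrable circle (\<lambda>x. bs \<alpha> \<phi> (q k) (x + b))" for k b
    by (rule integrable_circle_bounded[where B="8 * T"]) (use bs_bounded in auto)
  have "(LINT x|circle. bs \<alpha> \<phi> N x - W) = - W"
  proof -
    have "integrable circle (\<lambda>x. bs \<alpha> \<phi> N x)" unfolding a by (intro Bochner_Integration.integrable_sum ibs)
    then show ?thesis by (simp add: integral_bs)
  qed
  then have "norm W = norm (LINT x|circle. bs \<alpha> \<phi> N x - W)" by simp
  also have "\<dots> \<le> (LINT x|circle. norm (bs \<alpha> \<phi> N x - W))" by (rule integral_norm_bound)
  also have "\<dots> \<le> (LINT x|circle. (\<Sum>k\<in>S. 16 * T * of_bool (A k x)))"
  proof (rule integral_mono)
    show "integrable circle (\<lambda>x. norm (bs \<alpha> \<phi> N x - W))"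
      unfolding a by (intro integrable_norm Bochner_Integration.integrable_diff Bochner_Integration.integrable_sum ibs) auto
    show "integrable circle (\<lambda>x. \<Sum>k\<in>S. 16 * T * of_bool (A k x))"
      by (intro Bochner_Integration.integrable_sum integrable_mult_right iA)
    show "norm (bs \<alpha> \<phi> N x - W) \<le> (\<Sum>k\<in>S. 16 * T * of_bool (A k x))" for x
      unfolding diff using n16 by (intro sum_norm_le) (auto simp: A_def)
  qed
  also have "\<dots> = (\<Sum>k\<in>S. 16 * T * \<delta> k)"
    by (simp add: Bochner_Integration.integral_sum iA integral_of_bool_cm cA)
  finally show "norm W \<le> 16 * T * sum \<delta> S" by (simp add: sum_distrib_left)
qed

end

section \<open>Majority values and the Cauchy property modulo constants\<close>

lemma sum_half_powers:
  assumes "finite S" "\<And>k. k \<in> S \<Longrightarrow> n \<le> k"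
  shows "(\<Sum>k\<in>S. (1/2::real) ^ k) \<le> 2 * (1/2) ^ n"
proof -
  obtain N where N: "\<And>l. l \<in> S \<Longrightarrow> l < N" using assms(1) by (meson finite_nat_bounded lessThan_iff subsetD)
  have geo: "(\<Sum>k\<in>{n..<M}. (1/2::real) ^ k) = 2 * (1/2) ^ n - 2 * (1/2) ^ M" if "n \<le> M" for M
    using that by (induction M rule: dec_induct) simp_all
  have sub: "S \<subseteq> {n..<max n N}"
  proof
    fix k assume "k \<in> S"
    then show "k \<in> {n..<max n N}" using N[of k] assms(2)[of k] by simp
  qed
  have "(\<Sum>k\<in>S. (1/2::real) ^ k) \<le> (\<Sum>k\<in>{n..<max n N}. (1/2) ^ k)"
    by (intro sum_mono2 sub) simp_all
  also have "\<dots> \<le> 2 * (1/2) ^ n" using geo[of "max n N"] by simp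
  finally show ?thesis .
qed

lemma cm_True: "cm (\<lambda>x. True) = 1"
proof -
  have "{x \<in> {0..<1::real}. True} = {0..<1}" by auto
  then show ?thesis unfolding cm_def by (simp only: measure_space_circle)
qed

text \<open>e k is the largest admissible exponent up to k; the cap at k covers \<delta> k = 0 and
  accounts for the summand (1/2)^k.\<close>

lemma dyadic_heights:
  fixes \<delta> :: "nat \<Rightarrow> real"
  assumes "\<And>k. \<delta> k \<le> 1" "\<delta> \<longlonglongrightarrow> 0"
  shows "\<exists>e. (\<forall>k. \<delta> k \<le> (1/2) ^ e k) \<and> (\<forall>k. (1/2) ^ e k \<le> 2 * \<bar>\<delta> k\<bar> + (1/2) ^ k) \<and> (\<forall>M::nat. \<exists>n. \<forall>k\<ge>n. M \<le> e k)"
proof -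
  define E where "E k = {j\<in>{..k}. \<delta> k \<le> (1/2) ^ j}" for k
  define e where "e k = Max (E k)" for k
  have E: "finite (E k)" "0 \<in> E k" for k using assms(1) by (auto simp: E_def)
  have eE: "e k \<in> E k" for k unfolding e_def using E[of k] by (intro Max_in) auto
  have emax: "j \<le> e k" if "j \<in> E k" for j k unfolding e_def using E[of k] that by (intro Max_ge) auto
  show ?thesis
  proof (intro exI[of _ e] conjI allI)
    fix k show "\<delta> k \<le> (1/2) ^ e k" using eE[of k] by (simp add: E_def)
    show "(1/2) ^ e k \<le> 2 * \<bar>\<delta> k\<bar> + (1/2) ^ k"
    proof (cases "e k = k")
      case False
      then have "Suc (e k) \<notin> E k" "Suc (e k) \<le> k" using emax[of "Suc (e k)" k] eE[of k] by (auto simp: E_def)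
      then have "(1/2) ^ Suc (e k) < \<delta> k" by (auto simp: E_def)
      then have "(1/2) ^ e k \<le> 2 * \<bar>\<delta> k\<bar>" by simp
      moreover have "(0::real) \<le> (1/2) ^ k" by simp
      ultimately show ?thesis by linarith
    qed simp
  next
    fix M :: nat
    have "eventually (\<lambda>k. \<delta> k < (1/2) ^ M) sequentially" using assms(2) by (rule order_tendstoD) simp
    then obtain n where n: "\<And>k. k \<ge> n \<Longrightarrow> \<delta> k < (1/2) ^ M" by (auto simp: eventually_sequentially)
    have "M \<le> e k" if "k \<ge> max n M" for k using n[of k] that by (intro emax) (auto simp: E_def)
    then show "\<exists>n. \<forall>k\<ge>n. M \<le> e k" by blast
  qed
qed

context sawtooth begin

text \<open>The hypothesis rules out finite non-zero limit values: along times \<open>N\<close> with \<open>N \<alpha>\<close> close to an integer, the sums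
  cannot take one bounded value \<open>w\<close> and other bounded values, each with probability bounded away from 0.\<close>

definition no_finite_values :: bool where
  "no_finite_values \<longleftrightarrow> (\<forall>R \<epsilon>. \<epsilon> > 0 \<longrightarrow> (\<exists>\<eta>>0. \<forall>N (j::int) w. \<bar>real N * \<alpha> - of_int j\<bar> < \<eta> \<longrightarrow> norm w \<le> R \<longrightarrow>
     \<epsilon> \<le> cm (\<lambda>x. bs \<alpha> \<phi> N x = w) \<longrightarrow> cm (\<lambda>x. bs \<alpha> \<phi> N x \<noteq> w \<and> norm (bs \<alpha> \<phi> N x - w) \<le> R) < \<epsilon>))"

text \<open>The values at time q k differ by bounded integral vectors, so one of boundedly many has
  probability at least 1/M. By \<open>no_finite_values\<close> all others together become
  negligible.\<close>

lemma majority_values: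
  assumes K: no_finite_values
  shows "\<exists>w. (\<forall>k. norm (w k) \<le> 8 * T) \<and> (\<lambda>k. cm (\<lambda>x. bs \<alpha> \<phi> (q k) x \<noteq> w k)) \<longlonglongrightarrow> 0"
proof -
  define V where "V = {z \<in> int_vecs. norm (z :: real ^ 'n) \<le> 16 * T}"
  have V: "finite V" "0 \<in> V" unfolding V_def using finite_int_vecs_bounded T_nonneg by auto
  define M where "M = real (card V)"
  have M: "M > 0" unfolding M_def using V by (simp add: card_gt_0_iff) blast
  have "\<exists>v. norm v \<le> 8 * T \<and> 1 / M \<le> cm (\<lambda>x. bs \<alpha> \<phi> (q k) x = v)" for k
  proof -
    define P where "P z x \<longleftrightarrow> bs \<alpha> \<phi> (q k) x = bs \<alpha> \<phi> (q k) 0 + z" for z x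
    have Pm: "Measurable.pred borel (P z)" for z unfolding P_def by measurable
    have "\<exists>z\<in>V. P z x" for x
    proof
      show "P (bs \<alpha> \<phi> (q k) x - bs \<alpha> \<phi> (q k) 0) x" by (simp add: P_def)
      show "bs \<alpha> \<phi> (q k) x - bs \<alpha> \<phi> (q k) 0 \<in> V" unfolding V_def
        using bs_diff_int norm_triangle_ineq4[of "bs \<alpha> \<phi> (q k) x" "bs \<alpha> \<phi> (q k) 0"] bs_bounded[of k x] bs_bounded[of k 0]
        by (auto intro: order_trans)
    qed
    then have "cm (\<lambda>x. \<exists>z\<in>V. P z x) = cm (\<lambda>x. True)" by simp
    then have "1 = cm (\<lambda>x. \<exists>z\<in>V. P z x)" by (simp only: cm_True)
    also have "\<dots> \<le> (\<Sum>z\<in>V. cm (P z))" by (rule cm_Bex[OF V(1) Pm])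
    finally have ge: "1 \<le> (\<Sum>z\<in>V. cm (P z))" .
    have "\<exists>z\<in>V. 1 / M \<le> cm (P z)"
    proof (rule ccontr)
      assume "\<not> ?thesis"
      then have "(\<Sum>z\<in>V. cm (P z)) < (\<Sum>z\<in>V. 1 / M)" using V by (intro sum_strict_mono) (auto simp: not_le)
      then show False using ge M by (simp add: M_def)
    qed
    then obtain z where z: "1 / M \<le> cm (P z)" by blast
    then have "0 < cm (P z)" using M by (metis less_le_trans zero_less_divide_1_iff)
    then obtain x where "P z x" using ex_cm_pos by blast
    then have "norm (bs \<alpha> \<phi> (q k) 0 + z) \<le> 8 * T" using bs_bounded[of k x] by (simp add: P_def)
    then show ?thesis using z unfolding P_def by blast
  qed
  then obtain w where w: "\<And>k. norm (w k) \<le> 8 * T" "\<And>k. 1 / M \<le> cm (\<lambda>x. bs \<alpha> \<phi> (q k) x = w k)" by metis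
  have "(\<lambda>k. cm (\<lambda>x. bs \<alpha> \<phi> (q k) x \<noteq> w k)) \<longlonglongrightarrow> 0"
  proof (rule LIMSEQ_I)
    fix r :: real assume r: "0 < r"
    define \<epsilon> where "\<epsilon> = min r (1 / M)"
    have e0: "\<epsilon> > 0" using r M by (simp add: \<epsilon>_def)
    obtain \<eta> where eta: "\<eta> > 0" "\<And>N (j::int) w. \<bar>real N * \<alpha> - of_int j\<bar> < \<eta> \<Longrightarrow> norm w \<le> 16 * T \<Longrightarrow>
       \<epsilon> \<le> cm (\<lambda>x. bs \<alpha> \<phi> N x = w) \<Longrightarrow> cm (\<lambda>x. bs \<alpha> \<phi> N x \<noteq> w \<and> norm (bs \<alpha> \<phi> N x - w) \<le> 16 * T) < \<epsilon>"
      using K e0 unfolding no_finite_values_def by meson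
    obtain n where n: "(1/2::real) ^ n < \<eta>" using real_arch_pow_inv[OF eta(1), of "1/2"] by auto
    have "norm (cm (\<lambda>x. bs \<alpha> \<phi> (q k) x \<noteq> w k) - 0) < r" if k: "k \<ge> n" for k
    proof -
      have "(1/2::real) ^ k \<le> (1/2) ^ n" using k by (intro power_decreasing) auto
      then have "\<bar>real (q k) * \<alpha> - of_int (p k)\<bar> < \<eta>" using q_app[of k] n by (simp add: power_divide)
      moreover have "norm (w k) \<le> 16 * T" using w(1)[of k] T_nonneg by simp
      moreover have "\<epsilon> \<le> cm (\<lambda>x. bs \<alpha> \<phi> (q k) x = w k)" using w(2)[of k] by (simp add: \<epsilon>_def min.coboundedI2)
      ultimately have lt: "cm (\<lambda>x. bs \<alpha> \<phi> (q k) x \<noteq> w k \<and> norm (bs \<alpha> \<phi> (q k) x - w k) \<le> 16 * T) < \<epsilon>" by (rule eta(2))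
      have "norm (bs \<alpha> \<phi> (q k) x - w k) \<le> 16 * T" for x
        using norm_triangle_ineq4[of "bs \<alpha> \<phi> (q k) x" "w k"] bs_bounded[of k x] w(1)[of k] by linarith
      then have "cm (\<lambda>x. bs \<alpha> \<phi> (q k) x \<noteq> w k) < \<epsilon>" using lt by simp
      then show ?thesis using cm_nonneg[of "\<lambda>x. bs \<alpha> \<phi> (q k) x \<noteq> w k"] by (simp add: \<epsilon>_def)
    qed
    then show "\<exists>no. \<forall>k\<ge>no. norm (cm (\<lambda>x. bs \<alpha> \<phi> (q k) x \<noteq> w k) - 0) < r" by blast
  qed
  then show ?thesis using w(1) by blast
qed

end

context heights begin

text \<open>A scale is labelled by a nearby centre from the separated set, by a block of half the
  centre's exponent, and by its root map. Equal labels give equal offsets by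
  \<open>good_data_unique\<close>, so \<open>loop_erasure\<close> bounds the cost of a path by a
  constant times the weight of the centres. A cost that stays large leaves centres of weight between
  \<eta>/2 and \<eta>, for which \<open>rare_events\<close> contradicts
  \<open>no_finite_values\<close>.\<close>

lemma cauchy_transfer:
  assumes K: no_finite_values and w: "\<And>k. norm (w k) \<le> 8 * T"
    and e2: "\<And>k. D k \<le> 2 * cm (\<lambda>x. bs \<alpha> \<phi> (q k) x \<noteq> w k) + (1/2) ^ k"
    and e3: "\<And>M::nat. \<exists>n. \<forall>k\<ge>n. M \<le> e k"
  obtains k1 ro m where "\<And>k. k \<ge> k1 \<Longrightarrow> good_data k (ro k) (m k)"
    "\<And>\<epsilon>. \<epsilon> > 0 \<Longrightarrow> \<exists>n\<ge>k1. \<forall>i\<ge>n. \<forall>j\<ge>i. \<exists>v. cm (\<lambda>x. F (ro j) (m j) x - F (ro i) (m i) x \<noteq> v) \<le> \<epsilon>"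
proof -
  have Dsmall: "\<exists>n. \<forall>k\<ge>n. D k < \<epsilon>" if eps: "\<epsilon> > 0" for \<epsilon>
  proof -
    obtain M where M: "(1/2::real) ^ M < \<epsilon>" using real_arch_pow_inv[OF eps, of "1/2"] by auto
    obtain n where n: "\<And>k. k \<ge> n \<Longrightarrow> M \<le> e k" using e3 by blast
    have "D k < \<epsilon>" if "k \<ge> n" for k
    proof -
      have "D k \<le> (1/2) ^ M" unfolding D_def using n[OF that] by (intro power_decreasing) auto
      then show ?thesis using M by simp
    qed
    then show ?thesis by blast
  qed
  obtain \<eta>0 K6 where cons: "\<eta>0 > 0" "K6 \<ge> 0"
    "\<And>k ro m ro' m'. good_data k ro m \<Longrightarrow> good_data (Suc k) ro' m' \<Longrightarrow> D k + D (Suc k) < \<eta>0 \<Longrightarrow>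
       \<exists>v. cm (\<lambda>x. F ro' m' x - F ro m x \<noteq> v) \<le> K6 * (D k + D (Suc k))"
    by (rule consecutive, rule that)
  have "\<exists>n. \<forall>k\<ge>n. D k < \<eta>0 / 2" using cons(1) by (intro Dsmall) simp
  then obtain n1 where n1: "\<And>k. k \<ge> n1 \<Longrightarrow> D k < \<eta>0 / 2" by blast
  have "\<exists>n. \<forall>k\<ge>n. D k < min c 1 / C" using c_pos C_pos by (intro Dsmall) simp
  then obtain n2 where n2: "\<And>k. k \<ge> n2 \<Longrightarrow> D k < min c 1 / C" by blast
  have "c / (4 * K0 * K1) > 0" using c_pos K_pos by simp
  then obtain M3 where M3: "(1/2::real) ^ M3 < c / (4 * K0 * K1)" using real_arch_pow_inv[of "c / (4 * K0 * K1)" "1/2"] by auto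
  \<comment> \<open>Half of the exponent will pay for the gap of scales in \<open>same\<close>; the
    other half is at least \<open>M3\<close> and makes the product small enough for
    \<open>good_data_unique\<close>.\<close>
  obtain n3 where n3: "\<And>k. k \<ge> n3 \<Longrightarrow> 2 * M3 + 2 \<le> e k" using e3 by blast
  define k1 where "k1 = Max {n1, n2, n3}"
  have k1: "n1 \<le> k1" "n2 \<le> k1" "n3 \<le> k1" by (auto simp: k1_def)
  have "\<exists>ro m. good_data k ro m" if k: "k \<ge> k1" for k
  proof -
    have "C * D k < min c 1" using n2[of k] k k1 C_pos by (simp add: field_simps)
    then show ?thesis by (intro ex_good_data) auto
  qed
  then obtain ro m where data: "\<And>k. k \<ge> k1 \<Longrightarrow> good_data k (ro k) (m k)" by metis
  define Rel where "Rel i j \<epsilon> \<longleftrightarrow> (\<exists>v. cm (\<lambda>x. F (ro j) (m j) x - F (ro i) (m i) x \<noteq> v) \<le> \<epsilon>)" for i j \<epsilon>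
  have Rel_tr: "Rel i k (a + b)" if h: "Rel i j a" "Rel j k b" for i j k a b
  proof -
    obtain v v' where v: "cm (\<lambda>x. F (ro j) (m j) x - F (ro i) (m i) x \<noteq> v) \<le> a" "cm (\<lambda>x. F (ro k) (m k) x - F (ro j) (m j) x \<noteq> v') \<le> b"
      using h unfolding Rel_def by blast
    have "cm (\<lambda>x. F (ro k) (m k) x - F (ro i) (m i) x \<noteq> v + v') \<le>
        cm (\<lambda>x. F (ro j) (m j) x - F (ro i) (m i) x \<noteq> v \<or> F (ro k) (m k) x - F (ro j) (m j) x \<noteq> v')"
      by (rule cm_mono) (auto simp: algebra_simps)
    also have "\<dots> \<le> cm (\<lambda>x. F (ro j) (m j) x - F (ro i) (m i) x \<noteq> v) + cm (\<lambda>x. F (ro k) (m k) x - F (ro j) (m j) x \<noteq> v')"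
      by (rule cm_or) measurable
    finally show ?thesis using v unfolding Rel_def by (intro exI[of _ "v + v'"]) linarith
  qed
  have Rel_mono: "Rel i j b" if "Rel i j a" "a \<le> b" for i j a b
    using that unfolding Rel_def by (meson order_trans)
  have Rel_refl: "Rel k k' 0" if "ro k = ro k'" "m k = m k'" for k k'
    unfolding Rel_def using that by (intro exI[of _ 0]) (simp add: cm_def)
  have Rel_step: "Rel k (Suc k) (K6 * (D k + D (Suc k)))" if k: "k \<ge> k1" for k
  proof -
    have "D k + D (Suc k) < \<eta>0" using n1[of k] n1[of "Suc k"] k k1 by simp
    then show ?thesis unfolding Rel_def using cons(3)[OF data[OF k] data[of "Suc k"]] k by simp
  qed
  have KD: "0 \<le> K6 * D l" for l by (rule mult_nonneg_nonneg[OF cons(2) less_imp_le[OF D_pos]])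
  define \<Lambda> where "\<Lambda> = 25 * real (card (UNIV :: ('b \<Rightarrow> 'b) set))"
  have Lam: "\<Lambda> \<ge> 0" by (simp add: \<Lambda>_def)
  have h_pos: "e l div 2 > 0" if "l \<ge> k1" for l using n3[of l] that k1 by simp
  have same: "m k = m k'" if k: "k1 \<le> k" "k \<le> k'" and l: "l \<ge> k1" "D k \<le> D l" "D k' \<le> D l"
      and near: "k' - k < e l div 2" and rr: "ro k = ro k'" for k k' l
  proof (rule good_data_unique[of k "ro k" _ k' _ "D l"])
    have "2 ^ (k' - k) * D l \<le> (2::real) ^ (e l div 2) * (1/2) ^ (e l)"
      unfolding D_def using near by (intro mult_right_mono power_increasing) auto
    also have "\<dots> = (1/2) ^ (e l - e l div 2)" by (simp add: power_diff power_one_over)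
    also have "\<dots> \<le> (1/2) ^ M3" using n3[of l] l k1 by (intro power_decreasing) auto
    also have "\<dots> < c / (4 * K0 * K1)" by (rule M3)
    finally have "(4 * K0 * K1) * (2 ^ (k' - k) * D l) < c"
      using K_pos by (simp add: pos_less_divide_eq mult.commute)
    then show "4 * K0 * K1 * 2 ^ (k' - k) * D l < c" by (simp add: mult.assoc)
  qed (use data[of k] data[of k'] k l rr in auto)
  have claim: "\<exists>S\<subseteq>{i..j}. (\<forall>k\<in>S. \<forall>l\<in>S. k \<noteq> l \<longrightarrow> e k \<le> e l \<longrightarrow> 4 * int (e k) \<le> \<bar>int k - int l\<bar>) \<and>
      Rel i j (2 * (K6 * \<Lambda> * sum D S))" if ij: "k1 \<le> i" "i \<le> j" for i j
  proof -
    obtain S where S: "S \<subseteq> {i..j}" "\<forall>k\<in>S. \<forall>l\<in>S. k \<noteq> l \<longrightarrow> e k \<le> e l \<longrightarrow> 4 * int (e k) \<le> \<bar>int k - int l\<bar>"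
        "\<forall>k\<in>{i..j}. \<exists>l\<in>S. e l \<le> e k \<and> (k = l \<or> \<bar>int k - int l\<bar> < 4 * int (e l))"
      using greedy_separated[of "{i..j}" e] by auto
    have finS: "finite S" using S(1) finite_subset by blast
    obtain cl where cl: "\<And>k. k \<in> {i..j} \<Longrightarrow> cl k \<in> S \<and> e (cl k) \<le> e k \<and> (k = cl k \<or> \<bar>int k - int (cl k)\<bar> < 4 * int (e (cl k)))"
      using S(3) by metis
    \<comment> \<open>The offset from the centre, raised by 4 e to be non-negative and cut into
      blocks of length h = e div 2. As e \<le> 2 h + 1 and h \<ge> 1, it is below 8 e \<le> 24 h, so
      25 blocks suffice.\<close>
    define t where "t k = nat ((int k + 4 * int (e (cl k)) - int (cl k)) div int (e (cl k) div 2))" for k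
    define lab where "lab k = (cl k, t k, ro k)" for k
    define wt where "wt = (\<lambda>(l::nat, t::nat, r::'b \<Rightarrow> 'b). K6 * D l)"
    have clk1: "cl k \<ge> k1" if "k \<in> {i..j}" for k using cl[OF that] S(1) ij by auto
    have num: "0 \<le> int k + 4 * int (e (cl k)) - int (cl k)" "int k + 4 * int (e (cl k)) - int (cl k) < 8 * int (e (cl k))"
      if "k \<in> {i..j}" for k using cl[OF that] h_pos[OF clk1[OF that]] by auto
    have tbound: "t k < 25" if k: "k \<in> {i..j}" for k
    proof -
      define h where "h = int (e (cl k) div 2)"
      have h: "h > 0" "int (e (cl k)) \<le> 2 * h + 1" using h_pos[OF clk1[OF k]] by (auto simp: h_def)
      have "int k + 4 * int (e (cl k)) - int (cl k) < 25 * h" using num(2)[OF k] h by linarith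
      then have "(int k + 4 * int (e (cl k)) - int (cl k)) div h < 25"
      proof -
        define d where "d = (int k + 4 * int (e (cl k)) - int (cl k)) div h"
        have "h * d \<le> int k + 4 * int (e (cl k)) - int (cl k)"
          using mult_div_mod_eq[of h "int k + 4 * int (e (cl k)) - int (cl k)"] pos_mod_sign[OF h(1)] unfolding d_def
          by (metis add_le_same_cancel1 add.commute le_add_same_cancel1)
        then have "h * d < h * 25" using \<open>int k + 4 * int (e (cl k)) - int (cl k) < 25 * h\<close> by linarith
        then show ?thesis using h(1) unfolding d_def[symmetric] by simp
      qed
      then show ?thesis by (simp add: t_def h_def nat_less_iff)
    qed
    have Dcl: "D k \<le> D (cl k)" if "k \<in> {i..j}" for k unfolding D_def using cl[OF that] by (intro power_decreasing) auto
    have "Rel i j (2 * sum wt (lab ` {i..j}))"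
    proof (rule loop_erasure[where R=Rel and i=i and j=j and lab=lab and w=wt])
      show "0 \<le> wt x" for x unfolding wt_def using KD by (cases x) simp
      show "i \<le> j" by fact
    next
      fix k k' assume kk: "k \<in> {i..j}" "k' \<in> {i..j}" and lb: "lab k = lab k'"
      have main: "Rel k k' 0 \<and> Rel k' k 0" if kk: "k \<in> {i..j}" "k' \<in> {i..j}" "k \<le> k'" and lb: "lab k = lab k'" for k k'
      proof -
        have eqs: "cl k = cl k'" "t k = t k'" "ro k = ro k'" using lb by (auto simp: lab_def)
        define h where "h = int (e (cl k) div 2)"
        have h: "h > 0" using h_pos[OF clk1[OF kk(1)]] by (simp add: h_def)
        define a where "a = int k + 4 * int (e (cl k)) - int (cl k)"
        define b where "b = int k' + 4 * int (e (cl k)) - int (cl k)"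
        have ab: "0 \<le> a" "0 \<le> b" using num(1)[OF kk(1)] num(1)[OF kk(2)] eqs by (auto simp: a_def b_def)
        have "nat (a div h) = nat (b div h)" using eqs(1,2) by (simp add: t_def a_def b_def h_def)
        moreover have "0 \<le> a div h" "0 \<le> b div h" using ab h by (simp_all add: pos_imp_zdiv_nonneg_iff)
        ultimately have dh: "a div h = b div h" by (simp add: eq_nat_nat_iff)
        define dd where "dd = h * (a div h)"
        have "dd + a mod h = a" "dd + b mod h = b" unfolding dd_def by (simp, simp add: dh)
        moreover have "0 \<le> a mod h" "b mod h < h" using h by simp_all
        ultimately have "b - a < h" by linarith
        then have "k' - k < e (cl k) div 2" using kk(3) by (simp add: a_def b_def h_def)
        then have "m k = m k'"
          using same[of k k' "cl k"] kk ij clk1[OF kk(1)] Dcl[OF kk(1)] Dcl[OF kk(2)] eqs by auto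
        then show ?thesis using Rel_refl eqs(3) by simp
      qed
      show "Rel k k' 0"
      proof (cases "k \<le> k'")
        case True
        then show ?thesis using main[OF kk True lb] by simp
      next
        case False
        then show ?thesis using main[OF kk(2,1) _ lb[symmetric]] by simp
      qed
    next
      fix k assume k: "i \<le> k" "k < j"
      have "K6 * (D k + D (Suc k)) \<le> K6 * (D (cl k) + D (cl (Suc k)))"
        using k Dcl[of k] Dcl[of "Suc k"] cons(2) by (intro mult_left_mono add_mono) auto
      also have "\<dots> = wt (lab k) + wt (lab (Suc k))" by (simp add: wt_def lab_def distrib_left)
      finally show "Rel k (Suc k) (wt (lab k) + wt (lab (Suc k)))" using Rel_step[of k] k ij Rel_mono by (meson order_trans)
    qed (use Rel_tr Rel_mono in blast)+
    moreover have "sum wt (lab ` {i..j}) \<le> K6 * \<Lambda> * sum D S"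
    proof -
      have "sum wt (lab ` {i..j}) \<le> sum wt (S \<times> {..<25} \<times> UNIV)"
        using cl tbound finS KD by (intro sum_mono2) (auto simp: lab_def wt_def)
      also have "\<dots> = (\<Sum>l\<in>S. \<Sum>y\<in>{..<25::nat} \<times> (UNIV :: ('b \<Rightarrow> 'b) set). K6 * D l)"
        unfolding sum.cartesian_product by (intro sum.cong refl) (auto simp: wt_def)
      also have "\<dots> = (\<Sum>l\<in>S. K6 * \<Lambda> * D l)"
        by (intro sum.cong refl) (simp add: \<Lambda>_def card_cartesian_product)
      also have "\<dots> = K6 * \<Lambda> * sum D S" by (simp only: sum_distrib_left)
      finally show ?thesis .
    qed
    ultimately have "Rel i j (2 * (K6 * \<Lambda> * sum D S))" using Rel_mono by (meson mult_left_mono zero_le_numeral)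
    then show ?thesis using S(1,2) by blast
  qed
  have "\<exists>n\<ge>k1. \<forall>i\<ge>n. \<forall>j\<ge>i. Rel i j \<epsilon>0" if eps0: "\<epsilon>0 > 0" for \<epsilon>0
  proof (rule ccontr)
    assume neg: "\<not> ?thesis"
    \<comment> \<open>Weight below \<eta> would keep the path cost below \<epsilon>0, and \<eta>
      \<le> 1/16 makes the product term \<eta>^2 at most \<eta>/16.\<close>
    define \<eta> where "\<eta> = min (\<epsilon>0 / (2 * K6 * \<Lambda> + 1)) (1/16)"
    have den: "2 * K6 * \<Lambda> + 1 > 0" using cons(2) Lam by (simp add: add_nonneg_pos)
    have eta0: "\<eta> \<le> \<epsilon>0 / (2 * K6 * \<Lambda> + 1)" "\<eta> \<le> 1/16"
      unfolding \<eta>_def by (rule min.cobounded1, rule min.cobounded2)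
    have eta: "\<eta> > 0" "\<eta> \<le> 1/16" using eps0 den eta0(2) by (simp_all add: \<eta>_def)
    have eta2: "(2 * K6 * \<Lambda>) * \<eta> < \<epsilon>0"
    proof -
      have "(2 * K6 * \<Lambda> + 1) * \<eta> \<le> (2 * K6 * \<Lambda> + 1) * (\<epsilon>0 / (2 * K6 * \<Lambda> + 1))"
        using den eta0(1) by (intro mult_left_mono) auto
      also have "\<dots> = \<epsilon>0" using den by simp
      finally show ?thesis using eta(1) by (simp add: algebra_simps)
    qed
    \<comment> \<open>The first bound makes single weights at most \<eta>/2 for
      \<open>subset_sum_between\<close>; the second keeps the correlation errors 16 K7 \<kappa>
      \<eta> at or below \<eta>/32.\<close>
    define \<kappa> where "\<kappa> = min (\<eta> / 2) (1 / (32 * (16 * K7 + 1)))"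
    have kap: "\<kappa> > 0" using eta K7_nonneg by (simp add: \<kappa>_def)
    have kap2: "\<kappa> \<le> \<eta> / 2" "\<kappa> \<le> 1 / (32 * (16 * K7 + 1))"
      unfolding \<kappa>_def by (rule min.cobounded1, rule min.cobounded2)
    obtain n4 where n4: "\<And>k. k \<ge> n4 \<Longrightarrow> D k < \<kappa>" using Dsmall[OF kap] by blast
    obtain \<eta>K where etaK: "\<eta>K > 0" "\<And>N (j::int) w. \<bar>real N * \<alpha> - of_int j\<bar> < \<eta>K \<Longrightarrow> norm w \<le> 16 * T \<Longrightarrow>
       \<eta> / 16 \<le> cm (\<lambda>x. bs \<alpha> \<phi> N x = w) \<Longrightarrow> cm (\<lambda>x. bs \<alpha> \<phi> N x \<noteq> w \<and> norm (bs \<alpha> \<phi> N x - w) \<le> 16 * T) < \<eta> / 16"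
    proof -
      have "\<eta> / 16 > 0" using eta(1) by simp
      with K[unfolded no_finite_values_def, THEN spec[of _ "16 * T"], THEN spec[of _ "\<eta> / 16"]] show ?thesis
        using that by blast
    qed
    \<comment> \<open>The sum of (1/2)^k over the chosen scales then stays below \<eta>/16, the loss
      in comparing D with \<delta>, and below \<open>\<eta>K\<close>, the allowed distance of N
      \<alpha> from an integer.\<close>
    obtain n5 where n5: "(1/2::real) ^ n5 < min (\<eta>K / 2) (\<eta> / 32)"
      using real_arch_pow_inv[of "min (\<eta>K / 2) (\<eta> / 32)" "1/2"] etaK(1) eta(1) by auto
    define n where "n = Max {k1, n4, n5}"
    have n: "k1 \<le> n" "n4 \<le> n" "n5 \<le> n" by (auto simp: n_def)
    obtain i j where ij: "n \<le> i" "i \<le> j" "\<not> Rel i j \<epsilon>0" using neg n(1) by blast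
    obtain S where S: "S \<subseteq> {i..j}" "\<forall>k\<in>S. \<forall>l\<in>S. k \<noteq> l \<longrightarrow> e k \<le> e l \<longrightarrow> 4 * int (e k) \<le> \<bar>int k - int l\<bar>"
        "Rel i j (2 * (K6 * \<Lambda> * sum D S))"
      using claim[of i j] ij n by auto
    have finS: "finite S" using S(1) finite_subset by blast
    have "\<eta> \<le> sum D S"
    proof (rule ccontr)
      assume "\<not> \<eta> \<le> sum D S"
      then have "(2 * K6 * \<Lambda>) * sum D S \<le> (2 * K6 * \<Lambda>) * \<eta>" using cons(2) Lam by (intro mult_left_mono) auto
      then have "2 * (K6 * \<Lambda> * sum D S) \<le> \<epsilon>0" using eta2 by (simp add: mult.assoc)
      then show False using S(3) ij(3) Rel_mono by blast
    qed
    have SD: "D k < \<kappa>" if "k \<in> S" for k using n4[of k] that S(1) ij n by auto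
    have "D k \<le> \<eta> / 2" if "k \<in> S" for k
      using SD[OF that] kap2(1) by linarith
    then have "\<exists>S'\<subseteq>S. \<eta> / 2 \<le> sum D S' \<and> sum D S' \<le> \<eta>"
      using finS \<open>\<eta> \<le> sum D S\<close> eta(1) D_pos by (intro subset_sum_between) (auto intro: less_imp_le)
    then obtain S' where S': "S' \<subseteq> S" "\<eta> / 2 \<le> sum D S'" "sum D S' \<le> \<eta>" by blast
    have finS': "finite S'" using S'(1) finS finite_subset by blast
    have S'n: "n \<le> k" if "k \<in> S'" for k using that S'(1) S(1) ij by auto
    define \<delta> where "\<delta> k = cm (\<lambda>x. bs \<alpha> \<phi> (q k) x \<noteq> w k)" for k
    have dD: "0 \<le> \<delta> k" "\<delta> k \<le> D k" for k unfolding \<delta>_def using cm_nonneg height[of k] by (auto simp: D_def)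
    have sd1: "sum \<delta> S' \<le> \<eta>" using S'(3) dD by (meson order_trans sum_mono)
    have "(\<Sum>k\<in>S'. (1/2::real) ^ k) \<le> 2 * (1/2) ^ n" by (rule sum_half_powers[OF finS' S'n])
    also have pn: "(1/2::real) ^ n \<le> (1/2) ^ n5" using n by (intro power_decreasing) auto
    finally have tail: "(\<Sum>k\<in>S'. (1/2::real) ^ k) \<le> 2 * (1/2) ^ n5" by simp
    have sd2: "\<eta> / 4 - \<eta> / 32 \<le> sum \<delta> S'"
    proof -
      have "sum D S' \<le> (\<Sum>k\<in>S'. 2 * \<delta> k + (1/2) ^ k)" unfolding \<delta>_def by (intro sum_mono e2)
      also have "\<dots> = 2 * sum \<delta> S' + (\<Sum>k\<in>S'. (1/2) ^ k)" by (simp add: sum.distrib sum_distrib_left)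
      finally show ?thesis using S'(2) tail n5 by simp
    qed
    define g where "g k l = (1/2::real) ^ (nat \<bar>int k - int l\<bar> div 2)" for k l :: nat
    define B where "B k l = \<delta> k * \<delta> l + K7 * g k l" for k l
    have pr: "cm (\<lambda>x. bs \<alpha> \<phi> (q k) (x + a) \<noteq> w k \<and> bs \<alpha> \<phi> (q l) (x + b) \<noteq> w l) \<le> B k l" if "k \<noteq> l" for k l a b
    proof (cases "k < l")
      case True
      then have d: "nat \<bar>int k - int l\<bar> = l - k" by simp
      show ?thesis using quasi_independent[OF True, of a "w k" b "w l"] unfolding B_def \<delta>_def g_def d .
    next
      case False
      then have lk: "l < k" and d: "nat \<bar>int k - int l\<bar> = k - l" using that by simp_all
      show ?thesis using quasi_independent[OF lk, of b "w l" a "w k"] unfolding B_def \<delta>_def g_def d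
        by (simp only: mult.commute conj_commute)
    qed
    have gsym: "g k l = g l k" for k l by (simp add: g_def abs_minus_commute)
    have gnn: "0 \<le> g k l" for k l by (simp add: g_def)
    \<comment> \<open>Separation is by the smaller exponent, so every pair is far as seen from one
      of its members. Charged there, it costs 8 (D k)^2 per member, and each pair occurs in two
      orders.\<close>
    have sumg: "(\<Sum>k\<in>S'. \<Sum>l\<in>S' - {k}. g k l) \<le> 16 * (\<Sum>k\<in>S'. (D k)\<^sup>2)"
    proof -
      define far where "far k l \<longleftrightarrow> 4 * int (e k) \<le> \<bar>int k - int l\<bar>" for k l
      have far1: "(\<Sum>l\<in>S'. if far k l then g k l else 0) \<le> 8 * (D k)\<^sup>2" for k
      proof -
        have "(\<Sum>l\<in>S'. if far k l then g k l else 0) = (\<Sum>l\<in>{l\<in>S'. 4 * int (e k) \<le> \<bar>int k - int l\<bar>}. g k l)"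
          unfolding far_def using finS' by (intro sum.inter_filter[symmetric])
        also have "\<dots> \<le> 8 * (D k)\<^sup>2" unfolding g_def D_def by (rule sum_distant_scales[OF finS'])
        finally show ?thesis .
      qed
      have "(\<Sum>k\<in>S'. \<Sum>l\<in>S' - {k}. g k l) \<le> (\<Sum>k\<in>S'. \<Sum>l\<in>S'. (if far k l then g k l else 0) + (if far l k then g l k else 0))"
      proof (rule sum_mono)
        fix k assume k: "k \<in> S'"
        have "(\<Sum>l\<in>S' - {k}. g k l) \<le> (\<Sum>l\<in>S' - {k}. (if far k l then g k l else 0) + (if far l k then g l k else 0))"
        proof (rule sum_mono)
          fix l assume l: "l \<in> S' - {k}"
          have kl: "k \<in> S" "l \<in> S" "k \<noteq> l" using k l S'(1) by auto
          have "far k l \<or> far l k"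
          proof (cases "e k \<le> e l")
            case True
            then show ?thesis using S(2)[rule_format, OF kl] unfolding far_def by simp
          next
            case False
            then show ?thesis using S(2)[rule_format, OF kl(2,1)] kl(3) unfolding far_def by simp
          qed
          then show "g k l \<le> (if far k l then g k l else 0) + (if far l k then g l k else 0)"
            using gsym[of k l] gnn[of k l] by (cases "far k l"; cases "far l k") simp_all
        qed
        also have "\<dots> \<le> (\<Sum>l\<in>S'. (if far k l then g k l else 0) + (if far l k then g l k else 0))"
          using finS' gnn by (intro sum_mono2) auto
        finally show "(\<Sum>l\<in>S' - {k}. g k l) \<le> (\<Sum>l\<in>S'. (if far k l then g k l else 0) + (if far l k then g l k else 0))" .
      qed
      also have "\<dots> = (\<Sum>k\<in>S'. \<Sum>l\<in>S'. if far k l then g k l else 0) + (\<Sum>k\<in>S'. \<Sum>l\<in>S'. if far l k then g l k else 0)"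
        by (simp only: sum.distrib)
      also have "(\<Sum>k\<in>S'. \<Sum>l\<in>S'. if far l k then g l k else 0) = (\<Sum>l\<in>S'. \<Sum>k\<in>S'. if far l k then g l k else 0)"
        by (rule sum.swap)
      also have "(\<Sum>k\<in>S'. \<Sum>l\<in>S'. if far k l then g k l else 0) + (\<Sum>l\<in>S'. \<Sum>k\<in>S'. if far l k then g l k else 0)
          \<le> (\<Sum>k\<in>S'. 8 * (D k)\<^sup>2) + (\<Sum>k\<in>S'. 8 * (D k)\<^sup>2)"
        by (intro add_mono sum_mono far1)
      also have "\<dots> = 16 * (\<Sum>k\<in>S'. (D k)\<^sup>2)" by (simp add: sum_distrib_left[symmetric])
      finally show ?thesis .
    qed
    have sumD2: "(\<Sum>k\<in>S'. (D k)\<^sup>2) \<le> \<kappa> * \<eta>"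
    proof -
      have "(\<Sum>k\<in>S'. (D k)\<^sup>2) \<le> (\<Sum>k\<in>S'. \<kappa> * D k)"
        unfolding power2_eq_square using SD S'(1) D_pos by (intro sum_mono mult_right_mono) (auto intro: less_imp_le)
      also have "\<dots> = \<kappa> * sum D S'" by (simp add: sum_distrib_left)
      also have "\<dots> \<le> \<kappa> * \<eta>" using S'(3) kap by (intro mult_left_mono) auto
      finally show ?thesis .
    qed
    have sumB: "(\<Sum>k\<in>S'. \<Sum>l\<in>S' - {k}. B k l) \<le> \<eta> / 16 + \<eta> / 32"
    proof -
      have "(\<Sum>k\<in>S'. \<Sum>l\<in>S' - {k}. \<delta> k * \<delta> l) \<le> (\<Sum>k\<in>S'. \<Sum>l\<in>S'. \<delta> k * \<delta> l)"
        using finS' dD by (intro sum_mono sum_mono2) auto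
      also have "\<dots> = sum \<delta> S' * sum \<delta> S'" by (simp add: sum_product)
      also have "\<dots> \<le> \<eta> * (1/16)" using sd1 eta dD by (intro mult_mono) (auto intro: sum_nonneg)
      finally have 1: "(\<Sum>k\<in>S'. \<Sum>l\<in>S' - {k}. \<delta> k * \<delta> l) \<le> \<eta> / 16" by simp
      have "K7 * (\<Sum>k\<in>S'. \<Sum>l\<in>S' - {k}. g k l) \<le> K7 * (16 * (\<kappa> * \<eta>))"
        using sumg sumD2 K7_nonneg by (intro mult_left_mono) auto
      also have "\<dots> = (16 * K7 * \<kappa>) * \<eta>" by simp
      also have "\<dots> \<le> (1/32) * \<eta>"
      proof (rule mult_right_mono)
        have "16 * K7 * \<kappa> \<le> (16 * K7 + 1) * (1 / (32 * (16 * K7 + 1)))"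
          using K7_nonneg kap kap2(2) by (intro mult_mono) auto
        also have "\<dots> = 1/32" using K7_nonneg by simp
        finally show "16 * K7 * \<kappa> \<le> 1/32" .
      qed (use eta in simp)
      finally have 2: "K7 * (\<Sum>k\<in>S'. \<Sum>l\<in>S' - {k}. g k l) \<le> \<eta> / 32" by simp
      have "(\<Sum>k\<in>S'. \<Sum>l\<in>S' - {k}. B k l) = (\<Sum>k\<in>S'. \<Sum>l\<in>S' - {k}. \<delta> k * \<delta> l) + K7 * (\<Sum>k\<in>S'. \<Sum>l\<in>S' - {k}. g k l)"
        by (simp add: B_def sum.distrib sum_distrib_left)
      then show ?thesis using 1 2 by linarith
    qed
    define N where "N = (\<Sum>k\<in>S'. q k)"
    define W where "W = (\<Sum>k\<in>S'. w k)"
    note rare = rare_events[OF finS' w pr, folded \<delta>_def N_def W_def]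
    have r1: "1 - \<eta> \<le> cm (\<lambda>x. bs \<alpha> \<phi> N x = W)" using rare(1) sd1 unfolding \<delta>_def by linarith
    \<comment> \<open>In units of \<eta> the balance is 1/4 - 1/32 - 1/16 - 1/32 = 1/8.\<close>
    have r2: "\<eta> / 16 \<le> cm (\<lambda>x. bs \<alpha> \<phi> N x \<noteq> W \<and> norm (bs \<alpha> \<phi> N x - W) \<le> 16 * T)"
      using rare(2) sumB sd2 eta(1) unfolding \<delta>_def by linarith
    have r3: "norm W \<le> 16 * T"
    proof -
      have "norm W \<le> 16 * T * sum \<delta> S'" using rare(3) unfolding \<delta>_def by simp
      also have "\<dots> \<le> 16 * T * 1" using sd1 eta T_nonneg by (intro mult_left_mono) auto
      finally show ?thesis by simp
    qed
    have "\<bar>real N * \<alpha> - of_int (\<Sum>k\<in>S'. p k)\<bar> < \<eta>K"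
    proof -
      have "real N * \<alpha> - of_int (\<Sum>k\<in>S'. p k) = (\<Sum>k\<in>S'. real (q k) * \<alpha> - of_int (p k))"
        by (simp add: N_def sum_subtractf sum_distrib_right)
      also have "\<bar>\<dots>\<bar> \<le> (\<Sum>k\<in>S'. \<bar>real (q k) * \<alpha> - of_int (p k)\<bar>)" by (rule sum_abs)
      also have "\<dots> \<le> (\<Sum>k\<in>S'. (1/2) ^ k)" using q_app by (intro sum_mono) (auto simp: power_divide intro: less_imp_le)
      also have "\<dots> < \<eta>K" using tail n5 by simp
      finally show ?thesis .
    qed
    from etaK(2)[OF this r3] r1 r2 eta show False by simp
  qed
  then show ?thesis using that[of k1 ro m] data unfolding Rel_def by blast
qed

end

section \<open>Convergence of the transfer functions\<close>

context sawtooth begin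

text \<open>Successive approximants differ by an exact constant off a small set. With summable
  errors, Borel-Cantelli makes the corrected functions eventually constant at almost every point,
  and the residual constants \<open>d\<close> tend to 0, so the equation survives the limit.\<close>

theorem coboundary:
  assumes K: no_finite_values
  shows "\<exists>f. circle_fun f \<and> (AE x in circle. \<phi> x = f x - f (x + \<alpha>))"
proof -
  obtain w where w: "\<And>k. norm (w k) \<le> 8 * T" and lim: "(\<lambda>k. cm (\<lambda>x. bs \<alpha> \<phi> (q k) x \<noteq> w k)) \<longlonglongrightarrow> 0"
    using majority_values[OF K] by blast
  have le1: "cm (\<lambda>x. bs \<alpha> \<phi> (q k) x \<noteq> w k) \<le> 1" for k by (rule cm_le_1) measurable
  obtain e where e: "\<forall>k. cm (\<lambda>x. bs \<alpha> \<phi> (q k) x \<noteq> w k) \<le> (1/2) ^ e k"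
    "\<forall>k. (1/2) ^ e k \<le> 2 * \<bar>cm (\<lambda>x. bs \<alpha> \<phi> (q k) x \<noteq> w k)\<bar> + (1/2) ^ k" "\<forall>M::nat. \<exists>n. \<forall>k\<ge>n. M \<le> e k"
    using dyadic_heights[OF le1 lim] by blast
  interpret heights \<alpha> c q p X \<tau> w e
    by unfold_locales (use e(1) in blast)
  have e2: "D k \<le> 2 * cm (\<lambda>x. bs \<alpha> \<phi> (q k) x \<noteq> w k) + (1/2) ^ k" for k
    using e(2)[rule_format, of k] cm_nonneg[of "\<lambda>x. bs \<alpha> \<phi> (q k) x \<noteq> w k"] by (simp add: D_def)
  obtain k1 ro m where data: "\<And>k. k \<ge> k1 \<Longrightarrow> good_data k (ro k) (m k)"
    and cau: "\<And>\<epsilon>. \<epsilon> > 0 \<Longrightarrow> \<exists>n\<ge>k1. \<forall>i\<ge>n. \<forall>j\<ge>i. \<exists>v. cm (\<lambda>x. F (ro j) (m j) x - F (ro i) (m i) x \<noteq> v) \<le> \<epsilon>"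
    by (rule cauchy_transfer[OF K w e2], use e(3) in blast, rule that)
  have "\<exists>n\<ge>k1. \<forall>i\<ge>n. \<forall>j\<ge>i. \<exists>v. cm (\<lambda>x. F (ro j) (m j) x - F (ro i) (m i) x \<noteq> v) \<le> (1/2) ^ t" for t :: nat
    by (rule cau) simp
  then have "\<exists>M. \<forall>t::nat. M t \<ge> k1 \<and> (\<forall>i\<ge>M t. \<forall>j\<ge>i. \<exists>v. cm (\<lambda>x. F (ro j) (m j) x - F (ro i) (m i) x \<noteq> v) \<le> (1/2) ^ t)"
    by (intro choice allI)
  then obtain M where M0: "\<forall>t::nat. M t \<ge> k1 \<and> (\<forall>i\<ge>M t. \<forall>j\<ge>i. \<exists>v. cm (\<lambda>x. F (ro j) (m j) x - F (ro i) (m i) x \<noteq> v) \<le> (1/2) ^ t)" ..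
  have M: "M t \<ge> k1" "i \<ge> M t \<Longrightarrow> j \<ge> i \<Longrightarrow> \<exists>v. cm (\<lambda>x. F (ro j) (m j) x - F (ro i) (m i) x \<noteq> v) \<le> (1/2) ^ t" for t i j
    using M0[rule_format, of t] by simp_all
  \<comment> \<open>Monotone and at least \<open>M t\<close>, which gives the estimate between
    consecutive terms; at least t, which makes the exceptional sets of the cohomological equation
    summable.\<close>
  define n where "n t = (\<Sum>s\<le>t. M s) + t" for t
  have nM: "n t \<ge> M t" for t unfolding n_def by (rule trans_le_add1) (rule member_le_sum, auto)
  have nt: "n t \<ge> t" "n t \<ge> k1" "n (Suc t) \<ge> n t" for t using nM[of t] M(1)[of t] by (auto simp: n_def)
  define H where "H t = F (ro (n t)) (m (n t))" for t
  have Hm [measurable]: "H t \<in> borel_measurable borel" for t unfolding H_def by measurable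
  have Hper: "H t (x + 1) = H t x" for t x by (simp add: H_def F_periodic)
  have "\<exists>v. cm (\<lambda>x. H (Suc t) x - H t x \<noteq> v) \<le> (1/2) ^ t" for t
    unfolding H_def by (rule M(2)[OF nM nt(3)])
  then have "\<exists>v. \<forall>t. cm (\<lambda>x. H (Suc t) x - H t x \<noteq> v t) \<le> (1/2) ^ t" by (intro choice allI)
  then obtain v where v: "cm (\<lambda>x. H (Suc t) x - H t x \<noteq> v t) \<le> (1/2) ^ t" for t by blast
  define g where "g t x = H t x - (\<Sum>s<t. v s)" for t x
  have gm [measurable]: "g t \<in> borel_measurable borel" for t unfolding g_def by measurable
  have gper: "g t (x + 1) = g t x" for t x by (simp add: g_def Hper)
  define A where "A t = {x \<in> {0..<1}. H (Suc t) x - H t x \<noteq> v t}" for t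
  have A: "A t \<in> sets circle" "measure circle (A t) \<le> (1/2) ^ t" for t
  proof -
    show "A t \<in> sets circle" unfolding A_def by (intro Collect_circle_sets) measurable
    show "measure circle (A t) \<le> (1/2) ^ t" using v[of t] unfolding A_def cm_def .
  qed
  have summ: "summable (\<lambda>t. measure circle (A t))"
    by (rule summable_comparison_test'[of "\<lambda>t. (1/2) ^ t" 0]) (use A(2) in \<open>auto intro: summable_geometric\<close>)
  have "AE x in circle. eventually (\<lambda>t. x \<in> space circle - A t) sequentially"
    by (rule borel_cantelli_AE1[OF A(1) _ summ]) (simp add: less_top[symmetric])
  moreover have "AE x in circle. x \<in> space circle" by (rule AE_space)
  ultimately have AE1: "AE x in circle. eventually (\<lambda>t. g (Suc t) x = g t x) sequentially"
  proof eventually_elim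
    case (elim x)
    then show ?case by (auto elim!: eventually_mono simp: A_def g_def algebra_simps)
  qed
  then have AE2: "AE x in circle. eventually (\<lambda>t. g (Suc t) (x + \<alpha>) = g t (x + \<alpha>)) sequentially"
    by (rule AE_circle_shift) (simp add: gper)
  define f where "f x = lim (\<lambda>t. g t x)" for x
  have fc: "circle_fun f" unfolding circle_fun_def f_def
    by (intro conjI borel_measurable_lim_metric gm) (simp add: gper)
  have tend: "(\<lambda>t. g t x) \<longlonglongrightarrow> f x" if ev: "eventually (\<lambda>t. g (Suc t) x = g t x) sequentially" for x
  proof -
    obtain t0 where t0: "\<forall>t\<ge>t0. g (Suc t) x = g t x" using ev unfolding eventually_sequentially ..
    have "g t x = g t0 x" if "t \<ge> t0" for t using that by (induction t rule: dec_induct) (simp_all add: t0)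
    then have "eventually (\<lambda>t. g t x = g t0 x) sequentially" by (rule eventually_sequentiallyI)
    then have "(\<lambda>t. g t x) \<longlonglongrightarrow> g t0 x" by (rule tendsto_eventually)
    then show ?thesis unfolding f_def by (simp add: limI)
  qed
  have "\<exists>d. norm d \<le> T * (K1 * D (n t) / 2 ^ n t) \<and>
     cm (\<lambda>x. \<phi> x - (H t x - H t (x + \<alpha>)) \<noteq> - d) \<le> nb * (K1 * D (n t) / 2 ^ n t)" for t
  proof -
    obtain \<nu> where nu: "\<And>b. \<bar>X b - X (ro (n t) b) - of_int (m (n t) b) * \<alpha> - of_int (\<nu> b)\<bar> \<le> K1 * D (n t) / 2 ^ n t"
      "cm (\<lambda>x. \<phi> x - (F (ro (n t)) (m (n t)) x - F (ro (n t)) (m (n t)) (x + \<alpha>)) \<noteq> - (\<Sum>b\<in>UNIV. (X b - of_int (m (n t) b) * \<alpha> - of_int (\<nu> b)) *\<^sub>R \<tau> b))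
         \<le> nb * (K1 * D (n t) / 2 ^ n t)"
      by (rule transfer_eq[OF data[OF nt(2)]], rule that)
    show ?thesis using drift_small[OF data[OF nt(2)] nu(1)] nu(2) unfolding H_def by blast
  qed
  then have "\<exists>d. \<forall>t. norm (d t) \<le> T * (K1 * D (n t) / 2 ^ n t) \<and>
     cm (\<lambda>x. \<phi> x - (H t x - H t (x + \<alpha>)) \<noteq> - d t) \<le> nb * (K1 * D (n t) / 2 ^ n t)" by (intro choice allI)
  then obtain d where d0: "\<forall>t. norm (d t) \<le> T * (K1 * D (n t) / 2 ^ n t) \<and>
     cm (\<lambda>x. \<phi> x - (H t x - H t (x + \<alpha>)) \<noteq> - d t) \<le> nb * (K1 * D (n t) / 2 ^ n t)" ..
  have d: "norm (d t) \<le> T * (K1 * D (n t) / 2 ^ n t)"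
     "cm (\<lambda>x. \<phi> x - (H t x - H t (x + \<alpha>)) \<noteq> - d t) \<le> nb * (K1 * D (n t) / 2 ^ n t)" for t
    using d0[rule_format, of t] by simp_all
  have small: "K1 * D (n t) / 2 ^ n t \<le> K1 * (1/2) ^ t" for t
  proof -
    have "K1 * D (n t) / 2 ^ n t \<le> K1 * 1 / 2 ^ t"
      using K_pos D_le_1[of "n t"] D_pos[of "n t"] nt(1)[of t]
      by (intro frac_le mult_mono power_increasing mult_nonneg_nonneg) auto
    then show ?thesis by (simp add: power_divide)
  qed
  define B where "B t = {x \<in> {0..<1}. \<phi> x - (H t x - H t (x + \<alpha>)) \<noteq> - d t}" for t
  have B: "B t \<in> sets circle" "measure circle (B t) \<le> (nb * K1) * (1/2) ^ t" for t
  proof -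
    show "B t \<in> sets circle" unfolding B_def by (intro Collect_circle_sets) measurable
    have "nb * (K1 * D (n t) / 2 ^ n t) \<le> nb * (K1 * (1/2) ^ t)" using small[of t] nb_ge_1 by (intro mult_left_mono) auto
    then show "measure circle (B t) \<le> (nb * K1) * (1/2) ^ t" using d(2)[of t] unfolding B_def cm_def by simp
  qed
  have summB: "summable (\<lambda>t. measure circle (B t))"
    by (rule summable_comparison_test'[of "\<lambda>t. (nb * K1) * (1/2) ^ t" 0])
      (use B(2) in \<open>auto intro: summable_mult summable_geometric\<close>)
  have "AE x in circle. eventually (\<lambda>t. x \<in> space circle - B t) sequentially"
    by (rule borel_cantelli_AE1[OF B(1) _ summB]) (simp add: less_top[symmetric])
  then have AE3: "AE x in circle. eventually (\<lambda>t. \<phi> x - (H t x - H t (x + \<alpha>)) = - d t) sequentially"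
    by eventually_elim (auto elim!: eventually_mono simp: B_def)
  have d0: "d \<longlonglongrightarrow> 0"
  proof (rule Lim_null_comparison)
    show "eventually (\<lambda>t. norm (d t) \<le> (T * K1) * (1/2) ^ t) sequentially"
    proof (intro always_eventually allI)
      fix t
      have "T * (K1 * D (n t) / 2 ^ n t) \<le> T * (K1 * (1/2) ^ t)" using small[of t] T_nonneg by (intro mult_left_mono)
      then show "norm (d t) \<le> (T * K1) * (1/2) ^ t" using d(1)[of t] by simp
    qed
    show "(\<lambda>t. (T * K1) * (1/2) ^ t) \<longlonglongrightarrow> 0" by (intro tendsto_mult_right_zero LIMSEQ_power_zero) simp
  qed
  have "AE x in circle. \<phi> x = f x - f (x + \<alpha>)"
    using AE1 AE2 AE3
  proof eventually_elim
    case (elim x)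
    have "(\<lambda>t. g t x - g t (x + \<alpha>) - d t) \<longlonglongrightarrow> f x - f (x + \<alpha>) - 0"
      by (intro tendsto_diff tend elim d0)
    moreover have "eventually (\<lambda>t. g t x - g t (x + \<alpha>) - d t = \<phi> x) sequentially"
      using elim(3) by (rule eventually_mono) (simp add: g_def algebra_simps)
    then have "(\<lambda>t. g t x - g t (x + \<alpha>) - d t) \<longlonglongrightarrow> \<phi> x" by (rule tendsto_eventually)
    ultimately show ?case using LIMSEQ_unique by fastforce
  qed
  then show ?thesis using fc by blast
qed

end

section \<open>The cocycle of the theorem and its integral periods\<close>

definition Phi :: "real ^ 'd \<Rightarrow> real \<Rightarrow> real ^ 'd" where
  "Phi \<beta> x = (\<chi> j. frac (x - \<beta> $ j) - frac x)"

lemma Phi_sum: "Phi \<beta> x = (\<Sum>j\<in>UNIV. (frac (x - \<beta> $ j) - frac x) *\<^sub>R axis j 1)"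
  by (simp add: vec_eq_iff Phi_def axis_def if_distrib cong: if_cong)

lemma Phi_circle_fun: "circle_fun (Phi \<beta>)"
proof -
  have [measurable]: "Phi \<beta> \<in> borel_measurable borel" unfolding Phi_sum[abs_def] by measurable
  moreover have "Phi \<beta> (x + 1) = Phi \<beta> x" for x
  proof -
    have "frac (x + 1 - \<beta> $ j) = frac (x - \<beta> $ j)" for j using frac_periodic[of "x - \<beta> $ j"] by (simp add: algebra_simps)
    then show ?thesis by (simp add: Phi_def frac_periodic)
  qed
  ultimately show ?thesis by (simp add: circle_fun_def)
qed

lemma Phi_diff_int: "Phi \<beta> x - Phi \<beta> y \<in> int_vecs"
  by (auto simp: int_vecs_def Phi_def frac_def)

lemma bs_Phi_diff_int: "bs \<alpha> (Phi \<beta>) N x - bs \<alpha> (Phi \<beta>) N y \<in> int_vecs"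
  unfolding bs_def sum_subtractf[symmetric] by (intro int_vecs_sum Phi_diff_int)

lemma countable_int_vecs: "countable (int_vecs :: (real ^ 'n) set)"
proof -
  have "(int_vecs :: (real ^ 'n) set) \<subseteq> (\<Union>n::nat. {v \<in> int_vecs. norm v \<le> real n})"
  proof
    fix v :: "real ^ 'n" assume "v \<in> int_vecs"
    moreover obtain n :: nat where "norm v \<le> real n" using real_arch_simple by blast
    ultimately show "v \<in> (\<Union>n::nat. {v \<in> int_vecs. norm v \<le> real n})" by blast
  qed
  moreover have "countable (\<Union>n::nat. {v \<in> int_vecs. norm (v :: real ^ 'n) \<le> real n})"
    by (rule countable_UN[OF countableI_type countable_finite[OF finite_int_vecs_bounded]])
  ultimately show ?thesis by (rule countable_subset)
qed

text \<open>The candidates for r lie in one coset of the integral vectors and in the ball of radius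
  \<rho>. Their differences are integral of norm at most 2 \<rho>, which bounds their number by
  M.\<close>

lemma pigeonhole_value:
  fixes \<beta> :: "real ^ 'd" and E :: "(real ^ 'd) set"
  assumes E: "E \<subseteq> int_vecs"
    and P: "\<And>x. P x \<Longrightarrow> \<exists>v\<in>E. norm (bs \<alpha> (Phi \<beta>) N x - v) \<le> \<rho>" and Pm: "Measurable.pred borel P"
    and M: "M = real (card {z \<in> int_vecs. norm (z :: real ^ 'd) \<le> 2 * \<rho>})" and \<epsilon>: "0 < \<epsilon>" "\<epsilon> \<le> cm P"
  obtains r where "norm r \<le> \<rho>" "r - bs \<alpha> (Phi \<beta>) N 0 \<in> int_vecs"
    "M > 0" "\<epsilon> / M \<le> cm (\<lambda>x. P x \<and> bs \<alpha> (Phi \<beta>) N x - r \<in> E)"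
proof -
  have [measurable]: "bs \<alpha> (Phi \<beta>) N \<in> borel_measurable borel"
    by (rule bs_borel) (use Phi_circle_fun[of \<beta>] in \<open>simp add: circle_fun_def\<close>)
  have Eb: "E \<in> sets borel" by (rule sets.countable[OF _ countable_subset[OF E countable_int_vecs]]) simp
  define V where "V = {r. norm r \<le> \<rho> \<and> r - bs \<alpha> (Phi \<beta>) N 0 \<in> int_vecs}"
  define Q where "Q r x \<longleftrightarrow> P x \<and> bs \<alpha> (Phi \<beta>) N x - r \<in> E" for r x
  have Qm: "Measurable.pred borel (Q r)" for r unfolding Q_def using Pm Eb by measurable
  have ex: "\<exists>r\<in>V. Q r x" if Px: "P x" for x
  proof -
    obtain v where v: "v \<in> E" "norm (bs \<alpha> (Phi \<beta>) N x - v) \<le> \<rho>" using P[of x] Px by blast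
    have "bs \<alpha> (Phi \<beta>) N x - v - bs \<alpha> (Phi \<beta>) N 0 = (bs \<alpha> (Phi \<beta>) N x - bs \<alpha> (Phi \<beta>) N 0) - v" by simp
    also have "\<dots> \<in> int_vecs" by (rule int_vecs_diff[OF bs_Phi_diff_int]) (use v(1) E in blast)
    finally show ?thesis using v Px by (intro bexI[of _ "bs \<alpha> (Phi \<beta>) N x - v"]) (auto simp: V_def Q_def)
  qed
  have "0 < cm P" using \<epsilon> by simp
  then obtain x0 where "P x0" using ex_cm_pos by blast
  then obtain r0 where r0: "r0 \<in> V" using ex by blast
  have img: "(\<lambda>r. r - r0) ` V \<subseteq> {z \<in> int_vecs. norm z \<le> 2 * \<rho>}"
  proof
    fix z assume "z \<in> (\<lambda>r. r - r0) ` V"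
    then obtain r where r: "r \<in> V" "z = r - r0" by auto
    have "(r - bs \<alpha> (Phi \<beta>) N 0) - (r0 - bs \<alpha> (Phi \<beta>) N 0) \<in> int_vecs" by (rule int_vecs_diff) (use r r0 in \<open>auto simp: V_def\<close>)
    moreover have "norm (r - r0) \<le> 2 * \<rho>" using norm_triangle_ineq4[of r r0] r r0 by (auto simp: V_def)
    ultimately show "z \<in> {z \<in> int_vecs. norm z \<le> 2 * \<rho>}" using r by simp
  qed
  have injV: "inj_on (\<lambda>r. r - r0) V" by (auto simp: inj_on_def)
  have finV: "finite V" using finite_imageD[OF finite_subset[OF img finite_int_vecs_bounded] injV] .
  have "card V \<le> card {z \<in> int_vecs. norm (z :: real ^ 'd) \<le> 2 * \<rho>}"
    using card_mono[OF finite_int_vecs_bounded img] card_image[OF injV] by simp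
  then have cV: "real (card V) \<le> M" by (simp add: M)
  have "card V > 0" using r0 finV by (auto simp: card_gt_0_iff)
  then have M0: "M > 0" using cV by linarith
  have "\<exists>r\<in>V. \<epsilon> / M \<le> cm (Q r)"
  proof (rule ccontr)
    assume neg: "\<not> ?thesis"
    have "cm P \<le> cm (\<lambda>x. \<exists>r\<in>V. Q r x)" using ex Qm finV by (intro cm_mono pred_intros_finite) auto
    also have "\<dots> \<le> (\<Sum>r\<in>V. cm (Q r))" by (rule cm_Bex[OF finV Qm])
    also have "\<dots> < (\<Sum>r\<in>V. \<epsilon> / M)" using neg r0 finV by (intro sum_strict_mono) (auto simp: not_le)
    also have "\<dots> = real (card V) * (\<epsilon> / M)" by simp
    also have "\<dots> \<le> M * (\<epsilon> / M)" using cV \<epsilon> M0 by (intro mult_right_mono) auto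
    also have "\<dots> = \<epsilon>" using M0 by simp
    finally show False using \<epsilon> by simp
  qed
  then obtain r where "r \<in> V" "\<epsilon> / M \<le> cm (Q r)" by blast
  then show ?thesis using that[of r] M0 unfolding V_def Q_def by simp
qed

text \<open>If the projection of the cocycle modulo the integral periods violated the hypothesis of \<open>coboundary\<close>, compactness
  would yield a further integral period.\<close>

lemma integral_periods_span:
  fixes \<beta> :: "real ^ 'd"
  assumes irr: "\<alpha> \<notin> \<rat>" and bad: "badly_approximable c \<alpha>"
  obtains f where "circle_fun f"
    "AE x in circle. Phi \<beta> x - (f x - f (x + \<alpha>)) \<in> span (int_vecs \<inter> PER \<alpha> (Phi \<beta>))"
proof -
  define E where "E = int_vecs \<inter> PER \<alpha> (Phi \<beta>)"
  have E: "E \<subseteq> int_vecs" "\<And>x y. x \<in> E \<Longrightarrow> y \<in> E \<Longrightarrow> x - y \<in> E" "0 \<in> E"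
    by (auto simp: E_def intro: int_vecs_diff PER_diff)
  obtain P :: "real ^ 'd \<Rightarrow> real ^ 'd" and \<kappa> K where P: "linear P" "\<And>v. v \<in> int_vecs \<Longrightarrow> P v \<in> int_vecs" "\<And>v. v \<in> E \<Longrightarrow> P v = 0"
    "\<And>t. \<exists>v\<in>E. norm (t - v) \<le> K * (1 + norm (P t))" "\<And>t. t - \<kappa> *\<^sub>R P t \<in> span E"
    by (rule integer_quotient[OF E(1) _ E(3)], erule (1) E(2), rule that)
  obtain q :: "nat \<Rightarrow> nat" and p :: "nat \<Rightarrow> int" where qp:
    "\<And>k. q k > 0" "\<And>k. real (q k) \<le> 2 ^ k" "\<And>k. c * 2 ^ k \<le> real (q k)"
    "\<And>k. coprime (p k) (int (q k))" "\<And>k. \<bar>real (q k) * \<alpha> - of_int (p k)\<bar> < 1 / 2 ^ k"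
    by (rule dyadic_denominators[OF bad], rule that)
  \<comment> \<open>\<open>None\<close> stands for the discontinuity at 0 shared by all coordinates;
    its weight balances the others.\<close>
  define X where "X b = (case b of None \<Rightarrow> 0 | Some j \<Rightarrow> \<beta> $ j)" for b :: "'d option"
  define \<tau> where "\<tau> b = (case b of None \<Rightarrow> - (\<Sum>j\<in>UNIV. P (axis j 1)) | Some j \<Rightarrow> P (axis j 1))" for b :: "'d option"
  have opt: "(\<Sum>b\<in>UNIV. h b) = h None + (\<Sum>j\<in>UNIV. h (Some j))" for h :: "'d option \<Rightarrow> real ^ 'd"
    by (simp add: UNIV_option_conv sum.reindex)
  have ax: "P (axis j 1) \<in> int_vecs" for j by (rule P(2)) (auto simp: int_vecs_def axis_def)
  interpret sawtooth \<alpha> c q p X \<tau>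
  proof
    show "\<tau> b \<in> int_vecs" for b
      unfolding \<tau>_def by (cases b) (auto intro: ax int_vecs_minus int_vecs_sum)
    show "(\<Sum>b\<in>UNIV. \<tau> b) = 0" unfolding opt by (simp add: \<tau>_def)
  qed (use bad qp in auto)
  have phi: "\<phi> x = P (Phi \<beta> x)" for x
  proof -
    have "P (Phi \<beta> x) = (\<Sum>j\<in>UNIV. (frac (x - \<beta> $ j) - frac x) *\<^sub>R P (axis j 1))"
      unfolding Phi_sum by (simp add: linear_sum[OF P(1)] linear_scale[OF P(1)])
    also have "\<dots> = \<phi> x"
      unfolding \<phi>_def opt by (simp add: X_def \<tau>_def scaleR_diff_left sum_subtractf scaleR_sum_right)
    finally show ?thesis by simp
  qed
  have bsP: "bs \<alpha> \<phi> N x = P (bs \<alpha> (Phi \<beta>) N x)" for N x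
    unfolding bs_def phi by (simp add: linear_sum[OF P(1)])
  have PhiB [measurable]: "bs \<alpha> (Phi \<beta>) N \<in> borel_measurable borel" for N
    by (rule bs_borel) (use Phi_circle_fun[of \<beta>] in \<open>simp add: circle_fun_def\<close>)
  have Eb: "E \<in> sets borel" by (rule sets.countable[OF _ countable_subset[OF E(1) countable_int_vecs]]) simp
  have [measurable]: "Measurable.pred borel (\<lambda>x. bs \<alpha> (Phi \<beta>) N x - r \<in> E)" for N r using Eb by measurable
  have no_finite_values
  proof (rule ccontr)
    assume "\<not> no_finite_values"
    then have "\<exists>R \<epsilon>. \<epsilon> > 0 \<and> (\<forall>\<eta>>0. \<exists>N (j::int) w. \<bar>real N * \<alpha> - of_int j\<bar> < \<eta> \<and> norm w \<le> R \<and>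
     \<epsilon> \<le> cm (\<lambda>x. bs \<alpha> \<phi> N x = w) \<and> \<epsilon> \<le> cm (\<lambda>x. bs \<alpha> \<phi> N x \<noteq> w \<and> norm (bs \<alpha> \<phi> N x - w) \<le> R))"
      unfolding no_finite_values_def by (simp only: not_all not_ex imp_conv_disj de_Morgan_conj de_Morgan_disj not_not not_less not_le)
    then obtain R \<epsilon> where eps: "\<epsilon> > 0" and bd: "\<forall>\<eta>>0. \<exists>N (j::int) w. \<bar>real N * \<alpha> - of_int j\<bar> < \<eta> \<and> norm w \<le> R \<and>
     \<epsilon> \<le> cm (\<lambda>x. bs \<alpha> \<phi> N x = w) \<and> \<epsilon> \<le> cm (\<lambda>x. bs \<alpha> \<phi> N x \<noteq> w \<and> norm (bs \<alpha> \<phi> N x - w) \<le> R)"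
      by (elim exE conjE) (rule that)
    have "\<exists>N (j::int) w. \<bar>real N * \<alpha> - of_int j\<bar> < 1 / Suc n \<and> norm w \<le> R \<and>
     \<epsilon> \<le> cm (\<lambda>x. bs \<alpha> \<phi> N x = w) \<and> \<epsilon> \<le> cm (\<lambda>x. bs \<alpha> \<phi> N x \<noteq> w \<and> norm (bs \<alpha> \<phi> N x - w) \<le> R)" for n
      by (rule bd[rule_format]) simp
    then have "\<exists>N. \<forall>n. \<exists>(j::int) w. \<bar>real (N n) * \<alpha> - of_int j\<bar> < 1 / Suc n \<and> norm w \<le> R \<and>
     \<epsilon> \<le> cm (\<lambda>x. bs \<alpha> \<phi> (N n) x = w) \<and> \<epsilon> \<le> cm (\<lambda>x. bs \<alpha> \<phi> (N n) x \<noteq> w \<and> norm (bs \<alpha> \<phi> (N n) x - w) \<le> R)" by (intro choice allI)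
    then obtain N where "\<forall>n. \<exists>(j::int) w. \<bar>real (N n) * \<alpha> - of_int j\<bar> < 1 / Suc n \<and> norm w \<le> R \<and>
     \<epsilon> \<le> cm (\<lambda>x. bs \<alpha> \<phi> (N n) x = w) \<and> \<epsilon> \<le> cm (\<lambda>x. bs \<alpha> \<phi> (N n) x \<noteq> w \<and> norm (bs \<alpha> \<phi> (N n) x - w) \<le> R)" ..
    then have "\<exists>(j :: nat \<Rightarrow> int). \<forall>n. \<exists>w. \<bar>real (N n) * \<alpha> - of_int (j n)\<bar> < 1 / Suc n \<and> norm w \<le> R \<and>
     \<epsilon> \<le> cm (\<lambda>x. bs \<alpha> \<phi> (N n) x = w) \<and> \<epsilon> \<le> cm (\<lambda>x. bs \<alpha> \<phi> (N n) x \<noteq> w \<and> norm (bs \<alpha> \<phi> (N n) x - w) \<le> R)" by (intro choice)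
    then obtain j :: "nat \<Rightarrow> int" where "\<forall>n. \<exists>w. \<bar>real (N n) * \<alpha> - of_int (j n)\<bar> < 1 / Suc n \<and> norm w \<le> R \<and>
     \<epsilon> \<le> cm (\<lambda>x. bs \<alpha> \<phi> (N n) x = w) \<and> \<epsilon> \<le> cm (\<lambda>x. bs \<alpha> \<phi> (N n) x \<noteq> w \<and> norm (bs \<alpha> \<phi> (N n) x - w) \<le> R)" ..
    then have "\<exists>w. \<forall>n. \<bar>real (N n) * \<alpha> - of_int (j n)\<bar> < 1 / Suc n \<and> norm (w n) \<le> R \<and>
     \<epsilon> \<le> cm (\<lambda>x. bs \<alpha> \<phi> (N n) x = w n) \<and> \<epsilon> \<le> cm (\<lambda>x. bs \<alpha> \<phi> (N n) x \<noteq> w n \<and> norm (bs \<alpha> \<phi> (N n) x - w n) \<le> R)" by (intro choice)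
    then obtain w where "\<forall>n. \<bar>real (N n) * \<alpha> - of_int (j n)\<bar> < 1 / Suc n \<and> norm (w n) \<le> R \<and>
     \<epsilon> \<le> cm (\<lambda>x. bs \<alpha> \<phi> (N n) x = w n) \<and> \<epsilon> \<le> cm (\<lambda>x. bs \<alpha> \<phi> (N n) x \<noteq> w n \<and> norm (bs \<alpha> \<phi> (N n) x - w n) \<le> R)" ..
    note N0 = this[rule_format]
    have N: "\<And>n. \<bar>real (N n) * \<alpha> - of_int (j n)\<bar> < 1 / Suc n" "\<And>n. norm (w n) \<le> R"
     "\<And>n. \<epsilon> \<le> cm (\<lambda>x. bs \<alpha> \<phi> (N n) x = w n)" "\<And>n. \<epsilon> \<le> cm (\<lambda>x. bs \<alpha> \<phi> (N n) x \<noteq> w n \<and> norm (bs \<alpha> \<phi> (N n) x - w n) \<le> R)"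
      using N0 by blast+
    have R0: "R \<ge> 0" using N(2)[of 0] norm_ge_zero order_trans by blast
    \<comment> \<open>Both values have norm at most 2 R after projection, so
      \<open>integer_quotient\<close> brings the unprojected sum within \<rho> of an element of
      E.\<close>
    define \<rho> where "\<rho> = \<bar>K\<bar> * (1 + 2 * R)"
    define M where "M = real (card {z \<in> int_vecs. norm (z :: real ^ 'd) \<le> 2 * \<rho>})"
    have red: "\<exists>v\<in>E. norm (bs \<alpha> (Phi \<beta>) (N n) x - v) \<le> \<rho>" if le: "norm (bs \<alpha> \<phi> (N n) x) \<le> 2 * R" for n x
    proof -
      obtain v where v: "v \<in> E" "norm (bs \<alpha> (Phi \<beta>) (N n) x - v) \<le> K * (1 + norm (P (bs \<alpha> (Phi \<beta>) (N n) x)))" using P(4) by blast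
      have "K * (1 + norm (P (bs \<alpha> (Phi \<beta>) (N n) x))) \<le> \<rho>"
        unfolding \<rho>_def using le unfolding bsP by (intro mult_mono) auto
      then show ?thesis using v by force
    qed
    have "\<exists>r. norm r \<le> \<rho> \<and> r - bs \<alpha> (Phi \<beta>) (N n) 0 \<in> int_vecs \<and> M > 0 \<and>
       \<epsilon> / M \<le> cm (\<lambda>x. bs \<alpha> \<phi> (N n) x = w n \<and> bs \<alpha> (Phi \<beta>) (N n) x - r \<in> E)" for n
    proof (rule pigeonhole_value[OF E(1) _ _ M_def eps N(3)])
      fix x assume "bs \<alpha> \<phi> (N n) x = w n"
      then show "\<exists>v\<in>E. norm (bs \<alpha> (Phi \<beta>) (N n) x - v) \<le> \<rho>" using N(2)[of n] R0 by (intro red) simp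
    qed (measurable, blast)
    then have "\<exists>r. \<forall>n. norm (r n) \<le> \<rho> \<and> r n - bs \<alpha> (Phi \<beta>) (N n) 0 \<in> int_vecs \<and> M > 0 \<and>
       \<epsilon> / M \<le> cm (\<lambda>x. bs \<alpha> \<phi> (N n) x = w n \<and> bs \<alpha> (Phi \<beta>) (N n) x - r n \<in> E)" by (intro choice allI)
    then obtain r where "\<forall>n. norm (r n) \<le> \<rho> \<and> r n - bs \<alpha> (Phi \<beta>) (N n) 0 \<in> int_vecs \<and> M > 0 \<and>
       \<epsilon> / M \<le> cm (\<lambda>x. bs \<alpha> \<phi> (N n) x = w n \<and> bs \<alpha> (Phi \<beta>) (N n) x - r n \<in> E)" ..
    note r0 = this[rule_format]
    have r: "\<And>n. norm (r n) \<le> \<rho>" "\<And>n. r n - bs \<alpha> (Phi \<beta>) (N n) 0 \<in> int_vecs" "M > 0"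
       "\<And>n. \<epsilon> / M \<le> cm (\<lambda>x. bs \<alpha> \<phi> (N n) x = w n \<and> bs \<alpha> (Phi \<beta>) (N n) x - r n \<in> E)" using r0 by blast+
    have "\<exists>r. norm r \<le> \<rho> \<and> r - bs \<alpha> (Phi \<beta>) (N n) 0 \<in> int_vecs \<and> M > 0 \<and>
       \<epsilon> / M \<le> cm (\<lambda>x. (bs \<alpha> \<phi> (N n) x \<noteq> w n \<and> norm (bs \<alpha> \<phi> (N n) x - w n) \<le> R) \<and> bs \<alpha> (Phi \<beta>) (N n) x - r \<in> E)" for n
    proof (rule pigeonhole_value[OF E(1) _ _ M_def eps N(4)])
      fix x assume "bs \<alpha> \<phi> (N n) x \<noteq> w n \<and> norm (bs \<alpha> \<phi> (N n) x - w n) \<le> R"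
      then have "norm (bs \<alpha> \<phi> (N n) x) \<le> 2 * R" using N(2)[of n] norm_triangle_ineq[of "bs \<alpha> \<phi> (N n) x - w n" "w n"] by simp
      then show "\<exists>v\<in>E. norm (bs \<alpha> (Phi \<beta>) (N n) x - v) \<le> \<rho>" by (rule red)
    qed (measurable, blast)
    then have "\<exists>r. \<forall>n. norm (r n) \<le> \<rho> \<and> r n - bs \<alpha> (Phi \<beta>) (N n) 0 \<in> int_vecs \<and> M > 0 \<and>
       \<epsilon> / M \<le> cm (\<lambda>x. (bs \<alpha> \<phi> (N n) x \<noteq> w n \<and> norm (bs \<alpha> \<phi> (N n) x - w n) \<le> R) \<and> bs \<alpha> (Phi \<beta>) (N n) x - r n \<in> E)" by (intro choice allI)
    then obtain r' where "\<forall>n. norm (r' n) \<le> \<rho> \<and> r' n - bs \<alpha> (Phi \<beta>) (N n) 0 \<in> int_vecs \<and> M > 0 \<and>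
       \<epsilon> / M \<le> cm (\<lambda>x. (bs \<alpha> \<phi> (N n) x \<noteq> w n \<and> norm (bs \<alpha> \<phi> (N n) x - w n) \<le> R) \<and> bs \<alpha> (Phi \<beta>) (N n) x - r' n \<in> E)" ..
    note r'0 = this[rule_format]
    have r': "\<And>n. norm (r' n) \<le> \<rho>" "\<And>n. r' n - bs \<alpha> (Phi \<beta>) (N n) 0 \<in> int_vecs"
       "\<And>n. \<epsilon> / M \<le> cm (\<lambda>x. (bs \<alpha> \<phi> (N n) x \<noteq> w n \<and> norm (bs \<alpha> \<phi> (N n) x - w n) \<le> R) \<and> bs \<alpha> (Phi \<beta>) (N n) x - r' n \<in> E)" using r'0 by blast+
    have eM: "\<epsilon> / M > 0" using eps r(3) by simp
    have Pr: "P (r n) = w n" for n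
    proof -
      have "0 < cm (\<lambda>x. bs \<alpha> \<phi> (N n) x = w n \<and> bs \<alpha> (Phi \<beta>) (N n) x - r n \<in> E)" using r(4)[of n] eM by linarith
      then obtain x where x: "bs \<alpha> \<phi> (N n) x = w n" "bs \<alpha> (Phi \<beta>) (N n) x - r n \<in> E" using ex_cm_pos by blast
      then show ?thesis using P(3)[OF x(2)] by (simp add: bsP linear_diff[OF P(1)])
    qed
    have Pr': "P (r' n) \<noteq> w n" for n
    proof -
      have "0 < cm (\<lambda>x. (bs \<alpha> \<phi> (N n) x \<noteq> w n \<and> norm (bs \<alpha> \<phi> (N n) x - w n) \<le> R) \<and> bs \<alpha> (Phi \<beta>) (N n) x - r' n \<in> E)" using r'(3)[of n] eM by linarith
      then obtain x where x: "bs \<alpha> \<phi> (N n) x \<noteq> w n" "bs \<alpha> (Phi \<beta>) (N n) x - r' n \<in> E" using ex_cm_pos by blast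
      then show ?thesis using P(3)[OF x(2)] by (simp add: bsP linear_diff[OF P(1)])
    qed
    have "bounded (range (\<lambda>n. (r n, r' n)))"
    proof (rule boundedI)
      fix z assume "z \<in> range (\<lambda>n. (r n, r' n))"
      then obtain n where "z = (r n, r' n)" by auto
      then show "norm z \<le> 2 * \<rho>" using norm_Pair_le[of "r n" "r' n"] r(1)[of n] r'(1)[of n] by simp
    qed
    then obtain l s where s: "strict_mono (s :: nat \<Rightarrow> nat)" "((\<lambda>n. (r n, r' n)) \<circ> s) \<longlonglongrightarrow> l"
      using bounded_imp_convergent_subsequence by blast
    have lims: "(\<lambda>n. r (s n)) \<longlonglongrightarrow> fst l" "(\<lambda>n. r' (s n)) \<longlonglongrightarrow> snd l"
      using tendsto_fst[OF s(2)] tendsto_snd[OF s(2)] by (simp_all add: o_def)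
    have th: "(\<lambda>n. real (N (s n)) * \<alpha> - of_int (j (s n))) \<longlonglongrightarrow> 0"
    proof (rule Lim_null_comparison)
      show "eventually (\<lambda>n. norm (real (N (s n)) * \<alpha> - of_int (j (s n))) \<le> inverse (real (Suc n))) sequentially"
      proof (intro always_eventually allI)
        fix n
        have "n \<le> s n" using s(1) by (rule strict_mono_imp_increasing)
        then have "1 / real (Suc (s n)) \<le> 1 / real (Suc n)" by (intro divide_left_mono) auto
        then show "norm (real (N (s n)) * \<alpha> - of_int (j (s n))) \<le> inverse (real (Suc n))"
          using N(1)[of "s n"] by (simp add: inverse_eq_divide)
      qed
      show "(\<lambda>n. inverse (real (Suc n))) \<longlonglongrightarrow> 0" by (rule LIMSEQ_inverse_real_of_nat)
    qed
    have cE: "countable E" by (rule countable_subset[OF E(1) countable_int_vecs])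
    have EP: "E \<subseteq> PER \<alpha> (Phi \<beta>)" by (simp add: E_def)
    have p1: "fst l \<in> PER \<alpha> (Phi \<beta>)"
    proof (rule PER_limit[OF irr Phi_circle_fun cE EP _ _ eM _ th lims(1)])
      fix n
      show "{x \<in> {0..<1}. bs \<alpha> \<phi> (N (s n)) x = w (s n) \<and> bs \<alpha> (Phi \<beta>) (N (s n)) x - r (s n) \<in> E} \<in> sets circle"
        by (intro Collect_circle_sets) measurable
      show "\<epsilon> / M \<le> measure circle {x \<in> {0..<1}. bs \<alpha> \<phi> (N (s n)) x = w (s n) \<and> bs \<alpha> (Phi \<beta>) (N (s n)) x - r (s n) \<in> E}"
        using r(4)[of "s n"] by (simp add: cm_def)
    qed auto
    have p2: "snd l \<in> PER \<alpha> (Phi \<beta>)"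
    proof (rule PER_limit[OF irr Phi_circle_fun cE EP _ _ eM _ th lims(2)])
      fix n
      show "{x \<in> {0..<1}. (bs \<alpha> \<phi> (N (s n)) x \<noteq> w (s n) \<and> norm (bs \<alpha> \<phi> (N (s n)) x - w (s n)) \<le> R) \<and> bs \<alpha> (Phi \<beta>) (N (s n)) x - r' (s n) \<in> E} \<in> sets circle"
        by (intro Collect_circle_sets) measurable
      show "\<epsilon> / M \<le> measure circle {x \<in> {0..<1}. (bs \<alpha> \<phi> (N (s n)) x \<noteq> w (s n) \<and> norm (bs \<alpha> \<phi> (N (s n)) x - w (s n)) \<le> R) \<and> bs \<alpha> (Phi \<beta>) (N (s n)) x - r' (s n) \<in> E}"
        using r'(3)[of "s n"] by (simp add: cm_def)
    qed auto
    \<comment> \<open>Integral and convergent, hence eventually equal to its limit, which is a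
      difference of two periods. So \<open>d n0\<close> lies in E and P kills it, although P
      separates \<open>r\<close> from \<open>r'\<close>.\<close>
    define d where "d n = r' (s n) - r (s n)" for n
    have dint: "d n \<in> int_vecs" for n
      using int_vecs_diff[OF r'(2)[of "s n"] r(2)[of "s n"]] by (simp add: d_def)
    have dl: "d \<longlonglongrightarrow> snd l - fst l" unfolding d_def by (intro tendsto_diff lims)
    then obtain n0 where n0: "\<And>n. n \<ge> n0 \<Longrightarrow> norm (d n - (snd l - fst l)) < 1/2"
      using LIMSEQ_D[OF dl, of "1/2"] by auto
    have "d n = d n0" if "n \<ge> n0" for n
    proof -
      have "norm (d n - d n0) < 1"
        using n0[OF that] n0[of n0] norm_triangle_ineq4[of "d n - (snd l - fst l)" "d n0 - (snd l - fst l)"] by simp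
      then have "d n - d n0 = 0" by (intro int_vecs_small int_vecs_diff dint)
      then show ?thesis by simp
    qed
    then have "eventually (\<lambda>n. d n = d n0) sequentially" by (rule eventually_sequentiallyI)
    then have "d \<longlonglongrightarrow> d n0" by (rule tendsto_eventually)
    then have deq: "d n0 = snd l - fst l" using LIMSEQ_unique[OF dl] by simp
    have "d n0 \<in> E" unfolding E_def using dint[of n0] PER_diff[OF p2 p1] deq by simp
    then have "P (d n0) = 0" by (rule P(3))
    then show False using Pr[of "s n0"] Pr'[of "s n0"] by (simp add: d_def linear_diff[OF P(1)])
  qed
  from coboundary[OF this] obtain f where f: "circle_fun f" "AE x in circle. \<phi> x = f x - f (x + \<alpha>)" by blast
  show ?thesis
  proof (rule that[of "\<lambda>x. \<kappa> *\<^sub>R f x"])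
    show "circle_fun (\<lambda>x. \<kappa> *\<^sub>R f x)" using f(1) by (auto simp: circle_fun_def)
    show "AE x in circle. Phi \<beta> x - (\<kappa> *\<^sub>R f x - \<kappa> *\<^sub>R f (x + \<alpha>)) \<in> span (int_vecs \<inter> PER \<alpha> (Phi \<beta>))"
      using f(2)
    proof eventually_elim
      case (elim x)
      have "\<kappa> *\<^sub>R f x - \<kappa> *\<^sub>R f (x + \<alpha>) = \<kappa> *\<^sub>R P (Phi \<beta> x)" by (simp add: elim[symmetric] phi scaleR_diff_right[symmetric])
      then show ?case using P(5)[of "Phi \<beta> x"] by (simp add: E_def)
    qed
  qed
qed

section \<open>Fourier analysis on the torus\<close>

lemma Arg2pi_borel [measurable]: "Arg2pi \<in> borel_measurable borel"
proof -
  define A where "A = {z :: complex. Im z = 0 \<and> 0 \<le> Re z}"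
  have "closed A" unfolding A_def by (intro closed_Collect_conj closed_Collect_eq closed_Collect_le continuous_intros)
  then have "A \<in> sets borel" by simp
  moreover have "continuous_on (- A) Arg2pi"
  proof (rule continuous_at_imp_continuous_on, rule ballI)
    fix z assume "z \<in> - A"
    then show "isCont Arg2pi z" by (intro continuous_at_Arg2pi) (auto simp: A_def complex_nonneg_Reals_iff)
  qed
  ultimately have "(\<lambda>z. if z \<in> A then 0 else Arg2pi z) \<in> borel_measurable borel"
    by (intro borel_measurable_continuous_on_if continuous_intros)
  moreover have "(if z \<in> A then 0 else Arg2pi z) = Arg2pi z" for z
    using Arg2pi_eq_0[of z] by (auto simp: A_def complex_is_Real_iff)
  ultimately show ?thesis by simp
qed

definition angle :: "complex \<Rightarrow> real" where
  "angle z = Arg2pi z / (2 * pi)"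

lemma angle_borel [measurable]: "angle \<in> borel_measurable borel"
  unfolding angle_def by measurable

lemma cis_angle: "norm z = 1 \<Longrightarrow> cis (2 * pi * angle z) = z"
  using Arg2pi_eq[of z] by (simp add: angle_def cis_conv_exp)

lemma cis_2pi_frac: "cis (2 * pi * frac x) = cis (2 * pi * x)"
proof -
  have "cis (2 * pi * x) = cis (2 * pi * frac x + 2 * pi * of_int \<lfloor>x\<rfloor>)" by (simp add: frac_def algebra_simps)
  also have "\<dots> = cis (2 * pi * frac x)" by (simp only: cis_mult[symmetric] cis_multiple_2pi[OF Ints_of_int] mult_1_right)
  finally show ?thesis by simp
qed

lemma angle_cis: "angle (cis (2 * pi * x)) = frac x"
proof -
  have "Arg2pi (cis (2 * pi * frac x)) = 2 * pi * frac x"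
    by (rule Arg2pi_unique[of 1]) (auto simp: cis_conv_exp frac_lt_1)
  then show ?thesis by (simp add: angle_def cis_2pi_frac)
qed

definition ch :: "real ^ 'n \<Rightarrow> real ^ 'n \<Rightarrow> complex" where
  "ch n s = cis (2 * pi * (n \<bullet> s))"

lemma ch_borel [measurable]: "ch n \<in> borel_measurable borel"
  unfolding ch_def by (intro borel_measurable_continuous_onI continuous_intros)

lemma norm_ch [simp]: "norm (ch n s) = 1"
  by (simp add: ch_def)

lemma ch_add: "ch (n + m) s = ch n s * ch m s"
  by (simp add: ch_def cis_mult inner_add_left distrib_left)

lemma ch_add_right: "ch n (s + t) = ch n s * ch n t"
  by (simp add: ch_def cis_mult inner_add_right distrib_left)

lemma ch_0 [simp]: "ch 0 s = 1" "ch n 0 = 1"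
  by (simp_all add: ch_def)

lemma ch_nonzero [simp]: "ch n s \<noteq> 0"
  by (simp add: ch_def)

lemma ch_minus: "ch (- n) s = inverse (ch n s)" "ch n (- s) = inverse (ch n s)"
  by (simp_all add: ch_def)

lemma ch_diff: "ch (n - m) s = ch n s / ch m s"
  using ch_add[of "n - m" m s] by simp

lemma ch_diff_right: "ch n (s - t) = ch n s / ch n t"
  using ch_add_right[of n "s - t" t] by simp

lemma ch_Ints: "n \<bullet> s \<in> \<int> \<Longrightarrow> ch n s = 1"
  by (simp add: ch_def cis_multiple_2pi)

lemma ch_eq_cisD:
  assumes "ch n s = cis (2 * pi * x)"
  shows "n \<bullet> s - x \<in> \<int>"
proof -
  have "frac (n \<bullet> s) = frac x" using arg_cong[OF assms, of angle] by (simp add: ch_def angle_cis)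
  then have "n \<bullet> s - x = of_int (\<lfloor>n \<bullet> s\<rfloor> - \<lfloor>x\<rfloor>)" by (simp add: frac_def)
  then show ?thesis by (metis Ints_of_int)
qed

lemma inner_int_vecs: "n \<in> int_vecs \<Longrightarrow> z \<in> int_vecs \<Longrightarrow> n \<bullet> z \<in> \<int>"
  by (simp add: inner_vec_def int_vecs_def Ints_sum)

lemma axis_int_vecs [simp]: "axis i 1 \<in> int_vecs"
  by (auto simp: int_vecs_def axis_def)

inductive trig :: "(real ^ 'n \<Rightarrow> complex) \<Rightarrow> bool" where
  char: "n \<in> int_vecs \<Longrightarrow> trig (ch n)"
| scale: "trig f \<Longrightarrow> trig (\<lambda>s. c * f s)"
| add: "trig f \<Longrightarrow> trig g \<Longrightarrow> trig (\<lambda>s. f s + g s)"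

lemma trig_const: "trig (\<lambda>s. c)"
  using trig.scale[OF trig.char[OF int_vecs_0], of c] by simp

lemma trig_mult:
  assumes "trig f" "trig g"
  shows "trig (\<lambda>s. f s * g s)"
  using assms(1)
proof induction
  case (char n)
  from assms(2) show ?case
  proof induction
    case (char m)
    then show ?case using trig.char[OF int_vecs_add[OF \<open>n \<in> int_vecs\<close> char]] by (simp add: ch_add[abs_def])
  next
    case (scale g c)
    then show ?case using trig.scale[OF scale.IH, of c] by (simp add: mult.left_commute)
  next
    case (add g h)
    then show ?case using trig.add[OF add.IH] by (simp add: distrib_left)
  qed
next
  case (scale f c)
  then show ?case using trig.scale[OF scale.IH, of c] by (simp add: mult.assoc)
next
  case (add f h)
  then show ?case using trig.add[OF add.IH] by (simp add: distrib_right)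
qed

lemma trig_sum: "finite A \<Longrightarrow> (\<And>a. a \<in> A \<Longrightarrow> trig (f a)) \<Longrightarrow> trig (\<lambda>s. \<Sum>a\<in>A. f a s)"
  by (induction A rule: finite_induct) (auto intro: trig_const trig.add)

text \<open>Embeds the torus in a complex vector space, where Weierstrass approximation by
  polynomials on a compact set is available.\<close>

definition wind :: "real ^ 'n \<Rightarrow> complex ^ 'n" where
  "wind s = (\<chi> i. cis (2 * pi * s $ i))"

lemma continuous_wind: "continuous_on S wind"
  unfolding wind_def by (intro continuous_on_vec_lambda continuous_intros)

text \<open>Real and imaginary part of a coordinate of \<open>wind\<close> are combinations of the
  characters of \<open>axis i 1\<close> and of its negative; products of characters are
  characters.\<close>

lemma trig_polynomial:
  fixes p :: "complex ^ 'n \<Rightarrow> real"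
  assumes "real_polynomial_function p"
  shows "trig (\<lambda>s. complex_of_real (p (wind s)))"
  using assms
proof induction
  case (linear f)
  have t1: "trig (\<lambda>s. complex_of_real (wind s \<bullet> b))" if b: "b \<in> Basis" for b :: "complex ^ 'n"
  proof -
    obtain i u where u: "b = axis i u" "u \<in> Basis" using b by (auto simp: Basis_vec_def)
    have c: "ch (axis i 1) s = cis (2 * pi * s $ i)" "ch (- axis i 1) s = cis (- (2 * pi * s $ i))" for s :: "real ^ 'n"
      by (simp_all add: ch_def inner_axis' inner_minus_left)
    have tp: "trig (\<lambda>s. k * ch (axis i 1) s + l * ch (- axis i 1) s)" for k l
      by (intro trig.intros int_vecs_minus axis_int_vecs)
    have "u = 1 \<or> u = \<i>" using u(2) by (auto simp: Basis_complex_def)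
    then show ?thesis
    proof
      assume "u = 1"
      then have "complex_of_real (wind s \<bullet> b) = (1/2) * ch (axis i 1) s + (1/2) * ch (- axis i 1) s" for s
        unfolding u c by (simp add: inner_axis wind_def inner_complex_def complex_eq_iff)
      then show ?thesis using tp[of "1/2" "1/2"] by simp
    next
      assume "u = \<i>"
      then have "complex_of_real (wind s \<bullet> b) = (- \<i>/2) * ch (axis i 1) s + (\<i>/2) * ch (- axis i 1) s" for s
        unfolding u c by (simp add: inner_axis wind_def inner_complex_def complex_eq_iff)
      then show ?thesis using tp[of "- \<i>/2" "\<i>/2"] by simp
    qed
  qed
  interpret bounded_linear f by (rule linear)
  have fz: "f z = (\<Sum>b\<in>Basis. (z \<bullet> b) * f b)" for z
  proof -
    have "f z = f (\<Sum>b\<in>Basis. (z \<bullet> b) *\<^sub>R b)" by (simp only: euclidean_representation)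
    then show ?thesis by (simp add: sum scaleR)
  qed
  have "(\<lambda>s. complex_of_real (f (wind s))) = (\<lambda>s. \<Sum>b\<in>Basis. of_real (f b) * complex_of_real (wind s \<bullet> b))"
    by (subst fz) (simp add: mult.commute)
  moreover have "trig (\<lambda>s. \<Sum>b\<in>Basis. of_real (f b) * complex_of_real (wind s \<bullet> b))"
  proof (rule trig_sum[OF finite_Basis])
    fix b :: "complex ^ 'n" assume "b \<in> Basis"
    from trig.scale[OF t1[OF this]] show "trig (\<lambda>s. of_real (f b) * complex_of_real (wind s \<bullet> b))" .
  qed
  ultimately show ?case by (simp only:)
next
  case (const c)
  show ?case by (rule trig_const)
next
  case (add f g)
  then show ?case by (auto intro: trig.add)
next
  case (mult f g)
  then show ?case by (auto intro: trig_mult)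
qed

text \<open>Weierstrass approximation on K passes from polynomials to continuous functions, and the
  ramps \<open>f m\<close> decrease to the indicator of a closed set; closed sets are an
  intersection-stable generator.\<close>

lemma measure_eq_polynomials:
  fixes \<mu> \<nu> :: "'a::euclidean_space measure"
  assumes fm: "finite_measure \<mu>" "finite_measure \<nu>" and s: "sets \<mu> = sets borel" "sets \<nu> = sets borel"
    and K: "compact K" "AE x in \<mu>. x \<in> K" "AE x in \<nu>. x \<in> K"
    and eq: "\<And>p. real_polynomial_function p \<Longrightarrow> integral\<^sup>L \<mu> p = integral\<^sup>L \<nu> p"
  shows "\<mu> = \<nu>"
proof -
  have int: "integrable M f" if "M = \<mu> \<or> M = \<nu>" "continuous_on UNIV f" for M and f :: "'a \<Rightarrow> real"
  proof -
    interpret finite_measure M using that(1) fm by auto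
    have "compact (f ` K)" using that(2) K(1) by (intro compact_continuous_image) (auto intro: continuous_on_subset)
    then obtain B where B: "\<And>x. x \<in> K \<Longrightarrow> norm (f x) \<le> B" using compact_imp_bounded[of "f ` K"] by (auto simp: bounded_iff)
    have sM: "sets M = sets borel" using that(1) s by auto
    have "AE x in M. x \<in> K" using that(1) K by auto
    then have "AE x in M. norm (f x) \<le> B" by eventually_elim (rule B)
    moreover have "f \<in> borel_measurable M"
      unfolding measurable_cong_sets[OF sM refl] by (rule borel_measurable_continuous_onI[OF that(2)])
    ultimately show ?thesis by (rule integrable_const_bound)
  qed
  have cont: "integral\<^sup>L \<mu> f = integral\<^sup>L \<nu> f" if f: "continuous_on UNIV f" for f :: "'a \<Rightarrow> real"
  proof (rule ccontr)
    assume ne: "integral\<^sup>L \<mu> f \<noteq> integral\<^sup>L \<nu> f"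
    define d where "d = \<bar>integral\<^sup>L \<mu> f - integral\<^sup>L \<nu> f\<bar>"
    define m where "m = measure \<mu> (space \<mu>) + measure \<nu> (space \<nu>)"
    have m: "m \<ge> 0" by (simp add: m_def)
    have d: "d > 0" using ne by (simp add: d_def)
    \<comment> \<open>m + 1 exceeds the total mass, so the approximation errors of the two measures
      add up to less than d.\<close>
    have \<epsilon>: "d / (m + 1) > 0" using d m by simp
    obtain p where p: "real_polynomial_function p" "\<And>x. x \<in> K \<Longrightarrow> \<bar>f x - p x\<bar> < d / (m + 1)"
      using Stone_Weierstrass_real_polynomial_function[OF K(1) continuous_on_subset[OF f subset_UNIV] \<epsilon>] by blast
    have pc: "continuous_on UNIV p" using p(1) by (simp add: continuous_on_polymonial_function real_polynomial_function_eq)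
    have near: "\<bar>integral\<^sup>L M f - integral\<^sup>L M p\<bar> \<le> d / (m + 1) * measure M (space M)" if M: "M = \<mu> \<or> M = \<nu>" for M
    proof -
      interpret finite_measure M using M fm by auto
      have i: "integrable M f" "integrable M p" using int[OF M] f pc by auto
      have "AE x in M. x \<in> K" using M K by auto
      then have ae: "AE x in M. \<bar>f x - p x\<bar> \<le> d / (m + 1)" by eventually_elim (use p(2) in \<open>auto intro: less_imp_le\<close>)
      have "\<bar>integral\<^sup>L M f - integral\<^sup>L M p\<bar> = \<bar>LINT x|M. f x - p x\<bar>" using i by simp
      also have "\<dots> \<le> (LINT x|M. \<bar>f x - p x\<bar>)" by (rule integral_abs_bound)
      also have "\<dots> \<le> (LINT x|M. d / (m + 1))" by (rule integral_mono_AE) (use i ae in auto)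
      finally show ?thesis by (simp add: mult.commute)
    qed
    have "d \<le> d / (m + 1) * measure \<mu> (space \<mu>) + d / (m + 1) * measure \<nu> (space \<nu>)"
      using near[of \<mu>] near[of \<nu>] eq[OF p(1)] unfolding d_def by simp
    also have "\<dots> = d * (m / (m + 1))" unfolding m_def by (simp only: distrib_left[symmetric]) simp
    also have "\<dots> < d * 1" using d m by (intro mult_strict_left_mono) auto
    finally show False by simp
  qed
  have clos: "measure \<mu> C = measure \<nu> C" if C: "closed C" for C
  proof (cases "C = {}")
    case False
    define f where "f m x = max 0 (1 - real m * infdist x C)" for m x
    have fc: "continuous_on UNIV (f m)" for m unfolding f_def by (intro continuous_intros continuous_on_max)
    have lim: "(\<lambda>m. f m x) \<longlonglongrightarrow> indicat_real C x" for x
    proof (cases "x \<in> C")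
      case True
      then show ?thesis by (simp add: f_def)
    next
      case nC: False
      have pos: "infdist x C > 0" using in_closed_iff_infdist_zero[OF C False, of x] nC infdist_nonneg[of x C] by linarith
      obtain m0 :: nat where m0: "1 / infdist x C < real m0" using reals_Archimedean2 by blast
      have "f m x = 0" if "m \<ge> m0" for m
      proof -
        have "1 / infdist x C \<le> real m" using m0 that by linarith
        then have "1 \<le> real m * infdist x C" using pos by (simp add: field_simps)
        then show ?thesis by (simp add: f_def)
      qed
      then have "eventually (\<lambda>m. f m x = 0) sequentially" by (rule eventually_sequentiallyI)
      then show ?thesis using nC by (simp add: tendsto_eventually)
    qed
    have lims: "(\<lambda>m. integral\<^sup>L M (f m)) \<longlonglongrightarrow> measure M C" if M: "M = \<mu> \<or> M = \<nu>" for M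
    proof -
      interpret finite_measure M using M fm by auto
      have sM: "sets M = sets borel" using M s by auto
      have [measurable]: "C \<in> sets M" using C by (simp add: sM)
      have "(\<lambda>m. integral\<^sup>L M (f m)) \<longlonglongrightarrow> integral\<^sup>L M (indicat_real C)"
      proof (rule integral_dominated_convergence[where w="\<lambda>x. 1"])
        show "AE x in M. norm (f m x) \<le> 1" for m by (intro AE_I2) (simp add: f_def infdist_nonneg)
      qed (use int[OF M fc] lim in auto)
      moreover have "C \<inter> space M = C" using sets_eq_imp_space_eq[OF sM] by simp
      ultimately show ?thesis by simp
    qed
    then show ?thesis using lims[of \<mu>] lims[of \<nu>] cont[OF fc] LIMSEQ_unique by fastforce
  qed simp
  interpret m: finite_measure \<mu> by (rule fm)
  interpret n: finite_measure \<nu> by (rule fm)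
  show ?thesis
  proof (rule measure_eqI_generator_eq[where E="Collect closed" and \<Omega>=UNIV and A="\<lambda>_. UNIV"])
    show "Int_stable (Collect closed :: 'a set set)" by (auto simp: Int_stable_def)
    show "emeasure \<mu> X = emeasure \<nu> X" if "X \<in> Collect closed" for X
      using clos[of X] that by (simp add: m.emeasure_eq_measure n.emeasure_eq_measure)
    show "sets \<mu> = sigma_sets UNIV (Collect closed)" "sets \<nu> = sigma_sets UNIV (Collect closed)"
      unfolding s borel_eq_closed by simp_all
  qed (auto simp: m.emeasure_eq_measure)
qed

section \<open>Integer translates of the unit cube\<close>

definition cube :: "(real ^ 'n) set" where
  "cube = {s. \<forall>i. 0 \<le> s $ i \<and> s $ i < 1}"

definition fl :: "real ^ 'n \<Rightarrow> real ^ 'n" where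
  "fl s = (\<chi> i. of_int \<lfloor>s $ i\<rfloor>)"

lemma cube_borel [measurable]: "cube \<in> sets borel"
proof -
  have "(\<lambda>s. s $ i) \<in> borel_measurable (borel :: (real ^ 'n) measure)" for i
    by (intro borel_measurable_continuous_onI continuous_intros)
  then have [measurable]: "Measurable.pred borel (\<lambda>s :: real ^ 'n. 0 \<le> s $ i \<and> s $ i < 1)" for i by measurable
  have "Measurable.pred borel (\<lambda>s :: real ^ 'n. \<forall>i\<in>UNIV. 0 \<le> s $ i \<and> s $ i < 1)"
    by (intro pred_intros_finite) auto
  then show ?thesis by (simp add: cube_def pred_def)
qed

lemma fl_int [simp]: "fl s \<in> int_vecs"
  by (simp add: fl_def int_vecs_def)

lemma cube_diff_iff: "z \<in> int_vecs \<Longrightarrow> s - z \<in> cube \<longleftrightarrow> z = fl s"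
proof -
  assume z: "z \<in> int_vecs"
  have "0 \<le> s $ i - z $ i \<and> s $ i - z $ i < 1 \<longleftrightarrow> z $ i = of_int \<lfloor>s $ i\<rfloor>" for i
  proof -
    obtain k where k: "z $ i = of_int k" using z by (auto simp: int_vecs_def elim: Ints_cases)
    have "0 \<le> s $ i - of_int k \<and> s $ i - of_int k < 1 \<longleftrightarrow> \<lfloor>s $ i\<rfloor> = k" by (simp add: floor_eq_iff) linarith
    then show ?thesis by (auto simp: k)
  qed
  then show ?thesis by (simp add: cube_def fl_def vec_eq_iff)
qed

lemma norm_cube: "s \<in> cube \<Longrightarrow> norm (s :: real ^ 'n) \<le> real CARD('n)"
proof -
  assume "s \<in> cube"
  then have "(\<Sum>i\<in>UNIV. \<bar>s $ i\<bar>) \<le> (\<Sum>i\<in>(UNIV :: 'n set). 1)" by (intro sum_mono) (simp add: cube_def less_imp_le)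
  then show ?thesis using norm_le_l1_cart[of s] by simp
qed

lemma norm_fl: "norm (fl s) \<le> norm s + real CARD('n)" for s :: "real ^ 'n"
proof -
  have "s - fl s \<in> cube" by (simp add: cube_diff_iff)
  then have "norm (s - fl s) \<le> real CARD('n)" by (rule norm_cube)
  then show ?thesis using norm_triangle_ineq4[of s "s - fl s"] by simp
qed

lemma emeasure_cube: "emeasure lborel (cube :: (real ^ 'n) set) < \<infinity>"
proof -
  have "emeasure lborel (cube :: (real ^ 'n) set) \<le> emeasure lborel (cball 0 (real CARD('n)) :: (real ^ 'n) set)"
    by (rule emeasure_mono) (auto simp: norm_cube)
  also have "\<dots> < \<infinity>" by (rule emeasure_lborel_cball_finite)
  finally show ?thesis .
qed

lemma AE_int_period:
  fixes F :: "real ^ 'n \<Rightarrow> 'b"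
  assumes ax: "\<And>i. AE s in lborel. F (s + axis i 1) = F s" and z: "z \<in> int_vecs"
  shows "AE s in lborel. F (s + z) = F s"
proof -
  define G where "G = {z. AE s in lborel. F (s + z) = F s}"
  have diff: "u - v \<in> G" if u: "u \<in> G" and v: "v \<in> G" for u v
  proof -
    have "AE s in lborel. F (s + u) = F s" using u by (simp add: G_def)
    moreover have "AE s in lborel. F (s + (u - v) + v) = F (s + (u - v))"
      using v AE_lborel_shift[where P="\<lambda>s. F (s + v) = F s" and c="u - v"] by (simp add: G_def)
    ultimately have "AE s in lborel. F (s + (u - v)) = F s" by eventually_elim simp
    then show ?thesis by (simp add: G_def)
  qed
  have 0: "0 \<in> G" by (simp add: G_def)
  have add: "u + v \<in> G" if "u \<in> G" "v \<in> G" for u v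
    using diff[OF that(1) diff[OF 0 that(2)]] by simp
  have "z $ i *\<^sub>R axis i 1 \<in> G" for i
  proof -
    obtain k where k: "z $ i = of_int k" using z by (auto simp: int_vecs_def elim: Ints_cases)
    show ?thesis unfolding k by (rule subgroup_scale_int) (use diff ax in \<open>auto simp: G_def\<close>)
  qed
  then have "(\<Sum>i\<in>A. z $ i *\<^sub>R axis i 1) \<in> G" for A
    by (induction A rule: infinite_finite_induct) (auto intro: 0 add)
  moreover have "(\<Sum>i\<in>UNIV. z $ i *\<^sub>R axis i 1) = z" using basis_expansion[of z] by (simp add: scalar_mult_eq_scaleR)
  ultimately show ?thesis by (metis (no_types, lifting) G_def mem_Collect_eq)
qed

lemma LINT_lborel_shift:
  fixes G :: "'a::euclidean_space \<Rightarrow> complex"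
  assumes [measurable]: "G \<in> borel_measurable borel"
  shows "(LINT s|lborel. G (s + a)) = (LINT s|lborel. G s)"
proof -
  have "(LINT s|lborel. G s) = (LINT s|distr lborel borel ((+) a). G s)" by (simp add: lborel_distr_plus)
  also have "\<dots> = (LINT s|lborel. G (a + s))" by (rule integral_distr) auto
  finally show ?thesis by (simp add: add.commute)
qed

lemma integrable_cube:
  fixes F :: "real ^ 'n \<Rightarrow> complex"
  assumes [measurable]: "F \<in> borel_measurable borel" and "\<And>s. norm (F s) \<le> 1" and "\<And>s. P s \<Longrightarrow> s - a \<in> cube" and [measurable]: "Measurable.pred borel P"
  shows "integrable lborel (\<lambda>s. of_bool (P s) * F s)"
proof (rule Bochner_Integration.integrable_bound)
  have [measurable]: "{s. s - a \<in> cube} \<in> sets borel" using shift_sets_borel[OF cube_borel, of "- a"] by simp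
  have "emeasure lborel {s. s - a \<in> cube} < \<infinity>"
    using emeasure_lborel_shift[OF cube_borel, of "- a"] emeasure_cube[where 'n='n] by simp
  then show "integrable lborel (indicat_real {s. s - a \<in> cube})" by simp
  show "(\<lambda>s. of_bool (P s) * F s) \<in> borel_measurable lborel" unfolding of_bool_def by measurable
  show "AE s in lborel. norm (of_bool (P s) * F s) \<le> norm (indicat_real {s. s - a \<in> cube} s)"
    using assms(2,3) by (intro AE_I2) (auto simp: norm_mult indicator_def)
qed

text \<open>The translated cube is cut along the integer translates of the cube, and the finitely
  many pieces are moved back by periodicity.\<close>

lemma LINT_cube_shift:
  fixes F :: "real ^ 'n \<Rightarrow> complex"
  assumes F [measurable]: "F \<in> borel_measurable borel" and bd: "\<And>s. norm (F s) \<le> 1"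
    and per: "\<And>i. AE s in lborel. F (s + axis i 1) = F s"
  shows "(LINT s|lborel. of_bool (s \<in> cube) * F (s + a)) = (LINT s|lborel. of_bool (s \<in> cube) * F s)"
proof -
  have [measurable]: "Measurable.pred borel (\<lambda>s. s - c \<in> cube)" for c :: "real ^ 'n"
    using shift_sets_borel[OF cube_borel, of "- c"] by (simp add: pred_def)
  have [measurable]: "Measurable.pred borel (\<lambda>s. s + c \<in> cube)" for c :: "real ^ 'n"
    using shift_sets_borel[OF cube_borel, of c] by (simp add: pred_def)
  have [measurable]: "Measurable.pred borel (\<lambda>s :: real ^ 'n. s \<in> cube)" by (simp add: pred_def)
  \<comment> \<open>One CARD('n) bounds a point of the cube, the other its distance to
    \<open>fl\<close>; so Z contains every cell that meets the translated cube.\<close>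
  define Z where "Z = {z \<in> int_vecs. norm (z :: real ^ 'n) \<le> norm a + 2 * real CARD('n)}"
  have finZ: "finite Z" unfolding Z_def by (rule finite_int_vecs_bounded)
  have Z: "fl s \<in> Z" if "norm s \<le> norm a + real CARD('n)" for s :: "real ^ 'n"
    using norm_fl[of s] that by (simp add: Z_def)
  have one: "(\<Sum>z\<in>Z. of_bool (s - z \<in> cube)) = (1 :: complex)" if s: "norm s \<le> norm a + real CARD('n)" for s :: "real ^ 'n"
  proof -
    have "(\<Sum>z\<in>Z. of_bool (s - z \<in> cube)) = (\<Sum>z\<in>Z. if z = fl s then 1 else (0 :: complex))"
      by (intro sum.cong) (auto simp: cube_diff_iff Z_def)
    then show ?thesis using finZ Z[OF s] by simp
  qed
  have minus: "z \<in> Z \<Longrightarrow> - z \<in> Z" for z by (auto simp: Z_def intro: int_vecs_minus)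
  have one': "(\<Sum>z\<in>Z. of_bool (s + z \<in> cube)) = (1 :: complex)" if s: "norm s \<le> norm a + real CARD('n)" for s :: "real ^ 'n"
  proof -
    have "(\<Sum>z\<in>Z. of_bool (s + z \<in> cube)) = (\<Sum>z\<in>Z. of_bool (s - z \<in> cube) :: complex)"
      by (rule sum.reindex_bij_witness[of _ uminus uminus]) (use minus in auto)
    then show ?thesis using one[OF s] by simp
  qed
  have i1: "integrable lborel (\<lambda>s. of_bool (s - a \<in> cube \<and> s - z \<in> cube) * F s)" for z
    by (rule integrable_cube[where a=a]) (use bd in auto)
  have i2: "integrable lborel (\<lambda>s. of_bool (s \<in> cube \<and> s - a + z \<in> cube) * F s)" for z
  proof (rule integrable_cube[where a=0])
    show "Measurable.pred borel (\<lambda>s. s \<in> cube \<and> s - a + z \<in> cube)"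
      unfolding diff_add_eq by (simp only: diff_diff_eq2[symmetric]) measurable
  qed (use bd in auto)
  have meas: "(\<lambda>s. of_bool (s - a \<in> cube \<and> s - z \<in> cube) * F s) \<in> borel_measurable borel" for z
    using borel_measurable_integrable[OF i1[of z]] by simp
  have "(LINT s|lborel. of_bool (s \<in> cube) * F (s + a)) = (LINT s|lborel. of_bool (s - a \<in> cube) * F s)"
    using LINT_lborel_shift[of "\<lambda>s. of_bool (s - a \<in> cube) * F s" a] unfolding of_bool_def by simp
  also have "\<dots> = (LINT s|lborel. (\<Sum>z\<in>Z. of_bool (s - a \<in> cube \<and> s - z \<in> cube) * F s))"
  proof (rule Bochner_Integration.integral_cong[OF refl])
    fix s :: "real ^ 'n"
    show "of_bool (s - a \<in> cube) * F s = (\<Sum>z\<in>Z. of_bool (s - a \<in> cube \<and> s - z \<in> cube) * F s)"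
    proof (cases "s - a \<in> cube")
      case True
      then have "norm s \<le> norm a + real CARD('n)" using norm_cube[of "s - a"] norm_triangle_ineq[of "s - a" a] by simp
      then show ?thesis using True one by (simp add: sum_distrib_right[symmetric])
    qed simp
  qed
  also have "\<dots> = (\<Sum>z\<in>Z. LINT s|lborel. of_bool (s - a \<in> cube \<and> s - z \<in> cube) * F s)"
    by (rule Bochner_Integration.integral_sum) (rule i1)
  also have "\<dots> = (\<Sum>z\<in>Z. LINT s|lborel. of_bool (s \<in> cube \<and> s - a + z \<in> cube) * F s)"
  proof (rule sum.cong[OF refl])
    fix z assume "z \<in> Z"
    then have "z \<in> int_vecs" by (simp add: Z_def)
    from AE_int_period[where F=F, OF per this] have "AE s in lborel. F (s + z) = F s" .
    then have ae: "AE s in lborel. of_bool (s \<in> cube \<and> s - a + z \<in> cube) * F s = of_bool (s + z - a \<in> cube \<and> s + z - z \<in> cube) * F (s + z)"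
    proof eventually_elim
      case (elim s)
      have "s + z - a = s - a + z" "s + z - z = s" by simp_all
      then show ?case by (simp only: elim conj_commute)
    qed
    have "(LINT s|lborel. of_bool (s - a \<in> cube \<and> s - z \<in> cube) * F s) = (LINT s|lborel. of_bool (s + z - a \<in> cube \<and> s + z - z \<in> cube) * F (s + z))"
      by (rule LINT_lborel_shift[OF meas, symmetric])
    also have "\<dots> = (LINT s|lborel. of_bool (s \<in> cube \<and> s - a + z \<in> cube) * F s)"
      by (rule integral_cong_AE[symmetric, OF _ _ ae]) (simp_all add: borel_measurable_integrable[OF i2[of z], simplified] measurable_compose[OF _ meas[of z], of "\<lambda>s. s + z" borel, simplified])
    finally show "(LINT s|lborel. of_bool (s - a \<in> cube \<and> s - z \<in> cube) * F s) = (LINT s|lborel. of_bool (s \<in> cube \<and> s - a + z \<in> cube) * F s)" .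
  qed
  also have "\<dots> = (LINT s|lborel. (\<Sum>z\<in>Z. of_bool (s \<in> cube \<and> s - a + z \<in> cube) * F s))"
    by (rule Bochner_Integration.integral_sum[symmetric]) (rule i2)
  also have "\<dots> = (LINT s|lborel. of_bool (s \<in> cube) * F s)"
  proof (rule Bochner_Integration.integral_cong[OF refl])
    fix s :: "real ^ 'n"
    show "(\<Sum>z\<in>Z. of_bool (s \<in> cube \<and> s - a + z \<in> cube) * F s) = of_bool (s \<in> cube) * F s"
    proof (cases "s \<in> cube")
      case True
      then have "norm (s - a) \<le> norm a + real CARD('n)" using norm_cube[of s] norm_triangle_ineq4[of s a] by simp
      then show ?thesis using True one' by (simp add: sum_distrib_right[symmetric])
    qed simp
  qed
  finally show ?thesis .
qed

lemma vec_lambda_borel: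
  assumes "\<And>i. f i \<in> borel_measurable M"
  shows "(\<lambda>x. \<chi> i. f i x :: real ^ 'n) \<in> borel_measurable M"
proof -
  have "(\<lambda>x. \<Sum>i\<in>UNIV. f i x *\<^sub>R (axis i 1 :: real ^ 'n)) \<in> borel_measurable M" using assms by measurable
  moreover have "(\<Sum>i\<in>UNIV. f i x *\<^sub>R axis i 1) = (\<chi> i. f i x)" for x
    by (simp add: vec_eq_iff axis_def if_distrib cong: if_cong)
  ultimately show ?thesis by simp
qed

lemma vec_nth_borel [measurable]: "(\<lambda>x. x $ i) \<in> borel_measurable (borel :: ('a::real_normed_vector ^ 'n) measure)"
  by (intro borel_measurable_continuous_onI continuous_intros)

text \<open>Equal integrals of characters make the images under \<open>wind\<close> of the two
  restricted measures equal. On the cube \<open>wind\<close> has the Borel inverse \<open>h\<close>,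
  so the image of the part of E1 outside E2 can be tested by a Borel set that the second measure
  does not charge.\<close>

lemma fourier_uniqueness:
  fixes E1 E2 :: "(real ^ 'n) set"
  assumes b: "E1 \<in> sets borel" "E2 \<in> sets borel"
    and eq: "\<And>n. n \<in> int_vecs \<Longrightarrow> (LINT s|lborel. of_bool (s \<in> cube) * (of_bool (s \<in> E1) * ch n s)) = (LINT s|lborel. of_bool (s \<in> cube) * (of_bool (s \<in> E2) * ch n s))"
  shows "AE s in lborel. s \<in> cube \<longrightarrow> s \<in> E1 \<longrightarrow> s \<in> E2"
proof -
  define R where "R E = restrict_space lborel (cube \<inter> E)" for E :: "(real ^ 'n) set"
  define \<mu> where "\<mu> E = distr (R E) borel wind" for E
  have wb [measurable]: "wind \<in> borel_measurable borel" by (rule borel_measurable_continuous_onI[OF continuous_wind])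
  have fin: "finite_measure (R E)" if "E \<in> sets borel" for E
  proof
    have "emeasure lborel (cube \<inter> E) \<le> emeasure lborel (cube :: (real ^ 'n) set)" by (rule emeasure_mono) auto
    then have "emeasure lborel (cube \<inter> E) < \<infinity>" using emeasure_cube[where 'n='n] by (rule le_less_trans)
    then show "emeasure (R E) (space (R E)) \<noteq> \<infinity>" using that by (simp add: R_def emeasure_restrict_space space_restrict_space)
  qed
  have Rm: "f \<in> borel_measurable (R E)" if "f \<in> borel_measurable borel" for E and f :: "real ^ 'n \<Rightarrow> 'c::topological_space"
    unfolding R_def using that by (intro measurable_restrict_space1) simp
  have LR: "(LINT s|R E. f s) = (LINT s|lborel. of_bool (s \<in> cube) * (of_bool (s \<in> E) * f s))" if "E \<in> sets borel" for E and f :: "real ^ 'n \<Rightarrow> complex"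
    unfolding R_def using that by (subst integral_restrict_space) (auto intro!: Bochner_Integration.integral_cong simp: indicator_def)
  have trig_int: "integrable (R E) f" if "trig f" "E \<in> sets borel" for E f
    using that(1)
  proof induction
    case (char n)
    interpret finite_measure "R E" by (rule fin[OF that(2)])
    show ?case by (rule integrable_const_bound[where B=1]) (auto intro: Rm)
  qed auto
  have tr: "(LINT s|R E1. f s) = (LINT s|R E2. f s)" if "trig f" for f
    using that
  proof induction
    case (char n)
    then show ?case by (simp only: LR[OF b(1)] LR[OF b(2)] eq)
  next
    case (scale f c)
    then show ?case by simp
  next
    case (add f g)
    then show ?case using trig_int b by simp
  qed
  have wR: "wind \<in> measurable (R E) borel" for E by (rule Rm) (rule wb)
  have fin\<mu>: "finite_measure (\<mu> E)" if "E \<in> sets borel" for E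
    unfolding \<mu>_def by (rule finite_measure.finite_measure_distr[OF fin[OF that] wR])
  have eqm: "\<mu> E1 = \<mu> E2"
  proof (rule measure_eq_polynomials[of _ _ "wind ` cbox 0 1"])
    show "compact (wind ` cbox 0 1)" by (rule compact_continuous_image[OF continuous_wind]) simp
    have "AE x in \<mu> E. x \<in> wind ` cbox 0 1" if "E \<in> sets borel" for E
    proof -
      have c: "closed (wind ` cbox 0 (1 :: real ^ 'n))" by (intro compact_imp_closed compact_continuous_image[OF continuous_wind]) simp
      have "AE s in R E. s \<in> space (R E)" by (rule AE_space)
      then have "AE s in R E. wind s \<in> wind ` cbox 0 1"
        by eventually_elim (auto simp: R_def space_restrict_space cube_def mem_box_cart less_imp_le intro!: imageI)
      then show ?thesis unfolding \<mu>_def by (subst AE_distr_iff[OF wR]) (use c in auto)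
    qed
    then show "AE x in \<mu> E1. x \<in> wind ` cbox 0 1" "AE x in \<mu> E2. x \<in> wind ` cbox 0 1" using b by auto
    fix p :: "complex ^ 'n \<Rightarrow> real" assume p: "real_polynomial_function p"
    have "continuous_on UNIV p" using p by (simp add: continuous_on_polymonial_function real_polynomial_function_eq)
    then have pb: "p \<in> borel_measurable borel" by (rule borel_measurable_continuous_onI)
    have "complex_of_real (integral\<^sup>L (\<mu> E) p) = (LINT s|R E. complex_of_real (p (wind s)))" for E
      unfolding \<mu>_def by (subst integral_distr[OF wR pb]) (simp add: integral_complex_of_real)
    then show "integral\<^sup>L (\<mu> E1) p = integral\<^sup>L (\<mu> E2) p"
      using tr[OF trig_polynomial[OF p]] by (metis of_real_eq_iff)
  qed (use fin\<mu> b in \<open>auto simp: \<mu>_def\<close>)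
  define C where "C = (E1 - E2) \<inter> cube"
  have Cb [measurable]: "C \<in> sets borel" using b by (auto simp: C_def)
  define h :: "complex ^ 'n \<Rightarrow> real ^ 'n" where "h z = (\<chi> i. angle (z $ i))" for z
  have [measurable]: "h \<in> borel_measurable borel" unfolding h_def[abs_def]
    by (intro vec_lambda_borel) measurable
  have S: "h -` C \<in> sets borel" using measurable_sets_borel[of h borel C] by simp
  have hw: "h (wind s) = s" if "s \<in> cube" for s
    using that by (simp add: h_def wind_def angle_cis vec_eq_iff cube_def frac_eq)
  have "emeasure lborel C = emeasure (R E1) (wind -` (h -` C) \<inter> space (R E1))"
  proof -
    have "wind -` (h -` C) \<inter> space (R E1) = C" using hw by (auto simp: R_def space_restrict_space C_def)
    moreover have "emeasure (R E1) C = emeasure lborel C"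
      unfolding R_def by (rule emeasure_restrict_space) (use b in \<open>auto simp: C_def\<close>)
    ultimately show ?thesis by simp
  qed
  also have "\<dots> = emeasure (\<mu> E1) (h -` C)" unfolding \<mu>_def by (rule emeasure_distr[OF wR S, symmetric])
  also have "\<dots> = emeasure (\<mu> E2) (h -` C)" by (simp add: eqm)
  also have "\<dots> = emeasure (R E2) (wind -` (h -` C) \<inter> space (R E2))" unfolding \<mu>_def by (rule emeasure_distr[OF wR S])
  also have "\<dots> = 0"
  proof -
    have "wind -` (h -` C) \<inter> space (R E2) = {}" using hw by (auto simp: R_def space_restrict_space C_def)
    then show ?thesis by simp
  qed
  finally have "emeasure lborel C = 0" .
  then have "C \<in> null_sets lborel" using Cb by auto
  then show ?thesis by (rule AE_I') (auto simp: C_def)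
qed

section \<open>Fourier coefficients of invariant sets\<close>

definition chars :: "real \<Rightarrow> (real \<Rightarrow> real ^ 'n) \<Rightarrow> (real ^ 'n) set" where
  "chars \<alpha> \<xi> = {n \<in> int_vecs. \<exists>g. circle_fun g \<and> (\<forall>x. norm (g x) = 1) \<and>
     (AE x in lborel. g x = ch n (\<xi> x) * g (x + \<alpha>))}"

text \<open>The n-th fibre coefficient \<open>f n\<close> of A satisfies a multiplicative
  cohomological equation, so by ergodicity of the rotation it vanishes almost everywhere or almost
  nowhere. In the second case its phase puts -n into \<open>chars\<close>, whence
  \<open>ch n s0 = 1\<close>. Thus translation by s0 changes no coefficient.\<close>

lemma fourier_periods:
  fixes \<xi> :: "real \<Rightarrow> real ^ 'n"
  assumes irr: "\<alpha> \<notin> \<rat>" and \<xi>: "circle_fun \<xi>" and A: "skew_inv \<alpha> \<xi> A"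
    and ax: "\<And>i. period A (0, axis i 1)" and s0: "\<And>n. n \<in> chars \<alpha> \<xi> \<Longrightarrow> ch n s0 = 1"
  shows "period A (0, s0)"
proof -
  have [measurable]: "A \<in> sets borel" and A1: "\<And>x t. (x + 1, t) \<in> A \<longleftrightarrow> (x, t) \<in> A"
    and inv: "AE z in lborel. (fst z + \<alpha>, snd z + \<xi> (fst z)) \<in> A \<longleftrightarrow> z \<in> A"
    using A by (auto simp: skew_inv_def)
  have \<xi>m [measurable]: "\<xi> \<in> borel_measurable borel" using \<xi> by (simp add: circle_fun_def)
  have sec [measurable]: "{s. (x, s) \<in> A} \<in> sets borel" for x
    using measurable_sets_borel[of "Pair x" borel A] by (auto simp: vimage_def intro!: borel_measurable_Pair)
  have sec' [measurable]: "{s. (x, s + c) \<in> A} \<in> sets borel" for x c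
    using shift_sets_borel[OF sec[of x], of c] by simp
  have chm [measurable]: "(\<lambda>s. of_bool ((x, s + c) \<in> A) * ch n s) \<in> borel_measurable borel" for x c n
  proof -
    have [measurable]: "Measurable.pred borel (\<lambda>s. (x, s + c) \<in> A)" using sec'[of x c] by (simp add: pred_def)
    show ?thesis unfolding of_bool_def by measurable
  qed
  define good where "good x \<longleftrightarrow> (\<forall>i\<in>UNIV. AE s in lborel. ((x, s + axis i 1) \<in> A) = ((x, s) \<in> A))" for x
  have good: "AE x in lborel. good x"
    unfolding good_def
  proof (rule AE_finite_allI)
    fix i :: 'n
    have "AE z in lborel. z + (0, axis i 1) \<in> A \<longleftrightarrow> z \<in> A" using ax[of i] by (simp add: period_def)
    from AE_lborel_pairD[OF this] show "AE x in lborel. AE s in lborel. ((x, s + axis i 1) \<in> A) = ((x, s) \<in> A)" by simp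
  qed simp
  have good1: "good (x + 1) \<longleftrightarrow> good x" for x by (simp add: good_def A1)
  have axis_per: "AE s in lborel. of_bool ((x, s + axis i 1 + c) \<in> A) * ch n (s + axis i 1) = of_bool ((x, s + c) \<in> A) * ch n s"
    if "good x" "n \<in> int_vecs" for x i c n
  proof -
    have ae: "AE s in lborel. ((x, s + c + axis i 1) \<in> A) = ((x, s + c) \<in> A)"
      using that(1) AE_lborel_shift[where P="\<lambda>s. ((x, s + axis i 1) \<in> A) = ((x, s) \<in> A)" and c=c] by (simp add: good_def)
    have chp: "ch n (s + axis i 1) = ch n s" for s
      using ch_Ints[OF inner_int_vecs[OF that(2) axis_int_vecs[of i]]] by (simp add: ch_add_right)
    show ?thesis
      using ae
    proof eventually_elim
      case (elim s)
      have "s + axis i 1 + c = s + c + axis i 1" by simp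
      then show ?case by (simp only: elim chp)
    qed
  qed
  have shift: "(LINT s|lborel. of_bool (s \<in> cube) * (of_bool ((x, s + a + c) \<in> A) * ch n (s + a))) =
      (LINT s|lborel. of_bool (s \<in> cube) * (of_bool ((x, s + c) \<in> A) * ch n s))"
    if "good x" "n \<in> int_vecs" for x a c n
    by (rule LINT_cube_shift[where F="\<lambda>s. of_bool ((x, s + c) \<in> A) * ch n s"]) (auto simp: norm_mult axis_per[OF that])
  define f where "f n x = (LINT s|lborel. of_bool (s \<in> cube) * (of_bool ((x, s) \<in> A) * ch n s))" for n x
  have fm [measurable]: "f n \<in> borel_measurable borel" for n
  proof -
    have c1 [measurable]: "Measurable.pred (borel \<Otimes>\<^sub>M lborel) (\<lambda>z :: real \<times> (real ^ 'n). z \<in> A)"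
    proof -
      have "sets (borel \<Otimes>\<^sub>M lborel :: (real \<times> (real ^ 'n)) measure) = sets (borel \<Otimes>\<^sub>M borel)" by (rule sets_pair_measure_cong) auto
      then have "A \<in> sets (borel \<Otimes>\<^sub>M lborel)" using \<open>A \<in> sets borel\<close> by (simp only: borel_prod)
      then show ?thesis by (simp add: pred_def space_pair_measure)
    qed
    have [measurable]: "Measurable.pred borel (\<lambda>s :: real ^ 'n. s \<in> cube)" by (simp add: pred_def)
    have "(\<lambda>(x, s). of_bool (s \<in> cube) * (of_bool ((x, s) \<in> A) * ch n s)) \<in> borel_measurable (borel \<Otimes>\<^sub>M lborel)"
      unfolding of_bool_def by measurable
    then show ?thesis unfolding f_def[abs_def] by (rule lborel.borel_measurable_lebesgue_integral)
  qed
  have f1: "f n (x + 1) = f n x" for n x by (simp add: f_def A1)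
  have inv2: "AE x in lborel. AE s in lborel. ((x + \<alpha>, s + \<xi> x) \<in> A) = ((x, s) \<in> A)"
    using AE_lborel_pairD[OF inv] by simp
  have fe: "AE x in lborel. f n x = ch (- n) (\<xi> x) * f n (x + \<alpha>)" if n: "n \<in> int_vecs" for n
    using inv2 AE_lborel_shift[OF good, of \<alpha>]
  proof eventually_elim
    case (elim x)
    have "f n x = (LINT s|lborel. of_bool (s \<in> cube) * (of_bool ((x + \<alpha>, s + \<xi> x) \<in> A) * ch n s))"
      unfolding f_def
    proof (rule integral_cong_AE)
      show "AE s in lborel. of_bool (s \<in> cube) * (of_bool ((x, s) \<in> A) * ch n s) = of_bool (s \<in> cube) * (of_bool ((x + \<alpha>, s + \<xi> x) \<in> A) * ch n s)"
        using elim(1) by eventually_elim simp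
      have [measurable]: "Measurable.pred borel (\<lambda>s :: real ^ 'n. s \<in> cube)" by (simp add: pred_def)
      have [measurable]: "(\<lambda>s. of_bool (s \<in> cube)) \<in> borel_measurable (borel :: (real ^ 'n) measure)" unfolding of_bool_def by measurable
      show "(\<lambda>s. of_bool (s \<in> cube) * (of_bool ((x, s) \<in> A) * ch n s)) \<in> borel_measurable lborel"
        using chm[of x 0 n] by simp
      show "(\<lambda>s. of_bool (s \<in> cube) * (of_bool ((x + \<alpha>, s + \<xi> x) \<in> A) * ch n s)) \<in> borel_measurable lborel"
        using chm[of "x + \<alpha>" "\<xi> x" n] by simp
    qed
    also have "\<dots> = (LINT s|lborel. ch (- n) (\<xi> x) * (of_bool (s \<in> cube) * (of_bool ((x + \<alpha>, s + \<xi> x + 0) \<in> A) * ch n (s + \<xi> x))))"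
      by (intro Bochner_Integration.integral_cong) (simp_all add: ch_add_right ch_minus)
    also have "\<dots> = ch (- n) (\<xi> x) * f n (x + \<alpha>)"
      unfolding integral_mult_right_zero shift[OF elim(2) n] by (simp add: f_def)
    finally show ?case .
  qed
  have dich: "ch n s0 = 1 \<or> (AE x in lborel. f n x = 0)" if n: "n \<in> int_vecs" for n
  proof -
    have "(AE x in lborel. x \<in> {x. f n x = 0}) \<or> (AE x in lborel. x \<notin> {x. f n x = 0})"
    proof (rule rotation_ergodic[OF irr])
      show "{x. f n x = 0} \<in> sets borel" using measurable_sets_borel[OF fm[of n], of "{0}"] by (simp add: vimage_def)
      show "AE x in lborel. (x + \<alpha> \<in> {x. f n x = 0}) = (x \<in> {x. f n x = 0})"
        using fe[OF n] by eventually_elim simp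
    qed (simp add: f1)
    moreover have "ch n s0 = 1" if nz: "AE x in lborel. x \<notin> {x. f n x = 0}"
    proof -
      \<comment> \<open>The value 1 on the null set of zeros keeps the norm equal to 1 everywhere,
        as \<open>chars\<close> demands.\<close>
      define g where "g x = (if f n x = 0 then 1 else sgn (f n x))" for x
      have [measurable]: "g \<in> borel_measurable borel" unfolding g_def[abs_def] by measurable
      have "circle_fun g" by (simp add: circle_fun_def) (simp add: g_def f1)
      moreover have "norm (g x) = 1" for x by (simp add: g_def norm_sgn)
      moreover have "AE x in lborel. g x = ch (- n) (\<xi> x) * g (x + \<alpha>)"
        using fe[OF n] nz AE_lborel_shift[OF nz, of \<alpha>]
        by eventually_elim (simp add: g_def sgn_mult, simp add: sgn_div_norm)
      ultimately have "- n \<in> chars \<alpha> \<xi>" using int_vecs_minus[OF n] by (auto simp: chars_def)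
      from s0[OF this] show ?thesis by (simp add: ch_minus)
    qed
    ultimately show ?thesis by auto
  qed
  have "AE x in lborel. \<forall>n\<in>int_vecs. ch n s0 = 1 \<or> f n x = 0"
    using dich by (subst AE_ball_countable[OF countable_int_vecs]) auto
  then have "AE x in lborel. AE s in lborel. ((x, s + s0) \<in> A) = ((x, s) \<in> A)"
    using good
  proof eventually_elim
    case (elim x)
    have eq: "(LINT s|lborel. of_bool (s \<in> cube) * (of_bool (s \<in> {s. (x, s + s0) \<in> A}) * ch n s)) = (LINT s|lborel. of_bool (s \<in> cube) * (of_bool (s \<in> {s. (x, s) \<in> A}) * ch n s))"
      if n: "n \<in> int_vecs" for n
    proof -
      have "(LINT s|lborel. of_bool (s \<in> cube) * (of_bool (s \<in> {s. (x, s + s0) \<in> A}) * ch n s)) =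
         (LINT s|lborel. ch n (- s0) * (of_bool (s \<in> cube) * (of_bool ((x, s + s0 + 0) \<in> A) * ch n (s + s0))))"
        by (intro Bochner_Integration.integral_cong) (simp_all add: ch_add_right ch_minus)
      also have "\<dots> = ch n (- s0) * f n x"
        unfolding integral_mult_right_zero shift[OF elim(2) n] by (simp add: f_def)
      also have "\<dots> = f n x" using elim(1) n by (auto simp: ch_minus)
      finally show ?thesis by (simp add: f_def)
    qed
    define P where "P s \<longleftrightarrow> ((x, s + s0) \<in> A) = ((x, s) \<in> A)" for s
    have "AE s in lborel. s \<in> cube \<longrightarrow> P s"
      using fourier_uniqueness[OF _ _ eq] fourier_uniqueness[OF _ _ eq[symmetric]] by (auto simp: P_def)
    then have c: "AE s in lborel. s + z \<in> cube \<longrightarrow> P (s + z)" for z by (rule AE_lborel_shift)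
    have Pp: "AE s in lborel. P (s + z) = P s" if "z \<in> int_vecs" for z
    proof (rule AE_int_period[OF _ that])
      fix i
      have g: "AE s in lborel. ((x, s + axis i 1) \<in> A) = ((x, s) \<in> A)" using elim(2) by (simp add: good_def)
      show "AE s in lborel. P (s + axis i 1) = P s"
        using g AE_lborel_shift[OF g, of s0] by eventually_elim (simp add: P_def add.commute add.left_commute)
    qed
    have "AE s in lborel. \<forall>z\<in>int_vecs. (s + z \<in> cube \<longrightarrow> P (s + z)) \<and> P (s + z) = P s"
      by (subst AE_ball_countable[OF countable_int_vecs]) (use c Pp in \<open>auto simp: AE_conj_iff\<close>)
    then show "AE s in lborel. ((x, s + s0) \<in> A) = ((x, s) \<in> A)"
    proof eventually_elim
      case (elim s)
      have "s + - fl s \<in> cube" using cube_diff_iff[of "fl s" s] by simp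
      with elim[rule_format, of "- fl s"] have "P s" by (simp add: int_vecs_minus) blast
      then show ?case by (simp add: P_def)
    qed
  qed
  moreover have "{z. z + (0, s0) \<in> A \<longleftrightarrow> z \<in> A} \<in> sets borel"
  proof -
    have "{z. z + (0, s0) \<in> A} \<in> sets borel" by (rule shift_sets_borel) simp
    then have [measurable]: "Measurable.pred borel (\<lambda>z. z + (0, s0) \<in> A)" "Measurable.pred borel (\<lambda>z. z \<in> A)" by (simp_all add: pred_def)
    have "Measurable.pred borel (\<lambda>z. z + (0, s0) \<in> A \<longleftrightarrow> z \<in> A)" by measurable
    then show ?thesis by (simp add: pred_def)
  qed
  ultimately show ?thesis unfolding period_def by (simp add: AE_lborel_pair_iff)
qed

section \<open>Regularity\<close>

text \<open>M is a linear change of coordinates, I the set of coordinates that carry the cocycle,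
  and B, with its dual system, a basis of the lattice of obstructing characters. The fibre group is
  the image under M of the common annihilator of B.\<close>

locale lattice_fibre =
  fixes M Mi :: "real ^ 'n \<Rightarrow> real ^ 'n" and I :: "'n set" and B :: "(real ^ 'n) set" and dual :: "real ^ 'n \<Rightarrow> real ^ 'n"
  assumes M: "linear M" and Mi: "linear Mi" and MiM [simp]: "Mi (M s) = s" and MMi [simp]: "M (Mi t) = t"
    and finB: "finite B" and B_supp: "b \<in> B \<Longrightarrow> i \<notin> I \<Longrightarrow> b $ i = 0" and dual_supp: "b \<in> B \<Longrightarrow> i \<notin> I \<Longrightarrow> dual b $ i = 0"
    and dual: "b \<in> B \<Longrightarrow> b' \<in> B \<Longrightarrow> b \<bullet> dual b' = (if b = b' then 1 else 0)"
begin

definition H0 where "H0 = {c. (\<forall>i. i \<notin> I \<longrightarrow> c $ i = 0) \<and> (\<forall>b\<in>B. b \<bullet> c \<in> \<int>)}"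

definition H where "H = {h. Mi h \<in> H0}"

definition pr :: "real ^ 'n \<Rightarrow> real ^ 'n" where "pr s = (\<chi> i. if i \<in> I then s $ i else 0)"

text \<open>Removing the fractional part of each b \<bullet> s along the dual vector leaves integral
  values and does nothing to points of \<open>H0\<close>.\<close>

definition \<pi>0 where "\<pi>0 s = pr s - (\<Sum>b\<in>B. frac (b \<bullet> s) *\<^sub>R dual b)"

text \<open>A Borel retraction onto \<open>H\<close> commuting with translations by \<open>H\<close>; pushing Lebesgue measure forward along it,
  after restriction to an \<open>H\<close>-invariant set, gives Haar measure on \<open>H\<close>.\<close>

definition \<pi> where "\<pi> s = M (\<pi>0 s)"

text \<open>\<pi> ignores the coordinates outside I; confining these to a ball makes \<nu> finite on
  bounded sets, and translations by \<open>H0\<close> preserve D.\<close>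

definition D where "D = {s. norm (s - pr s) < 1}"

definition \<nu> where "\<nu> = distr (restrict_space lborel D) (restrict_space borel H) \<pi>"

lemma M_borel [measurable]: "M \<in> borel_measurable borel" and Mi_borel [measurable]: "Mi \<in> borel_measurable borel"
  using M Mi by (auto intro!: borel_measurable_continuous_onI linear_continuous_on simp: linear_conv_bounded_linear)

lemma pr_add: "pr (s + t) = pr s + pr t"
  by (simp add: pr_def vec_eq_iff)

lemma pr_continuous: "continuous_on S pr"
proof -
  have "continuous_on S (\<lambda>s. if i \<in> I then s $ i else 0)" for i by (cases "i \<in> I") (simp_all add: continuous_intros)
  then show ?thesis unfolding pr_def by (rule continuous_on_vec_lambda)
qed

lemma pr_borel [measurable]: "pr \<in> borel_measurable borel"
  by (rule borel_measurable_continuous_onI[OF pr_continuous])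

lemma inner_pr: "b \<in> B \<Longrightarrow> b \<bullet> pr s = b \<bullet> s"
  by (auto simp: inner_vec_def pr_def B_supp intro!: sum.cong)

lemma \<pi>0_in: "\<pi>0 s \<in> H0"
proof -
  have "b \<bullet> \<pi>0 s \<in> \<int>" if b: "b \<in> B" for b
  proof -
    have "(\<Sum>b'\<in>B. frac (b' \<bullet> s) * (b \<bullet> dual b')) = (\<Sum>b'\<in>B. if b = b' then frac (b' \<bullet> s) else 0)"
      using b by (intro sum.cong) (auto simp: dual)
    also have "\<dots> = frac (b \<bullet> s)" using finB b by simp
    finally have "b \<bullet> \<pi>0 s = b \<bullet> s - frac (b \<bullet> s)"
      by (simp add: \<pi>0_def inner_diff_right inner_sum_right inner_pr[OF b])
    then show ?thesis by (simp add: frac_def)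
  qed
  then show ?thesis by (auto simp: H0_def \<pi>0_def pr_def dual_supp)
qed

lemma pr_H0: "c \<in> H0 \<Longrightarrow> pr c = c"
  by (auto simp: H0_def pr_def vec_eq_iff)

lemma \<pi>0_add: "c \<in> H0 \<Longrightarrow> \<pi>0 (s + c) = \<pi>0 s + c"
proof -
  assume c: "c \<in> H0"
  have "frac (b \<bullet> (s + c)) = frac (b \<bullet> s)" if "b \<in> B" for b
  proof -
    have "b \<bullet> c \<in> \<int>" using c that by (simp add: H0_def)
    then obtain k where "b \<bullet> c = of_int k" by (auto elim: Ints_cases)
    then show ?thesis by (simp add: inner_add_right frac_def)
  qed
  then show ?thesis by (simp add: \<pi>0_def pr_add pr_H0[OF c])
qed

lemma \<pi>_add: "c \<in> H0 \<Longrightarrow> \<pi> (s + c) = \<pi> s + M c"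
  by (simp add: \<pi>_def \<pi>0_add linear_add[OF M])

lemma \<pi>_in [simp]: "\<pi> s \<in> H"
  by (simp add: H_def \<pi>_def \<pi>0_in)

lemma M_H0: "c \<in> H0 \<Longrightarrow> M c \<in> H"
  by (simp add: H_def)

lemma \<pi>0_borel [measurable]: "\<pi>0 \<in> borel_measurable borel"
  unfolding \<pi>0_def[abs_def] by measurable

lemma \<pi>_borel [measurable]: "\<pi> \<in> borel_measurable borel"
  unfolding \<pi>_def[abs_def] by measurable

lemma H0_add: "c \<in> H0 \<Longrightarrow> c' \<in> H0 \<Longrightarrow> c + c' \<in> H0" and H0_minus: "c \<in> H0 \<Longrightarrow> - c \<in> H0" and H0_0: "0 \<in> H0"
  by (auto simp: H0_def inner_add_right)

lemma closed_H0: "closed H0"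
proof -
  have "closed {c. b \<bullet> c \<in> \<int>}" for b :: "real ^ 'n"
    using continuous_closed_vimage[of \<int> "\<lambda>c. b \<bullet> c"] closed_Ints by (simp add: vimage_def)
  moreover have "closed {c :: real ^ 'n. c $ i = 0}" for i
    by (intro closed_Collect_eq continuous_intros)
  moreover have "H0 = (\<Inter>i\<in>-I. {c. c $ i = 0}) \<inter> (\<Inter>b\<in>B. {c. b \<bullet> c \<in> \<int>})" by (auto simp: H0_def)
  ultimately show ?thesis by (simp only:) (intro closed_Int closed_INT ballI)
qed

lemma closed_H: "closed H"
  using continuous_closed_vimage[OF closed_H0, of Mi] Mi
  by (simp add: H_def vimage_def linear_continuous_at linear_conv_bounded_linear)

lemma H_borel [measurable]: "H \<in> sets borel"
  using closed_H by simp

lemma closed_subgroup_H: "closed_subgroup H"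
  using closed_H H0_add H0_minus H0_0
  by (auto simp: closed_subgroup_def H_def linear_add[OF Mi] linear_neg[OF Mi] linear_0[OF Mi])

lemma D_borel [measurable]: "D \<in> sets borel"
  unfolding D_def by measurable

lemma D_add: "c \<in> H0 \<Longrightarrow> s + c \<in> D \<longleftrightarrow> s \<in> D"
  by (simp add: D_def pr_add pr_H0)

lemma sets_\<nu>: "sets \<nu> = sets (restrict_space borel H)"
  by (simp add: \<nu>_def)

lemma sets_\<nu>_iff: "A \<in> sets \<nu> \<longleftrightarrow> A \<in> sets borel \<and> A \<subseteq> H"
  by (auto simp: sets_\<nu> sets_restrict_space_iff)

lemma space_\<nu> [simp]: "space \<nu> = H"
  by (simp add: \<nu>_def space_restrict_space)

lemma \<pi>_measurable: "\<pi> \<in> measurable (restrict_space lborel D) (restrict_space borel H)"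
  by (intro measurable_restrict_space2 measurable_restrict_space1) auto

lemma \<pi>_measurable_\<nu>: "\<pi> \<in> measurable borel \<nu>"
  unfolding measurable_cong_sets[OF refl sets_\<nu>] by (intro measurable_restrict_space2) auto

lemma emeasure_\<nu>:
  assumes "A \<in> sets \<nu>"
  shows "emeasure \<nu> A = emeasure lborel {s \<in> D. \<pi> s \<in> A}"
proof -
  have A: "A \<in> sets (restrict_space borel H)" using assms by (simp add: sets_\<nu>)
  have "emeasure \<nu> A = emeasure (restrict_space lborel D) (\<pi> -` A \<inter> space (restrict_space lborel D))"
    unfolding \<nu>_def by (rule emeasure_distr[OF \<pi>_measurable A])
  also have "\<pi> -` A \<inter> space (restrict_space lborel D) = {s \<in> D. \<pi> s \<in> A}" by (auto simp: space_restrict_space)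
  also have "emeasure (restrict_space lborel D) \<dots> = emeasure lborel {s \<in> D. \<pi> s \<in> A}"
    by (rule emeasure_restrict_space) auto
  finally show ?thesis .
qed

lemma \<nu>_shift:
  assumes h: "h \<in> H" and A: "A \<in> sets \<nu>"
  shows "(+) h ` A \<in> sets \<nu>" "emeasure \<nu> ((+) h ` A) = emeasure \<nu> A"
proof -
  have eq: "(+) h ` A = {y. y + - h \<in> A}" by force
  have Ab: "A \<in> sets borel" "A \<subseteq> H" using A by (auto simp: sets_\<nu>_iff)
  have "(+) h ` A \<subseteq> H" using Ab h closed_subgroup_H by (auto simp: closed_subgroup_def)
  then show s: "(+) h ` A \<in> sets \<nu>" unfolding sets_\<nu>_iff using shift_sets_borel[OF Ab(1), of "- h"] by (simp add: eq)
  define c where "c = Mi (- h)"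
  have c: "c \<in> H0" "M c = - h" using h H0_minus by (auto simp: c_def H_def linear_neg[OF Mi] linear_neg[OF M])
  have "{s \<in> D. \<pi> s \<in> (+) h ` A} = {s. s + c \<in> {s \<in> D. \<pi> s \<in> A}}"
    by (auto simp: eq D_add[OF c(1)] \<pi>_add[OF c(1)] c(2))
  moreover have "{s \<in> D. \<pi> s \<in> A} \<in> sets borel"
  proof -
    have "{s \<in> D. \<pi> s \<in> A} = D \<inter> \<pi> -` A" by auto
    then show ?thesis using measurable_sets_borel[OF \<pi>_borel Ab(1)] by simp
  qed
  ultimately show "emeasure \<nu> ((+) h ` A) = emeasure \<nu> A"
    unfolding emeasure_\<nu>[OF s] emeasure_\<nu>[OF A] by (simp only: emeasure_lborel_shift)
qed

text \<open>Within D a point differs from its image under \<open>\<pi>0\<close> by a bounded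
  vector.\<close>

lemma \<nu>_bounded_finite:
  assumes A: "A \<in> sets \<nu>" and bd: "bounded A"
  shows "emeasure \<nu> A < \<infinity>"
proof -
  have "bounded (Mi ` A)" using bd Mi by (intro bounded_linear_image) (simp_all add: linear_conv_bounded_linear)
  then obtain R where R: "\<And>t. t \<in> A \<Longrightarrow> norm (Mi t) \<le> R" by (auto simp: bounded_iff)
  define R' where "R' = 1 + R + (\<Sum>b\<in>B. norm (dual b))"
  have "norm s \<le> R'" if s: "s \<in> D" "\<pi> s \<in> A" for s
  proof -
    have "norm (\<pi>0 s) \<le> R" using R[OF s(2)] by (simp add: \<pi>_def)
    moreover have "norm (\<Sum>b\<in>B. frac (b \<bullet> s) *\<^sub>R dual b) \<le> (\<Sum>b\<in>B. norm (dual b))"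
    proof (rule sum_norm_le)
      fix b assume "b \<in> B"
      show "norm (frac (b \<bullet> s) *\<^sub>R dual b) \<le> norm (dual b)"
        using mult_right_mono[OF less_imp_le[OF frac_lt_1[of "b \<bullet> s"]], of "norm (dual b)"] by simp
    qed
    moreover have "norm (s - pr s) \<le> 1" using s(1) by (simp add: D_def)
    moreover have "norm s = norm ((s - pr s) + \<pi>0 s + (\<Sum>b\<in>B. frac (b \<bullet> s) *\<^sub>R dual b))" by (simp add: \<pi>0_def)
    ultimately show ?thesis unfolding R'_def
      using norm_triangle_ineq[of "(s - pr s) + \<pi>0 s" "\<Sum>b\<in>B. frac (b \<bullet> s) *\<^sub>R dual b"] norm_triangle_ineq[of "s - pr s" "\<pi>0 s"] by linarith
  qed
  then have "emeasure lborel {s \<in> D. \<pi> s \<in> A} \<le> emeasure lborel (cball 0 R' :: (real ^ 'n) set)"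
    by (intro emeasure_mono) auto
  also have "\<dots> < \<infinity>" by (rule emeasure_lborel_cball_finite)
  finally show ?thesis by (simp add: emeasure_\<nu>[OF A])
qed

lemma haar_\<nu>: "haar_measure H \<nu>"
  unfolding haar_measure_def
proof (intro conjI ballI allI impI)
  show "emeasure \<nu> K < \<infinity>" if K: "compact K \<and> K \<subseteq> H" for K
    using K by (intro \<nu>_bounded_finite) (auto simp: sets_\<nu>_iff compact_imp_bounded compact_imp_closed)
  have Hs: "H \<in> sets \<nu>" by (simp add: sets_\<nu>_iff)
  show "emeasure \<nu> H \<noteq> 0"
  proof
    assume "emeasure \<nu> H = 0"
    then have "emeasure lborel D = 0" by (simp add: emeasure_\<nu>[OF Hs])
    then have "D \<in> null_sets lborel" by auto
    then have "negligible D" by (simp add: negligible_iff_null_sets null_sets_completionI)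
    moreover have "open D" unfolding D_def by (intro open_Collect_less continuous_intros pr_continuous)
    moreover have "pr 0 = 0" by (simp add: pr_def vec_eq_iff)
    then have "0 \<in> D" by (simp add: D_def)
    ultimately show False using open_not_negligible by blast
  qed
qed (use sets_\<nu> \<nu>_shift in auto)

lemma sigma_finite_\<nu>: "sigma_finite_measure \<nu>"
proof
  show "\<exists>A. countable A \<and> A \<subseteq> sets \<nu> \<and> \<Union> A = space \<nu> \<and> (\<forall>a\<in>A. emeasure \<nu> a \<noteq> \<infinity>)"
  proof (intro exI[of _ "range (\<lambda>n::nat. H \<inter> cball 0 (real n))"] conjI ballI)
    have s: "H \<inter> cball 0 (real n) \<in> sets \<nu>" for n by (auto simp: sets_\<nu>_iff)
    then show "range (\<lambda>n::nat. H \<inter> cball 0 (real n)) \<subseteq> sets \<nu>" by auto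
    have "x \<in> (\<Union>n::nat. cball 0 (real n))" for x :: "real ^ 'n" using real_arch_simple[of "norm x"] by auto
    then show "\<Union> (range (\<lambda>n::nat. H \<inter> cball 0 (real n))) = space \<nu>" by auto
    fix a assume "a \<in> range (\<lambda>n::nat. H \<inter> cball 0 (real n))"
    then obtain n where a: "a = H \<inter> cball 0 (real n)" by auto
    have "bounded a" unfolding a by (rule bounded_Int) simp
    then show "emeasure \<nu> a \<noteq> \<infinity>" using \<nu>_bounded_finite[OF s[of n]] a by (simp add: less_top[symmetric])
  qed simp
qed

lemma emeasure_\<nu>_eq_0:
  assumes A: "A \<in> sets \<nu>" and ae: "AE s in lborel. \<pi> s \<notin> A"
  shows "emeasure \<nu> A = 0"
proof -
  obtain N where N: "N \<in> null_sets lborel" "{s. \<not> \<pi> s \<notin> A} \<subseteq> N" using ae by (auto simp: eventually_ae_filter)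
  have "emeasure lborel {s \<in> D. \<pi> s \<in> A} \<le> emeasure lborel N" using N by (intro emeasure_mono) auto
  then show ?thesis using null_setsD1[OF N(1)] by (simp add: emeasure_\<nu>[OF A])
qed

text \<open>An invariant set is lifted along (frac, \<pi>) to the full vector space. Unit vectors in
  I are periods by hypothesis, the others because \<pi> ignores them, so
  \<open>fourier_periods\<close> applies and makes all of \<open>H0\<close> periods. Then almost
  every fibre is null or conull, and ergodicity of the rotation decides which.\<close>

lemma ergodic_skew:
  assumes irr: "\<alpha> \<notin> \<rat>" and \<Psi>: "circle_fun \<Psi>" and \<Psi>H: "\<And>x. \<Psi> x \<in> H0"
    and per: "\<And>i. i \<in> I \<Longrightarrow> axis i 1 \<in> PER \<alpha> \<Psi>"
    and chars: "\<And>n c. n \<in> chars \<alpha> \<Psi> \<Longrightarrow> c \<in> H0 \<Longrightarrow> n \<bullet> c \<in> \<int>"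
  shows "ergodic (circle \<Otimes>\<^sub>M \<nu>) (skew_product (rotation \<alpha>) (\<lambda>x. M (\<Psi> x)))"
proof -
  interpret \<nu>: sigma_finite_measure \<nu> by (rule sigma_finite_\<nu>)
  define S where "S = skew_product (rotation \<alpha>) (\<lambda>x. M (\<Psi> x))"
  have S: "S (x, h) = (frac (x + \<alpha>), h + M (\<Psi> x))" for x h by (simp add: S_def skew_product_def rotation_def)
  have \<Psi>m [measurable]: "\<Psi> \<in> borel_measurable borel" and \<Psi>1: "\<And>x. \<Psi> (x + 1) = \<Psi> x" using \<Psi> by (auto simp: circle_fun_def)
  have sp: "space (circle \<Otimes>\<^sub>M \<nu>) = {0..<1} \<times> H" by (simp add: space_pair_measure space_circle)
  have H_sum: "h + M c \<in> H" if "h \<in> H" "c \<in> H0" for h c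
    using closed_subgroup_H M_H0[OF that(2)] that(1) by (auto simp: closed_subgroup_def)
  have Smeas: "S \<in> measurable (circle \<Otimes>\<^sub>M \<nu>) (circle \<Otimes>\<^sub>M \<nu>)"
  proof (rule measurable_pair)
    have "(\<lambda>x. frac (x + \<alpha>)) \<circ> fst \<in> measurable (circle \<Otimes>\<^sub>M \<nu>) circle"
      by (rule measurable_comp[OF measurable_fst rotation_measurable])
    moreover have "fst \<circ> S = (\<lambda>x. frac (x + \<alpha>)) \<circ> fst" by (auto simp: S fun_eq_iff)
    ultimately show "fst \<circ> S \<in> measurable (circle \<Otimes>\<^sub>M \<nu>) circle" by simp
    have id: "(\<lambda>h. h) \<in> measurable \<nu> borel"
      unfolding measurable_cong_sets[OF sets_\<nu> refl] by (rule measurable_restrict_space1) simp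
    have "(\<lambda>x. x) \<in> measurable circle borel" by (rule measurable_circleI) simp
    then have [measurable]: "fst \<in> measurable (circle \<Otimes>\<^sub>M \<nu>) borel" "snd \<in> measurable (circle \<Otimes>\<^sub>M \<nu>) borel"
      using measurable_compose[OF measurable_fst] measurable_compose[OF measurable_snd id] by auto
    have "(\<lambda>z. snd z + M (\<Psi> (fst z))) \<in> measurable (circle \<Otimes>\<^sub>M \<nu>) borel" by measurable
    moreover have "(\<lambda>z. snd z + M (\<Psi> (fst z))) \<in> space (circle \<Otimes>\<^sub>M \<nu>) \<rightarrow> H"
      unfolding sp using H_sum \<Psi>H by auto
    ultimately have "(\<lambda>z. snd z + M (\<Psi> (fst z))) \<in> measurable (circle \<Otimes>\<^sub>M \<nu>) \<nu>"
      unfolding measurable_cong_sets[OF refl sets_\<nu>] by (intro measurable_restrict_space2)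
    moreover have "snd \<circ> S = (\<lambda>z. snd z + M (\<Psi> (fst z)))" by (auto simp: S fun_eq_iff)
    ultimately show "snd \<circ> S \<in> measurable (circle \<Otimes>\<^sub>M \<nu>) \<nu>" by simp
  qed
  have "distr (circle \<Otimes>\<^sub>M \<nu>) (circle \<Otimes>\<^sub>M \<nu>) S = circle \<Otimes>\<^sub>M \<nu>"
  proof (rule measure_eqI)
    fix A assume "A \<in> sets (distr (circle \<Otimes>\<^sub>M \<nu>) (circle \<Otimes>\<^sub>M \<nu>) S)"
    then have A: "A \<in> sets (circle \<Otimes>\<^sub>M \<nu>)" by simp
    have sec: "Pair x -` A \<in> sets \<nu>" for x using A by (rule sets_Pair1)
    \<comment> \<open>On fibres the map is a translation by an element of H, so Haar invariance
      applies; the rotation of the base is treated afterwards.\<close>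
    have eqx: "emeasure \<nu> (Pair x -` (S -` A \<inter> space (circle \<Otimes>\<^sub>M \<nu>))) = emeasure \<nu> (Pair (frac (x + \<alpha>)) -` A)"
      if x: "x \<in> space circle" for x
    proof -
      define h where "h = - M (\<Psi> x)"
      have h: "h \<in> H" unfolding h_def using M_H0[OF \<Psi>H[of x]] closed_subgroup_H by (auto simp: closed_subgroup_def)
      have sub: "Pair (frac (x + \<alpha>)) -` A \<subseteq> H" using sec[of "frac (x + \<alpha>)"] by (auto simp: sets_\<nu>_iff)
      have "Pair x -` (S -` A \<inter> space (circle \<Otimes>\<^sub>M \<nu>)) = (+) h ` (Pair (frac (x + \<alpha>)) -` A)"
      proof (rule set_eqI)
        fix y
        have "y \<in> (+) h ` (Pair (frac (x + \<alpha>)) -` A) \<longleftrightarrow> y + M (\<Psi> x) \<in> Pair (frac (x + \<alpha>)) -` A"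
          by (auto simp: h_def image_iff intro!: bexI[of _ "y + M (\<Psi> x)"])
        also have "\<dots> \<longleftrightarrow> y \<in> H \<and> y + M (\<Psi> x) \<in> Pair (frac (x + \<alpha>)) -` A"
        proof -
          have "y \<in> H" if "y + M (\<Psi> x) \<in> H" using that h closed_subgroup_H by (force simp: closed_subgroup_def h_def)
          then show ?thesis using sub by auto
        qed
        finally show "y \<in> Pair x -` (S -` A \<inter> space (circle \<Otimes>\<^sub>M \<nu>)) \<longleftrightarrow> y \<in> (+) h ` (Pair (frac (x + \<alpha>)) -` A)"
          using x by (auto simp: sp S space_circle)
      qed
      then show ?thesis using \<nu>_shift(2)[OF h sec] by simp
    qed
    have "emeasure (distr (circle \<Otimes>\<^sub>M \<nu>) (circle \<Otimes>\<^sub>M \<nu>) S) A = emeasure (circle \<Otimes>\<^sub>M \<nu>) (S -` A \<inter> space (circle \<Otimes>\<^sub>M \<nu>))"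
      by (rule emeasure_distr[OF Smeas A])
    also have "\<dots> = (\<integral>\<^sup>+x. emeasure \<nu> (Pair x -` (S -` A \<inter> space (circle \<Otimes>\<^sub>M \<nu>))) \<partial>circle)"
      by (rule \<nu>.emeasure_pair_measure_alt) (rule measurable_sets[OF Smeas A])
    also have "\<dots> = (\<integral>\<^sup>+x. emeasure \<nu> (Pair (frac (x + \<alpha>)) -` A) \<partial>circle)"
      by (rule nn_integral_cong) (rule eqx)
    also have "\<dots> = (\<integral>\<^sup>+x. emeasure \<nu> (Pair x -` A) \<partial>distr circle circle (\<lambda>x. frac (x + \<alpha>)))"
      by (rule nn_integral_distr[symmetric, OF rotation_measurable]) (simp add: \<nu>.measurable_emeasure_Pair[OF A])
    also have "\<dots> = emeasure (circle \<Otimes>\<^sub>M \<nu>) A"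
      unfolding distr_rotation by (rule \<nu>.emeasure_pair_measure_alt[OF A, symmetric])
    finally show "emeasure (distr (circle \<Otimes>\<^sub>M \<nu>) (circle \<Otimes>\<^sub>M \<nu>) S) A = emeasure (circle \<Otimes>\<^sub>M \<nu>) A" .
  qed simp
  moreover
  have null: "emeasure (circle \<Otimes>\<^sub>M \<nu>) A = 0"
    if A: "A \<in> sets (circle \<Otimes>\<^sub>M \<nu>)" and ae: "AE x in lborel. AE s in lborel. (frac x, \<pi> s) \<notin> A" for A
  proof -
    have "AE x in circle. AE s in lborel. (frac x, \<pi> s) \<notin> A" unfolding AE_circle_iff using ae by eventually_elim (rule impI)
    moreover have "AE x in circle. x \<in> space circle" by (rule AE_space)
    ultimately have "AE x in circle. emeasure \<nu> (Pair x -` A) = 0"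
    proof eventually_elim
      case (elim x)
      have "frac x = x" using elim(2) by (simp add: space_circle frac_eq)
      with elim(1) have "AE s in lborel. \<pi> s \<notin> Pair x -` A" by simp
      with sets_Pair1[OF A] show ?case by (rule emeasure_\<nu>_eq_0)
    qed
    then have "(\<integral>\<^sup>+x. emeasure \<nu> (Pair x -` A) \<partial>circle) = (\<integral>\<^sup>+x. 0 \<partial>circle)" by (rule nn_integral_cong_AE)
    then show ?thesis by (simp add: \<nu>.emeasure_pair_measure_alt[OF A])
  qed
  have "emeasure (circle \<Otimes>\<^sub>M \<nu>) A = 0 \<or> emeasure (circle \<Otimes>\<^sub>M \<nu>) (space (circle \<Otimes>\<^sub>M \<nu>) - A) = 0"
    if A: "A \<in> sets (circle \<Otimes>\<^sub>M \<nu>)" and inv: "S -` A \<inter> space (circle \<Otimes>\<^sub>M \<nu>) = A" for A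
  proof -
    have spx: "(frac x, \<pi> s) \<in> space (circle \<Otimes>\<^sub>M \<nu>)" for x s by (simp add: sp frac_lt_1)
    define A' where "A' = {z. (frac (fst z), \<pi> (snd z)) \<in> A}"
    have A'_iff: "(x, s) \<in> A' \<longleftrightarrow> (frac x, \<pi> s) \<in> A" for x s by (simp add: A'_def)
    have "frac \<in> measurable borel circle"
      unfolding circle_def by (rule measurable_restrict_space2) (auto simp: frac_lt_1)
    then have "(\<lambda>z. (frac (fst z), \<pi> (snd z))) \<in> measurable (borel :: (real \<times> (real ^ 'n)) measure) (circle \<Otimes>\<^sub>M \<nu>)"
      by (intro measurable_Pair measurable_compose[OF fst_borel] measurable_compose[OF snd_borel] \<pi>_measurable_\<nu>)
    from measurable_sets[OF this A] have A'b [measurable]: "A' \<in> sets borel" by (simp add: A'_def vimage_def)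
    have A'1: "(x + 1, s) \<in> A' \<longleftrightarrow> (x, s) \<in> A'" for x s by (simp add: A'_iff frac_periodic)
    have A'inv: "(x + \<alpha>, s + \<Psi> x) \<in> A' \<longleftrightarrow> (x, s) \<in> A'" for x s
    proof -
      have "frac (y + 1 + \<alpha>) = frac (y + \<alpha>)" for y using frac_periodic[of "y + \<alpha>"] by (simp add: algebra_simps)
      then have "frac (frac x + \<alpha>) = frac (x + \<alpha>)" by (rule periodic_frac)
      then have "S (frac x, \<pi> s) = (frac (x + \<alpha>), \<pi> (s + \<Psi> x))"
        unfolding S \<pi>_add[OF \<Psi>H] using periodic_frac[of \<Psi> x, OF \<Psi>1] by simp
      moreover have "(frac x, \<pi> s) \<in> A \<longleftrightarrow> S (frac x, \<pi> s) \<in> A" using inv spx[of x s] by blast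
      ultimately show ?thesis by (simp add: A'_iff)
    qed
    have sk: "skew_inv \<alpha> \<Psi> A'" using A'1 A'inv A'b by (auto simp: skew_inv_def)
    have ax: "period A' (0, axis i 1)" for i
    proof (cases "i \<in> I")
      case True
      then show ?thesis using per[OF True] sk by (simp add: PER_def)
    next
      case False
      have "pr (axis i 1) = 0" using False by (auto simp: pr_def vec_eq_iff axis_def)
      moreover have "b \<bullet> axis i 1 = 0" if "b \<in> B" for b using B_supp[OF that False] by (simp add: inner_axis)
      ultimately have "\<pi> (s + axis i 1) = \<pi> s" for s by (simp add: \<pi>_def \<pi>0_def pr_add inner_add_right)
      then show ?thesis by (auto simp: period_def A'_def)
    qed
    have perH: "period A' (0, c)" if "c \<in> H0" for c
      by (rule fourier_periods[OF irr \<Psi> sk ax]) (rule ch_Ints, rule chars[OF _ that])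
    \<comment> \<open>Every element of \<open>H0\<close> is a period, but with its own null set.
      Writing it as \<open>\<pi>0 t\<close> with t subject to Lebesgue measure allows Fubini to
      exchange the quantifiers.\<close>
    define Q where "Q t z \<longleftrightarrow> ((fst z, snd z + \<pi>0 t) \<in> A') = (z \<in> A')" for t z
    have "AE t in lborel. AE z in lborel. Q t z"
    proof (rule AE_I2)
      fix t :: "real ^ 'n"
      have "AE z in lborel. z + (0, \<pi>0 t) \<in> A' \<longleftrightarrow> z \<in> A'" using perH[OF \<pi>0_in] by (simp add: period_def)
      moreover have "z + (0, \<pi>0 t) = (fst z, snd z + \<pi>0 t)" for z :: "real \<times> (real ^ 'n)" by (simp add: prod_eq_iff)
      ultimately show "AE z in lborel. Q t z" by (simp add: Q_def)
    qed
    moreover have "{w. Q (fst w) (snd w)} \<in> sets (borel :: ((real ^ 'n) \<times> real \<times> (real ^ 'n)) measure)"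
    proof -
      have m1: "(\<lambda>w. (fst (snd w), snd (snd w) + \<pi>0 (fst w))) \<in> measurable (borel :: ((real ^ 'n) \<times> real \<times> (real ^ 'n)) measure) borel"
        by (intro borel_measurable_Pair borel_measurable_add measurable_compose[OF snd_borel] fst_borel snd_borel measurable_compose[OF fst_borel] \<pi>0_borel)
      have [measurable]: "Measurable.pred (borel :: ((real ^ 'n) \<times> real \<times> (real ^ 'n)) measure) (\<lambda>w. (fst (snd w), snd (snd w) + \<pi>0 (fst w)) \<in> A')"
        using measurable_sets[OF m1 A'b] by (simp add: pred_def vimage_def)
      have [measurable]: "Measurable.pred (borel :: ((real ^ 'n) \<times> real \<times> (real ^ 'n)) measure) (\<lambda>w. snd w \<in> A')"
        using measurable_sets[OF snd_borel A'b] by (simp add: pred_def vimage_def)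
      have "Measurable.pred (borel :: ((real ^ 'n) \<times> real \<times> (real ^ 'n)) measure) (\<lambda>w. Q (fst w) (snd w))"
        unfolding Q_def by measurable
      then show ?thesis by (simp add: pred_def)
    qed
    ultimately have "AE z in lborel. AE t in lborel. Q t z"
      using AE_lborel_commute[of Q] by simp
    then have "AE x in lborel. AE s in lborel. AE t in lborel. Q t (x, s)" by (rule AE_lborel_pairD)
    then have good: "AE x in lborel. (AE s in lborel. (x, s) \<notin> A') \<or> (AE s in lborel. (x, s) \<in> A')"
    proof eventually_elim
      case (elim x)
      show ?case
      proof (cases "\<exists>s. (x, s) \<in> A' \<and> (AE t in lborel. Q t (x, s))")
        case True
        then obtain s where s: "(x, s) \<in> A'" "AE t in lborel. Q t (x, s)" by blast
        have c: "- \<pi>0 s \<in> H0" using H0_minus[OF \<pi>0_in] .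
        have "AE t in lborel. (x, t + \<pi>0 s) \<in> A'"
          using s(2)
        proof eventually_elim
          case (elim t)
          \<comment> \<open>By this symmetry, moving the fixed s by \<open>\<pi>0 t\<close> is as
            good as moving t by the fixed \<open>\<pi>0 s\<close>; one good point of the fibre
            therefore decides almost all of it.\<close>
          have "\<pi> (t + \<pi>0 s) = \<pi> (s + \<pi>0 t)" unfolding \<pi>_add[OF \<pi>0_in] by (simp add: \<pi>_def)
          then show ?case using elim s(1) by (simp add: Q_def A'_iff)
        qed
        from AE_lborel_shift[OF this, of "- \<pi>0 s"] show ?thesis by simp
      next
        case False
        have "AE s in lborel. (x, s) \<notin> A'" using elim by eventually_elim (use False in blast)
        then show ?thesis ..
      qed
    qed
    define Z where "Z = {x. AE s in lborel. (x, s) \<notin> A'}"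
    have "(AE x in lborel. x \<in> Z) \<or> (AE x in lborel. x \<notin> Z)"
    proof (rule rotation_ergodic[OF irr])
      have "Z = (\<lambda>x. emeasure lborel {t. (x, t) \<in> A'}) -` {0} \<inter> space borel"
        by (auto simp: Z_def AE_section_iff[OF A'b])
      then show "Z \<in> sets borel" using measurable_sets[OF measurable_section_measure[OF A'b], of "{0}"] by simp
      show "x + 1 \<in> Z \<longleftrightarrow> x \<in> Z" for x by (simp add: Z_def A'1)
      have "x + \<alpha> \<in> Z \<longleftrightarrow> x \<in> Z" for x
      proof
        assume "x + \<alpha> \<in> Z"
        then have "AE s in lborel. (x + \<alpha>, s) \<notin> A'" by (simp add: Z_def)
        from AE_lborel_shift[OF this, of "\<Psi> x"] show "x \<in> Z" by (simp add: Z_def A'inv)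
      next
        assume "x \<in> Z"
        then have "AE s in lborel. (x + \<alpha>, s + \<Psi> x) \<notin> A'" by (simp add: Z_def A'inv)
        from AE_lborel_shift[OF this, of "- \<Psi> x"] show "x + \<alpha> \<in> Z" by (simp add: Z_def)
      qed
      then show "AE x in lborel. (x + \<alpha> \<in> Z) = (x \<in> Z)" by simp
    qed
    then show ?thesis
    proof
      assume "AE x in lborel. x \<in> Z"
      then have "AE x in lborel. AE s in lborel. (frac x, \<pi> s) \<notin> A" by (simp add: Z_def A'_iff)
      then show ?thesis using null[OF A] by simp
    next
      assume "AE x in lborel. x \<notin> Z"
      then have "AE x in lborel. AE s in lborel. (frac x, \<pi> s) \<notin> space (circle \<Otimes>\<^sub>M \<nu>) - A"
        using good by eventually_elim (auto simp: Z_def A'_iff)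
      then show ?thesis using null[OF sets.compl_sets[OF A]] by simp
    qed
  qed
  ultimately show ?thesis using Smeas unfolding ergodic_def S_def[symmetric] by blast
qed

end

section \<open>From periods to regularity\<close>

lemma regular_cocycle_transfer:
  assumes r: "regular_cocycle (rotation \<alpha>) \<Psi>" and \<phi>: "\<phi> \<in> borel_measurable circle"
    and F: "circle_fun F" and ae: "AE x in circle. \<phi> x - \<Psi> x = F x - F (x + \<alpha>)"
  shows "regular_cocycle (rotation \<alpha>) \<phi>"
proof -
  obtain \<Psi>' H \<nu> where h: "cocycle \<Psi>'" "cohomologous (rotation \<alpha>) \<Psi> \<Psi>'" "closed_subgroup H"
    "\<forall>x\<in>{0..<1}. \<Psi>' x \<in> H" "haar_measure H \<nu>" "ergodic (circle \<Otimes>\<^sub>M \<nu>) (skew_product (rotation \<alpha>) \<Psi>')"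
    using r unfolding regular_cocycle_def by blast
  obtain f where f: "f \<in> borel_measurable circle" "AE x in circle. \<Psi> x - \<Psi>' x = f x - f (rotation \<alpha> x)"
    using h(2) by (auto simp: cohomologous_def)
  have Fm: "F \<in> borel_measurable circle" and F1: "\<And>x. F (x + 1) = F x" using F by (auto simp: circle_fun_def measurable_circleI)
  have "AE x in circle. \<phi> x - \<Psi>' x = (F x + f x) - (F (rotation \<alpha> x) + f (rotation \<alpha> x))"
    using ae f(2)
  proof eventually_elim
    case (elim x)
    have "F (rotation \<alpha> x) = F (x + \<alpha>)" unfolding rotation_def by (rule periodic_frac[of F, OF F1])
    then show ?case using arg_cong2[OF elim, of "(+)"] by (simp add: algebra_simps)
  qed
  then have "cohomologous (rotation \<alpha>) \<phi> \<Psi>'" unfolding cohomologous_def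
    using Fm f(1) by (intro bexI[of _ "\<lambda>x. F x + f x"]) auto
  then show ?thesis using h \<phi> unfolding regular_cocycle_def cocycle_def by blast
qed

lemma chars_diff:
  assumes "n \<in> chars \<alpha> \<xi>" "m \<in> chars \<alpha> \<xi>"
  shows "n - m \<in> chars \<alpha> \<xi>"
proof -
  obtain g where g: "circle_fun g" "\<forall>x. norm (g x) = 1" "AE x in lborel. g x = ch n (\<xi> x) * g (x + \<alpha>)"
    using assms(1) by (auto simp: chars_def)
  obtain h where h: "circle_fun h" "\<forall>x. norm (h x) = 1" "AE x in lborel. h x = ch m (\<xi> x) * h (x + \<alpha>)"
    using assms(2) by (auto simp: chars_def)
  have "circle_fun (\<lambda>x. g x / h x)" using g(1) h(1) by (auto simp: circle_fun_def)
  moreover have "AE x in lborel. g x / h x = ch (n - m) (\<xi> x) * (g (x + \<alpha>) / h (x + \<alpha>))"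
    using g(3) h(3) by eventually_elim (simp add: ch_diff)
  moreover have "\<forall>x. norm (g x / h x) = 1" using g(2) h(2) by (simp add: norm_divide)
  moreover have "n - m \<in> int_vecs" using assms by (auto simp: chars_def intro: int_vecs_diff)
  ultimately show ?thesis unfolding chars_def by blast
qed

text \<open>A maximal independent part of Bs is completed to a basis indexed by the coordinates; I
  collects the indices of vectors from Bs. Periods thereby become unit vectors, as the analysis on
  the torus requires.\<close>

lemma span_coordinates:
  fixes Bs :: "(real ^ 'n) set"
  obtains M Mi :: "real ^ 'n \<Rightarrow> real ^ 'n" and I where "linear M" "linear Mi" "\<And>s. Mi (M s) = s" "\<And>t. M (Mi t) = t"
    "\<And>i. i \<in> I \<Longrightarrow> M (axis i 1) \<in> Bs" "\<And>t i. t \<in> span Bs \<Longrightarrow> i \<notin> I \<Longrightarrow> Mi t $ i = 0"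
proof -
  obtain B1 where B1: "B1 \<subseteq> Bs" "independent B1" "Bs \<subseteq> span B1" by (rule maximal_independent_subset[of Bs]) (rule that)
  obtain B2 where B2: "B1 \<subseteq> B2" "independent B2" "UNIV \<subseteq> span B2"
    by (rule maximal_independent_subset_extend[OF subset_UNIV B1(2)]) (rule that)
  have "span B2 = UNIV" using B2(3) by blast
  have "card B2 = dim (UNIV :: (real ^ 'n) set)" by (rule basis_card_eq_dim[OF subset_UNIV B2(3,2)])
  then have "card B2 = CARD('n)" by simp
  moreover have "finite B2" using B2(2) by (rule independent_imp_finite)
  ultimately obtain \<sigma> :: "'n \<Rightarrow> real ^ 'n" where \<sigma>: "bij_betw \<sigma> UNIV B2"
    using finite_same_card_bij[of "UNIV :: 'n set" B2] by auto
  define M where "M s = (\<Sum>i\<in>UNIV. s $ i *\<^sub>R \<sigma> i)" for s :: "real ^ 'n"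
  have M: "linear M" unfolding M_def
    by (rule linearI) (simp_all add: scaleR_add_left sum.distrib scaleR_sum_right)
  have Max: "M (axis i 1) = \<sigma> i" for i
    by (simp add: M_def axis_def if_distrib[where f="\<lambda>c. c *\<^sub>R _"] cong: if_cong)
  have "span B2 \<subseteq> range M"
  proof (rule span_minimal)
    show "B2 \<subseteq> range M"
    proof
      fix b assume "b \<in> B2"
      then obtain i where "b = \<sigma> i" using \<sigma> by (auto simp: bij_betw_def)
      then show "b \<in> range M" using Max[of i] by (metis rangeI)
    qed
    show "subspace (range M)" using M by (rule linear_subspace_image) simp
  qed
  then have "surj M" using B2(3) by blast
  then obtain Mi where Mi: "linear Mi" "\<forall>x. Mi (M x) = x" "\<forall>x. M (Mi x) = x" using linear_surjective_isomorphism[OF M] by blast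
  define I where "I = {i. \<sigma> i \<in> B1}"
  define V where "V = {t. \<forall>i. i \<notin> I \<longrightarrow> Mi t $ i = 0}"
  have "subspace V" unfolding V_def by (auto simp: subspace_def linear_add[OF Mi(1)] linear_scale[OF Mi(1)] linear_0[OF Mi(1)])
  moreover have "B1 \<subseteq> V"
  proof
    fix b assume b: "b \<in> B1"
    then obtain i where i: "b = \<sigma> i" using B2(1) \<sigma> by (auto simp: bij_betw_def)
    then have "i \<in> I" using b by (simp add: I_def)
    moreover have "Mi b = axis i 1" using Mi(2) Max[of i] i by metis
    ultimately show "b \<in> V" by (auto simp: V_def axis_def)
  qed
  ultimately have "span B1 \<subseteq> V" by (intro span_minimal)
  moreover have "span Bs \<subseteq> span B1" using B1(3) by (rule span_minimal) simp
  ultimately have supp: "Mi t $ i = 0" if "t \<in> span Bs" "i \<notin> I" for t i using that by (auto simp: V_def)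
  show thesis
  proof (rule that[OF M Mi(1)])
    show "M (axis i 1) \<in> Bs" if "i \<in> I" for i using that B1(1) by (auto simp: Max I_def)
  qed (use Mi supp in auto)
qed

text \<open>After the change of variables the cocycle has coordinates with integral periods. Subtracting suitable logarithms of
  the eigenfunctions forces it into the closed subgroup cut out by the surviving characters.\<close>

lemma regular_of_periods:
  fixes \<phi> :: "real \<Rightarrow> real ^ 'n"
  assumes irr: "\<alpha> \<notin> \<rat>" and \<phi>: "circle_fun \<phi>" and f: "circle_fun f" and Bs: "Bs \<subseteq> PER \<alpha> \<phi>"
    and ae: "AE x in circle. \<phi> x - (f x - f (x + \<alpha>)) \<in> span Bs"
  shows "regular_cocycle (rotation \<alpha>) \<phi>"
proof -
  obtain M Mi :: "real ^ 'n \<Rightarrow> real ^ 'n" and I where M: "linear M" "linear Mi" "\<And>s. Mi (M s) = s" "\<And>t. M (Mi t) = t"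
    "\<And>i. i \<in> I \<Longrightarrow> M (axis i 1) \<in> Bs" "\<And>t i. t \<in> span Bs \<Longrightarrow> i \<notin> I \<Longrightarrow> Mi t $ i = 0"
    by (rule span_coordinates[of Bs], rule that)
  have \<phi>m [measurable]: "\<phi> \<in> borel_measurable borel" and \<phi>1: "\<And>x. \<phi> (x + 1) = \<phi> x" using \<phi> by (auto simp: circle_fun_def)
  have fm [measurable]: "f \<in> borel_measurable borel" and f1: "\<And>x. f (x + 1) = f x" using f by (auto simp: circle_fun_def)
  have f1': "f (x + 1 + \<alpha>) = f (x + \<alpha>)" for x using f1[of "x + \<alpha>"] by (simp add: algebra_simps)
  \<comment> \<open>The value 0 on the exceptional null set makes the cocycle stay in the span
    everywhere; \<Psi> below is completed to \<open>H0\<close> in the same way.\<close>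
  define \<phi>' where "\<phi>' x = (if \<phi> x - (f x - f (x + \<alpha>)) \<in> span Bs then \<phi> x - (f x - f (x + \<alpha>)) else 0)" for x
  have [measurable]: "span Bs \<in> sets borel" by (rule borel_closed) (rule closed_span)
  have \<phi>'c: "circle_fun \<phi>'" unfolding circle_fun_def
  proof (intro conjI allI)
    show "\<phi>' \<in> borel_measurable borel" unfolding \<phi>'_def[abs_def] by measurable
  qed (simp add: \<phi>'_def \<phi>1 f1 f1')
  have \<phi>'V: "\<phi>' x \<in> span Bs" for x by (simp add: \<phi>'_def span_zero)
  have "AE x in lborel. \<phi> x - (f x - f (x + \<alpha>)) \<in> span Bs"
    using ae by (subst (asm) AE_circle_lborel) (simp_all add: \<phi>1 f1 f1')
  then have \<phi>'ae: "AE x in lborel. \<phi>' x = \<phi> x - f x + f (x + \<alpha>)" by eventually_elim (simp add: \<phi>'_def)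
  define \<xi> where "\<xi> x = Mi (\<phi>' x)" for x
  have [measurable]: "\<phi>' \<in> borel_measurable borel" using \<phi>'c by (simp add: circle_fun_def)
  have Mb: "M \<in> borel_measurable borel" "Mi \<in> borel_measurable borel"
    using M(1,2) by (auto intro!: borel_measurable_continuous_onI linear_continuous_on simp: linear_conv_bounded_linear)
  have \<xi>m [measurable]: "\<xi> \<in> borel_measurable borel" unfolding \<xi>_def[abs_def] by (rule measurable_compose[OF _ Mb(2)]) simp
  have \<xi>1: "\<xi> (x + 1) = \<xi> x" for x using \<phi>'c by (simp add: \<xi>_def circle_fun_def)
  have \<xi>supp: "\<xi> x $ i = 0" if "i \<notin> I" for x i unfolding \<xi>_def by (rule M(6)[OF \<phi>'V that])
  have \<xi>per: "axis i 1 \<in> PER \<alpha> \<xi>" if "i \<in> I" for i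
  proof -
    have "M (axis i 1) \<in> PER \<alpha> \<phi>'" using PER_cohomologous[OF f \<phi>'ae] Bs M(5)[OF that] by blast
    from PER_linear[OF M(2) this] show ?thesis by (simp add: \<xi>_def[abs_def] M(3))
  qed
  have "\<exists>B dual. finite B \<and> B \<subseteq> {n\<in>chars \<alpha> \<xi>. \<forall>i. i \<notin> I \<longrightarrow> n $ i = 0} \<and>
    (\<forall>b\<in>B. \<forall>b'\<in>B. b \<bullet> dual b' = (if b = b' then 1 else 0)) \<and>
    (\<forall>n\<in>chars \<alpha> \<xi>. (\<forall>i. i \<notin> I \<longrightarrow> n $ i = 0) \<longrightarrow> n = (\<Sum>b\<in>B. (n \<bullet> dual b) *\<^sub>R b) \<and> (\<forall>b\<in>B. n \<bullet> dual b \<in> \<int>)) \<and>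
    (\<forall>b\<in>B. \<forall>i. dual b $ i \<in> \<rat> \<and> (i \<notin> I \<longrightarrow> dual b $ i = 0))"
    by (rule integer_subgroup_basis) (simp add: chars_def subset_eq, blast intro: chars_diff)
  then obtain B dual where B: "finite B" "B \<subseteq> {n\<in>chars \<alpha> \<xi>. \<forall>i. i \<notin> I \<longrightarrow> n $ i = 0}"
    "\<forall>b\<in>B. \<forall>b'\<in>B. b \<bullet> dual b' = (if b = b' then 1 else 0)"
    "\<forall>n\<in>chars \<alpha> \<xi>. (\<forall>i. i \<notin> I \<longrightarrow> n $ i = 0) \<longrightarrow> n = (\<Sum>b\<in>B. (n \<bullet> dual b) *\<^sub>R b) \<and> (\<forall>b\<in>B. n \<bullet> dual b \<in> \<int>)"
    "\<forall>b\<in>B. \<forall>i. dual b $ i \<in> \<rat> \<and> (i \<notin> I \<longrightarrow> dual b $ i = 0)" by (elim exE conjE) (rule that)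
  interpret lattice_fibre M Mi I B dual
  proof (rule lattice_fibre.intro)
    show "b $ i = 0" if "b \<in> B" "i \<notin> I" for b i using B(2) that by blast
  qed (use M(1-4) B(1,3,5) in simp_all)
  have "\<forall>b\<in>B. \<exists>g. circle_fun g \<and> (\<forall>x. norm (g x) = 1) \<and> (AE x in lborel. g x = ch b (\<xi> x) * g (x + \<alpha>))"
    using B(2) by (auto simp: chars_def)
  then obtain g where g: "\<forall>b\<in>B. circle_fun (g b) \<and> (\<forall>x. norm (g b x) = 1) \<and> (AE x in lborel. g b x = ch b (\<xi> x) * g b (x + \<alpha>))"
    by (rule bchoice[THEN exE])
  define \<theta> where "\<theta> b x = angle (g b x)" for b x
  have \<theta>c: "\<theta> b \<in> borel_measurable borel" "\<theta> b (x + 1) = \<theta> b x" if "b \<in> B" for b x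
  proof -
    have [measurable]: "g b \<in> borel_measurable borel" using g that by (simp add: circle_fun_def)
    show "\<theta> b \<in> borel_measurable borel" unfolding \<theta>_def[abs_def] by measurable
    show "\<theta> b (x + 1) = \<theta> b x" using g that by (simp add: \<theta>_def circle_fun_def)
  qed
  have \<theta>ae: "AE x in lborel. b \<bullet> \<xi> x - (\<theta> b x - \<theta> b (x + \<alpha>)) \<in> \<int>" if b: "b \<in> B" for b
  proof -
    have "AE x in lborel. g b x = ch b (\<xi> x) * g b (x + \<alpha>)" using g b by blast
    then show ?thesis
    proof eventually_elim
      case (elim x)
      have c: "cis (2 * pi * \<theta> b y) = g b y" for y using g b by (simp add: \<theta>_def cis_angle)
      have "g b (x + \<alpha>) \<noteq> 0" using g b by (metis norm_zero zero_neq_one)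
      then have "ch b (\<xi> x) = g b x / g b (x + \<alpha>)" using elim by simp
      also have "\<dots> = cis (2 * pi * (\<theta> b x - \<theta> b (x + \<alpha>)))" by (simp add: c[symmetric] cis_divide right_diff_distrib)
      finally show ?case by (rule ch_eq_cisD)
    qed
  qed
  \<comment> \<open>Duality gives b \<bullet> u = \<theta> b, so removing the coboundary of u turns
    every b \<bullet> \<xi> into an integer almost everywhere.\<close>
  define u where "u x = (\<Sum>b\<in>B. \<theta> b x *\<^sub>R dual b)" for x
  have um [measurable]: "u \<in> borel_measurable borel" unfolding u_def[abs_def]
    by (intro borel_measurable_sum borel_measurable_scaleR \<theta>c) auto
  have u1: "u (x + 1) = u x" for x by (simp add: u_def \<theta>c)
  have u1': "u (x + 1 + \<alpha>) = u (x + \<alpha>)" for x using u1[of "x + \<alpha>"] by (simp add: algebra_simps)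
  have uc: "circle_fun u" using um u1 by (simp add: circle_fun_def)
  have bu: "b \<bullet> u x = \<theta> b x" if "b \<in> B" for b x
  proof -
    have "b \<bullet> u x = (\<Sum>b'\<in>B. if b = b' then \<theta> b' x else 0)"
      unfolding u_def inner_sum_right using that B(3) by (intro sum.cong) auto
    then show ?thesis using that B(1) by simp
  qed
  define \<Psi>0 where "\<Psi>0 x = \<xi> x - u x + u (x + \<alpha>)" for x
  have "AE x in lborel. \<forall>b\<in>B. b \<bullet> \<xi> x - (\<theta> b x - \<theta> b (x + \<alpha>)) \<in> \<int>"
    using B(1) \<theta>ae by (intro AE_finite_allI)
  then have \<Psi>0H: "AE x in lborel. \<Psi>0 x \<in> H0"
  proof eventually_elim
    case (elim x)
    have "b \<bullet> \<Psi>0 x \<in> \<int>" if "b \<in> B" for b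
      using elim that by (simp add: \<Psi>0_def inner_add_right inner_diff_right bu algebra_simps)
    moreover have "\<Psi>0 x $ i = 0" if "i \<notin> I" for i
      using that B(5) by (simp add: \<Psi>0_def u_def \<xi>supp)
    ultimately show ?case by (simp add: H0_def)
  qed
  define \<Psi> where "\<Psi> x = (if \<Psi>0 x \<in> H0 then \<Psi>0 x else 0)" for x
  have \<Psi>H: "\<Psi> x \<in> H0" for x by (simp add: \<Psi>_def H0_0)
  have \<Psi>ae: "AE x in lborel. \<Psi> x = \<xi> x - u x + u (x + \<alpha>)"
    using \<Psi>0H by eventually_elim (simp add: \<Psi>_def \<Psi>0_def)
  have \<Psi>c: "circle_fun \<Psi>" unfolding circle_fun_def
  proof (intro conjI allI)
    have [measurable]: "H0 \<in> sets borel" using closed_H0 by simp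
    have [measurable]: "\<Psi>0 \<in> borel_measurable borel" unfolding \<Psi>0_def[abs_def] by measurable
    show "\<Psi> \<in> borel_measurable borel" unfolding \<Psi>_def[abs_def] by measurable
  qed (simp add: \<Psi>_def \<Psi>0_def \<xi>1 u1 u1')
  have erg: "ergodic (circle \<Otimes>\<^sub>M \<nu>) (skew_product (rotation \<alpha>) (\<lambda>x. M (\<Psi> x)))"
  proof (rule ergodic_skew[OF irr \<Psi>c \<Psi>H])
    show "axis i 1 \<in> PER \<alpha> \<Psi>" if "i \<in> I" for i using PER_cohomologous[OF uc \<Psi>ae] \<xi>per[OF that] by blast
    fix n c assume n: "n \<in> chars \<alpha> \<Psi>" and c: "c \<in> H0"
    obtain k where k: "circle_fun k" "\<forall>x. norm (k x) = 1" "AE x in lborel. k x = ch n (\<Psi> x) * k (x + \<alpha>)"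
      using n by (auto simp: chars_def)
    have prI: "n \<bullet> t = pr n \<bullet> t" if "\<And>i. i \<notin> I \<Longrightarrow> t $ i = 0" for t
      using that by (auto simp: inner_vec_def pr_def intro!: sum.cong)
    \<comment> \<open>The coboundary of u is absorbed into the eigenfunction, and \<xi> sees only
      the coordinates in I. So any obstruction for \<Psi> comes from the lattice with basis B, which
      is integral on \<open>H0\<close>.\<close>
    have "pr n \<in> chars \<alpha> \<xi>"
    proof -
      have "pr n \<in> int_vecs" using n by (auto simp: chars_def int_vecs_def pr_def)
      moreover have "circle_fun (\<lambda>x. k x * ch n (u x))"
      proof -
        have [measurable]: "k \<in> borel_measurable borel" using k by (simp add: circle_fun_def)
        have "(\<lambda>x. k x * ch n (u x)) \<in> borel_measurable borel" by measurable
        then show ?thesis using k(1) u1 by (simp add: circle_fun_def)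
      qed
      moreover have "AE x in lborel. k x * ch n (u x) = ch (pr n) (\<xi> x) * (k (x + \<alpha>) * ch n (u (x + \<alpha>)))"
        using k(3) \<Psi>ae
      proof eventually_elim
        case (elim x)
        have "ch (pr n) (\<xi> x) = ch n (\<xi> x)" using prI[OF \<xi>supp] by (simp add: ch_def)
        then show ?case by (simp add: elim ch_add_right ch_diff_right)
      qed
      moreover have "\<forall>x. norm (k x * ch n (u x)) = 1" using k(2) by (simp add: norm_mult)
      ultimately show ?thesis unfolding chars_def by blast
    qed
    then have comb: "pr n = (\<Sum>b\<in>B. (pr n \<bullet> dual b) *\<^sub>R b)" "\<forall>b\<in>B. pr n \<bullet> dual b \<in> \<int>" using B(4) by (auto simp: pr_def)
    have "n \<bullet> c = pr n \<bullet> c" using c by (intro prI) (simp add: H0_def)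
    also have "\<dots> = (\<Sum>b\<in>B. (pr n \<bullet> dual b) *\<^sub>R b) \<bullet> c" using comb(1) by simp
    also have "\<dots> = (\<Sum>b\<in>B. (pr n \<bullet> dual b) * (b \<bullet> c))" by (simp add: inner_sum_left)
    also have "\<dots> \<in> \<int>" using comb(2) c by (intro Ints_sum Ints_mult) (auto simp: H0_def)
    finally show "n \<bullet> c \<in> \<int>" .
  qed
  have Mc: "circle_fun (\<lambda>x. M (h x))" if "circle_fun h" for h
    using that measurable_compose[OF _ Mb(1), of h borel] by (auto simp: circle_fun_def)
  have coc: "cocycle (\<lambda>x. M (\<Psi> x))" using Mc[OF \<Psi>c] by (simp add: cocycle_def circle_fun_def measurable_circleI)
  have "cohomologous (rotation \<alpha>) (\<lambda>x. M (\<Psi> x)) (\<lambda>x. M (\<Psi> x))"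
    unfolding cohomologous_def by (intro bexI[of _ "\<lambda>x. 0"]) auto
  then have reg: "regular_cocycle (rotation \<alpha>) (\<lambda>x. M (\<Psi> x))"
    unfolding regular_cocycle_def using coc closed_subgroup_H haar_\<nu> erg M_H0[OF \<Psi>H] by blast
  show ?thesis
  proof (rule regular_cocycle_transfer[OF reg measurable_circleI[OF \<phi>m], of "\<lambda>x. f x + M (u x)"])
    show "circle_fun (\<lambda>x. f x + M (u x))" using f Mc[OF uc] by (auto simp: circle_fun_def)
    have "AE x in lborel. \<phi> x - M (\<Psi> x) = (f x + M (u x)) - (f (x + \<alpha>) + M (u (x + \<alpha>)))"
      using \<phi>'ae \<Psi>ae
    proof eventually_elim
      case (elim x)
      have "M (\<Psi> x) = \<phi>' x - M (u x) + M (u (x + \<alpha>))"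
        unfolding elim(2) by (simp add: linear_add[OF M(1)] linear_diff[OF M(1)] \<xi>_def)
      then show ?case by (simp add: elim(1))
    qed
    then show "AE x in circle. \<phi> x - M (\<Psi> x) = (f x + M (u x)) - (f (x + \<alpha>) + M (u (x + \<alpha>)))"
      unfolding AE_circle_iff by eventually_elim simp
  qed
qed

section \<open>Step cocycles\<close>

text \<open>L carries periods to periods and the transfer function to a transfer function, so the
  single cohomology found for \<open>Phi\<close> serves all its linear images.\<close>

lemma regular_linear_Phi:
  fixes \<beta> :: "real ^ 'd" and L :: "real ^ 'd \<Rightarrow> real ^ 'e"
  assumes irr: "\<alpha> \<notin> \<rat>" and bad: "badly_approximable c \<alpha>" and L: "linear L"
    and \<phi>: "\<phi> \<in> borel_measurable circle" "AE x in circle. \<phi> x = L (Phi \<beta> x)"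
  shows "regular_cocycle (rotation \<alpha>) \<phi>"
proof -
  define E where "E = int_vecs \<inter> PER \<alpha> (Phi \<beta>)"
  obtain f where f: "circle_fun f" "AE x in circle. Phi \<beta> x - (f x - f (x + \<alpha>)) \<in> span (int_vecs \<inter> PER \<alpha> (Phi \<beta>))"
    by (rule integral_periods_span[where \<beta>=\<beta>, OF irr bad]) (rule that)
  have Lb: "L \<in> borel_measurable borel"
    using L by (auto intro!: borel_measurable_continuous_onI linear_continuous_on simp: linear_conv_bounded_linear)
  have Lc: "circle_fun (\<lambda>x. L (h x))" if "circle_fun h" for h
    using that measurable_compose[OF _ Lb, of h borel] by (auto simp: circle_fun_def)
  have reg: "regular_cocycle (rotation \<alpha>) (\<lambda>x. L (Phi \<beta> x))"
  proof (rule regular_of_periods[OF irr Lc[OF Phi_circle_fun] Lc[OF f(1)]])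
    show "L ` E \<subseteq> PER \<alpha> (\<lambda>x. L (Phi \<beta> x))"
      using PER_linear[OF L] Phi_circle_fun[of \<beta>] by (auto simp: E_def circle_fun_def)
    show "AE x in circle. L (Phi \<beta> x) - (L (f x) - L (f (x + \<alpha>))) \<in> span (L ` E)"
      using f(2) unfolding E_def[symmetric]
    proof eventually_elim
      case (elim x)
      have "L (Phi \<beta> x - (f x - f (x + \<alpha>))) \<in> L ` span E" using elim by (rule imageI)
      then show ?case by (simp add: linear_diff[OF L] linear_span_image[OF L])
    qed
  qed
  show ?thesis
  proof (rule regular_cocycle_transfer[OF reg \<phi>(1), of "\<lambda>x. 0"])
    show "circle_fun (\<lambda>x. 0)" by (simp add: circle_fun_def)
    show "AE x in circle. \<phi> x - L (Phi \<beta> x) = 0 - 0" using \<phi>(2) by eventually_elim simp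
  qed
qed

lemma Phi_unit_interval:
  assumes "x \<in> {0..<1}" and "0 \<le> \<beta> $ j" "\<beta> $ j < 1"
  shows "Phi \<beta> x $ j = of_bool (x < \<beta> $ j) - \<beta> $ j"
proof (cases "x < \<beta> $ j")
  case True
  have "frac (x - \<beta> $ j) = frac (x - \<beta> $ j + 1)" by (simp add: frac_periodic)
  also have "\<dots> = x - \<beta> $ j + 1" using True assms by (intro frac_eq[THEN iffD2]) auto
  finally show ?thesis using True assms by (simp add: Phi_def frac_eq)
next
  case False
  then have "frac (x - \<beta> $ j) = x - \<beta> $ j" using assms by (intro frac_eq[THEN iffD2]) auto
  then show ?thesis using False assms by (simp add: Phi_def frac_eq)
qed

lemma step_cocycle_measurable:
  fixes \<phi> :: "real \<Rightarrow> real ^ 'e"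
  assumes "step_cocycle \<phi>"
  shows "\<phi> \<in> borel_measurable circle" "finite (\<phi> ` {0..<1})"
proof -
  obtain P where P: "finite P" "partition_on {0..<1} P" "\<forall>I\<in>P. is_interval I \<and> \<phi> constant_on I"
    using assms by (auto simp: step_cocycle_def)
  have cover: "\<Union> P = {0..<1}" using P(2) by (rule partition_onD1[symmetric])
  have disj: "I = J" if "I \<in> P" "J \<in> P" "x \<in> I" "x \<in> J" for I J x
    using partition_onD2[OF P(2)] that by (auto simp: disjoint_def)
  have "\<forall>I\<in>P. \<exists>c. \<forall>x\<in>I. \<phi> x = c" using P(3) by (auto simp: constant_on_def)
  then obtain c where c: "\<forall>I\<in>P. \<forall>x\<in>I. \<phi> x = c I" by (rule bchoice[THEN exE])
  have "\<phi> ` {0..<1} \<subseteq> c ` P" using c unfolding cover[symmetric] by auto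
  then show "finite (\<phi> ` {0..<1})" using P(1) by (rule finite_surj[rotated])
  have [measurable]: "I \<in> sets borel" if "I \<in> P" for I using P(3) that by (intro real_interval_borel_measurable) auto
  have m: "(\<lambda>x. \<Sum>I\<in>P. indicat_real I x *\<^sub>R c I) \<in> borel_measurable circle"
    by (intro measurable_circleI borel_measurable_sum borel_measurable_scaleR borel_measurable_indicator) auto
  have "\<phi> x = (\<Sum>I\<in>P. indicat_real I x *\<^sub>R c I)" if "x \<in> space circle" for x
  proof -
    have "x \<in> \<Union> P" using that by (simp add: cover space_circle)
    then obtain J where J: "J \<in> P" "x \<in> J" by blast
    have "(\<Sum>I\<in>P. indicat_real I x *\<^sub>R c I) = (\<Sum>I\<in>P. if I = J then c I else 0)"
    proof (rule sum.cong[OF refl])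
      fix I assume "I \<in> P"
      then have "x \<in> I \<longleftrightarrow> I = J" using disj[of I J x] J by blast
      then show "indicat_real I x *\<^sub>R c I = (if I = J then c I else 0)" by (simp add: indicator_def)
    qed
    also have "\<dots> = c J" using P(1) J(1) by simp
    also have "\<dots> = \<phi> x" using c J by metis
    finally show ?thesis by simp
  qed
  then show "\<phi> \<in> borel_measurable circle" using m by (subst measurable_cong)
qed

text \<open>Induction on the largest point b of X: right of b the function is a constant, left of b
  the hypothesis applies with u cut to \<open>min u b\<close>, and the coefficient of b is the
  difference of the two constants.\<close>

lemma jump_expansion:
  fixes \<phi> :: "real \<Rightarrow> 'v::real_vector"
  assumes "finite X" and "\<forall>a b. 0 \<le> a \<longrightarrow> b \<le> u \<longrightarrow> {a<..<b} \<inter> X = {} \<longrightarrow> \<phi> constant_on {a<..<b}"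
  shows "\<exists>v c. \<forall>x\<in>{0<..<u} - X. \<phi> x = c + (\<Sum>p\<in>X. of_bool (x < p) *\<^sub>R v p)"
  using assms
proof (induction X arbitrary: u rule: finite_linorder_max_induct)
  case empty
  then have "\<phi> constant_on {0<..<u}" by simp
  then show ?case by (auto simp: constant_on_def)
next
  case (insert b A)
  have A: "b \<notin> A" using insert.hyps by auto
  have "\<exists>v c. \<forall>x\<in>{0<..<min u b} - A. \<phi> x = c + (\<Sum>p\<in>A. of_bool (x < p) *\<^sub>R v p)"
  proof (rule insert.IH, intro allI impI)
    fix a d assume *: "0 \<le> a" "d \<le> min u b" "{a<..<d} \<inter> A = {}"
    then have "{a<..<d} \<inter> insert b A = {}" by auto
    then show "\<phi> constant_on {a<..<d}" using insert.prems * by simp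
  qed
  then obtain v c where vc: "\<forall>x\<in>{0<..<min u b} - A. \<phi> x = c + (\<Sum>p\<in>A. of_bool (x < p) *\<^sub>R v p)" by blast
  have "{max 0 b<..<u} \<inter> insert b A = {}" using insert.hyps by force
  then have "\<phi> constant_on {max 0 b<..<u}" using insert.prems by simp
  then obtain d where d: "\<forall>x\<in>{max 0 b<..<u}. \<phi> x = d" by (auto simp: constant_on_def)
  define v' where "v' p = (if p = b then c - d else v p)" for p
  have sumA: "(\<Sum>p\<in>A. of_bool (x < p) *\<^sub>R v' p) = (\<Sum>p\<in>A. of_bool (x < p) *\<^sub>R v p)" for x
    using A by (intro sum.cong) (auto simp: v'_def)
  have "\<phi> x = d + (\<Sum>p\<in>insert b A. of_bool (x < p) *\<^sub>R v' p)" if x: "x \<in> {0<..<u} - insert b A" for x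
  proof (cases "x < b")
    case True
    then have "x \<in> {0<..<min u b} - A" using x by auto
    with vc have "\<phi> x = c + (\<Sum>p\<in>A. of_bool (x < p) *\<^sub>R v p)" by blast
    then show ?thesis using True insert.hyps(1) A by (simp add: sumA) (simp add: v'_def)
  next
    case False
    then have "x > b" using x by auto
    then have "x \<in> {max 0 b<..<u}" using x by auto
    then have "\<phi> x = d" using d by blast
    moreover have "(\<Sum>p\<in>insert b A. of_bool (x < p) *\<^sub>R v' p) = 0"
      using \<open>x > b\<close> insert.hyps(2) by (intro sum.neutral) force
    ultimately show ?thesis by simp
  qed
  then show ?case by blast
qed

text \<open>A continuous function with finitely many values is constant on an interval, so \<phi> is
  a constant plus jumps at the \<beta> j. As \<open>of_bool (x < p)\<close> has mean p, zero mean
  fixes the constant to the one that occurs in a linear image of \<open>Phi\<close>.\<close>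

lemma step_cocycle_linear_Phi:
  fixes \<phi> :: "real \<Rightarrow> real ^ 'e" and \<beta> :: "real ^ 'd"
  assumes step: "step_cocycle \<phi>" and mean: "zero_mean \<phi>" and \<beta>: "\<forall>j. \<beta> $ j \<in> {0..<1}"
    and disc: "discontinuities \<phi> \<subseteq> insert 0 (range (\<lambda>j. \<beta> $ j))"
  obtains L :: "real ^ 'd \<Rightarrow> real ^ 'e" where "linear L" "AE x in circle. \<phi> x = L (Phi \<beta> x)"
proof -
  define X where "X = range (\<lambda>j. \<beta> $ j)"
  have finX: "finite X" by (simp add: X_def)
  have X01: "0 \<le> p" "p < 1" if "p \<in> X" for p using that \<beta> by (auto simp: X_def)
  have "\<phi> constant_on {a<..<b}" if ab: "0 \<le> a" "b \<le> 1" "{a<..<b} \<inter> X = {}" for a b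
  proof -
    have sub: "{a<..<b} \<subseteq> {0..<1}" using ab by auto
    have cont: "continuous_on {a<..<b} (\<lambda>y. \<phi> (frac y))"
    proof (rule continuous_at_imp_continuous_on, rule ballI)
      fix x assume x: "x \<in> {a<..<b}"
      have "x \<notin> X" "x \<noteq> 0" using x ab by auto
      then have "x \<notin> discontinuities \<phi>" using disc by (auto simp: X_def)
      then show "isCont (\<lambda>y. \<phi> (frac y)) x" using x sub by (auto simp: discontinuities_def)
    qed
    have comp: "(\<lambda>x. \<phi> x $ i) constant_on {a<..<b}" for i
    proof (rule continuous_finite_range_constant)
      have "continuous_on {a<..<b} (\<lambda>y. \<phi> (frac y) $ i)" by (rule continuous_on_component[OF cont])
      moreover have "\<phi> (frac y) $ i = \<phi> y $ i" if "y \<in> {a<..<b}" for y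
      proof -
        have "frac y = y" using that sub by (intro frac_eq[THEN iffD2]) auto
        then show ?thesis by simp
      qed
      ultimately show "continuous_on {a<..<b} (\<lambda>x. \<phi> x $ i)" by (rule continuous_on_eq)
      have "(\<lambda>x. \<phi> x $ i) ` {a<..<b} \<subseteq> (\<lambda>t. t $ i) ` (\<phi> ` {0..<1})" using sub by auto
      then show "finite ((\<lambda>x. \<phi> x $ i) ` {a<..<b})"
        using step_cocycle_measurable(2)[OF step] by (meson finite_imageI finite_subset)
    qed simp
    show ?thesis
    proof (cases "{a<..<b} = {}")
      case False
      then obtain y where y: "y \<in> {a<..<b}" by blast
      have "\<phi> x = \<phi> y" if "x \<in> {a<..<b}" for x
        using comp that y unfolding vec_eq_iff constant_on_def by metis
      then show ?thesis by (auto simp: constant_on_def)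
    qed (simp only: constant_on_def, simp)
  qed
  then have "\<exists>v c. \<forall>x\<in>{0<..<1} - X. \<phi> x = c + (\<Sum>p\<in>X. of_bool (x < p) *\<^sub>R v p)"
    by (intro jump_expansion finX) blast
  then obtain v c where vc: "\<forall>x\<in>{0<..<1} - X. \<phi> x = c + (\<Sum>p\<in>X. of_bool (x < p) *\<^sub>R v p)" by blast
  have "AE x in lborel. x \<notin> insert 0 X" using finX by (intro AE_I'[OF finite_imp_null_set_lborel[of "insert 0 X"]]) auto
  then have ae: "AE x in circle. \<phi> x = c + (\<Sum>p\<in>X. of_bool (x < p) *\<^sub>R v p)"
    unfolding AE_circle_iff by eventually_elim (use vc in auto)
  have meanp: "(LINT x|circle. of_bool (x < p) :: real) = p" if "p \<in> X" for p
  proof -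
    have "(LINT x|circle. of_bool (x < p) :: real) = cm (\<lambda>x. x < p)" by (rule integral_of_bool_cm) measurable
    also have "\<dots> = measure circle {0..<p}" unfolding cm_def using X01[OF that] by (intro arg_cong[of _ _ "measure circle"]) auto
    also have "\<dots> = p" unfolding measure_def using X01[OF that] by (subst emeasure_circle) auto
    finally show ?thesis .
  qed
  have intp: "integrable circle (\<lambda>x. of_bool (x < p) :: real)" for p
    by (rule circle.integrable_const_bound[where B=1]) (auto intro!: measurable_circleI)
  have c: "c = - (\<Sum>p\<in>X. p *\<^sub>R v p)"
  proof -
    have "c $ i + (\<Sum>p\<in>X. p * v p $ i) = 0" for i
    proof -
      have "0 = (LINT x|circle. \<phi> x $ i)" using mean by (simp add: zero_mean_def)
      also have "\<dots> = (LINT x|circle. c $ i + (\<Sum>p\<in>X. of_bool (x < p) * v p $ i))"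
      proof (rule integral_cong_AE)
        show "(\<lambda>x. \<phi> x $ i) \<in> borel_measurable circle"
          using measurable_compose[OF step_cocycle_measurable(1)[OF step] vec_nth_borel] .
        show "(\<lambda>x. c $ i + (\<Sum>p\<in>X. of_bool (x < p) * v p $ i)) \<in> borel_measurable circle"
          by (intro borel_measurable_add borel_measurable_sum borel_measurable_times borel_measurable_integrable[OF intp]) auto
        show "AE x in circle. \<phi> x $ i = c $ i + (\<Sum>p\<in>X. of_bool (x < p) * v p $ i)"
          using ae by eventually_elim simp
      qed
      also have "\<dots> = c $ i + (\<Sum>p\<in>X. p * v p $ i)"
        using intp by (simp add: meanp measure_space_circle)
      finally show ?thesis by simp
    qed
    then show ?thesis by (simp add: vec_eq_iff eq_neg_iff_add_eq_0)
  qed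
  \<comment> \<open>Several \<beta> j may coincide; each point is represented by one index.\<close>
  define J where "J p = (SOME j. \<beta> $ j = p)" for p
  have J: "\<beta> $ J p = p" if "p \<in> X" for p unfolding J_def by (rule someI_ex) (use that in \<open>auto simp: X_def\<close>)
  define L :: "real ^ 'd \<Rightarrow> real ^ 'e" where "L t = (\<Sum>p\<in>X. t $ J p *\<^sub>R v p)" for t
  show thesis
  proof (rule that)
    show "linear L" unfolding L_def by (rule linearI) (simp_all add: scaleR_add_left sum.distrib scaleR_sum_right)
    have "AE x in circle. x \<in> space circle" by (rule AE_space)
    with ae show "AE x in circle. \<phi> x = L (Phi \<beta> x)"
    proof eventually_elim
      case (elim x)
      have "L (Phi \<beta> x) = (\<Sum>p\<in>X. (of_bool (x < p) - p) *\<^sub>R v p)" unfolding L_def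
      proof (rule sum.cong[OF refl])
        fix p assume p: "p \<in> X"
        have "Phi \<beta> x $ J p = of_bool (x < \<beta> $ J p) - \<beta> $ J p"
          by (rule Phi_unit_interval) (use elim(2) \<beta> in \<open>auto simp: space_circle\<close>)
        then show "Phi \<beta> x $ J p *\<^sub>R v p = (of_bool (x < p) - p) *\<^sub>R v p" by (simp add: J[OF p])
      qed
      then show ?case using elim(1) by (simp add: c scaleR_diff_left sum_subtractf)
    qed
  qed
qed

theorem theorem3p5:
  fixes \<alpha> :: real and \<beta> :: "real ^ 'd"
  assumes "0 < \<alpha>" and "\<alpha> < 1" and "\<alpha> \<notin> \<rat>" and "bounded_type \<alpha>"
    and "\<forall>j. \<beta> $ j \<in> {0..<1}"
    and "\<forall>(p::rat) (q::rat) (r :: 'd \<Rightarrow> rat).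
           of_rat p + of_rat q * \<alpha> + (\<Sum>j\<in>UNIV. of_rat (r j) * \<beta> $ j) = 0 \<longrightarrow>
           p = 0 \<and> q = 0 \<and> (\<forall>j. r j = 0)"
  shows "regular_cocycle (rotation \<alpha>) (\<lambda>x. \<chi> j. indicat_real {0..<\<beta> $ j} x - \<beta> $ j) \<and>
         (CARD('e::finite) \<le> CARD('d) \<longrightarrow>
           (\<forall>\<phi> :: real \<Rightarrow> real ^ 'e.
              step_cocycle \<phi> \<and> zero_mean \<phi> \<and>
              discontinuities \<phi> \<subseteq> insert 0 (range (\<lambda>j. \<beta> $ j)) \<longrightarrow>
              regular_cocycle (rotation \<alpha>) \<phi>))"
proof -
  obtain c where bad: "badly_approximable c \<alpha>"
    by (rule bounded_type_badly_approximable[OF assms(1-4)]) (rule that)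
  have "regular_cocycle (rotation \<alpha>) (\<lambda>x. \<chi> j. indicat_real {0..<\<beta> $ j} x - \<beta> $ j)"
  proof (rule regular_linear_Phi[OF assms(3) bad, of "\<lambda>t. t" _ \<beta>])
    show "(\<lambda>x. \<chi> j. indicat_real {0..<\<beta> $ j} x - \<beta> $ j) \<in> borel_measurable circle"
      by (intro vec_lambda_borel measurable_circleI) measurable
    have "AE x in circle. x \<in> space circle" by (rule AE_space)
    then show "AE x in circle. (\<chi> j. indicat_real {0..<\<beta> $ j} x - \<beta> $ j) = Phi \<beta> x"
    proof eventually_elim
      case (elim x)
      then show ?case using assms(5) by (simp add: vec_eq_iff Phi_unit_interval space_circle indicator_def)
    qed
  qed (rule linear_ident)
  moreover have "regular_cocycle (rotation \<alpha>) \<phi>"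
    if h: "step_cocycle \<phi>" "zero_mean \<phi>" "discontinuities \<phi> \<subseteq> insert 0 (range (\<lambda>j. \<beta> $ j))" for \<phi> :: "real \<Rightarrow> real ^ 'e"
  proof -
    obtain L :: "real ^ 'd \<Rightarrow> real ^ 'e" where "linear L" "AE x in circle. \<phi> x = L (Phi \<beta> x)"
      by (rule step_cocycle_linear_Phi[OF h(1,2) assms(5) h(3)])
    then show ?thesis by (intro regular_linear_Phi[OF assms(3) bad _ step_cocycle_measurable(1)[OF h(1)]])
  qed
  ultimately show ?thesis by blast
qed

end
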